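(* Let $n\ge2$ be an integer, let $\Omega=\{(x,y)\in(0,+\infty)^2\colon y<(\tan(\pi/2^n))\,x\}$ be the sector of angle $\pi/2^n$, let $\bullet\in\{D,N\}$, let $S\subset\mathbb{R}^2$ be $(\gamma,a)$-thick with $\gamma\in(0,1]$ and $a=(a_1,a_2)\in(0,+\infty)^2$, and let $\omega=\Omega\cap S$. Then the system $$\partial_tu(t)-\Delta^\bullet_\Omega u(t)=\chi_\omega v(t)\quad(0<t<T),\qquad u(0)=u_0\in L^2(\Omega),$$ is null-controllable in any time $T>0$ with control cost $$C_T\le\frac{1}{\sqrt T}\Bigl(\frac{2^{3n-4}K^2}{\tilde\gamma}\Bigr)^{K}\exp\Bigl(\frac{2^{3n-4}K\|\tilde a\|_1^2\ln^2(2^{3n-4}K^2/\tilde\gamma)}{2T}\Bigr),$$ where $$\tilde\gamma=\frac{\gamma a_1a_2}{4(a_1^2+a_2^2)},\qquad\tilde a=\Bigl(2\sqrt{a_1^2+a_2^2},\,2\sqrt{a_1^2+a_2^2}\Bigr),$$ $\|\tilde a\|_1=\tilde a_1+\tilde a_2$, and $K>0$ is the universal constant described in the context.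
   Context: Thick sets: a measurable set $S\subset\mathbb{R}^d$ is $(\gamma,a)$-thick, with $\gamma\in(0,1]$ and $a\in(0,+\infty)^d$, if $|S\cap(x+[0,a_1]\times\dots\times[0,a_d])|\ge\gamma\prod_{j=1}^da_j$ for all $x\in\mathbb{R}^d$, where $|\cdot|$ is Lebesgue measure. $\Delta_\Omega^D$ and $\Delta_\Omega^N$ are the Dirichlet and Neumann Laplacians on $L^2(\Omega)$: $-\Delta_\Omega^\bullet$ is the self-adjoint operator associated with the form $\int_\Omega\langle\nabla f,\nabla g\rangle_{\mathbb{C}^d}\,dx$ with form domain $H_0^1(\Omega)$ (for $D$) or $H^1(\Omega)$ (for $N$). The system $\partial_tu-\Delta_\Omega^\bullet u=\chi_\omega v$, $u(0)=u_0$, is null-controllable in time $T>0$ if for every $u_0\in L^2(\Omega)$ there is $v\in L^2((0,T),L^2(\Omega))$ with $(\ast)$ $e^{T\Delta_\Omega^\bullet}u_0+\int_0^Te^{(T-s)\Delta_\Omega^\bullet}\chi_\omega v(s)\,ds=0$. Its control cost is $C_T=\sup_{\|u_0\|_{L^2(\Omega)}=1}\inf\{\|v\|_{L^2((0,T),L^2(\omega))}\colon v\text{ satisfies }(\ast)\}$. The constant $K$: $K>0$ is a universal constant with the following property (such a constant is known to exist from earlier work). For every $d\in\mathbb{N}$, every $L>0$, every $\tilde\Omega\in\{\mathbb{R}^d,(0,L)^d\}$, every $\bullet\in\{D,N\}$, every $(\gamma,a)$-thick set $S\subset\mathbb{R}^d$ (with $a_j\le L$ for all $j$ if $\tilde\Omega=(0,L)^d$),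 the system $\partial_tu-\Delta_{\tilde\Omega}^\bullet u=\chi_{\tilde\Omega\cap S}v$ is null-controllable in any time $T>0$ with control cost $$C_T\le\frac1{\sqrt T}\left(\frac{K^d}{\gamma}\right)^{Kd/2}\exp\left(\frac{K\|a\|_1^2\ln^2(K^d/\gamma)}{2T}\right),\qquad\|a\|_1=a_1+\dots+a_d.$$ *)

theory Defs
  imports "HOL-Analysis.Analysis"
begin

text \<open>
  Since a type cannot depend on the dimension \<open>d\<close>, \<open>\<real>\<^sup>d\<close> is the carrier
  \<open>{..<d} \<rightarrow>\<^sub>E UNIV\<close> of the finite product measure (coordinates are numbered from \<open>0\<close>), and
  one Hilbert space type \<open>l2\<close> contains \<open>L\<^sup>2(\<real>\<^sup>d)\<close> for all \<open>d\<close>: it is the complex \<open>L\<^sup>2\<close> space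
  of the disjoint union of all \<open>\<real>\<^sup>d\<close>, whose points are pairs \<open>(d, x)\<close>. For \<open>\<Omega> \<subseteq> \<real>\<^sup>d\<close>, the space
  \<open>L\<^sup>2(\<Omega>)\<close> is the closed subspace \<open>l2_on d \<Omega>\<close> below of classes vanishing a.e. outside
  \<open>{d} \<times> \<Omega>\<close>, i.e. functions on \<open>\<Omega>\<close> are extended by zero. Completeness and separability of
  \<open>l2\<close> make the library's Bochner integral available for \<open>l2\<close>-valued functions.
\<close>

definition lborel_dim :: "nat \<Rightarrow> (nat \<Rightarrow> real) measure" where
  "lborel_dim d = Pi\<^sub>M {..<d} (\<lambda>_. lborel)"

definition lebesgue_dim :: "nat \<Rightarrow> (nat \<Rightarrow> real) measure" where
  "lebesgue_dim d = completion (lborel_dim d)"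

definition lborel_all :: "(nat \<times> (nat \<Rightarrow> real)) measure" where
  "lborel_all = measure_of UNIV (sets borel)
     (\<lambda>A. \<Sum>d. emeasure (distr (lborel_dim d) borel (Pair d)) A)"

definition lebesgue_all :: "(nat \<times> (nat \<Rightarrow> real)) measure" where
  "lebesgue_all = completion lborel_all"

lemma space_lborel_dim: "space (lborel_dim d) = {..<d} \<rightarrow>\<^sub>E UNIV"
  by (simp add: lborel_dim_def space_PiM)

lemma measurable_Pair_lborel_dim: "Pair d \<in> lborel_dim d \<rightarrow>\<^sub>M borel"
proof -
  have "(\<lambda>x. x) \<in> lborel_dim d \<rightarrow>\<^sub>M (borel :: (nat \<Rightarrow> real) measure)"
  proof (rule measurable_coordinatewise_then_product)
    fix i
    show "(\<lambda>x. x i) \<in> borel_measurable (lborel_dim d)"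
    proof (cases "i < d")
      case True
      then show ?thesis
        unfolding lborel_dim_def by (metis lessThan_iff measurable_component_singleton measurable_lborel1)
    next
      case False
      then have "x i = undefined" if "x \<in> space (lborel_dim d)" for x
        using that by (auto simp: space_lborel_dim PiE_iff extensional_def)
      then show ?thesis
        by (subst measurable_cong[where g = "\<lambda>_. undefined"]) auto
    qed
  qed
  then show ?thesis by measurable
qed


lemma sets_lborel_all [simp, measurable_cong]: "sets lborel_all = sets borel"
  by (metis (no_types) lborel_all_def sets.sigma_sets_eq sets_measure_of space_borel top_greatest
      Pow_UNIV)

lemma space_lborel_all [simp]: "space lborel_all = UNIV"
  by (metis sets_eq_imp_space_eq sets_lborel_all space_borel)

lemma emeasure_lborel_all:
  assumes "A \<in> sets borel"
  shows "emeasure lborel_all A = (\<Sum>d. emeasure (distr (lborel_dim d) borel (Pair d)) A)"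
proof (rule emeasure_measure_of[OF lborel_all_def])
  show "sets borel \<subseteq> Pow UNIV" by simp
  show "A \<in> sets lborel_all" using assms by simp
  show "positive (sets lborel_all) (\<lambda>A. \<Sum>d. emeasure (distr (lborel_dim d) borel (Pair d)) A)"
    by (simp add: positive_def)
  show "countably_additive (sets lborel_all)
          (\<lambda>A. \<Sum>d. emeasure (distr (lborel_dim d) borel (Pair d)) A)"
  proof (rule countably_additiveI)
    fix A :: "nat \<Rightarrow> (nat \<times> (nat \<Rightarrow> real)) set"
    assume A: "range A \<subseteq> sets lborel_all" "disjoint_family A"
    have "(\<Sum>i. \<Sum>d. emeasure (distr (lborel_dim d) borel (Pair d)) (A i))
        = (\<Sum>i. \<integral>\<^sup>+d. emeasure (distr (lborel_dim d) borel (Pair d)) (A i) \<partial>count_space UNIV)"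
      by (simp add: nn_integral_count_space_nat)
    also have "\<dots> = (\<integral>\<^sup>+d. (\<Sum>i. emeasure (distr (lborel_dim d) borel (Pair d)) (A i)) \<partial>count_space UNIV)"
      by (rule nn_integral_suminf[symmetric]) simp
    also have "\<dots> = (\<Sum>d. \<Sum>i. emeasure (distr (lborel_dim d) borel (Pair d)) (A i))"
      by (simp add: nn_integral_count_space_nat)
    also have "\<dots> = (\<Sum>d. emeasure (distr (lborel_dim d) borel (Pair d)) (\<Union>i. A i))"
      using A by (intro suminf_cong suminf_emeasure) auto
    finally show "(\<Sum>i. \<Sum>d. emeasure (distr (lborel_dim d) borel (Pair d)) (A i))
        = (\<Sum>d. emeasure (distr (lborel_dim d) borel (Pair d)) (\<Union>i. A i))" .
  qed
qed

lemma sigma_finite_lborel_all: "sigma_finite_measure lborel_all"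
proof
  define E :: "nat \<Rightarrow> nat \<Rightarrow> (nat \<times> (nat \<Rightarrow> real)) set"
    where "E d n = {d} \<times> {x. \<forall>i<d. \<bar>x i\<bar> \<le> real n}" for d n
  have coord: "(\<lambda>x::nat \<Rightarrow> real. x i) \<in> borel_measurable borel" for i
    by (intro borel_measurable_continuous_onI continuous_on_product_coordinates)
  have box: "{x. \<forall>i<d. \<bar>x i\<bar> \<le> real n} \<in> sets (borel :: (nat \<Rightarrow> real) measure)" for d n
  proof -
    have "{x \<in> space borel. \<forall>i\<in>{..<d}. \<bar>x i\<bar> \<le> real n} \<in> sets (borel :: (nat \<Rightarrow> real) measure)"
      using coord by measurable
    then show ?thesis by (simp add: Ball_def)
  qed
  have E: "E d n \<in> sets borel" for d n
    unfolding E_def borel_prod[symmetric] using box by (intro pair_measureI) auto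
  have fin: "emeasure lborel_all (E d n) \<noteq> \<infinity>" for d n
  proof -
    interpret product_sigma_finite "\<lambda>_::nat. lborel :: real measure"
      by standard
    have vim: "Pair k -` E d n \<inter> space (lborel_dim k)
        = (if k = d then Pi\<^sub>E {..<d} (\<lambda>_. {- real n..real n}) else {})" for k
    proof (cases "k = d")
      case True
      have "\<bar>t\<bar> \<le> real n \<longleftrightarrow> t \<in> {- real n..real n}" for t
        by auto
      then show ?thesis
        using True by (auto simp only: E_def space_lborel_dim PiE_iff vimage_eq Int_iff mem_Times_iff
            fst_conv snd_conv mem_Collect_eq lessThan_iff UNIV_I if_True simp_thms Ball_def insert_iff)
    next
      case False
      then show ?thesis by (auto simp: E_def)
    qed
    have box_em: "emeasure (lborel_dim d) (Pi\<^sub>E {..<d} (\<lambda>_. {- real n..real n}))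
        = (\<Prod>i<d. emeasure lborel {- real n..real n})"
      unfolding lborel_dim_def by (rule emeasure_PiM) auto
    have "emeasure (distr (lborel_dim k) borel (Pair k)) (E d n)
        = (if k = d then (\<Prod>i<d. emeasure lborel {- real n..real n}) else 0)" for k
      by (subst emeasure_distr[OF measurable_Pair_lborel_dim E], subst vim)
        (simp add: box_em)
    then have "emeasure lborel_all (E d n) = (\<Prod>i<d. emeasure lborel {- real n..real n})"
      by (subst emeasure_lborel_all[OF E], subst suminf_finite[of "{d}"]) auto
    also have "\<dots> < \<infinity>"
      by (simp add: ennreal_power less_top[symmetric])
    finally show ?thesis by simp
  qed
  have un: "(\<Union>d n. E d n) = UNIV"
  proof -
    have "(d, x) \<in> (\<Union>d n. E d n)" for d and x :: "nat \<Rightarrow> real"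
    proof -
      have "\<bar>x i\<bar> \<le> real (nat \<lceil>\<Sum>i<d. \<bar>x i\<bar>\<rceil>)" if "i < d" for i
      proof -
        have "\<bar>x i\<bar> \<le> (\<Sum>i<d. \<bar>x i\<bar>)"
          using that by (intro member_le_sum) auto
        then show ?thesis by linarith
      qed
      then have "(d, x) \<in> E d (nat \<lceil>\<Sum>i<d. \<bar>x i\<bar>\<rceil>)" by (simp add: E_def)
      then show ?thesis by blast
    qed
    then show ?thesis by auto
  qed
  show "\<exists>A. countable A \<and> A \<subseteq> sets lborel_all \<and> \<Union>A = space lborel_all \<and> (\<forall>a\<in>A. emeasure lborel_all a \<noteq> \<infinity>)"
  proof (intro exI[of _ "(\<lambda>(d, n). E d n) ` UNIV"] conjI)
    show "\<Union> (range (\<lambda>(d, n). E d n)) = space lborel_all"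
      using un by (auto simp: set_eq_iff)
  qed (use E fin in auto)
qed

interpretation lborel_all: sigma_finite_measure lborel_all
  by (rule sigma_finite_lborel_all)

lemma space_lebesgue_all [simp]: "space lebesgue_all = UNIV"
  by (simp add: lebesgue_all_def)

definition sq_int :: "(nat \<times> (nat \<Rightarrow> real) \<Rightarrow> complex) \<Rightarrow> bool" where
  "sq_int f \<longleftrightarrow> f \<in> borel_measurable lebesgue_all \<and> integrable lebesgue_all (\<lambda>p. (cmod (f p))\<^sup>2)"

lemma sq_int_measurable: "sq_int f \<Longrightarrow> f \<in> borel_measurable lebesgue_all"
  by (simp add: sq_int_def)

lemma sq_int_zero: "sq_int (\<lambda>_. 0)"
  by (simp add: sq_int_def)

lemma sq_int_bound:
  assumes "integrable lebesgue_all g" "f \<in> borel_measurable lebesgue_all"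
    "\<And>p. (cmod (f p))\<^sup>2 \<le> g p"
  shows "sq_int f"
  unfolding sq_int_def
proof (intro conjI assms Bochner_Integration.integrable_bound[OF assms(1)] AE_I2)
  show "(\<lambda>p. (cmod (f p))\<^sup>2) \<in> borel_measurable lebesgue_all"
    using assms(2) by measurable
  show "norm ((cmod (f p))\<^sup>2) \<le> norm (g p)" for p
    using assms(3)[of p] by simp
qed

lemma sq_int_add:
  assumes "sq_int f" "sq_int g"
  shows "sq_int (\<lambda>p. f p + g p)"
proof (rule sq_int_bound)
  show "integrable lebesgue_all (\<lambda>p. 2 * (cmod (f p))\<^sup>2 + 2 * (cmod (g p))\<^sup>2)"
    using assms by (auto simp: sq_int_def)
  show "(\<lambda>p. f p + g p) \<in> borel_measurable lebesgue_all"
    using assms by (auto simp: sq_int_def)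
  fix p
  have "(cmod (f p + g p))\<^sup>2 \<le> (cmod (f p) + cmod (g p))\<^sup>2"
    by (simp add: norm_triangle_ineq power_mono)
  also have "\<dots> \<le> 2 * (cmod (f p))\<^sup>2 + 2 * (cmod (g p))\<^sup>2"
    using zero_le_power2[of "cmod (f p) - cmod (g p)"] by (simp add: power2_eq_square algebra_simps)
  finally show "(cmod (f p + g p))\<^sup>2 \<le> 2 * (cmod (f p))\<^sup>2 + 2 * (cmod (g p))\<^sup>2" .
qed

lemma sq_int_scaleC: "sq_int f \<Longrightarrow> sq_int (\<lambda>p. c * f p)"
  by (auto simp: sq_int_def norm_mult power_mult_distrib)

lemma sq_int_uminus: "sq_int f \<Longrightarrow> sq_int (\<lambda>p. - f p)"
  by (auto simp: sq_int_def)

lemma sq_int_diff: "sq_int f \<Longrightarrow> sq_int g \<Longrightarrow> sq_int (\<lambda>p. f p - g p)"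
  using sq_int_add[of f "\<lambda>p. - g p"] sq_int_uminus[of g] by simp

lemma sq_int_mult_cnj:
  assumes "sq_int f" "sq_int g"
  shows "integrable lebesgue_all (\<lambda>p. f p * cnj (g p))"
proof (rule Bochner_Integration.integrable_bound)
  show "integrable lebesgue_all (\<lambda>p. (cmod (f p))\<^sup>2 + (cmod (g p))\<^sup>2)"
    using assms by (auto simp: sq_int_def)
  have [measurable]: "f \<in> borel_measurable lebesgue_all" "g \<in> borel_measurable lebesgue_all"
    using assms by (auto simp: sq_int_def)
  have "(\<lambda>p. cnj (g p)) \<in> borel_measurable lebesgue_all"
    by (rule measurable_compose[of g _ borel]) (auto intro!: borel_measurable_continuous_onI continuous_intros)
  then show "(\<lambda>p. f p * cnj (g p)) \<in> borel_measurable lebesgue_all" by measurable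
  have "cmod a * cmod b \<le> (cmod a)\<^sup>2 + (cmod b)\<^sup>2" for a b
  proof -
    have "2 * (cmod a * cmod b) \<le> (cmod a)\<^sup>2 + (cmod b)\<^sup>2"
      using sum_squares_bound[of "cmod a" "cmod b"] by simp
    moreover have "0 \<le> cmod a * cmod b" by simp
    ultimately show ?thesis by linarith
  qed
  then show "AE p in lebesgue_all. norm (f p * cnj (g p)) \<le> norm ((cmod (f p))\<^sup>2 + (cmod (g p))\<^sup>2)"
    by (simp add: norm_mult)
qed

lemma sq_int_mult_cnj_self:
  assumes "sq_int f"
  shows "(LINT p|lebesgue_all. f p * cnj (f p)) = of_real (LINT p|lebesgue_all. (cmod (f p))\<^sup>2)"
  unfolding complex_norm_square[symmetric]
  by (rule integral_of_real) (use assms in \<open>simp add: sq_int_def\<close>)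

definition l2_rel ::
    "(nat \<times> (nat \<Rightarrow> real) \<Rightarrow> complex) \<Rightarrow> (nat \<times> (nat \<Rightarrow> real) \<Rightarrow> complex) \<Rightarrow> bool" where
  "l2_rel f g \<longleftrightarrow> sq_int f \<and> sq_int g \<and> (AE p in lebesgue_all. f p = g p)"

lemma part_equivp_l2_rel: "part_equivp l2_rel"
proof (rule part_equivpI)
  show "\<exists>f. l2_rel f f"
    using sq_int_zero by (auto simp: l2_rel_def intro!: exI[of _ "\<lambda>_. 0"])
  show "symp l2_rel" by (auto simp: symp_def l2_rel_def elim: eventually_mono)
  show "transp l2_rel"
    unfolding transp_def l2_rel_def by (auto elim: eventually_elim2)
qed

quotient_type l2 = "nat \<times> (nat \<Rightarrow> real) \<Rightarrow> complex" / partial: l2_rel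
  by (rule part_equivp_l2_rel)

lift_definition cinner :: "l2 \<Rightarrow> l2 \<Rightarrow> complex" is "\<lambda>f g. LINT p|lebesgue_all. f p * cnj (g p)"
proof -
  fix f f' g g'
  assume "l2_rel f f'" "l2_rel g g'"
  then have a: "sq_int f" "sq_int g" "sq_int f'" "sq_int g'"
    "AE p in lebesgue_all. f p = f' p" "AE p in lebesgue_all. g p = g' p"
    by (auto simp: l2_rel_def)
  show "(LINT p|lebesgue_all. f p * cnj (g p)) = (LINT p|lebesgue_all. f' p * cnj (g' p))"
  proof (rule integral_cong_AE)
    show "AE p in lebesgue_all. f p * cnj (g p) = f' p * cnj (g' p)"
      using a(5,6) by eventually_elim simp
  qed (use a in \<open>auto dest: sq_int_mult_cnj borel_measurable_integrable\<close>)
qed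

lift_definition scaleC :: "complex \<Rightarrow> l2 \<Rightarrow> l2" (infixr "*\<^sub>C" 75) is "\<lambda>c f p. c * f p"
  by (auto simp: l2_rel_def sq_int_scaleC elim: eventually_mono)

instantiation l2 :: real_inner
begin

lift_definition zero_l2 :: l2 is "\<lambda>_. 0"
  by (simp add: l2_rel_def sq_int_zero)

lift_definition plus_l2 :: "l2 \<Rightarrow> l2 \<Rightarrow> l2" is "\<lambda>f g p. f p + g p"
  by (auto simp: l2_rel_def sq_int_add elim: eventually_elim2)

lift_definition minus_l2 :: "l2 \<Rightarrow> l2 \<Rightarrow> l2" is "\<lambda>f g p. f p - g p"
  by (auto simp: l2_rel_def intro!: sq_int_diff sq_int_add sq_int_uminus elim: eventually_elim2)

lift_definition uminus_l2 :: "l2 \<Rightarrow> l2" is "\<lambda>f p. - f p"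
  by (auto simp: l2_rel_def intro!: sq_int_uminus elim: eventually_mono)

lift_definition scaleR_l2 :: "real \<Rightarrow> l2 \<Rightarrow> l2" is "\<lambda>r f p. complex_of_real r * f p"
  by (auto simp: l2_rel_def sq_int_scaleC elim: eventually_mono)

definition inner_l2 :: "l2 \<Rightarrow> l2 \<Rightarrow> real" where
  "inner_l2 u v = Re (cinner u v)"

definition norm_l2 :: "l2 \<Rightarrow> real" where
  "norm_l2 u = sqrt (inner u u)"

definition sgn_l2 :: "l2 \<Rightarrow> l2" where
  "sgn_l2 u = scaleR (inverse (norm u)) u"

definition dist_l2 :: "l2 \<Rightarrow> l2 \<Rightarrow> real" where
  "dist_l2 u v = norm (u - v)"

definition uniformity_l2 :: "(l2 \<times> l2) filter" where
  "uniformity_l2 = (INF e\<in>{0<..}. principal {(x, y). dist x y < e})"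

definition open_l2 :: "l2 set \<Rightarrow> bool" where
  "open_l2 U \<longleftrightarrow> (\<forall>x\<in>U. \<forall>\<^sub>F (x', y) in uniformity. x' = x \<longrightarrow> y \<in> U)"

instance
proof
  fix u v w :: l2 and r s :: real
  have cinner_cnj: "cinner u v = cnj (cinner v u)" for u v
    by transfer (simp flip: Bochner_Integration.integral_cnj add: mult.commute)
  show "u + v + w = u + (v + w)"
    by transfer (auto simp: l2_rel_def add.assoc intro!: sq_int_add)
  show "u + v = v + u"
    by transfer (auto simp: l2_rel_def add.commute intro!: sq_int_add)
  show "0 + u = u"
    by transfer (auto simp: l2_rel_def)
  show "- u + u = 0"
    by transfer (auto simp: l2_rel_def sq_int_zero)
  show "u - v = u + - v"
    by transfer (auto simp: l2_rel_def intro!: sq_int_diff sq_int_add sq_int_uminus)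
  show "r *\<^sub>R (u + v) = r *\<^sub>R u + r *\<^sub>R v"
    by transfer (auto simp: l2_rel_def distrib_left distrib_right mult.assoc intro!: sq_int_add sq_int_scaleC)
  show "(r + s) *\<^sub>R u = r *\<^sub>R u + s *\<^sub>R u"
    by transfer (auto simp: l2_rel_def distrib_left distrib_right mult.assoc intro!: sq_int_add sq_int_scaleC)
  show "r *\<^sub>R s *\<^sub>R u = (r * s) *\<^sub>R u"
    by transfer (auto simp: l2_rel_def distrib_left distrib_right mult.assoc intro!: sq_int_add sq_int_scaleC)
  show "1 *\<^sub>R u = u"
    by transfer (auto simp: l2_rel_def)
  show "dist u v = norm (u - v)" by (rule dist_l2_def)
  show "sgn u = inverse (norm u) *\<^sub>R u" by (rule sgn_l2_def)
  show "(uniformity :: (l2 \<times> l2) filter) = (INF e\<in>{0<..}. principal {(x, y). dist x y < e})"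
    by (rule uniformity_l2_def)
  show "open U \<longleftrightarrow> (\<forall>x\<in>U. \<forall>\<^sub>F (x', y) in uniformity. x' = x \<longrightarrow> y \<in> U)" for U :: "l2 set"
    by (rule open_l2_def)
  show "inner u v = inner v u"
    unfolding inner_l2_def by (subst cinner_cnj) simp
  show "inner (u + v) w = inner u w + inner v w"
    unfolding inner_l2_def
    by transfer (auto simp: l2_rel_def algebra_simps sq_int_mult_cnj)
  show "inner (r *\<^sub>R u) v = r * inner u v"
    unfolding inner_l2_def by transfer (simp add: mult.assoc)
  show "0 \<le> inner u u"
    unfolding inner_l2_def by transfer (simp add: l2_rel_def sq_int_mult_cnj_self)
  show "inner u u = 0 \<longleftrightarrow> u = 0"
    unfolding inner_l2_def
  proof transfer
    fix f assume "l2_rel f f"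
    then have f: "sq_int f" by (simp add: l2_rel_def)
    have "(LINT p|lebesgue_all. (cmod (f p))\<^sup>2) = 0 \<longleftrightarrow> (AE p in lebesgue_all. (cmod (f p))\<^sup>2 = 0)"
      using f by (intro integral_nonneg_eq_0_iff_AE) (auto simp: sq_int_def)
    then show "Re (LINT p|lebesgue_all. f p * cnj (f p)) = 0 \<longleftrightarrow> l2_rel f (\<lambda>_. 0)"
      using f sq_int_zero by (simp add: sq_int_mult_cnj_self l2_rel_def)
  qed
  show "norm u = sqrt (inner u u)" by (rule norm_l2_def)
qed

end

lemma l2_rel_refl: "l2_rel f f \<longleftrightarrow> sq_int f"
  by (simp add: l2_rel_def)

lemma sq_int_rep_l2: "sq_int (rep_l2 u)"
  using Quotient_rep_reflp[OF Quotient_l2, of u] by (simp add: l2_rel_refl)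

lemma abs_rep_l2: "abs_l2 (rep_l2 u) = u"
  by (rule Quotient_abs_rep[OF Quotient_l2])

lemma abs_l2_diff: "sq_int f \<Longrightarrow> sq_int g \<Longrightarrow> abs_l2 f - abs_l2 g = abs_l2 (\<lambda>p. f p - g p)"
  by (simp add: minus_l2.abs_eq l2_rel_refl)

lemma abs_l2_add: "sq_int f \<Longrightarrow> sq_int g \<Longrightarrow> abs_l2 f + abs_l2 g = abs_l2 (\<lambda>p. f p + g p)"
  by (simp add: plus_l2.abs_eq l2_rel_refl)

lemma abs_l2_scaleR: "sq_int f \<Longrightarrow> r *\<^sub>R abs_l2 f = abs_l2 (\<lambda>p. of_real r * f p)"
  by (simp add: scaleR_l2.abs_eq l2_rel_refl)

lemma norm_abs_l2:
  assumes "sq_int f"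
  shows "(norm (abs_l2 f))\<^sup>2 = (LINT p|lebesgue_all. (cmod (f p))\<^sup>2)"
proof -
  have "cinner (abs_l2 f) (abs_l2 f) = of_real (LINT p|lebesgue_all. (cmod (f p))\<^sup>2)"
    using assms sq_int_mult_cnj_self by (simp add: cinner.abs_eq l2_rel_refl)
  then have "inner (abs_l2 f) (abs_l2 f) = (LINT p|lebesgue_all. (cmod (f p))\<^sup>2)"
    unfolding inner_l2_def by simp
  then show ?thesis
    by (simp add: power2_norm_eq_inner)
qed

lemma ennreal_norm_abs_l2:
  assumes "sq_int f"
  shows "ennreal ((norm (abs_l2 f))\<^sup>2) = (\<integral>\<^sup>+p. ennreal ((cmod (f p))\<^sup>2) \<partial>lebesgue_all)"
  using assms by (simp add: norm_abs_l2 nn_integral_eq_integral sq_int_def)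

lemma sq_intI_nn:
  assumes "f \<in> borel_measurable lebesgue_all"
    and "(\<integral>\<^sup>+p. ennreal ((cmod (f p))\<^sup>2) \<partial>lebesgue_all) < \<infinity>"
  shows "sq_int f"
  unfolding sq_int_def using assms by (auto intro!: integrableI_bounded)

lemma summable_of_weighted:
  fixes z :: "nat \<Rightarrow> complex"
  assumes "(\<Sum>n. ennreal (2 ^ n * (cmod (z n))\<^sup>2)) \<noteq> \<infinity>"
  shows "summable z"
proof -
  define a where "a n = ennreal (2 ^ n * (cmod (z n))\<^sup>2)" for n
  define C where "C = enn2real (\<Sum>n. a n)"
  have C: "(\<Sum>n. a n) = ennreal C" "C \<ge> 0"
    using assms unfolding C_def a_def by (simp_all add: less_top)
  have le: "norm (z n) \<le> sqrt C * (1 / sqrt 2) ^ n" for n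
  proof (rule power2_le_imp_le)
    have "sum a {n} \<le> (\<Sum>n. a n)"
      by (rule sum_le_suminf) auto
    then have "2 ^ n * (cmod (z n))\<^sup>2 \<le> C"
      using C by (simp add: a_def)
    then have "(cmod (z n))\<^sup>2 \<le> C * (1 / 2) ^ n"
      by (simp add: power_one_over field_simps)
    also have "\<dots> = (sqrt C * (1 / sqrt 2) ^ n)\<^sup>2"
      using C(2) by (simp add: power_mult_distrib power_divide power_mult[symmetric] mult.commute[of n] power_mult)
    finally show "(norm (z n))\<^sup>2 \<le> (sqrt C * (1 / sqrt 2) ^ n)\<^sup>2" .
  qed (use C in simp)
  have "summable (\<lambda>n. sqrt C * (1 / sqrt 2) ^ n)"
    by (intro summable_mult summable_geometric) simp
  then show ?thesis
    by (rule summable_comparison_test') (rule le)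
qed

instance l2 :: banach
proof
  fix X :: "nat \<Rightarrow> l2"
  assume X: "Cauchy X"
  define f where "f n = rep_l2 (X n)" for n
  have f: "sq_int (f n)" and Xf: "X n = abs_l2 (f n)" for n
    by (simp_all add: f_def sq_int_rep_l2 abs_rep_l2)
  have [measurable]: "f n \<in> borel_measurable lebesgue_all" for n
    using f by (rule sq_int_measurable)
  have "\<exists>N. \<forall>m\<ge>N. \<forall>k\<ge>N. norm (X m - X k) < (1/2) ^ n" for n
    using X by (simp add: Cauchy_iff)
  then obtain N where N: "\<And>n m k. m \<ge> N n \<Longrightarrow> k \<ge> N n \<Longrightarrow> norm (X m - X k) < (1/2) ^ n"
    by metis
  define r where "r n = (\<Sum>i\<le>n. N i) + n" for n
  have r: "strict_mono r"
    by (rule strict_monoI_Suc) (simp add: r_def)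
  have rN: "r n \<ge> N n" for n
    unfolding r_def using member_le_sum[of n "{..n}" N] by simp
  have rk: "norm (X (r k) - X (r n)) \<le> (1/2) ^ n" if "k \<ge> n" for k n
    using N[of n "r k" "r n"] rN[of n] strict_mono_mono[OF r] that
    by (meson less_imp_le monoD order_trans)
  have nn: "(\<integral>\<^sup>+p. ennreal ((cmod (f (r k) p - f (r n) p))\<^sup>2) \<partial>lebesgue_all) \<le> ennreal ((1/4) ^ n)"
    if "k \<ge> n" for k n
  proof -
    have "(norm (X (r k) - X (r n)))\<^sup>2 \<le> ((1/2) ^ n)\<^sup>2"
      using rk[OF that] by (intro power_mono) auto
    also have "\<dots> = (1/4) ^ n"
      by (simp add: power2_eq_square flip: power_mult_distrib)
    finally show ?thesis
      using ennreal_norm_abs_l2[OF sq_int_diff[OF f f], of "r k" "r n"]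
      by (simp add: Xf abs_l2_diff f) (metis ennreal_leI)
  qed
  define D where "D n p = f (r (Suc n)) p - f (r n) p" for n p
  have [measurable]: "D n \<in> borel_measurable lebesgue_all" for n
    unfolding D_def by measurable
  have "(\<integral>\<^sup>+p. (\<Sum>n. ennreal (2 ^ n * (cmod (D n p))\<^sup>2)) \<partial>lebesgue_all)
      = (\<Sum>n. \<integral>\<^sup>+p. ennreal (2 ^ n * (cmod (D n p))\<^sup>2) \<partial>lebesgue_all)"
    by (rule nn_integral_suminf) measurable
  also have "\<dots> \<le> (\<Sum>n. ennreal ((1/2) ^ n))"
  proof (rule suminf_le)
    fix n
    have "(\<integral>\<^sup>+p. ennreal (2 ^ n * (cmod (D n p))\<^sup>2) \<partial>lebesgue_all)
        = ennreal (2 ^ n) * (\<integral>\<^sup>+p. ennreal ((cmod (D n p))\<^sup>2) \<partial>lebesgue_all)"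
      by (simp add: ennreal_mult nn_integral_cmult)
    also have "\<dots> \<le> ennreal (2 ^ n) * ennreal ((1/4) ^ n)"
      unfolding D_def by (intro mult_left_mono nn) auto
    also have "\<dots> = ennreal ((1/2) ^ n)"
      by (simp add: ennreal_mult[symmetric] flip: power_mult_distrib)
    finally show "(\<integral>\<^sup>+p. ennreal (2 ^ n * (cmod (D n p))\<^sup>2) \<partial>lebesgue_all) \<le> ennreal ((1/2) ^ n)" .
  qed auto
  also have "\<dots> < \<infinity>"
    by (subst suminf_ennreal2) (auto intro: summable_geometric)
  finally have "AE p in lebesgue_all. (\<Sum>n. ennreal (2 ^ n * (cmod (D n p))\<^sup>2)) \<noteq> \<infinity>"
    by (intro nn_integral_PInf_AE) auto
  then have conv: "AE p in lebesgue_all. convergent (\<lambda>n. f (r n) p)"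
  proof eventually_elim
    case (elim p)
    have "convergent (\<lambda>n. \<Sum>i<n. D i p)"
      using summable_of_weighted[OF elim] by (simp add: summable_iff_convergent)
    then have "convergent (\<lambda>n. f (r 0) p + (\<Sum>i<n. D i p))"
      by (intro convergent_add convergent_const)
    then show ?case
      by (simp add: D_def sum_lessThan_telescope[of "\<lambda>i. f (r i) p"])
  qed
  define g where "g p = lim (\<lambda>n. f (r n) p)" for p
  have [measurable]: "g \<in> borel_measurable lebesgue_all"
    unfolding g_def by measurable
  have lim: "AE p in lebesgue_all. (\<lambda>n. f (r n) p) \<longlonglongrightarrow> g p"
    using conv by eventually_elim (simp add: g_def convergent_LIMSEQ_iff)
  have fatou: "(\<integral>\<^sup>+p. ennreal ((cmod (g p - f (r n) p))\<^sup>2) \<partial>lebesgue_all) \<le> ennreal ((1/4) ^ n)" for n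
  proof -
    have "(\<integral>\<^sup>+p. ennreal ((cmod (g p - f (r n) p))\<^sup>2) \<partial>lebesgue_all)
        = (\<integral>\<^sup>+p. liminf (\<lambda>k. ennreal ((cmod (f (r k) p - f (r n) p))\<^sup>2)) \<partial>lebesgue_all)"
    proof (rule nn_integral_cong_AE)
      show "AE p in lebesgue_all. ennreal ((cmod (g p - f (r n) p))\<^sup>2)
          = liminf (\<lambda>k. ennreal ((cmod (f (r k) p - f (r n) p))\<^sup>2))"
        using lim
      proof eventually_elim
        case (elim p)
        have "(\<lambda>k. ennreal ((cmod (f (r k) p - f (r n) p))\<^sup>2)) \<longlonglongrightarrow> ennreal ((cmod (g p - f (r n) p))\<^sup>2)"
          by (intro tendsto_intros elim)
        then show ?case
          by (rule lim_imp_Liminf[OF trivial_limit_sequentially, symmetric])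
      qed
    qed
    also have "\<dots> \<le> liminf (\<lambda>k. \<integral>\<^sup>+p. ennreal ((cmod (f (r k) p - f (r n) p))\<^sup>2) \<partial>lebesgue_all)"
      by (rule nn_integral_liminf) measurable
    also have "\<dots> \<le> liminf (\<lambda>k. ennreal ((1/4) ^ n))"
      by (rule Liminf_mono) (rule eventually_mono[OF eventually_ge_at_top[of n]], rule nn)
    also have "\<dots> = ennreal ((1/4) ^ n)"
      by (rule Liminf_const) simp
    finally show ?thesis .
  qed
  have gf: "sq_int (\<lambda>p. g p - f (r n) p)" for n
  proof (rule sq_intI_nn)
    show "(\<integral>\<^sup>+p. ennreal ((cmod (g p - f (r n) p))\<^sup>2) \<partial>lebesgue_all) < \<infinity>"
      using fatou[of n] by (rule order.strict_trans1) simp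
  qed measurable
  have g: "sq_int g"
    using sq_int_add[OF gf[of 0] f[of "r 0"]] by simp
  have "norm ((X \<circ> r) n - abs_l2 g) \<le> (1/2) ^ n" for n
  proof -
    have "ennreal ((norm (abs_l2 g - X (r n)))\<^sup>2) \<le> ennreal ((1/4) ^ n)"
      using fatou[of n] by (simp add: Xf abs_l2_diff g f ennreal_norm_abs_l2 gf)
    then have "(norm (abs_l2 g - X (r n)))\<^sup>2 \<le> (1/4) ^ n"
      by simp
    also have "\<dots> = ((1/2) ^ n)\<^sup>2"
      by (simp add: power2_eq_square flip: power_mult_distrib)
    finally have "norm (abs_l2 g - X (r n)) \<le> (1/2) ^ n"
      by (rule power2_le_imp_le) simp
    then show ?thesis
      using norm_minus_commute[of "abs_l2 g" "X (r n)"] by simp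
  qed
  then have "(\<lambda>n. (X \<circ> r) n - abs_l2 g) \<longlonglongrightarrow> 0"
    by (intro Lim_null_comparison[OF always_eventually LIMSEQ_realpow_zero[of "1/2"]]) auto
  then have "(X \<circ> r) \<longlonglongrightarrow> abs_l2 g"
    by (rule LIM_zero_cancel)
  then show "convergent X"
    using X r by (metis Cauchy_converges_subseq convergent_def)
qed

lemma tendsto_abs_l2_dominated:
  assumes f: "sq_int f" "\<And>k. sq_int (F k)"
    and lim: "\<And>p. (\<lambda>k. F k p) \<longlonglongrightarrow> f p"
    and le: "\<And>k p. cmod (F k p) \<le> 2 * cmod (f p)"
  shows "(\<lambda>k. abs_l2 (F k)) \<longlonglongrightarrow> abs_l2 f"
proof -
  have [measurable]: "f \<in> borel_measurable lebesgue_all" "F k \<in> borel_measurable lebesgue_all" for k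
    using f by (auto intro: sq_int_measurable)
  have "(\<lambda>k. LINT p|lebesgue_all. (cmod (F k p - f p))\<^sup>2) \<longlonglongrightarrow> (LINT p|lebesgue_all. 0)"
  proof (rule integral_dominated_convergence)
    show "integrable lebesgue_all (\<lambda>p. 9 * (cmod (f p))\<^sup>2)"
      using f by (simp add: sq_int_def)
    show "AE p in lebesgue_all. (\<lambda>k. (cmod (F k p - f p))\<^sup>2) \<longlonglongrightarrow> 0"
    proof (rule AE_I2)
      fix p
      have "(\<lambda>k. (cmod (F k p - f p))\<^sup>2) \<longlonglongrightarrow> (cmod (f p - f p))\<^sup>2"
        by (intro tendsto_intros lim)
      then show "(\<lambda>k. (cmod (F k p - f p))\<^sup>2) \<longlonglongrightarrow> 0" by simp
    qed
    show "AE p in lebesgue_all. norm ((cmod (F k p - f p))\<^sup>2) \<le> 9 * (cmod (f p))\<^sup>2" for k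
    proof (rule AE_I2)
      fix p
      have "cmod (F k p - f p) \<le> 3 * cmod (f p)"
        using norm_triangle_ineq4[of "F k p" "f p"] le[of k p] by linarith
      then have "(cmod (F k p - f p))\<^sup>2 \<le> (3 * cmod (f p))\<^sup>2"
        by (intro power_mono) auto
      then show "norm ((cmod (F k p - f p))\<^sup>2) \<le> 9 * (cmod (f p))\<^sup>2"
        by (simp add: power_mult_distrib)
    qed
  qed measurable
  then have "(\<lambda>k. (norm (abs_l2 (F k) - abs_l2 f))\<^sup>2) \<longlonglongrightarrow> 0"
    by (simp add: abs_l2_diff f norm_abs_l2 sq_int_diff)
  then have "(\<lambda>k. sqrt ((norm (abs_l2 (F k) - abs_l2 f))\<^sup>2)) \<longlonglongrightarrow> sqrt 0"
    by (rule tendsto_real_sqrt)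
  then have "(\<lambda>k. norm (abs_l2 (F k) - abs_l2 f)) \<longlonglongrightarrow> 0"
    by simp
  then show ?thesis
    by (simp add: LIM_zero_iff tendsto_norm_zero_iff)
qed

lemma sq_int_indicator:
  assumes "A \<in> sets lebesgue_all" "emeasure lebesgue_all A < \<infinity>"
  shows "sq_int (\<lambda>p. c * indicator A p)"
proof -
  have "integrable lebesgue_all (\<lambda>p. (cmod (indicator A p))\<^sup>2)"
  proof -
    have "(\<lambda>p. (cmod (indicator A p))\<^sup>2) = (indicator A :: _ \<Rightarrow> real)"
      by (auto simp: indicator_def)
    then show ?thesis using assms by (simp add: less_top[symmetric])
  qed
  then have "sq_int (indicator A)"
    using assms by (simp add: sq_int_def)
  then show ?thesis by (rule sq_int_scaleC)
qed

lemma abs_l2_cong_AE: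
  assumes "sq_int f" "g \<in> borel_measurable lebesgue_all" "AE p in lebesgue_all. f p = g p"
  shows "abs_l2 f = abs_l2 g"
proof -
  have "integrable lebesgue_all (\<lambda>p. (cmod (g p))\<^sup>2)"
  proof (rule integrable_cong_AE_imp)
    show "integrable lebesgue_all (\<lambda>p. (cmod (f p))\<^sup>2)"
      using assms by (simp add: sq_int_def)
    show "AE p in lebesgue_all. (cmod (f p))\<^sup>2 = (cmod (g p))\<^sup>2"
      using assms(3) by eventually_elim simp
    show "(\<lambda>p. (cmod (g p))\<^sup>2) \<in> borel_measurable lebesgue_all"
      using assms(2) by measurable
  qed
  then have "l2_rel f g"
    using assms by (simp add: l2_rel_def sq_int_def)
  then show ?thesis
    by (rule Quotient_rel_abs[OF Quotient_l2])
qed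

lemma l2_separable: "\<exists>D :: l2 set. countable D \<and> closure D = UNIV"
proof -
  obtain B :: "(nat \<times> (nat \<Rightarrow> real)) set set" where B: "countable B" "topological_basis B"
    using ex_countable_basis by blast
  define G where "G = Inter ` {F. finite F \<and> F \<subseteq> B}"
  have G: "countable G"
    unfolding G_def using B(1) by (intro countable_image countable_Collect_finite_subset)
  have BG: "B \<subseteq> G"
    unfolding G_def by (auto intro!: image_eqI[of _ _ "{_}"])
  have UG: "UNIV \<in> G"
    unfolding G_def by (auto intro!: image_eqI[of _ _ "{}"])
  have IG: "Int_stable G"
  proof (rule Int_stableI)
    fix a b assume "a \<in> G" "b \<in> G"
    then obtain F H where "finite F" "F \<subseteq> B" "a = \<Inter>F" "finite H" "H \<subseteq> B" "b = \<Inter>H"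
      unfolding G_def by auto
    then show "a \<inter> b \<in> G"
      unfolding G_def by (intro image_eqI[of _ _ "F \<union> H"]) auto
  qed
  have Gborel: "A \<in> sets borel" if A: "A \<in> G" for A
  proof -
    obtain F where "finite F" "F \<subseteq> B" "A = \<Inter>F"
      using A unfolding G_def by auto
    moreover have "open X" if "X \<in> F" for X
      using topological_basis_open[OF B(2)] that \<open>F \<subseteq> B\<close> by blast
    ultimately have "open A"
      by (simp add: open_Inter)
    then show ?thesis by (rule borel_open)
  qed
  have sG: "A \<in> sigma_sets UNIV G" if "A \<in> sets borel" for A
  proof -
    have "A \<in> sigma_sets UNIV B"
      using that unfolding borel_eq_countable_basis[OF B] by (simp add: sets_measure_of)
    then show ?thesis
      using sigma_sets_mono'[OF BG] by blast
  qed
  have GP: "G \<subseteq> Pow UNIV" by simp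
  have sGb: "A \<in> sets borel" if "A \<in> sigma_sets UNIV G" for A
    using sets.sigma_sets_subset[of G borel] Gborel that by auto
  obtain E where E: "range E \<subseteq> sets lborel_all" "(\<Union>i. E i) = space lborel_all"
      "\<And>i. emeasure lborel_all (E i) \<noteq> \<infinity>" "incseq E"
    using lborel_all.sigma_finite_incseq by blast
  have Eb: "E i \<in> sets borel" for i using E(1) by auto
  have setsI: "A \<in> sets lebesgue_all" if "A \<in> sets borel" for A
    using that by (simp add: lebesgue_all_def sets_completionI_sets)
  have em: "emeasure lebesgue_all A = emeasure lborel_all A" if "A \<in> sets borel" for A
    using that by (simp add: lebesgue_all_def emeasure_completion)
  have finE: "emeasure lebesgue_all (A \<inter> E n) < \<infinity>" if "A \<in> sets borel" for A n
  proof -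
    have "emeasure lebesgue_all (A \<inter> E n) \<le> emeasure lebesgue_all (E n)"
      using that Eb by (intro emeasure_mono setsI) auto
    also have "\<dots> < \<infinity>" using E(3) em[OF Eb] by (simp add: less_top)
    finally show ?thesis .
  qed
  define I where "I c A = abs_l2 (\<lambda>p. c * indicator A p)" for c :: complex and A
  have sqE: "sq_int (\<lambda>p. c * indicator (A \<inter> E n) p)" if "A \<in> sets borel" for c A n
    using that Eb by (intro sq_int_indicator setsI finE) auto

  define D0 where "D0 = (\<lambda>(q, c, A, n). q *\<^sub>R I c (A \<inter> E n)) ` (\<rat> \<times> {1, \<i>} \<times> G \<times> UNIV)"
  define D where "D = sum_list ` lists D0"
  have "countable D"
    unfolding D_def D0_def using G
    by (intro countable_image countable_lists countable_SIGMA) (auto simp: countable_rat)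
  define V where "V = closure D"
  have V_lim: "x \<in> V" if "\<And>n. F n \<in> V" "F \<longlonglongrightarrow> x" for F x
    unfolding V_def by (rule closed_sequentially[OF closed_closure]) (use that in \<open>simp_all add: V_def\<close>)
  have V_seq: "\<exists>F. (\<forall>n. F n \<in> D) \<and> F \<longlonglongrightarrow> x" if "x \<in> V" for x
    using that by (auto simp: V_def closure_sequential)
  have D_V: "x \<in> V" if "x \<in> D" for x
    using that closure_subset by (auto simp: V_def)
  have D_add: "x + y \<in> D" if xy: "x \<in> D" "y \<in> D" for x y
  proof -
    obtain xs ys where "xs \<in> lists D0" "ys \<in> lists D0" "x = sum_list xs" "y = sum_list ys"
      using xy by (auto simp: D_def)
    then show ?thesis
      unfolding D_def by (intro image_eqI[of _ _ "xs @ ys"]) auto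
  qed
  have D0_scale: "q *\<^sub>R x \<in> D0" if q: "q \<in> \<rat>" and x: "x \<in> D0" for q x
  proof -
    obtain r c A n where "r \<in> \<rat>" "c \<in> {1, \<i>}" "A \<in> G" "x = r *\<^sub>R I c (A \<inter> E n)"
      using x by (auto simp: D0_def)
    then show ?thesis
      unfolding D0_def using q by (intro image_eqI[of _ _ "(q * r, c, A, n)"]) auto
  qed
  have D_scale: "q *\<^sub>R x \<in> D" if q: "q \<in> \<rat>" and x: "x \<in> D" for q x
  proof -
    obtain xs where xs: "xs \<in> lists D0" "x = sum_list xs"
      using x by (auto simp: D_def)
    have "q *\<^sub>R sum_list xs = sum_list (map ((*\<^sub>R) q) xs)"
      by (induction xs) (auto simp: scaleR_right_distrib)
    then show ?thesis
      unfolding D_def using xs D0_scale[OF q]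
      by (intro image_eqI[of _ _ "map ((*\<^sub>R) q) xs"]) auto
  qed
  have V_add: "x + y \<in> V" if xy: "x \<in> V" "y \<in> V" for x y
  proof -
    obtain X where X: "\<And>n. X n \<in> D" "X \<longlonglongrightarrow> x"
      using V_seq[OF xy(1)] by blast
    obtain Y where Y: "\<And>n. Y n \<in> D" "Y \<longlonglongrightarrow> y"
      using V_seq[OF xy(2)] by blast
    have "X n + Y n \<in> V" for n
      using X(1) Y(1) by (intro D_V D_add)
    from V_lim[of "\<lambda>n. X n + Y n", OF this tendsto_add[OF X(2) Y(2)]] show ?thesis .
  qed
  have V_scale: "r *\<^sub>R x \<in> V" if x: "x \<in> V" for r x
  proof -
    obtain X where X: "\<And>n. X n \<in> D" "X \<longlonglongrightarrow> x"
      using V_seq[OF x] by blast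
    obtain q where q: "\<And>n. q n \<in> \<rat>" "q \<longlonglongrightarrow> r"
      using closure_sequential[of r "\<rat>"] by (auto simp: Rats_closure_real)
    have "q n *\<^sub>R X n \<in> V" for n
      using X(1) q(1) by (intro D_V D_scale)
    from V_lim[of "\<lambda>n. q n *\<^sub>R X n", OF this tendsto_scaleR[OF q(2) X(2)]] show ?thesis .
  qed
  have V_0: "0 \<in> V"
    using D_V[of 0] unfolding D_def by (force intro: image_eqI[of _ _ "[]"])
  have V_diff: "x - y \<in> V" if "x \<in> V" "y \<in> V" for x y
    using V_add[OF that(1) V_scale[OF that(2), of "-1"]] by simp

  have stepA: "I c (A \<inter> E n) \<in> V" if A: "A \<in> sets borel" and c: "c \<in> {1, \<i>}" for A c n
    using IG GP sG[OF A]
  proof (induction rule: sigma_sets_induct_disjoint)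
    case (basic A)
    have "I c (A \<inter> E n) \<in> D0"
      unfolding D0_def using basic c by (intro image_eqI[of _ _ "(1, c, A, n)"]) auto
    then have "I c (A \<inter> E n) \<in> D"
      unfolding D_def by (intro image_eqI[of _ _ "[I c (A \<inter> E n)]"]) auto
    then show ?case by (rule D_V)
  next
    case empty
    have "I c ({} \<inter> E n) = 0"
      by (simp add: I_def zero_l2.abs_eq)
    then show ?case using V_0 by simp
  next
    case (compl A)
    have Ab: "A \<in> sets borel"
      using compl(1) by (rule sGb)
    have UE: "I c (UNIV \<inter> E n) \<in> V"
    proof -
      have "I c (UNIV \<inter> E n) \<in> D0"
        unfolding D0_def using UG c by (intro image_eqI[of _ _ "(1, c, UNIV, n)"]) auto
      then have "I c (UNIV \<inter> E n) \<in> D"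
        unfolding D_def by (intro image_eqI[of _ _ "[I c (UNIV \<inter> E n)]"]) auto
      then show ?thesis by (rule D_V)
    qed
    have "I c (UNIV \<inter> E n) - I c (A \<inter> E n)
        = abs_l2 (\<lambda>p. c * indicator (UNIV \<inter> E n) p - c * indicator (A \<inter> E n) p)"
      unfolding I_def by (rule abs_l2_diff[OF sqE sqE]) (use Ab in auto)
    also have "\<dots> = I c ((UNIV - A) \<inter> E n)"
      unfolding I_def by (rule arg_cong[of _ _ abs_l2]) (auto simp: indicator_def)
    finally show ?case
      using V_diff[OF UE compl(2)] by simp
  next
    case (union A)
    have Ab: "A i \<in> sets borel" for i
      using union(2) by (intro sGb) auto
    have part: "I c ((\<Union>i<k. A i) \<inter> E n) \<in> V" for k
    proof (induction k)
      case 0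
      have "I c ({} \<inter> E n) = 0"
        by (simp add: I_def zero_l2.abs_eq)
      then show ?case using V_0 by simp
    next
      case (Suc k)
      have disj: "(\<Union>i<k. A i) \<inter> A k = {}"
        using union(1) by (auto simp: disjoint_family_on_def) (metis Int_iff empty_iff less_irrefl)
      have "I c ((\<Union>i<k. A i) \<inter> E n) + I c (A k \<inter> E n)
          = abs_l2 (\<lambda>p. c * indicator ((\<Union>i<k. A i) \<inter> E n) p + c * indicator (A k \<inter> E n) p)"
        unfolding I_def by (rule abs_l2_add[OF sqE sqE]) (use Ab in auto)
      also have "\<dots> = I c ((\<Union>i<Suc k. A i) \<inter> E n)"
        unfolding I_def using disj
        by (intro arg_cong[of _ _ abs_l2]) (auto simp: indicator_def lessThan_Suc fun_eq_iff)
      finally show ?case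
        using V_add[OF Suc union(3)[of k]] by simp
    qed
    have "(\<lambda>k. I c ((\<Union>i<k. A i) \<inter> E n)) \<longlonglongrightarrow> I c ((\<Union>i. A i) \<inter> E n)"
      unfolding I_def
    proof (rule tendsto_abs_l2_dominated[OF sqE sqE])
      fix p
      show "(\<lambda>k. c * indicator ((\<Union>i<k. A i) \<inter> E n) p) \<longlonglongrightarrow> c * indicator ((\<Union>i. A i) \<inter> E n) p"
      proof (cases "p \<in> (\<Union>i. A i) \<inter> E n")
        case True
        then obtain j where j: "p \<in> A j" "p \<in> E n" by auto
        have "\<forall>\<^sub>F k in sequentially. c * indicator ((\<Union>i<k. A i) \<inter> E n) p = c * indicator ((\<Union>i. A i) \<inter> E n) p"
          using eventually_gt_at_top[of j] by eventually_elim (use j in \<open>auto simp: indicator_def\<close>)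
        then show ?thesis by (rule tendsto_eventually)
      next
        case False
        then show ?thesis by (auto simp: indicator_def)
      qed
      show "cmod (c * indicator ((\<Union>i<k. A i) \<inter> E n) p) \<le> 2 * cmod (c * indicator ((\<Union>i. A i) \<inter> E n) p)" for k
        using c by (auto simp: indicator_def)
    qed (use Ab in auto)
    then show ?case
      by (rule V_lim[OF part])
  qed
  have stepB: "I c A \<in> V" if A: "A \<in> sets borel" "emeasure lebesgue_all A < \<infinity>" and c: "c \<in> {1, \<i>}" for A c
  proof -
    have "(\<lambda>k. I c (A \<inter> E k)) \<longlonglongrightarrow> I c A"
      unfolding I_def
    proof (rule tendsto_abs_l2_dominated[OF _ sqE[OF A(1)]])
      show "sq_int (\<lambda>p. c * indicator A p)"
        using A by (intro sq_int_indicator setsI)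
      fix p
      obtain j where j: "p \<in> E j" using E(2) by auto
      have "\<forall>\<^sub>F k in sequentially. c * indicator (A \<inter> E k) p = c * indicator A p"
        using eventually_ge_at_top[of j]
        by eventually_elim (use j incseqD[OF E(4)] in \<open>auto simp: indicator_def\<close>)
      then show "(\<lambda>k. c * indicator (A \<inter> E k) p) \<longlonglongrightarrow> c * indicator A p"
        by (rule tendsto_eventually)
      show "cmod (c * indicator (A \<inter> E k) p) \<le> 2 * cmod (c * indicator A p)" for k
        using c by (auto simp: indicator_def)
    qed
    then show ?thesis
      by (rule V_lim[OF stepA[OF A(1) c]])
  qed
  have stepC: "I c A \<in> V" if A: "A \<in> sets lebesgue_all" "emeasure lebesgue_all A < \<infinity>" and c: "c \<in> {1, \<i>}" for A c
  proof -
    define A' where "A' = main_part lborel_all A"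
    have A': "A' \<in> sets borel"
      using A(1) main_part_sets[of A lborel_all] by (simp add: A'_def lebesgue_all_def)
    have "emeasure lebesgue_all A' < \<infinity>"
      using A emeasure_completion[of A lborel_all] em[OF A'] by (simp add: A'_def lebesgue_all_def)
    then have "I c A' \<in> V" using A' c stepB by blast
    moreover have "I c A' = I c A"
      unfolding I_def
    proof (rule abs_l2_cong_AE)
      show "sq_int (\<lambda>p. c * indicator A' p)"
        using \<open>emeasure lebesgue_all A' < \<infinity>\<close> A' by (intro sq_int_indicator setsI)
      have "AE p in lborel_all. p \<in> A' \<longleftrightarrow> p \<in> A"
        using A(1) AE_in_main_part[of A lborel_all] by (simp add: A'_def lebesgue_all_def)
      then have "AE p in lborel_all. c * indicator A' p = c * indicator A p"
        by eventually_elim (auto simp: indicator_def)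
      then show "AE p in lebesgue_all. c * indicator A' p = c * indicator A p"
        unfolding lebesgue_all_def by (rule AE_completion)
    qed (use A in auto)
    ultimately show ?thesis by simp
  qed
  have stepD: "I z A \<in> V" if A: "A \<in> sets lebesgue_all" "emeasure lebesgue_all A < \<infinity>" for A z
  proof -
    have "I z A = Re z *\<^sub>R I 1 A + Im z *\<^sub>R I \<i> A"
      unfolding I_def using A
      by (subst (1 2) abs_l2_scaleR, (intro sq_int_indicator A)+)
        (subst abs_l2_add, (intro sq_int_scaleC sq_int_indicator A)+,
         auto intro!: arg_cong[of _ _ abs_l2] simp: fun_eq_iff indicator_def complex_eq_iff)
    then show ?thesis
      using stepC[OF A] by (auto intro!: V_add V_scale)
  qed
  have stepE: "abs_l2 s \<in> V" if s: "simple_function lebesgue_all s" and sq: "sq_int s" for s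
  proof -
    have fin: "finite (range s)" and meas: "s -` {y} \<in> sets lebesgue_all" for y
      using s simple_functionD[OF s] by (auto)
    have fin_em: "emeasure lebesgue_all (s -` {y}) < \<infinity>" if "y \<noteq> 0" for y
    proof -
      have "integrable lebesgue_all (\<lambda>p. (cmod y)\<^sup>2 * indicator (s -` {y}) p)"
      proof (rule Bochner_Integration.integrable_bound)
        show "integrable lebesgue_all (\<lambda>p. (cmod (s p))\<^sup>2)"
          using sq by (simp add: sq_int_def)
        show "(\<lambda>p. (cmod y)\<^sup>2 * indicator (s -` {y}) p) \<in> borel_measurable lebesgue_all"
          using meas by measurable
      qed (auto simp: indicator_def)
      then have "integrable lebesgue_all (indicator (s -` {y}) :: _ \<Rightarrow> real)"
        using that by simp
      then show ?thesis
        by (simp add: integrable_indicator_iff)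
    qed
    have sqy: "sq_int (\<lambda>p. y * indicator (s -` {y}) p)" for y
      using sq_int_indicator[OF meas fin_em] sq_int_zero by (cases "y = 0") auto
    have sums: "sq_int (\<lambda>p. \<Sum>y\<in>Y. y * indicator (s -` {y}) p) \<and> abs_l2 (\<lambda>p. \<Sum>y\<in>Y. y * indicator (s -` {y}) p) \<in> V"
      if "finite Y" for Y
      using that
    proof (induction Y rule: finite_induct)
      case empty
      then show ?case using V_0 sq_int_zero by (simp add: zero_l2.abs_eq)
    next
      case (insert y Y)
      have "I y (s -` {y}) \<in> V"
      proof (cases "y = 0")
        case True
        then show ?thesis using V_0 by (simp add: I_def zero_l2.abs_eq)
      next
        case False
        then show ?thesis by (intro stepD meas fin_em)
      qed
      then have "abs_l2 (\<lambda>p. y * indicator (s -` {y}) p) + abs_l2 (\<lambda>p. \<Sum>y\<in>Y. y * indicator (s -` {y}) p) \<in> V"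
        using insert.IH unfolding I_def by (intro V_add) simp_all
      moreover have "(\<lambda>p. \<Sum>y\<in>insert y Y. y * indicator (s -` {y}) p)
          = (\<lambda>p. y * indicator (s -` {y}) p + (\<Sum>y\<in>Y. y * indicator (s -` {y}) p))"
        using insert.hyps by (simp only: sum.insert simp_thms)
      ultimately show ?case
        using sq_int_add[OF sqy[of y] insert.IH[THEN conjunct1]] abs_l2_add[OF sqy[of y] insert.IH[THEN conjunct1]]
        by simp
    qed
    have "(\<lambda>p. \<Sum>y\<in>range s. y * indicator (s -` {y}) p) = s"
    proof
      fix p
      have "(\<Sum>y\<in>range s. y * indicator (s -` {y}) p) = (\<Sum>y\<in>range s. if y = s p then y else 0)"
        by (intro sum.cong) (auto simp: indicator_def)
      also have "\<dots> = s p" using fin by simp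
      finally show "(\<Sum>y\<in>range s. y * indicator (s -` {y}) p) = s p" .
    qed
    then show ?thesis using sums[OF fin] by simp
  qed
  have "u \<in> V" for u
  proof -
    obtain f where f: "sq_int f" "u = abs_l2 f"
      using sq_int_rep_l2 abs_rep_l2 by metis
    obtain F where F: "\<And>i. simple_function lebesgue_all (F i)" "\<And>p. (\<lambda>i. F i p) \<longlonglongrightarrow> f p"
        "\<And>i p. dist (F i p) 0 \<le> 2 * dist (f p) 0"
      using borel_measurable_implies_sequence_metric[OF sq_int_measurable[OF f(1)], of 0] by auto
    have sqF: "sq_int (F i)" for i
    proof (rule sq_int_bound)
      show "integrable lebesgue_all (\<lambda>p. 4 * (cmod (f p))\<^sup>2)"
        using f by (simp add: sq_int_def)
      show "F i \<in> borel_measurable lebesgue_all"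
        using F(1) by (rule borel_measurable_simple_function)
      show "(cmod (F i p))\<^sup>2 \<le> 4 * (cmod (f p))\<^sup>2" for p
        using power_mono[OF F(3)[of i p], of 2] by (simp add: power_mult_distrib)
    qed
    have "(\<lambda>i. abs_l2 (F i)) \<longlonglongrightarrow> abs_l2 f"
      using F by (intro tendsto_abs_l2_dominated f sqF) auto
    then show ?thesis
      unfolding f(2) by (rule V_lim[OF stepE[OF F(1) sqF]])
  qed
  then show ?thesis
    using \<open>countable D\<close> unfolding V_def by blast
qed

instance l2 :: second_countable_topology
proof
  obtain D :: "l2 set" where D: "countable D" "closure D = UNIV"
    using l2_separable by blast
  define B where "B = (\<lambda>(x, q). ball x q) ` (D \<times> \<rat>)"
  have "topological_basis B"
  proof (rule topological_basisI)
    show "open U" if "U \<in> B" for U using that by (auto simp: B_def)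
    fix U :: "l2 set" and x assume "open U" "x \<in> U"
    then obtain e where e: "e > 0" "ball x e \<subseteq> U"
      using openE by blast
    obtain q where q: "q \<in> \<rat>" "0 < q" "q < e / 2"
      using Rats_dense_in_real[of 0 "e / 2"] e by auto
    obtain y where y: "y \<in> D" "dist y x < q"
      using D(2) q(2) closure_approachable[of x D] by auto
    have "ball y q \<subseteq> U"
    proof
      fix z assume "z \<in> ball y q"
      then have "dist x z < e"
        using y q dist_triangle[of x z y] by (simp add: dist_commute)
      then show "z \<in> U" using e by auto
    qed
    then show "\<exists>B'\<in>B. x \<in> B' \<and> B' \<subseteq> U"
      using y q by (intro bexI[of _ "ball y q"]) (auto simp: B_def)
  qed
  moreover have "countable B"
    unfolding B_def using D(1) by (intro countable_image countable_SIGMA) (auto simp: countable_rat)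
  ultimately show "\<exists>B :: l2 set set. countable B \<and> open = generate_topology B"
    using topological_basis_imp_subbasis by blast
qed

definition Rn :: "nat \<Rightarrow> (nat \<Rightarrow> real) set" where
  "Rn d = {..<d} \<rightarrow>\<^sub>E UNIV"

definition cube :: "nat \<Rightarrow> real \<Rightarrow> (nat \<Rightarrow> real) set" where
  "cube d L = {..<d} \<rightarrow>\<^sub>E {0<..<L}"

definition sector :: "nat \<Rightarrow> (nat \<Rightarrow> real) set" where
  "sector n = {x \<in> Rn 2. 0 < x 0 \<and> 0 < x 1 \<and> x 1 < tan (pi / 2 ^ n) * x 0}"

definition thick :: "nat \<Rightarrow> real \<Rightarrow> (nat \<Rightarrow> real) \<Rightarrow> (nat \<Rightarrow> real) set \<Rightarrow> bool" where
  "thick d \<gamma> a S \<longleftrightarrow> 0 < \<gamma> \<and> \<gamma> \<le> 1 \<and> (\<forall>j<d. 0 < a j) \<and> S \<in> sets (lebesgue_dim d) \<and>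
     (\<forall>x\<in>Rn d. measure (lebesgue_dim d) (S \<inter> (\<Pi>\<^sub>E j\<in>{..<d}. {x j..x j + a j})) \<ge> \<gamma> * (\<Prod>j<d. a j))"

definition l2_on :: "nat \<Rightarrow> (nat \<Rightarrow> real) set \<Rightarrow> l2 set" where
  "l2_on d \<Omega> = {u. AE p in lebesgue_all. p \<notin> {d} \<times> \<Omega> \<longrightarrow> rep_l2 u p = 0}"

definition l2_of :: "nat \<Rightarrow> ((nat \<Rightarrow> real) \<Rightarrow> complex) \<Rightarrow> l2" where
  "l2_of d \<phi> = abs_l2 (\<lambda>(k, x). if k = d \<and> x \<in> Rn d then \<phi> x else 0)"

definition restrict_l2 :: "nat \<Rightarrow> (nat \<Rightarrow> real) set \<Rightarrow> l2 \<Rightarrow> l2" where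
  "restrict_l2 d \<omega> u = abs_l2 (\<lambda>p. indicator ({d} \<times> \<omega>) p * rep_l2 u p)"

definition partial_deriv :: "nat \<Rightarrow> ((nat \<Rightarrow> real) \<Rightarrow> complex) \<Rightarrow> (nat \<Rightarrow> real) \<Rightarrow> complex" where
  "partial_deriv i \<phi> x = vector_derivative (\<lambda>t. \<phi> (x(i := t))) (at (x i))"

definition smooth :: "nat \<Rightarrow> ((nat \<Rightarrow> real) \<Rightarrow> complex) \<Rightarrow> bool" where
  "smooth d \<phi> \<longleftrightarrow> (\<forall>js\<in>lists {..<d}.
     continuous_on (Rn d) (fold partial_deriv js \<phi>) \<and>
     (\<forall>i<d. \<forall>x\<in>Rn d. (\<lambda>t. fold partial_deriv js \<phi> (x(i := t))) differentiable (at (x i))))"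

definition test_functions :: "nat \<Rightarrow> (nat \<Rightarrow> real) set \<Rightarrow> ((nat \<Rightarrow> real) \<Rightarrow> complex) set" where
  "test_functions d \<Omega> =
     {\<phi>. smooth d \<phi> \<and> (\<exists>C. compact C \<and> C \<subseteq> \<Omega> \<and> (\<forall>x\<in>Rn d - C. \<phi> x = 0))}"

text \<open>
  \<open>weak_deriv d \<Omega> i u g\<close>: \<open>u\<close> and \<open>g\<close> lie in \<open>L\<^sup>2(\<Omega>)\<close> and \<open>g\<close> is the distributional derivative
  \<open>\<partial>\<^sub>i u\<close> on \<open>\<Omega>\<close>. It only tests against functions supported in \<open>\<Omega>\<close>, so the extension of \<open>u\<close> by
  zero contributes nothing on the boundary.
\<close>

definition weak_deriv :: "nat \<Rightarrow> (nat \<Rightarrow> real) set \<Rightarrow> nat \<Rightarrow> l2 \<Rightarrow> l2 \<Rightarrow> bool" where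
  "weak_deriv d \<Omega> i u g \<longleftrightarrow> u \<in> l2_on d \<Omega> \<and> g \<in> l2_on d \<Omega> \<and>
     (\<forall>\<phi>\<in>test_functions d \<Omega>.
        (LINT x|lebesgue_dim d. rep_l2 u (d, x) * partial_deriv i \<phi> x) =
        - (LINT x|lebesgue_dim d. rep_l2 g (d, x) * \<phi> x))"

definition wderiv :: "nat \<Rightarrow> (nat \<Rightarrow> real) set \<Rightarrow> nat \<Rightarrow> l2 \<Rightarrow> l2" where
  "wderiv d \<Omega> i u = (THE g. weak_deriv d \<Omega> i u g)"

definition H1 :: "nat \<Rightarrow> (nat \<Rightarrow> real) set \<Rightarrow> l2 set" where
  "H1 d \<Omega> = {u \<in> l2_on d \<Omega>. \<forall>i<d. \<exists>g. weak_deriv d \<Omega> i u g}"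

definition H1_norm :: "nat \<Rightarrow> (nat \<Rightarrow> real) set \<Rightarrow> l2 \<Rightarrow> real" where
  "H1_norm d \<Omega> u = sqrt ((norm u)\<^sup>2 + (\<Sum>i<d. (norm (wderiv d \<Omega> i u))\<^sup>2))"

definition H1_0 :: "nat \<Rightarrow> (nat \<Rightarrow> real) set \<Rightarrow> l2 set" where
  "H1_0 d \<Omega> = {u \<in> H1 d \<Omega>. \<forall>\<epsilon>>0. \<exists>\<phi>\<in>test_functions d \<Omega>. H1_norm d \<Omega> (u - l2_of d \<phi>) < \<epsilon>}"

datatype boundary_condition = Dirichlet | Neumann

fun form_domain :: "boundary_condition \<Rightarrow> nat \<Rightarrow> (nat \<Rightarrow> real) set \<Rightarrow> l2 set" where
  "form_domain Dirichlet d \<Omega> = H1_0 d \<Omega>"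
| "form_domain Neumann d \<Omega> = H1 d \<Omega>"

definition energy_form :: "nat \<Rightarrow> (nat \<Rightarrow> real) set \<Rightarrow> l2 \<Rightarrow> l2 \<Rightarrow> complex" where
  "energy_form d \<Omega> f g = (\<Sum>i<d. cinner (wderiv d \<Omega> i f) (wderiv d \<Omega> i g))"

text \<open>
  The graph of the Laplacian: \<open>laplacian bc d \<Omega> f g\<close> says that \<open>f\<close> is in its domain and \<open>\<Delta> f = g\<close>,
  where \<open>- \<Delta>\<close> is the operator associated with the form.
\<close>

definition laplacian :: "boundary_condition \<Rightarrow> nat \<Rightarrow> (nat \<Rightarrow> real) set \<Rightarrow> l2 \<Rightarrow> l2 \<Rightarrow> bool" where
  "laplacian bc d \<Omega> f g \<longleftrightarrow> f \<in> form_domain bc d \<Omega> \<and> g \<in> l2_on d \<Omega> \<and>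
     (\<forall>h\<in>form_domain bc d \<Omega>. energy_form d \<Omega> f h = cinner (- g) h)"

definition c0_semigroup :: "l2 set \<Rightarrow> (real \<Rightarrow> l2 \<Rightarrow> l2) \<Rightarrow> bool" where
  "c0_semigroup X S \<longleftrightarrow>
     (\<forall>t\<ge>0. \<forall>u\<in>X. S t u \<in> X) \<and>
     (\<forall>t\<ge>0. \<forall>u\<in>X. \<forall>v\<in>X. S t (u + v) = S t u + S t v) \<and>
     (\<forall>t\<ge>0. \<forall>u\<in>X. \<forall>c. S t (c *\<^sub>C u) = c *\<^sub>C S t u) \<and>
     (\<forall>t\<ge>0. \<exists>M. \<forall>u\<in>X. norm (S t u) \<le> M * norm u) \<and>
     (\<forall>u\<in>X. S 0 u = u) \<and>
     (\<forall>s\<ge>0. \<forall>t\<ge>0. \<forall>u\<in>X. S (s + t) u = S s (S t u)) \<and>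
     (\<forall>u\<in>X. ((\<lambda>t. S t u) \<longlongrightarrow> u) (at_right 0))"

definition generator :: "l2 set \<Rightarrow> (real \<Rightarrow> l2 \<Rightarrow> l2) \<Rightarrow> l2 \<Rightarrow> l2 \<Rightarrow> bool" where
  "generator X S f g \<longleftrightarrow> f \<in> X \<and> ((\<lambda>t. (S t f - f) /\<^sub>R t) \<longlongrightarrow> g) (at_right 0)"

text \<open>
  \<open>heat bc d \<Omega> t u\<close> is \<open>e\<^bsup>t\<Delta>\<^esup> u\<close> for \<open>t \<ge> 0\<close> and \<open>u \<in> L\<^sup>2(\<Omega>)\<close>, given by the unique strongly continuous
  semigroup on \<open>L\<^sup>2(\<Omega>)\<close> with generator \<open>\<Delta>\<close>. The description ranges over values since a semigroup
  \<open>S\<close> is only determined on \<open>L\<^sup>2(\<Omega>)\<close> and for \<open>t \<ge> 0\<close>.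
\<close>

definition heat :: "boundary_condition \<Rightarrow> nat \<Rightarrow> (nat \<Rightarrow> real) set \<Rightarrow> real \<Rightarrow> l2 \<Rightarrow> l2" where
  "heat bc d \<Omega> t u = (THE w. \<exists>S. c0_semigroup (l2_on d \<Omega>) S \<and>
     (\<forall>f g. generator (l2_on d \<Omega>) S f g \<longleftrightarrow> laplacian bc d \<Omega> f g) \<and> w = S t u)"

definition controls :: "nat \<Rightarrow> (nat \<Rightarrow> real) set \<Rightarrow> real \<Rightarrow> (real \<Rightarrow> l2) set" where
  "controls d \<Omega> T = {v. (\<forall>s\<in>{0<..<T}. v s \<in> l2_on d \<Omega>) \<and>
     set_borel_measurable lebesgue {0<..<T} v \<and>
     set_integrable lebesgue {0<..<T} (\<lambda>s. (norm (v s))\<^sup>2)}"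

text \<open>
  \<open>steers bc d \<Omega> \<omega> T u0 v\<close>: the mild solution with initial value \<open>u0\<close> and control \<open>v\<close> acting on
  \<open>\<omega>\<close> vanishes at time \<open>T\<close>. Integrability is automatic for \<open>v \<in> controls d \<Omega> T\<close> and is stated
  only because the library integral of a non-integrable function is \<open>0\<close>.
\<close>

definition steers ::
    "boundary_condition \<Rightarrow> nat \<Rightarrow> (nat \<Rightarrow> real) set \<Rightarrow> (nat \<Rightarrow> real) set \<Rightarrow> real \<Rightarrow> l2 \<Rightarrow> (real \<Rightarrow> l2) \<Rightarrow> bool" where
  "steers bc d \<Omega> \<omega> T u0 v \<longleftrightarrow>
     set_integrable lebesgue {0<..<T} (\<lambda>s. heat bc d \<Omega> (T - s) (restrict_l2 d \<omega> (v s))) \<and>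
     heat bc d \<Omega> T u0 + (LINT s:{0<..<T}|lebesgue. heat bc d \<Omega> (T - s) (restrict_l2 d \<omega> (v s))) = 0"

definition null_controllable ::
    "boundary_condition \<Rightarrow> nat \<Rightarrow> (nat \<Rightarrow> real) set \<Rightarrow> (nat \<Rightarrow> real) set \<Rightarrow> real \<Rightarrow> bool" where
  "null_controllable bc d \<Omega> \<omega> T \<longleftrightarrow>
     (\<forall>u0\<in>l2_on d \<Omega>. \<exists>v\<in>controls d \<Omega> T. steers bc d \<Omega> \<omega> T u0 v)"

definition control_norm :: "nat \<Rightarrow> (nat \<Rightarrow> real) set \<Rightarrow> real \<Rightarrow> (real \<Rightarrow> l2) \<Rightarrow> real" where
  "control_norm d \<omega> T v = sqrt (LINT s:{0<..<T}|lebesgue. (norm (restrict_l2 d \<omega> (v s)))\<^sup>2)"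

definition control_cost ::
    "boundary_condition \<Rightarrow> nat \<Rightarrow> (nat \<Rightarrow> real) set \<Rightarrow> (nat \<Rightarrow> real) set \<Rightarrow> real \<Rightarrow> ennreal" where
  "control_cost bc d \<Omega> \<omega> T =
     (SUP u0\<in>{u \<in> l2_on d \<Omega>. norm u = 1}.
        INF v\<in>{v \<in> controls d \<Omega> T. steers bc d \<Omega> \<omega> T u0 v}. ennreal (control_norm d \<omega> T v))"

definition control_constant :: "real \<Rightarrow> bool" where
  "control_constant K \<longleftrightarrow> K > 0 \<and>
     (\<forall>d\<ge>1. \<forall>L>0. \<forall>\<Omega>\<in>{Rn d, cube d L}. \<forall>bc \<gamma> a S.
        thick d \<gamma> a S \<longrightarrow> (\<Omega> = cube d L \<longrightarrow> (\<forall>j<d. a j \<le> L)) \<longrightarrow>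
        (\<forall>T>0. null_controllable bc d \<Omega> (\<Omega> \<inter> S) T \<and>
           control_cost bc d \<Omega> (\<Omega> \<inter> S) T \<le> ennreal (
             1 / sqrt T * (K ^ d / \<gamma>) powr (K * real d / 2) *
             exp (K * (\<Sum>j<d. a j)\<^sup>2 * (ln (K ^ d / \<gamma>))\<^sup>2 / (2 * T)))))"

end

theory Submission
  imports Defs "HOL-Computational_Algebra.Polynomial"
begin

text \<open>
  The sector of angle \<open>\<pi> / 2\<^sup>n\<close> is obtained from the plane by halving \<open>n + 1\<close> times: every sector
  \<open>W\<^sub>k\<close> of angle \<open>\<pi> / 2\<^sup>k\<close> is one half of \<open>W\<^sub>k\<^sub>-\<^sub>1\<close>, which is symmetric under the reflection \<open>R\<close> in
  the oblique edge of \<open>W\<^sub>k\<close>. Let \<open>J u = u \<circ> R\<close>, let \<open>\<sigma>\<close> be \<open>-1\<close> for Dirichlet and \<open>1\<close> for Neumann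
  conditions, and let \<open>lift u = (u + \<sigma> J u) / \<surd>2\<close>, with \<open>unlift\<close> its restriction to the half. Odd
  and even reflection match the form domains on the half with those on the whole, so \<open>unlift\<close>
  intertwines the Laplacians and hence the heat semigroups. As \<open>lift\<close> is an isometry on the half,
  \<open>unlift\<close> is a contraction and \<open>unlift (lift u) = u\<close>, a control for \<open>lift u\<close> acting on
  \<open>\<omega> \<union> R \<omega>\<close> yields one for \<open>u\<close> acting on \<open>\<omega>\<close>, of no larger norm.

  After \<open>n + 1\<close> reflections \<open>\<omega>\<close> has become a subset of the plane. It is thick: the reflections
  carry discs to discs and every centre into the closed sector, where a disc of suitable radius
  around any point contains a translate of the original box lying inside the sector.

  The heat semigroup is defined by description. Its existence is Hille-Yosida for the dissipative
  operator associated with the form, and an operator \<open>B\<close> intertwining the generators of \<open>S'\<close> and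
  \<open>S\<close> intertwines the semigroups because \<open>s \<mapsto> S (t - s) (B (S' s f))\<close> has derivative \<open>0\<close>.
\<close>

section \<open>Riesz representation and uniform boundedness\<close>

text \<open>The delicate point is that reflected functions land in the right Sobolev space.
  \<open>H1\<close> is defined by weak derivatives alone, without traces or approximation by
  functions smooth up to the boundary. A test function that crosses the line of reflection therefore
  has to be cut off there, and the gradient of the cutoff blows up. Two facts tame it: this gradient
  is normal to the line, hence invisible to tangential derivatives, and against an odd test
  function, which vanishes linearly on the line, it stays bounded. The even extension rests on both
  facts, the restriction of odd parts on the second. The statements about the Laplacians then follow
  by duality, since \<open>unlift\<close> is adjoint to \<open>lift\<close> in L2 and for the forms.
  The constant: let r be the diagonal of the box and q = 2^(3n-4). Discs of radius \<rho> with
  \<rho>^2 = q r^2 around points of the closed sector contain a translate of the box inside the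
  sector. Reflections change no constant, so the set in the plane is thick for squares of side 2
  \<rho> with parameter \<open>\<gamma>' / q\<close>. Hence q stands beside K^2 and, through
  \<rho>^2, in the exponent.\<close>

lemma quadratic_form_bound:
  fixes p q r :: real
  assumes "\<And>t. 0 \<le> p + 2 * t * q + t\<^sup>2 * r" "0 \<le> r"
  shows "q\<^sup>2 \<le> p * r"
proof (cases "r = 0")
  case True
  have "q = 0"
  proof (rule ccontr)
    assume "q \<noteq> 0"
    \<comment> \<open>With r = 0 the polynomial is affine; this t turns p + 2 t q into - p - 2,
      which is negative because t = 0 gives p \<ge> 0.\<close>
    then have "2 * (- (p + 1) / q) * q = - 2 * (p + 1)" by simp
    with assms(1)[of "- (p + 1) / q"] assms(1)[of 0] True show False by simp
  qed
  with True show ?thesis by simp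
next
  case False
  with assms(2) have "r > 0" by simp
  have "0 \<le> p + 2 * (- q / r) * q + (- q / r)\<^sup>2 * r" by (rule assms(1))
  also have "\<dots> = p - q\<^sup>2 / r"
    using \<open>r > 0\<close> by (simp add: field_simps power2_eq_square)
  finally show ?thesis using \<open>r > 0\<close> by (simp add: field_simps)
qed

text \<open>The direct method: the solution minimises Q v = a v v - 2 l v. The space is a subset
  with its own form \<open>a\<close>, complete for \<open>a\<close> by assumption, so that one
  statement yields both the resolvent of the Laplacian on a form domain and the orthogonal
  projection onto a closed subspace of L2.\<close>

lemma riesz_representation:
  fixes V :: "'a::real_vector set" and a :: "'a \<Rightarrow> 'a \<Rightarrow> real" and l :: "'a \<Rightarrow> real"
  assumes V: "subspace V"
    and add: "\<And>u v w. u \<in> V \<Longrightarrow> v \<in> V \<Longrightarrow> w \<in> V \<Longrightarrow> a (u + v) w = a u w + a v w"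
    and scale: "\<And>r u w. u \<in> V \<Longrightarrow> w \<in> V \<Longrightarrow> a (r *\<^sub>R u) w = r * a u w"
    and sym: "\<And>u v. u \<in> V \<Longrightarrow> v \<in> V \<Longrightarrow> a u v = a v u"
    and pos: "\<And>u. u \<in> V \<Longrightarrow> 0 \<le> a u u"
    and ladd: "\<And>u v. u \<in> V \<Longrightarrow> v \<in> V \<Longrightarrow> l (u + v) = l u + l v"
    and lscale: "\<And>r u. u \<in> V \<Longrightarrow> l (r *\<^sub>R u) = r * l u"
    and bound: "\<And>u. u \<in> V \<Longrightarrow> (l u)\<^sup>2 \<le> C * a u u"
    and complete: "\<And>X. (\<And>n. X n \<in> V) \<Longrightarrow>
      (\<And>e. e > 0 \<Longrightarrow> \<exists>N::nat. \<forall>m\<ge>N. \<forall>n\<ge>N. a (X m - X n) (X m - X n) < e) \<Longrightarrow>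
      \<exists>u\<in>V. (\<lambda>n. a (X n - u) (X n - u)) \<longlonglongrightarrow> 0"
  shows "\<exists>u\<in>V. \<forall>v\<in>V. a u v = l v"
proof -
  have V0: "0 \<in> V" and Vadd: "\<And>u v. u \<in> V \<Longrightarrow> v \<in> V \<Longrightarrow> u + v \<in> V"
    and Vsc: "\<And>r u. u \<in> V \<Longrightarrow> r *\<^sub>R u \<in> V" and Vdiff: "\<And>u v. u \<in> V \<Longrightarrow> v \<in> V \<Longrightarrow> u - v \<in> V"
    using V by (auto intro: subspace_0 subspace_add subspace_scale subspace_diff)
  have add2: "a w (u + v) = a w u + a w v" if "u \<in> V" "v \<in> V" "w \<in> V" for u v w
    using add[OF that] sym that Vadd by auto
  have scale2: "a w (r *\<^sub>R u) = r * a w u" if "u \<in> V" "w \<in> V" for r u w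
    using scale[OF that] sym that Vsc by auto
  have diff: "a (u - v) w = a u w - a v w" if "u \<in> V" "v \<in> V" "w \<in> V" for u v w
    using add[of u "- v" w] scale[of v w "-1"] that Vsc[of v "-1"] by simp
  have diff2: "a w (u - v) = a w u - a w v" if "u \<in> V" "v \<in> V" "w \<in> V" for u v w
    using diff[OF that] sym that Vdiff by auto
  define Q where "Q v = a v v - 2 * l v" for v
  have expand: "Q (u + t *\<^sub>R v) = Q u + 2 * t * (a u v - l v) + t\<^sup>2 * a v v" if "u \<in> V" "v \<in> V" for u v t
    using that sym[of u v] unfolding Q_def
    by (simp add: add add2 scale scale2 ladd lscale Vadd Vsc power2_eq_square algebra_simps)
  have cs: "(a u v)\<^sup>2 \<le> a u u * a v v" if "u \<in> V" "v \<in> V" for u v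
  proof (rule quadratic_form_bound)
    show "0 \<le> a u u + 2 * t * a u v + t\<^sup>2 * a v v" for t
      using pos[of "u + t *\<^sub>R v"] that sym[of u v]
      by (simp add: add add2 scale scale2 Vadd Vsc power2_eq_square algebra_simps)
  qed (use pos that in auto)
  \<comment> \<open>By the inequality of means, 2 |l v| \<le> 2 sqrt(|C| a v v) \<le> |C| + a v
    v.\<close>
  have lower: "Q v \<ge> - \<bar>C\<bar>" if "v \<in> V" for v
  proof -
    have "(l v)\<^sup>2 \<le> \<bar>C\<bar> * a v v"
      using bound[OF that] mult_right_mono[OF abs_ge_self pos[OF that], of C] by linarith
    also have "4 * \<dots> \<le> (\<bar>C\<bar> + a v v)\<^sup>2"
      using zero_le_power2[of "\<bar>C\<bar> - a v v"] by (simp add: power2_eq_square algebra_simps)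
    finally have "(2 * l v)\<^sup>2 \<le> (\<bar>C\<bar> + a v v)\<^sup>2" by (simp add: power_mult_distrib)
    then have "2 * l v \<le> \<bar>C\<bar> + a v v"
      by (rule power2_le_imp_le) (use pos[OF that] in simp)
    then show ?thesis by (simp add: Q_def)
  qed
  define m where "m = Inf (Q ` V)"
  have bdd: "bdd_below (Q ` V)" using lower by (auto intro!: bdd_belowI2)
  have m: "m \<le> Q v" if "v \<in> V" for v
    unfolding m_def by (rule cInf_lower) (use that bdd in auto)
  have "\<exists>v\<in>V. Q v < m + 1 / real (Suc n)" for n
  proof -
    have "Inf (Q ` V) < m + 1 / real (Suc n)" by (simp add: m_def)
    then obtain y where "y \<in> Q ` V" "y < m + 1 / real (Suc n)"
      using cInf_lessD[of "Q ` V"] V0 by blast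
    then show ?thesis by auto
  qed
  then obtain X where X: "\<And>n. X n \<in> V" "\<And>n. Q (X n) < m + 1 / real (Suc n)"
    by metis
  \<comment> \<open>Parallelogram identity, with Q at the midpoint of u and v bounded below by the
    infimum; the linear terms cancel. It makes a minimising sequence Cauchy.\<close>
  have par: "a (u - v) (u - v) \<le> 2 * (Q u - m) + 2 * (Q v - m)" if "u \<in> V" "v \<in> V" for u v
  proof -
    have "m \<le> Q ((1/2) *\<^sub>R (u + v))" using that by (intro m Vsc Vadd)
    then show ?thesis
      using that sym[of u v] unfolding Q_def
      by (simp add: add add2 scale scale2 diff diff2 ladd lscale Vadd Vsc Vdiff algebra_simps)
  qed
  have inv0: "(\<lambda>n. 1 / real (Suc n)) \<longlonglongrightarrow> 0"
    using LIMSEQ_inverse_real_of_nat by (simp add: inverse_eq_divide)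
  have "\<exists>u\<in>V. (\<lambda>n. a (X n - u) (X n - u)) \<longlonglongrightarrow> 0"
  proof (rule complete[OF X(1)])
    fix e :: real assume "e > 0"
    then obtain N where N: "\<And>n. n \<ge> N \<Longrightarrow> 1 / real (Suc n) < e / 4"
      using order_tendstoD(2)[OF inv0, of "e / 4"] by (auto simp: eventually_sequentially)
    have "a (X k - X n) (X k - X n) < e" if "k \<ge> N" "n \<ge> N" for k n
    proof -
      have "Q (X k) - m < e / 4" "Q (X n) - m < e / 4"
        using X(2)[of k] X(2)[of n] N[OF that(1)] N[OF that(2)] by (simp_all only: less_diff_eq diff_less_eq)
      moreover have "p < e" if "x < e / 4" "y < e / 4" "p \<le> 2 * x + 2 * y" for p x y :: real
        using that by linarith
      ultimately show ?thesis using par[OF X(1) X(1), of k n] by blast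
    qed
    then show "\<exists>N. \<forall>k\<ge>N. \<forall>n\<ge>N. a (X k - X n) (X k - X n) < e" by blast
  qed
  then obtain u where u: "u \<in> V" "(\<lambda>n. a (X n - u) (X n - u)) \<longlonglongrightarrow> 0" by blast
  have "a u v = l v" if v: "v \<in> V" for v
  proof -
    have "(\<lambda>n. a (X n) v - l v) \<longlonglongrightarrow> 0"
    proof -
      \<comment> \<open>The polynomial t \<mapsto> Q (X n + t v) - m is nonnegative, and its linear
        coefficient is twice the residual. Its constant term is less than 1/(n+1), so it may be
        raised to that value before the discriminant is taken.\<close>
      have sq: "(a (X n) v - l v)\<^sup>2 \<le> (1 / real (Suc n)) * a v v" for n
      proof (rule quadratic_form_bound)
        show "0 \<le> 1 / real (Suc n) + 2 * t * (a (X n) v - l v) + t\<^sup>2 * a v v" for t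
          using m[of "X n + t *\<^sub>R v"] expand[OF X(1) v, of n t] X(2)[of n] Vadd[OF X(1) Vsc[OF v]]
          by force
      qed (use pos v in auto)
      have "(\<lambda>n. (a (X n) v - l v)\<^sup>2) \<longlonglongrightarrow> 0"
        by (rule tendsto_sandwich[OF _ _ tendsto_const tendsto_mult_left_zero[OF inv0]])
          (use sq in \<open>auto intro!: always_eventually\<close>)
      then show ?thesis by simp
    qed
    moreover have "(\<lambda>n. a (X n) v - a u v) \<longlonglongrightarrow> 0"
    proof -
      have "(\<lambda>n. (a (X n) v - a u v)\<^sup>2) \<longlonglongrightarrow> 0"
        by (rule tendsto_sandwich[OF _ _ tendsto_const tendsto_mult_left_zero[OF u(2)]])
          (use cs[OF Vdiff[OF X(1) u(1)] v] diff X(1) u(1) v in \<open>auto intro!: always_eventually\<close>)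
      then show ?thesis by simp
    qed
    ultimately have "(\<lambda>n. (a (X n) v - l v) - (a (X n) v - a u v)) \<longlonglongrightarrow> 0 - 0"
      by (rule tendsto_diff)
    then have "(\<lambda>n::nat. a u v - l v) \<longlonglongrightarrow> 0" by simp
    then show ?thesis by (simp add: LIMSEQ_const_iff)
  qed
  with u(1) show ?thesis by blast
qed

text \<open>Baire's theorem: by pointwise boundedness the open sets \<open>G k\<close> have empty
  intersection, so one of them is not dense, and on a ball that misses it all \<open>T n\<close> are
  bounded by k. Differences of points of the ball, rescaled, carry the bound to every
  vector.\<close>

lemma uniform_boundedness:
  fixes T :: "nat \<Rightarrow> 'a::banach \<Rightarrow> 'b::real_normed_vector"
  assumes T: "\<And>n. bounded_linear (T n)" and b: "\<And>x. \<exists>B. \<forall>n. norm (T n x) \<le> B"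
  shows "\<exists>M. \<forall>n x. norm (T n x) \<le> M * norm x"
proof -
  define G where "G k = {x. \<exists>n. norm (T n x) > real k}" for k :: nat
  have opG: "open (G k)" for k
  proof -
    have "open {x. norm (T n x) > real k}" for n
      by (intro open_Collect_less continuous_intros linear_continuous_on T continuous_on_norm)
    then have "open (\<Union>n. {x. norm (T n x) > real k})" by blast
    then show ?thesis by (simp add: G_def Collect_ex_eq)
  qed
  have "\<exists>k. closure (G k) \<noteq> UNIV"
  proof (rule ccontr)
    assume "\<not> ?thesis"
    then have d: "closure (G k) = UNIV" for k by blast
    have "Met_TC.mtopology closure_of (\<Inter>(range G)) = (UNIV :: 'a set)"
      by (rule Met_TC.metric_Baire_category) (use d opG in \<open>auto simp: complete_UNIV\<close>)
    then have "\<Inter>(range G) \<noteq> {}" by auto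
    then obtain x where x: "\<And>k. x \<in> G k" by auto
    obtain B where "\<And>n. norm (T n x) \<le> B" using b by blast
    moreover obtain k :: nat where "B \<le> real k" using real_arch_simple by blast
    ultimately show False using x[of k] unfolding G_def by (auto simp: not_less) (meson leD order_trans)
  qed
  then obtain k x where "x \<notin> closure (G k)" by blast
  then obtain r where r: "r > 0" "\<And>y. dist y x < r \<Longrightarrow> y \<notin> G k"
    unfolding closure_approachable by blast
  have "norm (T n y) \<le> (4 * real k / r) * norm y" for n y
  proof (cases "y = 0")
    case True
    then show ?thesis using bounded_linear.linear[OF T, of n] by (simp add: linear_0)
  next
    case False
    \<comment> \<open>Half the radius keeps x + z inside the ball; the two bounds k then give 2 k
      for z, and 4 k / r after rescaling.\<close>
    define z where "z = (r / (2 * norm y)) *\<^sub>R y"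
    have nz: "norm z = r / 2" using False r by (simp add: z_def)
    have "norm (T n (x + z)) \<le> real k" "norm (T n x) \<le> real k"
      using r(2)[of "x + z"] r(2)[of x] r(1) nz by (auto simp: G_def dist_norm not_less)
    moreover have "T n z = T n (x + z) - T n x"
      using bounded_linear.linear[OF T, of n] by (simp add: linear_add)
    ultimately have "norm (T n z) \<le> 2 * real k"
      using norm_triangle_ineq4[of "T n (x + z)" "T n x"] by simp
    moreover have "T n z = (r / (2 * norm y)) *\<^sub>R T n y"
      using bounded_linear.linear[OF T, of n] by (simp add: z_def linear_scale)
    ultimately show ?thesis using False r by (simp add: field_simps)
  qed
  then show ?thesis by blast
qed

text \<open>
  A copy of the bounded operators on a space, in which composition can be the multiplication of a
  Banach algebra, so that \<open>exp\<close> applies. Class \<open>perfect_space\<close> serves to get \<open>0 \<noteq> 1\<close>.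
\<close>

typedef (overloaded) 'a endo = "UNIV :: ('a::real_normed_vector \<Rightarrow>\<^sub>L 'a) set" ..

setup_lifting type_definition_endo

lift_definition endo_app :: "'a::real_normed_vector endo \<Rightarrow> 'a \<Rightarrow> 'a" is blinfun_apply .

instantiation endo :: ("{real_normed_vector, perfect_space}") real_normed_algebra_1
begin

lift_definition zero_endo :: "'a endo" is 0 .
lift_definition one_endo :: "'a endo" is id_blinfun .
lift_definition plus_endo :: "'a endo \<Rightarrow> 'a endo \<Rightarrow> 'a endo" is "(+)" .
lift_definition minus_endo :: "'a endo \<Rightarrow> 'a endo \<Rightarrow> 'a endo" is "(-)" .
lift_definition uminus_endo :: "'a endo \<Rightarrow> 'a endo" is uminus .
lift_definition times_endo :: "'a endo \<Rightarrow> 'a endo \<Rightarrow> 'a endo" is "(o\<^sub>L)" .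
lift_definition scaleR_endo :: "real \<Rightarrow> 'a endo \<Rightarrow> 'a endo" is "(*\<^sub>R)" .
lift_definition norm_endo :: "'a endo \<Rightarrow> real" is norm .

definition sgn_endo :: "'a endo \<Rightarrow> 'a endo" where
  "sgn_endo u = scaleR (inverse (norm u)) u"

definition dist_endo :: "'a endo \<Rightarrow> 'a endo \<Rightarrow> real" where
  "dist_endo u v = norm (u - v)"

definition uniformity_endo :: "('a endo \<times> 'a endo) filter" where
  "uniformity_endo = (INF e\<in>{0<..}. principal {(x, y). dist x y < e})"

definition open_endo :: "'a endo set \<Rightarrow> bool" where
  "open_endo U \<longleftrightarrow> (\<forall>x\<in>U. \<forall>\<^sub>F (x', y) in uniformity. x' = x \<longrightarrow> y \<in> U)"

instance
proof
  fix u v w :: "'a endo" and r s :: real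
  show "u + v + w = u + (v + w)" by transfer (rule add.assoc)
  show "u + v = v + u" by transfer (rule add.commute)
  show "0 + u = u" by transfer simp
  show "- u + u = 0" by transfer simp
  show "u - v = u + - v" by transfer simp
  show "r *\<^sub>R (u + v) = r *\<^sub>R u + r *\<^sub>R v" by transfer (rule scaleR_add_right)
  show "(r + s) *\<^sub>R u = r *\<^sub>R u + s *\<^sub>R u" by transfer (rule scaleR_add_left)
  show "r *\<^sub>R s *\<^sub>R u = (r * s) *\<^sub>R u" by transfer simp
  show "1 *\<^sub>R u = u" by transfer simp
  show "u * v * w = u * (v * w)" by transfer (auto intro: blinfun_eqI)
  show "(u + v) * w = u * w + v * w" by transfer (auto intro: blinfun_eqI simp: blinfun.add_left)
  show "u * (v + w) = u * v + u * w" by transfer (auto intro: blinfun_eqI simp: blinfun.add_left blinfun.add_right)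
  show "1 * u = u" by transfer (auto intro: blinfun_eqI)
  show "u * 1 = u" by transfer (auto intro: blinfun_eqI)
  show "r *\<^sub>R u * v = r *\<^sub>R (u * v)" by transfer (auto intro: blinfun_eqI simp: blinfun.scaleR_left)
  show "u * r *\<^sub>R v = r *\<^sub>R (u * v)" by transfer (auto intro: blinfun_eqI simp: blinfun.scaleR_left blinfun.scaleR_right)
  show "norm (1 :: 'a endo) = 1" by transfer (rule norm_blinfun_id)
  show "(0 :: 'a endo) \<noteq> 1"
    by transfer (metis norm_blinfun_id norm_zero zero_neq_one)
  show "norm (u * v) \<le> norm u * norm v" by transfer (rule norm_blinfun_compose)
  show "norm (u + v) \<le> norm u + norm v" by transfer (rule norm_triangle_ineq)
  show "norm (r *\<^sub>R u) = \<bar>r\<bar> * norm u" by transfer simp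
  show "norm u = 0 \<longleftrightarrow> u = 0" by transfer simp
  show "sgn u = inverse (norm u) *\<^sub>R u" by (rule sgn_endo_def)
  show "dist u v = norm (u - v)" by (rule dist_endo_def)
  show "(uniformity :: ('a endo \<times> 'a endo) filter) = (INF e\<in>{0<..}. principal {(x, y). dist x y < e})"
    by (rule uniformity_endo_def)
  show "open U \<longleftrightarrow> (\<forall>x\<in>U. \<forall>\<^sub>F (x', y) in uniformity. x' = x \<longrightarrow> y \<in> U)" for U :: "'a endo set"
    by (rule open_endo_def)
qed

end

instance endo :: ("{banach, perfect_space}") banach
proof
  fix X :: "nat \<Rightarrow> 'a endo"
  assume "Cauchy X"
  then have "Cauchy (\<lambda>n. Rep_endo (X n))"
    by (simp add: Cauchy_iff norm_endo.rep_eq minus_endo.rep_eq)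
  then obtain L where "(\<lambda>n. Rep_endo (X n)) \<longlonglongrightarrow> L"
    using Cauchy_convergent convergent_def by blast
  then have "X \<longlonglongrightarrow> Abs_endo L"
    by (simp add: LIMSEQ_iff norm_endo.rep_eq minus_endo.rep_eq Abs_endo_inverse)
  then show "convergent X" by (auto simp: convergent_def)
qed

lemma bounded_linear_endo_app_left:
  "bounded_linear (\<lambda>E :: 'a::{real_normed_vector,perfect_space} endo. endo_app E x)"
  by (rule bounded_linear_intro[where K = "norm x"])
    (auto simp: endo_app.rep_eq plus_endo.rep_eq scaleR_endo.rep_eq norm_endo.rep_eq
      blinfun.add_left blinfun.scaleR_left norm_blinfun mult.commute[of "norm x"])

lemma norm_endo_app: "norm (endo_app E x) \<le> norm E * norm x"
  for E :: "'a::{real_normed_vector,perfect_space} endo"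
  by transfer (rule norm_blinfun)

lemma endo_app_simps [simp]:
  fixes E F :: "'a::{real_normed_vector,perfect_space} endo"
  shows "endo_app (E * F) x = endo_app E (endo_app F x)" "endo_app 1 x = x" "endo_app 0 x = 0"
    "endo_app (E + F) x = endo_app E x + endo_app F x"
    "endo_app (E - F) x = endo_app E x - endo_app F x"
    "endo_app (r *\<^sub>R E) x = r *\<^sub>R endo_app E x"
    "endo_app E (x + y) = endo_app E x + endo_app E y"
    "endo_app E (x - y) = endo_app E x - endo_app E y"
    "endo_app E (r *\<^sub>R x) = r *\<^sub>R endo_app E x"
  by (transfer, simp add: blinfun.bilinear_simps)+

lemma endo_eqI:
  fixes E F :: "'a::real_normed_vector endo"
  shows "(\<And>x. endo_app E x = endo_app F x) \<Longrightarrow> E = F"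
  by transfer (rule blinfun_eqI)

lemma endo_of_bounded_linear:
  fixes f :: "'a::{real_normed_vector,perfect_space} \<Rightarrow> 'a"
  assumes f: "linear f" and b: "\<And>x. norm (f x) \<le> c * norm x" and "c \<ge> 0"
  shows "\<exists>E :: 'a endo. endo_app E = f \<and> norm E \<le> c"
proof (intro exI conjI)
  have bl: "bounded_linear f"
    using f b by (intro bounded_linear_intro[where K = c]) (auto simp: linear_add linear_scale mult.commute)
  show 1: "endo_app (Abs_endo (Blinfun f)) = f"
    by (simp add: endo_app.rep_eq Abs_endo_inverse bounded_linear_Blinfun_apply[OF bl])
  show "norm (Abs_endo (Blinfun f)) \<le> c"
    unfolding norm_endo.rep_eq
    by (rule norm_blinfun_bound) (use assms in \<open>auto simp: Abs_endo_inverse bounded_linear_Blinfun_apply[OF bl]\<close>)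
qed

lemma exp_commute:
  fixes x y :: "'a::{real_normed_algebra_1,banach}"
  assumes "x * y = y * x"
  shows "exp x * y = y * exp x"
proof -
  have p: "x ^ n * y = y * x ^ n" for n
    using assms power_commuting_commutes by blast
  have "(\<lambda>n. (x ^ n /\<^sub>R fact n) * y) sums (exp x * y)"
    unfolding exp_def by (intro sums_mult2 summable_sums summable_exp_generic)
  moreover have "(\<lambda>n. y * (x ^ n /\<^sub>R fact n)) sums (y * exp x)"
    unfolding exp_def by (intro sums_mult summable_sums summable_exp_generic)
  ultimately show ?thesis
    using sums_unique2 by (simp add: p)
qed

section \<open>Intertwining strongly continuous semigroups\<close>

text \<open>The part of \<open>c0_semigroup\<close> that makes sense over the reals. The generation
  theorem is proved for real Hilbert spaces; homogeneity under complex scalars is regained for the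
  heat semigroup by an intertwining argument.\<close>

definition linear_semigroup :: "'a::real_normed_vector set \<Rightarrow> (real \<Rightarrow> 'a \<Rightarrow> 'a) \<Rightarrow> bool" where
  "linear_semigroup X S \<longleftrightarrow>
     (\<forall>t\<ge>0. \<forall>u\<in>X. S t u \<in> X) \<and>
     (\<forall>t\<ge>0. \<forall>u\<in>X. \<forall>v\<in>X. S t (u + v) = S t u + S t v) \<and>
     (\<forall>t\<ge>0. \<forall>u\<in>X. \<forall>c. S t (c *\<^sub>R u) = c *\<^sub>R S t u) \<and>
     (\<forall>t\<ge>0. \<exists>M. \<forall>u\<in>X. norm (S t u) \<le> M * norm u) \<and>
     (\<forall>u\<in>X. S 0 u = u) \<and>
     (\<forall>s\<ge>0. \<forall>t\<ge>0. \<forall>u\<in>X. S (s + t) u = S s (S t u)) \<and>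
     (\<forall>u\<in>X. ((\<lambda>t. S t u) \<longlongrightarrow> u) (at_right 0))"

definition generates :: "'a::real_normed_vector set \<Rightarrow> (real \<Rightarrow> 'a \<Rightarrow> 'a) \<Rightarrow> 'a \<Rightarrow> 'a \<Rightarrow> bool" where
  "generates X S f g \<longleftrightarrow> f \<in> X \<and> ((\<lambda>t. (S t f - f) /\<^sub>R t) \<longlongrightarrow> g) (at_right 0)"

text \<open>A closed subspace of a type, given as the range of a bounded projection. Composing with
  \<open>P\<close> turns an operator on \<open>X\<close> into one on the whole type, where uniform
  boundedness and closedness arguments apply.\<close>

locale projected_space =
  fixes X :: "'a::{real_normed_vector} set" and P :: "'a \<Rightarrow> 'a"
  assumes P: "bounded_linear P" and P_in: "\<And>x. P x \<in> X" and P_id: "\<And>x. x \<in> X \<Longrightarrow> P x = x"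
begin

lemma subspace_X: "subspace X"
proof (rule subspaceI)
  interpret bounded_linear P by (rule P)
  show "0 \<in> X" using P_in[of 0] by (simp add: zero)
  show "x + y \<in> X" if "x \<in> X" "y \<in> X" for x y
    using P_in[of "x + y"] P_id that by (simp add: add)
  show "c *\<^sub>R x \<in> X" if "x \<in> X" for c x
    using P_in[of "c *\<^sub>R x"] P_id that by (simp add: scaleR)
qed

lemma closed_X: "closed X"
proof -
  have "x \<in> X \<longleftrightarrow> P x = x" for x using P_in[of x] P_id[of x] by auto
  then have "X = {x. P x = x}" by blast
  moreover have "closed {x. P x = x}"
    by (intro closed_Collect_eq linear_continuous_on P continuous_intros)
  ultimately show ?thesis by simp
qed

end

locale linear_semigroup_on = projected_space X P for X :: "'a::banach set" and P +
  fixes S :: "real \<Rightarrow> 'a \<Rightarrow> 'a"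
  assumes sg: "linear_semigroup X S"
begin

lemma S_in: "t \<ge> 0 \<Longrightarrow> u \<in> X \<Longrightarrow> S t u \<in> X"
  and S_add: "t \<ge> 0 \<Longrightarrow> u \<in> X \<Longrightarrow> v \<in> X \<Longrightarrow> S t (u + v) = S t u + S t v"
  and S_scale: "t \<ge> 0 \<Longrightarrow> u \<in> X \<Longrightarrow> S t (c *\<^sub>R u) = c *\<^sub>R S t u"
  and S_bound: "t \<ge> 0 \<Longrightarrow> \<exists>M. \<forall>u\<in>X. norm (S t u) \<le> M * norm u"
  and S_0: "u \<in> X \<Longrightarrow> S 0 u = u"
  and S_plus: "s \<ge> 0 \<Longrightarrow> t \<ge> 0 \<Longrightarrow> u \<in> X \<Longrightarrow> S (s + t) u = S s (S t u)"
  and S_right: "u \<in> X \<Longrightarrow> ((\<lambda>t. S t u) \<longlongrightarrow> u) (at_right 0)"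
  using sg by (auto simp: linear_semigroup_def)

lemma S_diff: "t \<ge> 0 \<Longrightarrow> u \<in> X \<Longrightarrow> v \<in> X \<Longrightarrow> S t (u - v) = S t u - S t v"
  using S_add[of t u "(-1) *\<^sub>R v"] S_scale[of t v "-1"] subspace_scale[OF subspace_X, of v "-1"] by simp

lemma bounded_linear_SP: "t \<ge> 0 \<Longrightarrow> bounded_linear (\<lambda>x. S t (P x))"
proof -
  assume t: "t \<ge> 0"
  obtain M where M: "\<And>u. u \<in> X \<Longrightarrow> norm (S t u) \<le> M * norm u" using S_bound[OF t] by blast
  obtain K where K: "\<And>x. norm (P x) \<le> norm x * K" "K \<ge> 0"
    using bounded_linear.nonneg_bounded[OF P] by blast
  show ?thesis
  proof (rule bounded_linear_intro[where K = "\<bar>M\<bar> * K"])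
    fix x
    have "norm (S t (P x)) \<le> M * norm (P x)" using M P_in by blast
    also have "\<dots> \<le> \<bar>M\<bar> * norm (P x)" by (intro mult_right_mono) auto
    also have "\<dots> \<le> \<bar>M\<bar> * (norm x * K)" by (intro mult_left_mono K) auto
    finally show "norm (S t (P x)) \<le> norm x * (\<bar>M\<bar> * K)" by (simp add: algebra_simps)
  qed (use t P_in P in \<open>simp_all add: linear_add linear_scale bounded_linear.linear S_add S_scale\<close>)
qed

text \<open>If it failed, there would be times t n tending to 0 at which the operator bound n + 1 is
  violated. Right continuity at 0 bounds each orbit along these times, so uniform boundedness gives
  a contradiction.\<close>

lemma bounded_near_0: "\<exists>d>0. \<exists>M\<ge>1. \<forall>t\<in>{0..d}. \<forall>u\<in>X. norm (S t u) \<le> M * norm u"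
proof (rule ccontr)
  assume *: "\<not> ?thesis"
  have "\<exists>t u. t \<in> {0..1 / real (Suc n)} \<and> u \<in> X \<and> norm (S t u) > real (Suc n) * norm u" for n
  proof (rule ccontr)
    assume "\<not> ?thesis"
    then have "\<forall>t\<in>{0..1 / real (Suc n)}. \<forall>u\<in>X. norm (S t u) \<le> real (Suc n) * norm u"
      by (meson not_less)
    moreover have "1 / real (Suc n) > 0" "real (Suc n) \<ge> 1" by auto
    ultimately show False using * by blast
  qed
  then obtain t u where tu: "\<And>n. t n \<in> {0..1 / real (Suc n)}" "\<And>n. u n \<in> X"
    "\<And>n. norm (S (t n) (u n)) > real (Suc n) * norm (u n)" by metis
  have t0: "t n > 0" for n
  proof (rule ccontr)
    assume "\<not> t n > 0"
    then have "t n = 0" using tu(1)[of n] by auto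
    then have "norm (u n) > real (Suc n) * norm (u n)" using tu(3)[of n] S_0[OF tu(2)[of n]] by simp
    moreover have "real (Suc n) * norm (u n) \<ge> 1 * norm (u n)" by (intro mult_right_mono) auto
    ultimately show False by simp
  qed
  have tlim: "t \<longlonglongrightarrow> 0"
    by (rule tendsto_sandwich[OF _ _ tendsto_const LIMSEQ_inverse_real_of_nat])
      (use tu(1) in \<open>auto intro!: always_eventually simp: inverse_eq_divide\<close>)
  have tr: "filterlim t (at_right 0) sequentially"
    by (rule tendsto_imp_filterlim_at_right[OF tlim always_eventually]) (simp add: t0)
  have "\<exists>B. \<forall>n. norm (S (t n) (P x)) \<le> B" for x
  proof -
    have "(\<lambda>n. S (t n) (P x)) \<longlonglongrightarrow> P x"
      by (rule filterlim_compose[OF S_right[OF P_in] tr])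
    then have "bounded (range (\<lambda>n. S (t n) (P x)))" by (rule convergent_imp_bounded)
    then show ?thesis by (auto simp: bounded_iff)
  qed
  then obtain M where M: "\<And>n x. norm (S (t n) (P x)) \<le> M * norm x"
    using uniform_boundedness[of "\<lambda>n x. S (t n) (P x)"] bounded_linear_SP t0
    by (metis less_imp_le)
  obtain n :: nat where n: "M \<le> real n" using real_arch_simple by blast
  have "real (Suc n) * norm (u n) < M * norm (u n)"
    using tu(3)[of n] M[of n "u n"] P_id[OF tu(2)[of n]] by simp
  moreover have "M * norm (u n) \<le> real (Suc n) * norm (u n)"
    using n by (intro mult_right_mono) auto
  ultimately show False by simp
qed

text \<open>The semigroup law is iterated in steps of length d. Each step costs a factor M, and
  finitely many steps reach T.\<close>

lemma locally_bounded: "\<exists>M\<ge>1. \<forall>t\<in>{0..T}. \<forall>u\<in>X. norm (S t u) \<le> M * norm u"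
proof -
  obtain d M where d: "d > 0" "M \<ge> 1" and M: "\<And>t u. t \<in> {0..d} \<Longrightarrow> u \<in> X \<Longrightarrow> norm (S t u) \<le> M * norm u"
    using bounded_near_0 by blast
  have "\<forall>t\<in>{0..real n * d}. \<forall>u\<in>X. norm (S t u) \<le> M ^ n * norm u" for n
  proof (induction n)
    case 0
    then show ?case by (auto simp: S_0)
  next
    case (Suc n)
    show ?case
    proof (intro ballI)
      fix t u assume t: "t \<in> {0..real (Suc n) * d}" and u: "u \<in> X"
      show "norm (S t u) \<le> M ^ Suc n * norm u"
      proof (cases "t \<le> d")
        case True
        have "M * norm u \<le> M ^ Suc n * norm u"
          using d(2) by (intro mult_right_mono) (simp_all add: one_le_power)
        then show ?thesis using M[of t u] t u True by force
      next
        case False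
        then have td: "t - d \<in> {0..real n * d}" using t by (auto simp: algebra_simps)
        have "S t u = S d (S (t - d) u)" using S_plus[of d "t - d" u] d td u by simp
        then have "norm (S t u) \<le> M * norm (S (t - d) u)" using M[of d "S (t - d) u"] S_in td u d by auto
        also have "\<dots> \<le> M * (M ^ n * norm u)" using Suc td u d by (intro mult_left_mono) auto
        finally show ?thesis by (simp add: mult.assoc)
      qed
    qed
  qed
  moreover obtain n :: nat where "T / d \<le> real n" using real_arch_simple by blast
  then have "T \<le> real n * d" using d by (simp add: field_simps)
  then have "t \<in> {0..real n * d}" if "t \<in> {0..T}" for t using that by auto
  ultimately have "\<forall>t\<in>{0..T}. \<forall>u\<in>X. norm (S t u) \<le> M ^ n * norm u" by blast
  then show ?thesis using one_le_power[OF d(2)] by blast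
qed

text \<open>Only right continuity at 0 is assumed. Continuity from both sides follows because, for s
  \<le> t, the increment is \<open>S s\<close> applied to S (t - s) u - u, and \<open>S s\<close> is
  bounded uniformly for s up to T.\<close>

lemma continuous_orbit:
  assumes u: "u \<in> X"
  shows "continuous_on {0..T} (\<lambda>t. S t u)"
proof -
  obtain M where M: "M \<ge> 1" "\<And>t u. t \<in> {0..T} \<Longrightarrow> u \<in> X \<Longrightarrow> norm (S t u) \<le> M * norm u"
    using locally_bounded by blast
  have le: "norm (S t u - S s u) \<le> M * norm (S (t - s) u - u)" if "s \<in> {0..T}" "t \<in> {0..T}" "s \<le> t" for s t
  proof -
    have "S t u = S s (S (t - s) u)" using S_plus[of s "t - s" u] that u by simp
    then have "S t u - S s u = S s (S (t - s) u - u)" using S_diff that u S_in by simp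
    then show ?thesis using M(2)[of s "S (t - s) u - u"] that u S_in subspace_diff[OF subspace_X] by simp
  qed
  show ?thesis
  proof (rule continuous_on_iff[THEN iffD2], intro ballI allI impI)
    fix t e assume t: "t \<in> {0..T}" and e: "(e::real) > 0"
    have "eventually (\<lambda>h. dist (S h u) u < e / M) (at_right 0)"
      using S_right[OF u] e M(1) by (intro tendstoD) auto
    then obtain d where d: "d > 0" "\<And>h. 0 < h \<Longrightarrow> h < d \<Longrightarrow> norm (S h u - u) < e / M"
      unfolding eventually_at_right_field dist_norm by auto
    have "norm (S s u - S t u) < e" if s: "s \<in> {0..T}" "dist s t < d" for s
    proof (cases s t rule: linorder_cases)
      case less
      have "norm (S t u - S s u) \<le> M * norm (S (t - s) u - u)" using le s t less by simp
      also have "\<dots> < M * (e / M)" using d(2)[of "t - s"] less s M(1) by (intro mult_strict_left_mono) (auto simp: dist_real_def)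
      finally show ?thesis using M(1) by (simp add: norm_minus_commute)
    next
      case greater
      have "norm (S s u - S t u) \<le> M * norm (S (s - t) u - u)" using le s t greater by simp
      also have "\<dots> < M * (e / M)" using d(2)[of "s - t"] greater s M(1) by (intro mult_strict_left_mono) (auto simp: dist_real_def)
      finally show ?thesis using M(1) by simp
    qed (use e in simp)
    then show "\<exists>d>0. \<forall>x'\<in>{0..T}. dist x' t < d \<longrightarrow> dist (S x' u) (S t u) < e"
      using d(1) unfolding dist_norm by (intro exI[of _ d]) blast
  qed
qed

lemma generates_in:
  assumes "generates X S f g"
  shows "f \<in> X" "g \<in> X"
proof -
  show f: "f \<in> X" using assms by (simp add: generates_def)
  show "g \<in> X"
  proof (rule Lim_in_closed_set[OF closed_X])
    show "\<forall>\<^sub>F t in at_right 0. (S t f - f) /\<^sub>R t \<in> X"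
      using eventually_at_right_less[of "0::real"]
      by eventually_elim (use f S_in subspace_X in \<open>auto intro!: subspace_scale subspace_diff\<close>)
    show "((\<lambda>t. (S t f - f) /\<^sub>R t) \<longlongrightarrow> g) (at_right 0)" using assms by (simp add: generates_def)
  qed simp
qed

lemma generates_orbit:
  assumes "generates X S f g" "s \<ge> 0"
  shows "generates X S (S s f) (S s g)"
proof -
  note fg = generates_in[OF assms(1)]
  obtain M where M: "\<And>u. u \<in> X \<Longrightarrow> norm (S s u) \<le> M * norm u" using S_bound[OF assms(2)] by blast
  have "((\<lambda>t. (S t f - f) /\<^sub>R t - g) \<longlongrightarrow> 0) (at_right 0)"
    using assms(1) by (intro LIM_zero) (simp add: generates_def)
  then have 0: "((\<lambda>t. M * norm ((S t f - f) /\<^sub>R t - g)) \<longlongrightarrow> 0) (at_right 0)"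
    by (intro tendsto_mult_right_zero tendsto_norm_zero)
  have "((\<lambda>t. (S t (S s f) - S s f) /\<^sub>R t - S s g) \<longlongrightarrow> 0) (at_right 0)"
  proof (rule Lim_null_comparison[OF _ 0])
    show "\<forall>\<^sub>F t in at_right 0. norm ((S t (S s f) - S s f) /\<^sub>R t - S s g) \<le> M * norm ((S t f - f) /\<^sub>R t - g)"
      using eventually_at_right_less[of "0::real"]
    proof eventually_elim
      case (elim t)
      have "S t (S s f) = S s (S t f)"
        using S_plus[of t s f] S_plus[of s t f] assms(2) elim fg by (simp add: add.commute)
      then have "(S t (S s f) - S s f) /\<^sub>R t - S s g = S s ((S t f - f) /\<^sub>R t - g)"
        using fg elim assms(2) subspace_X
        by (simp add: S_diff S_scale S_in subspace_diff subspace_scale)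
      then show ?case
        using M fg elim subspace_X by (simp add: S_in subspace_diff subspace_scale)
    qed
  qed
  then show ?thesis using fg assms(2) by (simp add: generates_def LIM_zero_iff S_in)
qed

text \<open>The generator gives a right derivative. For s < t the increment is written with the
  smaller time s outside, which leaves the extra term S s g - S t g; it tends to 0 by continuity of
  the orbit of g.\<close>

lemma orbit_derivative:
  assumes fg: "generates X S f g" and t: "t \<in> {0..T}"
  shows "((\<lambda>t. S t f) has_vector_derivative S t g) (at t within {0..T})"
proof -
  note in_X = generates_in[OF fg]
  obtain M where M: "M \<ge> 1" "\<And>t u. t \<in> {0..T} \<Longrightarrow> u \<in> X \<Longrightarrow> norm (S t u) \<le> M * norm u"
    using locally_bounded by blast
  define q where "q h = (S h f - f) /\<^sub>R h" for h
  have qX: "q h \<in> X" if "h > 0" for h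
    using that in_X subspace_X by (simp add: q_def subspace_diff subspace_scale S_in)
  have qlim: "(q \<longlongrightarrow> g) (at_right 0)" using fg unfolding generates_def q_def by blast
  have main: "norm (S s f - S t f - (s - t) *\<^sub>R S t g) /\<^sub>R norm (s - t) \<le>
      M * norm (q \<bar>s - t\<bar> - g) + norm (S s g - S t g)" if s: "s \<in> {0..T}" "s \<noteq> t" for s
  proof (cases s t rule: linorder_cases)
    case greater
    have "S s f - S t f = (s - t) *\<^sub>R S t (q (s - t))"
      using S_plus[of t "s - t" f] greater t in_X subspace_X
      by (simp add: q_def S_scale S_diff S_in subspace_diff)
    then have "S s f - S t f - (s - t) *\<^sub>R S t g = (s - t) *\<^sub>R S t (q (s - t) - g)"
      using t in_X qX greater by (simp add: S_diff scaleR_diff_right)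
    then have "norm (S s f - S t f - (s - t) *\<^sub>R S t g) /\<^sub>R norm (s - t) = norm (S t (q (s - t) - g))"
      using greater by simp
    also have "\<dots> \<le> M * norm (q (s - t) - g)"
      using M(2)[of t] t qX greater in_X subspace_X by (simp add: subspace_diff)
    finally show ?thesis using greater by (simp add: add_increasing2)
  next
    case less
    have "S t f - S s f = (t - s) *\<^sub>R S s (q (t - s))"
      using S_plus[of s "t - s" f] less s in_X subspace_X
      by (simp add: q_def S_scale S_diff S_in subspace_diff)
    then have "S s f - S t f - (s - t) *\<^sub>R S t g = (s - t) *\<^sub>R (S s (q (t - s) - g) + (S s g - S t g))"
    proof -
      have "S s f - S t f = - ((t - s) *\<^sub>R S s (q (t - s)))"
        using \<open>S t f - S s f = _\<close> by (metis minus_diff_eq)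
      moreover have "S s (q (t - s) - g) = S s (q (t - s)) - S s g"
        using s in_X qX less by (simp add: S_diff)
      ultimately show ?thesis by (simp add: algebra_simps)
    qed
    then have "norm (S s f - S t f - (s - t) *\<^sub>R S t g) /\<^sub>R norm (s - t) = norm (S s (q (t - s) - g) + (S s g - S t g))"
      using less by simp
    also have "\<dots> \<le> M * norm (q (t - s) - g) + norm (S s g - S t g)"
      using M(2)[of s "q (t - s) - g"] s qX less in_X subspace_X
      by (intro order_trans[OF norm_triangle_ineq] add_right_mono) (simp add: subspace_diff)
    finally show ?thesis using less by simp
  qed (use s in simp)
  have "((\<lambda>s. \<bar>s - t\<bar>) \<longlongrightarrow> \<bar>t - t\<bar>) (at t within {0..T})" by (intro tendsto_intros)
  then have "filterlim (\<lambda>s. \<bar>s - t\<bar>) (at_right 0) (at t within {0..T})"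
    by (auto simp: filterlim_at eventually_at_filter)
  then have "((\<lambda>s. q \<bar>s - t\<bar>) \<longlongrightarrow> g) (at t within {0..T})"
    by (rule filterlim_compose[OF qlim])
  moreover have "((\<lambda>s. S s g) \<longlongrightarrow> S t g) (at t within {0..T})"
    using continuous_orbit[OF in_X(2)] t by (simp add: continuous_on_def)
  ultimately have "((\<lambda>s. M * norm (q \<bar>s - t\<bar> - g) + norm (S s g - S t g)) \<longlongrightarrow> M * norm (g - g) + norm (S t g - S t g)) (at t within {0..T})"
    by (intro tendsto_intros)
  then have lim0: "((\<lambda>s. M * norm (q \<bar>s - t\<bar> - g) + norm (S s g - S t g)) \<longlongrightarrow> 0) (at t within {0..T})" by simp
  show ?thesis
    unfolding has_vector_derivative_def has_derivative_at_within
  proof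
    show "bounded_linear (\<lambda>x. x *\<^sub>R S t g)" by (rule bounded_linear_scaleR_left)
    show "((\<lambda>y. (S y f - S t f - (y - t) *\<^sub>R S t g) /\<^sub>R norm (y - t)) \<longlongrightarrow> 0) (at t within {0..T})"
      by (rule Lim_null_comparison[OF _ lim0]) (use main in \<open>auto simp: eventually_at_filter\<close>)
  qed
qed

end

text \<open>The family r \<mapsto> S (t - r) is differentiable only along orbits of the domain, so
  the usual product rule does not apply. The increment is split into three terms:
  \<open>S (t - r)\<close> applied to the error in differentiating y, the error in differentiating
  the orbit of \<open>y s\<close>, and the oscillation of the orbit of \<open>z s\<close>. Local
  boundedness controls the first. Density carries the identity from the domain to
  \<open>X'\<close>.\<close>

lemma semigroup_intertwine:
  fixes B :: "'b::banach \<Rightarrow> 'a::banach"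
  assumes S: "linear_semigroup_on X P S" and S': "linear_semigroup_on X' P' S'"
    and B: "bounded_linear B" and BX: "\<And>x. x \<in> X' \<Longrightarrow> B x \<in> X"
    and gen: "\<And>f g. generates X' S' f g \<Longrightarrow> generates X S (B f) (B g)"
    and dense: "X' \<subseteq> closure {f. \<exists>g. generates X' S' f g}"
    and t: "t \<ge> 0" and x: "x \<in> X'"
  shows "B (S' t x) = S t (B x)"
proof -
  interpret S: linear_semigroup_on X P S by fact
  interpret S': linear_semigroup_on X' P' S' by fact
  interpret B: bounded_linear B by fact
  have eq: "B (S' t f) = S t (B f)" if fg: "generates X' S' f g" for f g
  proof -
    obtain M where M: "M \<ge> 1" "\<And>s u. s \<in> {0..t} \<Longrightarrow> u \<in> X \<Longrightarrow> norm (S s u) \<le> M * norm u"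
      using S.locally_bounded by blast
    define y where "y s = B (S' s f)" for s
    define z where "z s = B (S' s g)" for s
    have gyz: "generates X S (y s) (z s)" if "s \<in> {0..t}" for s
      unfolding y_def z_def by (rule gen[OF S'.generates_orbit[OF fg]]) (use that in auto)
    have yz: "y s \<in> X" "z s \<in> X" if "s \<in> {0..t}" for s
      using S.generates_in[OF gyz[OF that]] by auto
    have dy: "(y has_vector_derivative z s) (at s within {0..t})" if "s \<in> {0..t}" for s
      unfolding y_def z_def by (rule B.has_vector_derivative[OF S'.orbit_derivative[OF fg that]])
    have "((\<lambda>r. S (t - r) (y r)) has_vector_derivative 0) (at s within {0..t})" if s: "s \<in> {0..t}" for s
      unfolding has_vector_derivative_def has_derivative_at_within
    proof
      define F where "F = at s within {0..t}"
      have refl: "filterlim (\<lambda>r. t - r) (at (t - s) within {0..t}) F"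
      proof -
        have "((\<lambda>r. t - r) \<longlongrightarrow> t - s) F" unfolding F_def by (intro tendsto_intros)
        then show ?thesis unfolding filterlim_at F_def by (auto simp: eventually_at_filter)
      qed
      have ts: "t - s \<in> {0..t}" using s by auto
      have 1: "((\<lambda>r. (y r - y s - (r - s) *\<^sub>R z s) /\<^sub>R norm (r - s)) \<longlongrightarrow> 0) F"
        using dy[OF s] unfolding has_vector_derivative_def has_derivative_at_within F_def by simp
      have "((\<lambda>r. (S r (y s) - S (t - s) (y s) - (r - (t - s)) *\<^sub>R S (t - s) (z s)) /\<^sub>R norm (r - (t - s))) \<longlongrightarrow> 0) (at (t - s) within {0..t})"
        using S.orbit_derivative[OF gyz[OF s] ts] unfolding has_vector_derivative_def has_derivative_at_within by simp
      from filterlim_compose[OF this refl]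
      have 2: "((\<lambda>r. (S (t - r) (y s) - S (t - s) (y s) + (r - s) *\<^sub>R S (t - s) (z s)) /\<^sub>R norm (r - s)) \<longlongrightarrow> 0) F"
        by (simp add: norm_minus_commute abs_minus_commute algebra_simps)
      have "((\<lambda>r. S r (z s)) \<longlongrightarrow> S (t - s) (z s)) (at (t - s) within {0..t})"
        using S.continuous_orbit[OF yz(2)[OF s]] ts by (simp add: continuous_on_def)
      from filterlim_compose[OF this refl]
      have 3: "((\<lambda>r. S (t - r) (z s)) \<longlongrightarrow> S (t - s) (z s)) F" .
      have "((\<lambda>r. M * norm ((y r - y s - (r - s) *\<^sub>R z s) /\<^sub>R norm (r - s))
          + norm ((S (t - r) (y s) - S (t - s) (y s) + (r - s) *\<^sub>R S (t - s) (z s)) /\<^sub>R norm (r - s))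
          + norm (S (t - r) (z s) - S (t - s) (z s))) \<longlongrightarrow> M * norm (0::'a) + norm (0::'a) + norm (S (t - s) (z s) - S (t - s) (z s))) F"
        by (intro tendsto_intros 1 2 3)
      then have lim0: "((\<lambda>r. M * norm ((y r - y s - (r - s) *\<^sub>R z s) /\<^sub>R norm (r - s))
          + norm ((S (t - r) (y s) - S (t - s) (y s) + (r - s) *\<^sub>R S (t - s) (z s)) /\<^sub>R norm (r - s))
          + norm (S (t - r) (z s) - S (t - s) (z s))) \<longlongrightarrow> 0) F" by simp
      show "((\<lambda>r. (S (t - r) (y r) - S (t - s) (y s) - (r - s) *\<^sub>R 0) /\<^sub>R norm (r - s)) \<longlongrightarrow> 0) (at s within {0..t})"
        unfolding F_def[symmetric]
      proof (rule Lim_null_comparison[OF _ lim0])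
        show "\<forall>\<^sub>F r in F. norm ((S (t - r) (y r) - S (t - s) (y s) - (r - s) *\<^sub>R 0) /\<^sub>R norm (r - s)) \<le>
          M * norm ((y r - y s - (r - s) *\<^sub>R z s) /\<^sub>R norm (r - s))
          + norm ((S (t - r) (y s) - S (t - s) (y s) + (r - s) *\<^sub>R S (t - s) (z s)) /\<^sub>R norm (r - s))
          + norm (S (t - r) (z s) - S (t - s) (z s))"
          unfolding F_def eventually_at_filter
        proof (rule always_eventually, intro allI impI)
          fix r assume r: "r \<noteq> s" "r \<in> {0..t}"
          have tr: "t - r \<ge> 0" "t - r \<in> {0..t}" using r by auto
          let ?a = "(y r - y s - (r - s) *\<^sub>R z s) /\<^sub>R norm (r - s)"
          let ?b = "(S (t - r) (y s) - S (t - s) (y s) + (r - s) *\<^sub>R S (t - s) (z s)) /\<^sub>R norm (r - s)"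
          let ?c = "S (t - r) (z s) - S (t - s) (z s)"
          have aX: "?a \<in> X"
            using yz[OF s] yz[OF r(2)] S.subspace_X by (simp add: subspace_diff subspace_scale)
          have Sa: "S (t - r) ?a = (S (t - r) (y r) - S (t - r) (y s) - (r - s) *\<^sub>R S (t - r) (z s)) /\<^sub>R norm (r - s)"
            using yz[OF s] yz[OF r(2)] S.subspace_X tr
            by (simp only: S.S_diff S.S_scale subspace_diff subspace_scale)
          have "(S (t - r) (y r) - S (t - s) (y s) - (r - s) *\<^sub>R 0) /\<^sub>R norm (r - s)
              = S (t - r) ?a + ?b + ((r - s) / norm (r - s)) *\<^sub>R ?c" (is "?l = _")
          proof -
            \<comment> \<open>Adds and subtracts \<open>S (t - r) (y s)\<close> and the multiple of
              \<open>S (t - r) (z s)\<close> by r - s.\<close>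
            have "k *\<^sub>R (a - c - d *\<^sub>R 0) = k *\<^sub>R (a - b - d *\<^sub>R g') + k *\<^sub>R (b - c + d *\<^sub>R g) + (d * k) *\<^sub>R (g' - g)"
              for a b c g g' :: 'a and d k :: real
              by (simp add: algebra_simps)
            then show ?thesis unfolding Sa divide_inverse by blast
          qed
          moreover have "norm (a + b + c) \<le> norm a + norm b + norm c" for a b c :: 'a
            using norm_triangle_ineq[of "a + b" c] norm_triangle_ineq[of a b] by linarith
          ultimately have "norm ?l \<le> norm (S (t - r) ?a) + norm ?b + norm (((r - s) / norm (r - s)) *\<^sub>R ?c)"
            by metis
          moreover have "norm (((r - s) / norm (r - s)) *\<^sub>R ?c) = norm ?c" using r by simp
          moreover have "norm (S (t - r) ?a) \<le> M * norm ?a" using M(2)[OF tr(2) aX] .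
          ultimately show "norm ?l \<le> M * norm ?a + norm ?b + norm ?c"
            by linarith
        qed
      qed
    qed (rule bounded_linear_scaleR_left)
    then obtain c where c: "\<And>r. r \<in> {0..t} \<Longrightarrow> S (t - r) (y r) = c"
      using has_vector_derivative_zero_constant[of "{0..t}" "\<lambda>r. S (t - r) (y r)"] by auto
    show ?thesis
      using c[of 0] c[of t] t S'.generates_in[OF fg] by (simp add: y_def S.S_0 S'.S_0 BX S'.S_in)
  qed
  \<comment> \<open>With the projections inserted both sides are bounded operators on the whole
    type, so the set on which they agree is closed.\<close>
  have bl: "bounded_linear (\<lambda>x. B (S' t (P' x)) - S t (P (B (P' x))))"
    using t
    by (intro bounded_linear_sub bounded_linear_compose[OF B S'.bounded_linear_SP]
        bounded_linear_compose[OF S.bounded_linear_SP] bounded_linear_compose[OF B] S'.P)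
  have "closure {f. \<exists>g. generates X' S' f g} \<subseteq> {x. B (S' t (P' x)) - S t (P (B (P' x))) = 0}"
  proof (rule closure_minimal)
    show "closed {x. B (S' t (P' x)) - S t (P (B (P' x))) = 0}"
      by (intro closed_Collect_eq linear_continuous_on bl continuous_on_const)
    show "{f. \<exists>g. generates X' S' f g} \<subseteq> {x. B (S' t (P' x)) - S t (P (B (P' x))) = 0}"
      using eq S'.generates_in S'.P_id S.P_id BX by auto
  qed
  then show ?thesis
    using dense x S'.P_id S.P_id BX by auto
qed

section \<open>Semigroups generated by dissipative operators\<close>

lemma eventually_at_right_less_pos: "e > 0 \<Longrightarrow> \<forall>\<^sub>F t in at_right 0. t < (e :: real)"
  unfolding eventually_at_right_field by blast

lemma norm_triangle3:
  fixes a b c :: "'a::real_normed_vector"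
  shows "x = a + b + c \<Longrightarrow> norm x \<le> norm a + norm b + norm c"
  using norm_triangle_ineq[of "a + b" c] norm_triangle_ineq[of a b] by simp

lemma norm_increment_le:
  fixes f :: "real \<Rightarrow> 'a::real_normed_vector"
  assumes "0 \<le> t" and d: "\<And>s. s \<in> {0..t} \<Longrightarrow> (f has_vector_derivative f' s) (at s within {0..t})"
    and B: "\<And>s. s \<in> {0..t} \<Longrightarrow> norm (f' s) \<le> B"
  shows "norm (f t - f 0) \<le> t * B"
proof -
  have "norm (f t - f 0) \<le> B * norm (t - 0)"
  proof (rule differentiable_bound[where f' = "\<lambda>s h. h *\<^sub>R f' s"])
    show "onorm (\<lambda>h. h *\<^sub>R f' s) \<le> B" if "s \<in> {0..t}" for s
      using B[OF that] onorm_scaleR_left[OF bounded_linear_ident, of "f' s"] onorm_id[where 'a = real]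
      by (simp add: id_def)
  qed (use assms in \<open>auto simp: has_vector_derivative_def\<close>)
  then show ?thesis using assms(1) by (simp add: mult.commute)
qed

text \<open>The hypotheses of Lumer and Phillips: A is dissipative, has dense domain, and l - A is
  onto for every l > 0. The operator is given by its graph, like \<open>laplacian\<close>; the class
  \<open>perfect_space\<close> makes the Banach algebra \<open>endo\<close> available.\<close>

locale dissipative_operator = projected_space X P
  for X :: "'a::{real_inner,banach,perfect_space} set" and P +
  fixes A :: "'a \<Rightarrow> 'a \<Rightarrow> bool"
  assumes P_le: "norm (P x) \<le> norm x"
    and A_in: "A f g \<Longrightarrow> f \<in> X \<and> g \<in> X"
    and A_add: "A f g \<Longrightarrow> A f' g' \<Longrightarrow> A (f + f') (g + g')"
    and A_scale: "A f g \<Longrightarrow> A (c *\<^sub>R f) (c *\<^sub>R g)"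
    and dissipative: "A f g \<Longrightarrow> inner g f \<le> 0"
    and range: "l > 0 \<Longrightarrow> h \<in> X \<Longrightarrow> \<exists>f g. A f g \<and> l *\<^sub>R f - g = h"
    and dense: "X \<subseteq> closure {f. \<exists>g. A f g}"
begin

lemma P_lin: "P (x + y) = P x + P y" "P (x - y) = P x - P y" "P (c *\<^sub>R x) = c *\<^sub>R P x"
  using bounded_linear.linear[OF P] by (simp_all add: linear_add linear_diff linear_scale)

lemma A_diff: "A f g \<Longrightarrow> A f' g' \<Longrightarrow> A (f - f') (g - g')"
  using A_add[of f g "(-1) *\<^sub>R f'" "(-1) *\<^sub>R g'"] A_scale[of f' g' "-1"] by simp

definition R :: "real \<Rightarrow> 'a \<Rightarrow> 'a" where
  "R l x = (THE f. \<exists>g. A f g \<and> l *\<^sub>R f - g = P x)"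

text \<open>Pairing g - g' = l (f - f') with f - f' shows that l times a squared norm is at most
  0.\<close>

lemma injective_on_domain:
  assumes "l > 0" "A f g" "A f' g'" "l *\<^sub>R f - g = l *\<^sub>R f' - g'"
  shows "f = f'"
proof -
  have "g - g' = l *\<^sub>R (f - f')" using assms(4) by (simp add: algebra_simps)
  then have "l * inner (f - f') (f - f') \<le> 0"
    using dissipative[OF A_diff[OF assms(2,3)]] by simp
  moreover have "inner (f - f') (f - f') \<ge> 0" by simp
  ultimately have "inner (f - f') (f - f') = 0" using assms(1) by (simp add: mult_le_0_iff)
  then show ?thesis by simp
qed

lemma R_eqI: "l > 0 \<Longrightarrow> A f g \<Longrightarrow> l *\<^sub>R f - g = P x \<Longrightarrow> R l x = f"
  unfolding R_def by (rule the_equality) (auto dest: injective_on_domain)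

lemma A_R: "l > 0 \<Longrightarrow> A (R l x) (l *\<^sub>R R l x - P x)"
proof -
  assume l: "l > 0"
  obtain f g where fg: "A f g" "l *\<^sub>R f - g = P x" using range[OF l P_in] by blast
  then have "g = l *\<^sub>R f - P x" by (auto simp: algebra_simps)
  then show ?thesis using R_eqI[OF l fg] fg by simp
qed

lemma linear_R: "l > 0 \<Longrightarrow> linear (R l)"
  by (intro linearI R_eqI[OF _ A_add[OF A_R A_R]] R_eqI[OF _ A_scale[OF A_R]])
    (auto simp: algebra_simps P_lin)

text \<open>Pair the resolvent equation with its solution and drop the dissipative term.\<close>

lemma R_le: "l > 0 \<Longrightarrow> norm (R l x) \<le> (1 / l) * norm x"
proof -
  assume l: "l > 0"
  have "l * (norm (R l x))\<^sup>2 = inner (l *\<^sub>R R l x - P x) (R l x) + inner (P x) (R l x)"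
    by (simp add: inner_diff_left power2_norm_eq_inner)
  also have "\<dots> \<le> inner (P x) (R l x)"
    using dissipative[OF A_R[OF l, of x]] by simp
  also have "\<dots> \<le> norm (P x) * norm (R l x)" by (rule norm_cauchy_schwarz)
  also have "\<dots> \<le> norm x * norm (R l x)" by (intro mult_right_mono P_le) simp
  finally have "(l * norm (R l x)) * norm (R l x) \<le> norm x * norm (R l x)"
    by (simp add: power2_eq_square)
  then have "l * norm (R l x) \<le> norm x"
    by (cases "norm (R l x) = 0") (auto simp: mult_le_cancel_right)
  then show ?thesis using l by (simp add: field_simps)
qed

lemma R_P: "R l (P x) = R l x"
  by (simp add: R_def P_id P_in)

lemma P_R: "l > 0 \<Longrightarrow> P (R l x) = R l x"
  using A_in A_R P_id by blast

text \<open>The right-hand side is checked to solve the equation that characterises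
  \<open>R l x\<close>.\<close>

lemma resolvent_identity:
  assumes "l > 0" "m > 0"
  shows "R l x = R m x + (m - l) *\<^sub>R R l (R m x)"
  by (rule R_eqI[OF assms(1) A_add[OF A_R[OF assms(2)] A_scale[OF A_R[OF assms(1)]]]])
    (simp add: P_R assms algebra_simps)

lemma R_commute:
  assumes "l > 0" "m > 0"
  shows "R l (R m x) = R m (R l x)"
proof (cases "l = m")
  case False
  have "(m - l) *\<^sub>R R l (R m x) = (m - l) *\<^sub>R R m (R l x)"
  proof -
    have "(m - l) *\<^sub>R R m (R l x) = - ((l - m) *\<^sub>R R m (R l x))"
      by (simp flip: scaleR_minus_left)
    also have "(l - m) *\<^sub>R R m (R l x) = R m x - R l x"
      using resolvent_identity[OF assms(2,1), of x] by (metis add_diff_cancel_left')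
    also have "- (R m x - R l x) = (m - l) *\<^sub>R R l (R m x)"
      using resolvent_identity[OF assms, of x] by (metis add_diff_cancel_left' minus_diff_eq)
    finally show ?thesis by (rule sym)
  qed
  then show ?thesis using False scaleR_cancel_left[of "m - l"] by (metis right_minus_eq)
qed simp

lemma R_A: "l > 0 \<Longrightarrow> A f g \<Longrightarrow> R l (l *\<^sub>R f - g) = f"
  using A_in subspace_X by (intro R_eqI[of l f g]) (auto simp: P_id subspace_diff subspace_scale)

definition E :: "real \<Rightarrow> 'a endo" where
  "E l = (SOME e. endo_app e = R l \<and> norm e \<le> 1 / l)"

lemma E: "l > 0 \<Longrightarrow> endo_app (E l) = R l" "l > 0 \<Longrightarrow> norm (E l) \<le> 1 / l"
  using someI_ex[OF endo_of_bounded_linear[OF linear_R R_le, of l]] by (auto simp: E_def)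

text \<open>On X this is the Yosida approximation l A (l - A)^{-1} at l = n + 1, rewritten with A (l
  - A)^{-1} = l (l - A)^{-1} - 1 so that it is a bounded operator.\<close>

definition Y :: "nat \<Rightarrow> 'a endo" where
  "Y n = (real (Suc n))\<^sup>2 *\<^sub>R E (real (Suc n)) - real (Suc n) *\<^sub>R 1"

definition U :: "nat \<Rightarrow> real \<Rightarrow> 'a endo" where
  "U n t = exp (t *\<^sub>R Y n)"

lemma Y_commute: "Y m * Y n = Y n * Y m"
proof -
  have "E (real (Suc m)) * E (real (Suc n)) = E (real (Suc n)) * E (real (Suc m))"
    by (rule endo_eqI) (simp add: E R_commute del: of_nat_Suc)
  then show ?thesis unfolding Y_def by (simp add: algebra_simps del: of_nat_Suc)
qed

text \<open>Splitting off the scalar part gives exp (- t l) exp (t l^2 E), and norm E \<le> 1 / l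
  bounds the norm of the second factor by exp (t l).\<close>

lemma norm_U: "t \<ge> 0 \<Longrightarrow> norm (U n t) \<le> 1"
proof -
  assume t: "t \<ge> 0"
  define l where "l = real (Suc n)"
  have l: "l > 0" by (simp add: l_def)
  have "U n t = exp ((t * l\<^sup>2) *\<^sub>R E l + of_real (- (t * l)))"
    unfolding U_def Y_def l_def[symmetric] by (simp add: of_real_def algebra_simps)
  also have "\<dots> = exp ((t * l\<^sup>2) *\<^sub>R E l) * exp (of_real (- (t * l)))"
    by (rule exp_add_commuting) (simp add: of_real_def)
  also have "\<dots> = exp (- (t * l)) *\<^sub>R exp ((t * l\<^sup>2) *\<^sub>R E l)"
    unfolding exp_of_real by (simp add: of_real_def)
  finally have "norm (U n t) = exp (- (t * l)) * norm (exp ((t * l\<^sup>2) *\<^sub>R E l))" by simp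
  also have "\<dots> \<le> exp (- (t * l)) * exp (norm ((t * l\<^sup>2) *\<^sub>R E l))"
    by (intro mult_left_mono norm_exp) simp
  also have "\<dots> \<le> exp (- (t * l)) * exp (t * l)"
  proof (intro mult_left_mono)
    have "(t * l\<^sup>2) * norm (E l) \<le> (t * l\<^sup>2) * (1 / l)" using E(2)[OF l] t by (intro mult_left_mono) auto
    then show "exp (norm ((t * l\<^sup>2) *\<^sub>R E l)) \<le> exp (t * l)" using t l by (simp add: power2_eq_square)
  qed simp
  also have "\<dots> = 1" by (simp add: exp_minus)
  finally show ?thesis .
qed

lemma U_le: "t \<ge> 0 \<Longrightarrow> norm (endo_app (U n t) x) \<le> norm x"
  using order_trans[OF norm_endo_app mult_right_mono[OF norm_U norm_ge_zero]] by simp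

lemma U_0: "U n 0 = 1" by (simp add: U_def)

lemma U_plus: "U n (s + t) = U n s * U n t"
  unfolding U_def scaleR_add_left by (rule exp_add_commuting) simp

lemma U_in:
  assumes "x \<in> X"
  shows "endo_app (U n t) x \<in> X"
proof -
  obtain p :: "'a endo" where p: "endo_app p = P"
    using endo_of_bounded_linear[OF bounded_linear.linear[OF P], of 1] P_le by auto
  have "Y n * p = p * Y n"
    by (rule endo_eqI) (simp add: Y_def p E R_P P_R P_lin del: of_nat_Suc)
  then have "U n t * p = p * U n t" unfolding U_def by (intro exp_commute) simp
  then have "endo_app (U n t) (P x) = P (endo_app (U n t) x)"
    by (metis endo_app_simps(1) p)
  then show ?thesis using assms P_id P_in by metis
qed

text \<open>The resolvent commutes with the operator on its domain. In this form Y f is bounded by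
  the norm of g uniformly in n and converges to g.\<close>

lemma Y_A: "A f g \<Longrightarrow> endo_app (Y n) f = real (Suc n) *\<^sub>R R (real (Suc n)) g"
proof -
  assume fg: "A f g"
  define l where "l = real (Suc n)"
  have l: "l > 0" by (simp add: l_def)
  have "l *\<^sub>R R l f - R l g = f"
    using R_A[OF l fg] linear_R[OF l] by (simp add: linear_diff linear_scale)
  then have eq: "R l g = l *\<^sub>R R l f - f" by (auto simp: algebra_simps)
  show ?thesis
    unfolding Y_def l_def[symmetric] eq using l by (simp add: E power2_eq_square scaleR_diff_right)
qed

lemma Y_A_le: "A f g \<Longrightarrow> norm (endo_app (Y n) f) \<le> norm g"
  using R_le[of "real (Suc n)" g] by (simp add: Y_A field_simps del: of_nat_Suc)

lemma domain_approximation: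
  assumes "x \<in> X" "e > 0"
  obtains f g where "A f g" "norm (f - x) < e"
proof -
  have "x \<in> closure {f. \<exists>g. A f g}" using dense assms(1) by blast
  then obtain f where "f \<in> {f. \<exists>g. A f g}" "dist f x < e"
    using assms(2) unfolding closure_approachable by blast
  then show ?thesis using that by (auto simp: dist_norm)
qed

text \<open>On the domain l R f - f = R g has norm at most norm g / l. The uniform bound 1 on the
  norm of l R extends the convergence to X by density.\<close>

lemma resolvent_limit:
  assumes x: "x \<in> X"
  shows "(\<lambda>n. real (Suc n) *\<^sub>R R (real (Suc n)) x) \<longlonglongrightarrow> x"
proof (rule LIMSEQ_I)
  fix e :: real assume "e > 0"
  then have "e / 4 > 0" by simp
    from domain_approximation[OF x this] obtain f g where fg: "A f g" "norm (f - x) < e / 4" by blast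
  obtain N :: nat where N: "N > 2 * norm g / e" using reals_Archimedean2 by blast
  have "norm (real (Suc n) *\<^sub>R R (real (Suc n)) x - x) < e" if n: "n \<ge> N" for n
  proof -
    define l where "l = real (Suc n)"
    have l: "l > 0" by (simp add: l_def)
    have "2 * norm g / e < l" using N n by (simp add: l_def)
    then have small: "norm g / l < e / 2" using l \<open>e > 0\<close> by (simp add: field_simps)
    have "l *\<^sub>R R l f - R l g = f"
      using R_A[OF l fg(1)] linear_R[OF l] by (simp add: linear_diff linear_scale)
    then have "l *\<^sub>R R l x - x = l *\<^sub>R R l (x - f) + R l g + (f - x)"
      using linear_R[OF l] by (simp add: linear_diff algebra_simps)
    then have "norm (l *\<^sub>R R l x - x) \<le> norm (l *\<^sub>R R l (x - f)) + norm (R l g) + norm (f - x)"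
      by (rule norm_triangle3)
    moreover have "norm (l *\<^sub>R R l (x - f)) \<le> norm (f - x)"
      using R_le[OF l, of "x - f"] l by (simp add: field_simps norm_minus_commute)
    moreover have "norm (R l g) \<le> norm g / l" using R_le[OF l, of g] by simp
    ultimately show ?thesis using fg(2) small unfolding l_def by linarith
  qed
  then show "\<exists>N. \<forall>n\<ge>N. norm (real (Suc n) *\<^sub>R R (real (Suc n)) x - x) < e" by blast
qed

lemma Y_limit: "A f g \<Longrightarrow> (\<lambda>n. endo_app (Y n) f) \<longlonglongrightarrow> g"
  using resolvent_limit[of g] A_in[of f g] by (simp add: Y_A del: of_nat_Suc)

lemma U_derivative: "((\<lambda>t. U n t) has_vector_derivative U n t * Y n) (at t within T)"
  unfolding U_def
  by (rule has_vector_derivative_at_within[OF exp_scaleR_has_vector_derivative_right[THEN has_vector_derivative_at_within, of _ _ UNIV, simplified]])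

text \<open>The path s \<mapsto> U m s U n (t - s) joins the two exponentials. All factors commute,
  so its derivative is a contraction applied to (Y m - Y n) f.\<close>

lemma U_difference:
  assumes t: "t \<ge> 0"
  shows "norm (endo_app (U m t) f - endo_app (U n t) f) \<le> t * norm (endo_app (Y m) f - endo_app (Y n) f)"
proof -
  define D where "D s = endo_app (U m s * U n (t - s)) f" for s
  define D' where "D' s = endo_app (U m s * Y m * U n (t - s) - U m s * (U n (t - s) * Y n)) f" for s
  have "norm (D t - D 0) \<le> t * norm (endo_app (Y m) f - endo_app (Y n) f)"
  proof (rule norm_increment_le[OF t])
    fix s assume s: "s \<in> {0..t}"
    have "((\<lambda>s. U n (t - s)) has_vector_derivative (-1) *\<^sub>R (U n (t - s) * Y n)) (at s within {0..t})"
      by (rule vector_diff_chain_within[of "\<lambda>s. t - s" "-1" s "{0..t}" "U n", unfolded o_def])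
        (auto intro!: derivative_eq_intros U_derivative)
    then have "((\<lambda>s. U m s * U n (t - s)) has_vector_derivative
        (U m s * ((-1) *\<^sub>R (U n (t - s) * Y n)) + (U m s * Y m) * U n (t - s))) (at s within {0..t})"
      by (rule has_vector_derivative_mult[OF U_derivative])
    from bounded_linear.has_vector_derivative[OF bounded_linear_endo_app_left this, of f]
    show "(D has_vector_derivative D' s) (at s within {0..t})"
      unfolding D_def[abs_def] D'_def by (simp add: algebra_simps)
    have "Y m * U n (t - s) = U n (t - s) * Y m"
      unfolding U_def by (rule exp_commute[symmetric]) (simp add: Y_commute)
    then have "U m s * Y m * U n (t - s) - U m s * (U n (t - s) * Y n) = U m s * U n (t - s) * (Y m - Y n)"
      by (simp add: right_diff_distrib mult.assoc)
    then have "D' s = endo_app (U m s * U n (t - s)) (endo_app (Y m) f - endo_app (Y n) f)"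
      unfolding D'_def by simp
    also have "norm \<dots> \<le> norm (endo_app (Y m) f - endo_app (Y n) f)"
      unfolding endo_app_simps(1) by (rule order_trans[OF U_le U_le]) (use s in auto)
    finally show "norm (D' s) \<le> norm (endo_app (Y m) f - endo_app (Y n) f)" .
  qed
  then show ?thesis by (simp add: D_def U_0)
qed

definition S :: "real \<Rightarrow> 'a \<Rightarrow> 'a" where
  "S t x = lim (\<lambda>n. endo_app (U n t) x)"

lemma S_limit:
  assumes t: "t \<ge> 0" and x: "x \<in> X"
  shows "(\<lambda>n. endo_app (U n t) x) \<longlonglongrightarrow> S t x"
proof -
  have "Cauchy (\<lambda>n. endo_app (U n t) x)"
  proof (rule CauchyI)
    fix e :: real assume "e > 0"
    then have "e / 3 > 0" by simp
    from domain_approximation[OF x this] obtain f g where fg: "A f g" "norm (f - x) < e / 3" by blast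
    have "Cauchy (\<lambda>n. endo_app (Y n) f)"
      using Y_limit[OF fg(1)] by (rule LIMSEQ_imp_Cauchy)
    then obtain N where N: "\<And>m n. m \<ge> N \<Longrightarrow> n \<ge> N \<Longrightarrow>
        norm (endo_app (Y m) f - endo_app (Y n) f) < e / (3 * (t + 1))"
      using CauchyD[of _ "e / (3 * (t + 1))"] \<open>e > 0\<close> t by (metis add_nonneg_pos divide_pos_pos mult_pos_pos zero_less_numeral zero_less_one)
    have "norm (endo_app (U m t) x - endo_app (U n t) x) < e" if mn: "m \<ge> N" "n \<ge> N" for m n
    proof -
      have "norm (endo_app (U m t) f - endo_app (U n t) f) \<le> t * norm (endo_app (Y m) f - endo_app (Y n) f)"
        by (rule U_difference[OF t])
      also have "\<dots> \<le> t * (e / (3 * (t + 1)))" using N[OF mn] t by (intro mult_left_mono) auto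
      also have "\<dots> \<le> e / 3" using t \<open>e > 0\<close> by (simp add: field_simps)
      finally have 1: "norm (endo_app (U m t) f - endo_app (U n t) f) \<le> e / 3" .
      have 2: "norm (endo_app (U k t) (x - f)) < e / 3" for k
        using U_le[OF t, of k "x - f"] fg(2) by (simp add: norm_minus_commute)
      have "endo_app (U m t) x - endo_app (U n t) x
          = endo_app (U m t) (x - f) + (endo_app (U m t) f - endo_app (U n t) f) - endo_app (U n t) (x - f)"
        by simp
      then have "norm (endo_app (U m t) x - endo_app (U n t) x) \<le> norm (endo_app (U m t) (x - f))
          + norm (endo_app (U m t) f - endo_app (U n t) f) + norm (endo_app (U n t) (x - f))"
        using norm_triangle3[of _ "endo_app (U m t) (x - f)" "endo_app (U m t) f - endo_app (U n t) f" "- endo_app (U n t) (x - f)"]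
        by (simp add: norm_minus_commute[of "endo_app (U n t) f"])
      then show ?thesis using 1 2[of m] 2[of n] by linarith
    qed
    then show "\<exists>N. \<forall>m\<ge>N. \<forall>n\<ge>N. norm (endo_app (U m t) x - endo_app (U n t) x) < e" by blast
  qed
  then show ?thesis unfolding S_def by (simp add: Cauchy_convergent convergent_LIMSEQ_iff[symmetric])
qed

lemma S_le: "t \<ge> 0 \<Longrightarrow> x \<in> X \<Longrightarrow> norm (S t x) \<le> norm x"
  by (rule LIMSEQ_le_const2[OF tendsto_norm[OF S_limit]]) (auto intro: U_le)

lemma S_diff: "t \<ge> 0 \<Longrightarrow> x \<in> X \<Longrightarrow> y \<in> X \<Longrightarrow> S t (x - y) = S t x - S t y"
  using LIMSEQ_unique[OF S_limit[of t "x - y"] ] tendsto_diff[OF S_limit S_limit, of t x t y] subspace_diff[OF subspace_X]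
  by simp

lemma S_increment: "t \<ge> 0 \<Longrightarrow> A f g \<Longrightarrow> norm (S t f - f) \<le> t * norm g"
proof -
  assume t: "t \<ge> 0" and fg: "A f g"
  have fX: "f \<in> X" using A_in fg by blast
  have "norm (endo_app (U n t) f - f) \<le> t * norm g" for n
  proof -
    have "norm (endo_app (U n t) f - endo_app (U n 0) f) \<le> t * norm g"
    proof (rule norm_increment_le[OF t bounded_linear.has_vector_derivative[OF bounded_linear_endo_app_left U_derivative]])
      show "norm (endo_app (U n s * Y n) f) \<le> norm g" if "s \<in> {0..t}" for s
        using that order_trans[OF U_le Y_A_le[OF fg]] by simp
    qed
    then show ?thesis by (simp add: U_0)
  qed
  then show ?thesis
    by (intro LIMSEQ_le_const2[OF tendsto_norm[OF tendsto_diff[OF S_limit[OF t fX] tendsto_const]]]) blast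
qed

lemma S_tendsto:
  assumes x: "x \<in> X"
  shows "((\<lambda>t. S t x) \<longlongrightarrow> x) (at_right 0)"
proof (rule tendstoI)
  fix e :: real assume "e > 0"
  then have "e / 3 > 0" by simp
    from domain_approximation[OF x this] obtain f g where fg: "A f g" "norm (f - x) < e / 3" by blast
  have fX: "f \<in> X" using A_in fg by blast
  have "\<forall>\<^sub>F t in at_right 0. t < e / (3 * (norm g + 1))"
    using \<open>e > 0\<close> by (intro eventually_at_right_less_pos) (auto intro!: divide_pos_pos add_nonneg_pos)
  then show "\<forall>\<^sub>F t in at_right 0. dist (S t x) x < e"
    using eventually_at_right_less[of "0::real"]
  proof eventually_elim
    case (elim t)
    have "t * norm g \<le> e / (3 * (norm g + 1)) * norm g" using elim by (intro mult_right_mono) auto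
    also have "\<dots> \<le> e / 3"
    proof -
      have "norm g + 1 > 0" by (simp add: add_nonneg_pos)
      then show ?thesis using \<open>e > 0\<close> by (simp add: field_simps)
    qed
    finally have 1: "norm (S t f - f) \<le> e / 3" using S_increment[OF _ fg(1), of t] elim by simp
    have 2: "norm (S t (x - f)) < e / 3"
      using S_le[of t "x - f"] x fX subspace_diff[OF subspace_X] fg(2) elim by (simp add: norm_minus_commute)
    have "S t x - x = S t (x - f) + (S t f - f) + (f - x)"
      using S_diff[of t x f] x fX elim by simp
    then have "norm (S t x - x) \<le> norm (S t (x - f)) + norm (S t f - f) + norm (f - x)"
      by (rule norm_triangle3)
    then show ?case using 1 2 fg(2) by (simp add: dist_norm)
  qed
qed

lemma linear_semigroup_S: "linear_semigroup X S"
  unfolding linear_semigroup_def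
proof (intro conjI allI impI ballI)
  fix t :: real and u assume t: "t \<ge> 0" and u: "u \<in> X"
  show SX: "S t u \<in> X"
    by (rule closed_sequentially[OF closed_X _ S_limit[OF t u]]) (simp add: U_in u)
  show "S t (u + v) = S t u + S t v" if v: "v \<in> X" for v
    using LIMSEQ_unique[OF S_limit[OF t, of "u + v"] ] tendsto_add[OF S_limit[OF t u] S_limit[OF t v]]
      u v subspace_add[OF subspace_X] by simp
  show "S t (c *\<^sub>R u) = c *\<^sub>R S t u" for c
    using LIMSEQ_unique[OF S_limit[OF t, of "c *\<^sub>R u"] ] tendsto_scaleR[OF tendsto_const S_limit[OF t u], of c]
      u subspace_scale[OF subspace_X] by simp
  show "S (s + t) u = S s (S t u)" if s: "s \<ge> 0" for s
  proof (rule LIMSEQ_unique[OF S_limit])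
    have "(\<lambda>n. norm (endo_app (U n t) u - S t u)) \<longlonglongrightarrow> 0"
      using S_limit[OF t u] by (simp add: tendsto_norm_zero_iff LIM_zero_iff)
    moreover have "(\<lambda>n. norm (endo_app (U n s) (S t u) - S s (S t u))) \<longlonglongrightarrow> 0"
      using S_limit[OF s SX] by (simp add: tendsto_norm_zero_iff LIM_zero_iff)
    ultimately have 0: "(\<lambda>n. norm (endo_app (U n t) u - S t u) + norm (endo_app (U n s) (S t u) - S s (S t u))) \<longlonglongrightarrow> 0"
      using tendsto_add by fastforce
    have "(\<lambda>n. endo_app (U n (s + t)) u - S s (S t u)) \<longlonglongrightarrow> 0"
    proof (rule Lim_null_comparison[OF _ 0], rule always_eventually, rule allI)
      fix n
      have "endo_app (U n (s + t)) u - S s (S t u) = endo_app (U n s) (endo_app (U n t) u - S t u)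
          + (endo_app (U n s) (S t u) - S s (S t u))"
        by (simp add: U_plus)
      then have "norm (endo_app (U n (s + t)) u - S s (S t u)) \<le> norm (endo_app (U n s) (endo_app (U n t) u - S t u))
          + norm (endo_app (U n s) (S t u) - S s (S t u))"
        by (metis norm_triangle_ineq)
      then show "norm (endo_app (U n (s + t)) u - S s (S t u)) \<le>
          norm (endo_app (U n t) u - S t u) + norm (endo_app (U n s) (S t u) - S s (S t u))"
        using U_le[OF s, of n "endo_app (U n t) u - S t u"]
        by linarith
    qed
    then show "(\<lambda>n. endo_app (U n (s + t)) u) \<longlonglongrightarrow> S s (S t u)" by (simp add: LIM_zero_iff)
  qed (use s t u in auto)
next
  fix u assume u: "u \<in> X"
  show "S 0 u = u"
    using LIMSEQ_unique[OF S_limit[of 0 u]] u by (simp add: U_0)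
  show "((\<lambda>t. S t u) \<longlongrightarrow> u) (at_right 0)" by (rule S_tendsto[OF u])
next
  fix t :: real assume "t \<ge> 0"
  then show "\<exists>M. \<forall>u\<in>X. norm (S t u) \<le> M * norm u"
    using S_le by (intro exI[of _ 1]) simp
qed

text \<open>The estimate of S t f - f - t g is proved for \<open>U n\<close> and \<open>Y n\<close>
  up to an error that vanishes with n, and then passed to the limit. Uniformity in n comes from
  replacing g by a nearby h of the domain with \<open>A h k\<close>, whose orbit under every
  \<open>U n\<close> moves by at most s norm k in time s.\<close>

lemma generates_of_A:
  assumes fg: "A f g"
  shows "generates X S f g"
proof -
  have fX: "f \<in> X" and gX: "g \<in> X" using A_in fg by auto
  have "((\<lambda>t. (S t f - f) /\<^sub>R t) \<longlongrightarrow> g) (at_right 0)"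
  proof (rule tendstoI)
    fix e :: real assume "e > 0"
    then have "e / 6 > 0" by simp
    from domain_approximation[OF gX this] obtain h k where hk: "A h k" "norm (h - g) < e / 6" by blast
    \<comment> \<open>Exchanging g for h costs e / 6 twice; the rest is the drift of h.\<close>
    have Us: "norm (endo_app (U n s) g - g) \<le> e / 3 + t * norm k" if s: "0 \<le> s" "s \<le> t" for n s t
    proof -
      have "norm (endo_app (U n s) h - endo_app (U n 0) h) \<le> s * norm k"
      proof (rule norm_increment_le[OF s(1) bounded_linear.has_vector_derivative[OF bounded_linear_endo_app_left U_derivative]])
        show "norm (endo_app (U n r * Y n) h) \<le> norm k" if "r \<in> {0..s}" for r
          using that order_trans[OF U_le Y_A_le[OF hk(1)]] by simp
      qed
      then have 1: "norm (endo_app (U n s) h - h) \<le> t * norm k"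
        using s mult_right_mono[of s t "norm k"] by (simp add: U_0)
      have "endo_app (U n s) g - g = endo_app (U n s) (g - h) + (endo_app (U n s) h - h) + (h - g)" by simp
      then have "norm (endo_app (U n s) g - g) \<le> norm (endo_app (U n s) (g - h)) + norm (endo_app (U n s) h - h) + norm (h - g)"
      by (rule norm_triangle3)
      then show ?thesis using 1 hk(2) U_le[OF s(1), of n "g - h"] by (simp add: norm_minus_commute)
    qed
    have main: "norm (S t f - f - t *\<^sub>R g) \<le> t * (e / 3 + t * norm k)" if t: "t \<ge> 0" for t
    proof -
      have Un: "norm (endo_app (U n t) f - f - t *\<^sub>R endo_app (Y n) f)
          \<le> t * (e / 3 + t * norm k + 2 * norm (endo_app (Y n) f - g))" for n
      proof -
        let ?w = "\<lambda>s. endo_app (U n s) f - s *\<^sub>R endo_app (Y n) f"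
        have "norm (?w t - ?w 0) \<le> t * (e / 3 + t * norm k + 2 * norm (endo_app (Y n) f - g))"
        proof (rule norm_increment_le[OF t])
          fix s assume s: "s \<in> {0..t}"
          show "(?w has_vector_derivative endo_app (U n s * Y n) f - endo_app (Y n) f) (at s within {0..t})"
            by (rule has_vector_derivative_diff[OF bounded_linear.has_vector_derivative[OF bounded_linear_endo_app_left U_derivative]])
              (auto intro!: derivative_eq_intros)
          let ?y = "endo_app (Y n) f"
          have "endo_app (U n s) ?y - ?y = endo_app (U n s) (?y - g) + (endo_app (U n s) g - g) + (g - ?y)" by simp
          then have "norm (endo_app (U n s) ?y - ?y) \<le> norm (endo_app (U n s) (?y - g)) + norm (endo_app (U n s) g - g) + norm (g - ?y)"
      by (rule norm_triangle3)
          then show "norm (endo_app (U n s * Y n) f - ?y) \<le> e / 3 + t * norm k + 2 * norm (?y - g)"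
            using Us[of s t n] s U_le[of s n "?y - g"] by (simp add: norm_minus_commute)
        qed
        then show ?thesis by (simp add: U_0 algebra_simps)
      qed
      have "(\<lambda>n. t * (e / 3 + t * norm k + 2 * norm (endo_app (Y n) f - g))) \<longlonglongrightarrow> t * (e / 3 + t * norm k + 2 * norm (g - g))"
        by (intro tendsto_intros Y_limit fg)
      moreover have "(\<lambda>n. norm (endo_app (U n t) f - f - t *\<^sub>R endo_app (Y n) f)) \<longlonglongrightarrow> norm (S t f - f - t *\<^sub>R g)"
        by (intro tendsto_intros Y_limit fg S_limit t fX)
      ultimately show ?thesis using Un by (auto intro: LIMSEQ_le)
    qed
    have "\<forall>\<^sub>F t in at_right 0. t < e / (3 * (norm k + 1))"
      using \<open>e > 0\<close> by (intro eventually_at_right_less_pos) (auto intro!: divide_pos_pos add_nonneg_pos)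
    then show "\<forall>\<^sub>F t in at_right 0. dist ((S t f - f) /\<^sub>R t) g < e"
      using eventually_at_right_less[of "0::real"]
    proof eventually_elim
      case (elim t)
      have "t * norm k \<le> e / (3 * (norm k + 1)) * norm k" using elim by (intro mult_right_mono) auto
      also have "\<dots> \<le> e / 3"
      proof -
        have "norm k + 1 > 0" by (simp add: add_nonneg_pos)
        then show ?thesis using \<open>e > 0\<close> by (simp add: field_simps)
      qed
      finally have 1: "t * norm k \<le> e / 3" .
      have "(S t f - f) /\<^sub>R t - g = (S t f - f - t *\<^sub>R g) /\<^sub>R t"
        using elim by (simp add: algebra_simps)
      then have "norm ((S t f - f) /\<^sub>R t - g) = norm (S t f - f - t *\<^sub>R g) / t"
        using elim by (simp add: divide_inverse mult.commute)
      also have "\<dots> \<le> e / 3 + t * norm k"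
        using main[of t] elim by (simp add: field_simps)
      finally show ?case using 1 \<open>e > 0\<close> by (simp add: dist_norm)
    qed
  qed
  then show ?thesis using fX by (simp add: generates_def)
qed

text \<open>Maximality: choose \<open>A h k\<close> with h - k = f - g. The generator is dissipative
  because S is a contraction, and at f - h it takes the value g - k = f - h, so f = h.\<close>

lemma A_of_generates:
  assumes fg: "generates X S f g"
  shows "A f g"
proof -
  interpret S: linear_semigroup_on X P S
    by unfold_locales (rule linear_semigroup_S)
  have fX: "f \<in> X" and gX: "g \<in> X" using S.generates_in[OF fg] by auto
  obtain h k where hk: "A h k" "1 *\<^sub>R h - k = f - g"
    using range[of 1 "f - g"] subspace_diff[OF subspace_X fX gX] by auto
  have hX: "h \<in> X" using A_in hk(1) by blast
  have "generates X S h k" by (rule generates_of_A[OF hk(1)])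
  then have lim: "((\<lambda>t. (S t f - f) /\<^sub>R t - (S t h - h) /\<^sub>R t) \<longlongrightarrow> g - k) (at_right 0)"
    using fg unfolding generates_def by (intro tendsto_diff) auto
  have "inner (g - k) (f - h) \<le> 0"
  proof (rule tendsto_upperbound[OF tendsto_inner[OF lim tendsto_const]])
    show "\<forall>\<^sub>F t in at_right 0. inner ((S t f - f) /\<^sub>R t - (S t h - h) /\<^sub>R t) (f - h) \<le> 0"
      using eventually_at_right_less[of "0::real"]
    proof eventually_elim
      case (elim t)
      have d: "f - h \<in> X" using fX hX subspace_diff[OF subspace_X] by blast
      have "(S t f - f) /\<^sub>R t - (S t h - h) /\<^sub>R t = (S t (f - h) - (f - h)) /\<^sub>R t"
      proof -
        have e: "S t (f - h) = S t f - S t h" using S_diff[of t f h] fX hX elim by simp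
        show ?thesis unfolding e by (simp add: scaleR_diff_right algebra_simps)
      qed
      moreover have "inner (S t (f - h)) (f - h) \<le> inner (f - h) (f - h)"
      proof -
        have "inner (S t (f - h)) (f - h) \<le> norm (S t (f - h)) * norm (f - h)" by (rule norm_cauchy_schwarz)
        also have "\<dots> \<le> norm (f - h) * norm (f - h)" using S_le d elim by (intro mult_right_mono) auto
        finally show ?thesis by (simp add: power2_norm_eq_inner[symmetric] power2_eq_square)
      qed
      ultimately show ?case using elim
        by (simp add: inner_diff_left[of "S t (f - h)"] mult_nonneg_nonpos)
    qed
  qed simp
  moreover have "g - k = f - h" using hk(2) by (simp add: algebra_simps)
  ultimately have "f = h" "g = k"
    by (metis inner_ge_zero inner_eq_zero_iff order_antisym right_minus_eq)+
  then show ?thesis using hk(1) by simp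
qed

theorem generation: "linear_semigroup X S" "generates X S f g \<longleftrightarrow> A f g"
  using linear_semigroup_S generates_of_A A_of_generates by blast+

end

section \<open>The Hilbert space of square-integrable functions\<close>

lemma sets_lebesgue_allI: "A \<in> sets borel \<Longrightarrow> A \<in> sets lebesgue_all"
  by (simp add: lebesgue_all_def sets_completionI_sets)

lemma measurable_lebesgue_allI: "f \<in> borel_measurable borel \<Longrightarrow> f \<in> borel_measurable lebesgue_all"
  unfolding lebesgue_all_def by (rule measurable_completion) simp

lemma emeasure_lebesgue_all: "A \<in> sets borel \<Longrightarrow> emeasure lebesgue_all A = emeasure lborel_all A"
  by (simp add: lebesgue_all_def emeasure_completion)

lemma Rn_borel: "Rn d \<in> sets borel"
proof -
  have "x \<in> Rn d \<longleftrightarrow> (\<forall>i. d \<le> i \<longrightarrow> x i = undefined)" for x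
    unfolding Rn_def PiE_iff extensional_def by (simp add: not_less)
  then have "Rn d = (\<Inter>i\<in>{d..}. {x. x i = undefined})" by blast
  moreover have "closed {x :: nat \<Rightarrow> real. x i = undefined}" for i
    by (intro closed_Collect_eq continuous_on_product_coordinates continuous_on_const)
  ultimately have "closed (Rn d)" by (simp add: closed_INT)
  then show ?thesis by (rule borel_closed)
qed

lemma sets_lborel_dim_borel:
  assumes "A \<in> sets (lborel_dim d)"
  shows "A \<in> sets borel" "A \<subseteq> Rn d"
proof -
  show sub: "A \<subseteq> Rn d" using sets.sets_into_space[OF assms] by (simp add: space_lborel_dim Rn_def)
  have "(\<lambda>x. restrict x {..<d}) \<in> borel \<rightarrow>\<^sub>M lborel_dim d"
    unfolding lborel_dim_def
    by (intro measurable_restrict) (auto intro!: borel_measurable_continuous_onI continuous_on_product_coordinates)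
  then have "(\<lambda>x. restrict x {..<d}) -` A \<in> sets borel"
    using assms by (auto dest: measurable_sets)
  moreover have "A = (\<lambda>x. restrict x {..<d}) -` A \<inter> Rn d"
    using sub by (auto simp: Rn_def restrict_PiE_iff PiE_restrict)
  ultimately show "A \<in> sets borel" using Rn_borel by (metis sets.Int)
qed

lemma slice_borel: "A \<in> sets borel \<Longrightarrow> {d} \<times> A \<in> sets (borel :: (nat \<times> (nat \<Rightarrow> real)) measure)"
  unfolding borel_prod[symmetric] by (intro pair_measureI) auto

lemma emeasure_lborel_all_slice:
  assumes "A \<in> sets borel"
  shows "emeasure lborel_all (A \<inter> {d} \<times> UNIV) = emeasure (lborel_dim d) (Pair d -` A \<inter> space (lborel_dim d))"
proof -
  have b: "A \<inter> {d} \<times> UNIV \<in> sets borel" using assms slice_borel[of UNIV d] by auto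
  have "emeasure (distr (lborel_dim k) borel (Pair k)) (A \<inter> {d} \<times> UNIV)
      = (if k = d then emeasure (lborel_dim d) (Pair d -` A \<inter> space (lborel_dim d)) else 0)" for k
    by (subst emeasure_distr[OF measurable_Pair_lborel_dim b])
      (auto intro!: arg_cong2[where f = emeasure] emeasure_empty simp: vimage_def)
  then show ?thesis
    by (subst emeasure_lborel_all[OF b], subst suminf_finite[of "{d}"]) auto
qed

lemma AE_slice:
  assumes "AE p in lborel_all. Q p"
  shows "AE x in lborel_dim d. Q (d, x)"
proof -
  obtain N where N: "{p. \<not> Q p} \<subseteq> N" "N \<in> sets borel" "emeasure lborel_all N = 0"
    using assms by (auto elim: AE_E)
  have "emeasure lborel_all (N \<inter> {d} \<times> UNIV) \<le> emeasure lborel_all N"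
    using N(2) by (intro emeasure_mono) auto
  then have "emeasure (lborel_dim d) (Pair d -` N \<inter> space (lborel_dim d)) = 0"
    using N by (simp add: emeasure_lborel_all_slice)
  moreover have "Pair d -` N \<inter> space (lborel_dim d) \<in> sets (lborel_dim d)"
    using measurable_Pair_lborel_dim N(2) by (rule measurable_sets)
  ultimately have "Pair d -` N \<inter> space (lborel_dim d) \<in> null_sets (lborel_dim d)" by (simp add: null_setsI)
  then show ?thesis by (rule AE_I'[rotated 0]) (use N(1) in auto)
qed

lemma measurable_Pair_lebesgue: "Pair d \<in> lebesgue_dim d \<rightarrow>\<^sub>M lebesgue_all"
  unfolding lebesgue_dim_def lebesgue_all_def
proof (rule completion.measurable_completion2)
  show m: "Pair d \<in> completion (lborel_dim d) \<rightarrow>\<^sub>M lborel_all"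
    using measurable_completion[OF measurable_Pair_lborel_dim, of d] by simp
  show "null_sets lborel_all \<subseteq> null_sets (distr (completion (lborel_dim d)) lborel_all (Pair d))"
  proof
    fix N assume N: "N \<in> null_sets lborel_all"
    then have "AE p in lborel_all. p \<notin> N" by (rule AE_not_in)
    then have "AE x in lborel_dim d. (d, x) \<notin> N" by (rule AE_slice)
    then have "AE x in completion (lborel_dim d). (d, x) \<notin> N" by (rule AE_completion)
    then show "N \<in> null_sets (distr (completion (lborel_dim d)) lborel_all (Pair d))"
      using N m by (subst null_sets_distr_iff[OF m]) (auto simp: null_sets_def completion.AE_iff_null_sets vimage_def Int_def conj_commute)
  qed
qed

text \<open>Links the integrals over \<open>lebesgue_dim d\<close> in \<open>weak_deriv\<close> with
  the inner product of \<open>l2\<close>. Both measures are completions, so A is first replaced by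
  its Borel main part, from which it differs by a null set.\<close>

lemma distr_Pair_lebesgue:
  "distr (lebesgue_dim d) lebesgue_all (Pair d) = density lebesgue_all (\<lambda>p. ennreal (indicator ({d} \<times> UNIV) p))"
proof (rule measure_eqI)
  fix A assume "A \<in> sets (distr (lebesgue_dim d) lebesgue_all (Pair d))"
  then have A: "A \<in> sets lebesgue_all" by simp
  define B where "B = main_part lborel_all A"
  have B: "B \<in> sets borel" using A main_part_sets[of A lborel_all] by (simp add: B_def lebesgue_all_def)
  have AB: "AE p in lborel_all. p \<in> B \<longleftrightarrow> p \<in> A"
    using A AE_in_main_part[of A lborel_all] by (simp add: B_def lebesgue_all_def)
  have D: "{d} \<times> UNIV \<in> sets lebesgue_all" by (intro sets_lebesgue_allI slice_borel) simp
  have "emeasure (distr (lebesgue_dim d) lebesgue_all (Pair d)) A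
      = emeasure (lebesgue_dim d) (Pair d -` A \<inter> space (lebesgue_dim d))"
    using A measurable_Pair_lebesgue by (simp add: emeasure_distr)
  also have "\<dots> = emeasure (lebesgue_dim d) (Pair d -` B \<inter> space (lebesgue_dim d))"
  proof (rule emeasure_eq_AE)
    show "AE x in lebesgue_dim d. (x \<in> Pair d -` A \<inter> space (lebesgue_dim d)) = (x \<in> Pair d -` B \<inter> space (lebesgue_dim d))"
      unfolding lebesgue_dim_def using AE_completion[OF AE_slice[OF AB, of d]] by eventually_elim auto
  qed (use A sets_lebesgue_allI[OF B] in \<open>auto intro: measurable_sets[OF measurable_Pair_lebesgue]\<close>)
  also have "\<dots> = emeasure (lborel_dim d) (Pair d -` B \<inter> space (lborel_dim d))"
    unfolding lebesgue_dim_def space_completion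
    using measurable_sets[OF measurable_Pair_lborel_dim B] by (simp add: emeasure_completion)
  also have "\<dots> = emeasure lborel_all (B \<inter> {d} \<times> UNIV)" by (rule emeasure_lborel_all_slice[OF B, symmetric])
  also have "\<dots> = emeasure lebesgue_all (B \<inter> {d} \<times> UNIV)"
    using B slice_borel[of UNIV d] by (simp add: emeasure_lebesgue_all)
  also have "\<dots> = emeasure lebesgue_all (A \<inter> {d} \<times> UNIV)"
  proof (rule emeasure_eq_AE)
    show "AE p in lebesgue_all. (p \<in> B \<inter> {d} \<times> UNIV) = (p \<in> A \<inter> {d} \<times> UNIV)"
      unfolding lebesgue_all_def using AE_completion[OF AB] by eventually_elim auto
  qed (use A D sets_lebesgue_allI[OF B] in auto)
  also have "\<dots> = emeasure (density lebesgue_all (\<lambda>p. ennreal (indicator ({d} \<times> UNIV) p))) A"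
  proof -
    have "emeasure lebesgue_all (A \<inter> {d} \<times> UNIV) = (\<integral>\<^sup>+p. indicator (A \<inter> {d} \<times> UNIV) p \<partial>lebesgue_all)"
      using A D by (simp only: nn_integral_indicator sets.Int)
    also have "\<dots> = (\<integral>\<^sup>+p. ennreal (indicator ({d} \<times> UNIV) p) * indicator A p \<partial>lebesgue_all)"
      by (rule nn_integral_cong) (simp split: split_indicator)
    also have "\<dots> = emeasure (density lebesgue_all (\<lambda>p. ennreal (indicator ({d} \<times> UNIV) p))) A"
      using A D by (simp add: emeasure_density)
    finally show ?thesis .
  qed
  finally show "emeasure (distr (lebesgue_dim d) lebesgue_all (Pair d)) A
      = emeasure (density lebesgue_all (\<lambda>p. ennreal (indicator ({d} \<times> UNIV) p))) A" .
qed simp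

lemma integral_slice:
  fixes F :: "nat \<times> (nat \<Rightarrow> real) \<Rightarrow> complex"
  assumes "F \<in> borel_measurable lebesgue_all"
  shows "(LINT x|lebesgue_dim d. F (d, x)) = (LINT p|lebesgue_all. indicator ({d} \<times> UNIV) p * F p)"
proof -
  have D: "{d} \<times> UNIV \<in> sets lebesgue_all" by (intro sets_lebesgue_allI slice_borel) simp
  have "(LINT x|lebesgue_dim d. F (d, x)) = integral\<^sup>L (distr (lebesgue_dim d) lebesgue_all (Pair d)) F"
    by (rule integral_distr[OF measurable_Pair_lebesgue assms, symmetric])
  also have "\<dots> = (LINT p|lebesgue_all. indicator ({d} \<times> UNIV) p *\<^sub>R F p)"
    unfolding distr_Pair_lebesgue using assms D by (subst integral_density) auto
  also have "\<dots> = (LINT p|lebesgue_all. indicator ({d} \<times> UNIV) p * F p)"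
    by (intro Bochner_Integration.integral_cong) (auto simp: indicator_def)
  finally show ?thesis .
qed

lemma AE_lebesgue_slice_iff:
  assumes "Measurable.pred lebesgue_all Q"
  shows "(AE x in lebesgue_dim d. Q (d, x)) \<longleftrightarrow> (AE p in lebesgue_all. p \<in> {d} \<times> UNIV \<longrightarrow> Q p)"
proof -
  have D: "{d} \<times> UNIV \<in> sets lebesgue_all" by (intro sets_lebesgue_allI slice_borel) simp
  have "(AE x in lebesgue_dim d. Q (d, x)) \<longleftrightarrow> (AE p in distr (lebesgue_dim d) lebesgue_all (Pair d). Q p)"
    using assms by (subst AE_distr_iff[OF measurable_Pair_lebesgue]) (auto simp: pred_def)
  also have "\<dots> \<longleftrightarrow> (AE p in lebesgue_all. p \<in> {d} \<times> UNIV \<longrightarrow> Q p)"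
    unfolding distr_Pair_lebesgue using D by (subst AE_density) (auto simp: indicator_def)
  finally show ?thesis .
qed

lemma slice_lebesgue:
  assumes "\<omega> \<in> sets (lebesgue_dim d)"
  shows "{d} \<times> \<omega> \<in> sets lebesgue_all"
proof -
  obtain A N N' where A: "\<omega> = A \<union> N" "A \<in> sets (lborel_dim d)" "N \<subseteq> N'" "N' \<in> null_sets (lborel_dim d)"
    using assms unfolding lebesgue_dim_def by (rule sets_completionE)
  have N': "N' \<in> sets (lborel_dim d)" using A(4) by auto
  note b = sets_lborel_dim_borel[OF A(2)] sets_lborel_dim_borel[OF N']
  have "Pair d -` ({d} \<times> N') \<inter> space (lborel_dim d) = N'"
    using b(4) by (auto simp: space_lborel_dim Rn_def)
  then have "emeasure lborel_all ({d} \<times> N') = 0"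
    using emeasure_lborel_all_slice[OF slice_borel[OF b(3), of d], of d] A(4) by (auto simp: Times_Int_Times null_sets_def)
  then have "{d} \<times> N' \<in> null_sets lborel_all" using slice_borel[OF b(3)] by (simp add: null_setsI)
  then have "{d} \<times> N \<in> null_sets lebesgue_all"
    unfolding lebesgue_all_def
    by (rule null_sets_completion_subset[rotated, OF null_sets_completionI]) (use A(3) in auto)
  moreover have "{d} \<times> A \<in> sets lebesgue_all" by (intro sets_lebesgue_allI slice_borel b)
  moreover have "{d} \<times> \<omega> = {d} \<times> A \<union> {d} \<times> N" using A(1) by auto
  ultimately show ?thesis by (auto simp: null_sets_def)
qed

section \<open>Complex inner product and restriction to a measurable set\<close>

lemma cinner_abs_l2:
  "sq_int f \<Longrightarrow> sq_int g \<Longrightarrow> cinner (abs_l2 f) (abs_l2 g) = (LINT p|lebesgue_all. f p * cnj (g p))"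
  by (simp add: cinner.abs_eq l2_rel_refl)

lemma scaleC_abs_l2: "sq_int f \<Longrightarrow> c *\<^sub>C abs_l2 f = abs_l2 (\<lambda>p. c * f p)"
  by (simp add: scaleC.abs_eq l2_rel_refl)

lemma cinner_add_left: "cinner (u + v) w = cinner u w + cinner v w"
  by transfer (auto simp: l2_rel_def algebra_simps sq_int_mult_cnj)

lemma cinner_scaleC_left: "cinner (c *\<^sub>C u) w = c * cinner u w"
  by transfer (simp add: l2_rel_def mult.assoc sq_int_mult_cnj)

lemma cinner_commute: "cinner u v = cnj (cinner v u)"
  by transfer (simp flip: Bochner_Integration.integral_cnj add: mult.commute)

lemma cinner_add_right: "cinner w (u + v) = cinner w u + cinner w v"
  by (subst (1 2 3) cinner_commute) (simp add: cinner_add_left)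

lemma cinner_scaleC_right: "cinner w (c *\<^sub>C u) = cnj c * cinner w u"
  by (subst (1 2) cinner_commute) (simp add: cinner_scaleC_left)

lemma scaleR_eq_scaleC: "r *\<^sub>R u = complex_of_real r *\<^sub>C u"
  by transfer (auto simp: l2_rel_def sq_int_scaleC)

lemma cinner_scaleR: "cinner (r *\<^sub>R u) w = r * cinner u w" "cinner w (r *\<^sub>R u) = r * cinner w u"
  by (simp_all add: scaleR_eq_scaleC cinner_scaleC_left cinner_scaleC_right)

lemma cinner_minus: "cinner (- u) w = - cinner u w" "cinner w (- u) = - cinner w u"
  using cinner_scaleR(1)[of "-1" u w] cinner_scaleR(2)[of w "-1" u] by simp_all

lemma cinner_diff: "cinner (u - v) w = cinner u w - cinner v w" "cinner w (u - v) = cinner w u - cinner w v"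
  using cinner_add_left[of u "- v" w] cinner_add_right[of w u "- v"] by (simp_all add: cinner_minus)

lemma cinner_zero [simp]: "cinner 0 w = 0" "cinner w 0 = 0"
  using cinner_scaleR(1)[of 0 w w] cinner_scaleR(2)[of w 0 w] by simp_all

lemma cinner_sum: "cinner (\<Sum>i\<in>I. u i) w = (\<Sum>i\<in>I. cinner (u i) w)"
  "cinner w (\<Sum>i\<in>I. u i) = (\<Sum>i\<in>I. cinner w (u i))"
  by (induction I rule: infinite_finite_induct; simp add: cinner_add_left cinner_add_right)+

lemma l2_cases:
  obtains f where "sq_int f" "u = abs_l2 f"
  using sq_int_rep_l2 abs_rep_l2 by metis

lemma scaleC_simps:
  "c *\<^sub>C (u + v) = c *\<^sub>C u + c *\<^sub>C v" "(b + c) *\<^sub>C u = b *\<^sub>C u + c *\<^sub>C u"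
  "b *\<^sub>C c *\<^sub>C u = (b * c) *\<^sub>C u" "1 *\<^sub>C u = u"
  by (cases u rule: l2_cases; cases v rule: l2_cases;
      simp add: scaleC_abs_l2 abs_l2_add sq_int_scaleC sq_int_add distrib_left distrib_right mult.assoc)+

lemma scaleC_scaleR: "b *\<^sub>C r *\<^sub>R u = r *\<^sub>R b *\<^sub>C u"
  by (simp add: scaleR_eq_scaleC scaleC_simps mult.commute)

lemma inner_eq_Re_cinner: "inner u v = Re (cinner u v)" for u v :: l2
  by (rule inner_l2_def)

lemma cinner_self: "cinner u u = complex_of_real ((norm u)\<^sup>2)"
proof -
  have "Im (cinner u u) = 0" using arg_cong[OF cinner_commute[of u u], of Im] by simp
  then show ?thesis by (simp add: complex_eq_iff power2_norm_eq_inner inner_eq_Re_cinner)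
qed

text \<open>Reduces complex limits and orthogonality to real ones, by testing with v and i
  v.\<close>

lemma cinner_eq_inner: "cinner u v = Complex (inner u v) (inner u (\<i> *\<^sub>C v))"
  by (simp add: complex_eq_iff inner_eq_Re_cinner cinner_scaleC_right)

lemma norm_scaleC: "norm (c *\<^sub>C u) = cmod c * norm u"
proof -
  have "complex_of_real ((norm (c *\<^sub>C u))\<^sup>2) = (c * cnj c) * cinner u u"
    unfolding cinner_self[symmetric] cinner_scaleC_left cinner_scaleC_right by simp
  also have "\<dots> = complex_of_real ((cmod c * norm u)\<^sup>2)"
    unfolding cinner_self complex_norm_square[symmetric] by (simp add: power_mult_distrib)
  finally have "(norm (c *\<^sub>C u))\<^sup>2 = (cmod c * norm u)\<^sup>2"
    unfolding of_real_eq_iff .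
  then show ?thesis by (simp add: power2_eq_iff_nonneg)
qed

lemma bounded_linear_scaleC: "bounded_linear (\<lambda>u. c *\<^sub>C u)"
  by (rule bounded_linear_intro[where K = "cmod c"]) (simp_all add: scaleC_simps scaleC_scaleR norm_scaleC)

lemma tendsto_cinner:
  assumes "(f \<longlongrightarrow> u) F" "(g \<longlongrightarrow> v) F"
  shows "((\<lambda>x. cinner (f x) (g x)) \<longlongrightarrow> cinner u v) F"
proof -
  have "((\<lambda>x. Complex (inner (f x) (g x)) (inner (f x) (\<i> *\<^sub>C g x))) \<longlongrightarrow> Complex (inner u v) (inner u (\<i> *\<^sub>C v))) F"
    by (intro tendsto_Complex tendsto_inner assms bounded_linear.tendsto[OF bounded_linear_scaleC])
  then show ?thesis by (simp add: cinner_eq_inner)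
qed

lemma rep_abs_l2: "sq_int f \<Longrightarrow> AE p in lebesgue_all. rep_l2 (abs_l2 f) p = f p"
  using rep_abs_rsp[OF Quotient3_l2, of f f] by (auto simp: l2_rel_def elim: eventually_mono)

lemma abs_l2_eq_iff: "sq_int f \<Longrightarrow> sq_int g \<Longrightarrow> abs_l2 f = abs_l2 g \<longleftrightarrow> (AE p in lebesgue_all. f p = g p)"
  using Quotient3_rel[OF Quotient3_l2, of f g] by (simp add: l2_rel_def)

lemma l2_on_abs_l2:
  assumes "sq_int f"
  shows "abs_l2 f \<in> l2_on d \<Omega> \<longleftrightarrow> (AE p in lebesgue_all. p \<notin> {d} \<times> \<Omega> \<longrightarrow> f p = 0)"
  unfolding l2_on_def using rep_abs_l2[OF assms] by (auto elim: eventually_elim2)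

lemma sq_int_indicator_mult:
  assumes "A \<in> sets lebesgue_all" "sq_int f"
  shows "sq_int (\<lambda>p. indicator A p * f p)"
proof (rule sq_int_bound)
  show "integrable lebesgue_all (\<lambda>p. (cmod (f p))\<^sup>2)" using assms by (simp add: sq_int_def)
  show "(\<lambda>p. indicator A p * f p) \<in> borel_measurable lebesgue_all"
    using assms by (auto dest: sq_int_measurable)
qed (auto simp: indicator_def)

lemma restrict_abs_l2:
  assumes "\<omega> \<in> sets (lebesgue_dim d)" "sq_int f"
  shows "restrict_l2 d \<omega> (abs_l2 f) = abs_l2 (\<lambda>p. indicator ({d} \<times> \<omega>) p * f p)"
  unfolding restrict_l2_def
  by (rule abs_l2_cong_AE)
    (use rep_abs_l2[OF assms(2)] slice_lebesgue[OF assms(1)] assms(2) in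
      \<open>auto intro!: sq_int_indicator_mult sq_int_rep_l2 dest: sq_int_measurable elim: eventually_mono\<close>)

context
  fixes d \<omega> assumes \<omega>: "\<omega> \<in> sets (lebesgue_dim d)"
begin

lemma restrict_l2_add: "restrict_l2 d \<omega> (u + v) = restrict_l2 d \<omega> u + restrict_l2 d \<omega> v"
  by (cases u rule: l2_cases, cases v rule: l2_cases)
    (simp add: restrict_abs_l2 \<omega> abs_l2_add sq_int_add sq_int_indicator_mult slice_lebesgue distrib_left)

lemma restrict_l2_scaleC: "restrict_l2 d \<omega> (c *\<^sub>C u) = c *\<^sub>C restrict_l2 d \<omega> u"
  by (cases u rule: l2_cases)
    (simp add: restrict_abs_l2 \<omega> scaleC_abs_l2 sq_int_scaleC sq_int_indicator_mult slice_lebesgue mult.left_commute[of _ c])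

lemma restrict_l2_scaleR: "restrict_l2 d \<omega> (r *\<^sub>R u) = r *\<^sub>R restrict_l2 d \<omega> u"
  by (simp add: scaleR_eq_scaleC restrict_l2_scaleC)

lemma cinner_restrict_l2: "cinner (restrict_l2 d \<omega> u) v = cinner u (restrict_l2 d \<omega> v)"
  by (cases u rule: l2_cases, cases v rule: l2_cases)
    (simp add: restrict_abs_l2 \<omega> cinner_abs_l2 sq_int_indicator_mult slice_lebesgue,
      rule Bochner_Integration.integral_cong, auto split: split_indicator)

lemma restrict_l2_in: "restrict_l2 d \<omega> u \<in> l2_on d \<omega>"
  by (cases u rule: l2_cases)
    (simp add: restrict_abs_l2 \<omega> l2_on_abs_l2 sq_int_indicator_mult slice_lebesgue)

lemma restrict_l2_id: "u \<in> l2_on d \<omega> \<Longrightarrow> restrict_l2 d \<omega> u = u"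
proof (cases u rule: l2_cases)
  case (1 f)
  assume "u \<in> l2_on d \<omega>"
  then have "AE p in lebesgue_all. p \<notin> {d} \<times> \<omega> \<longrightarrow> f p = 0" using 1 by (simp add: l2_on_abs_l2)
  then have "AE p in lebesgue_all. indicator ({d} \<times> \<omega>) p * f p = f p"
    by eventually_elim (auto simp: indicator_def)
  then show ?thesis
    using 1 by (simp add: restrict_abs_l2 \<omega> abs_l2_eq_iff sq_int_indicator_mult slice_lebesgue)
qed

lemma restrict_l2_idem: "restrict_l2 d \<omega> (restrict_l2 d \<omega> u) = restrict_l2 d \<omega> u"
  by (rule restrict_l2_id[OF restrict_l2_in])

lemma norm_restrict_l2: "norm (restrict_l2 d \<omega> u) \<le> norm u"
proof -
  have "(norm (restrict_l2 d \<omega> u))\<^sup>2 = inner u (restrict_l2 d \<omega> u)"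
    by (simp add: power2_norm_eq_inner inner_eq_Re_cinner cinner_restrict_l2 restrict_l2_idem)
  also have "\<dots> \<le> norm u * norm (restrict_l2 d \<omega> u)" by (rule norm_cauchy_schwarz)
  finally show ?thesis
    by (cases "norm (restrict_l2 d \<omega> u) = 0") (auto simp: power2_eq_square)
qed

lemma bounded_linear_restrict_l2: "bounded_linear (restrict_l2 d \<omega>)"
  by (rule bounded_linear_intro[where K = 1])
    (simp_all add: restrict_l2_add restrict_l2_scaleR norm_restrict_l2)

lemma projected_space_restrict_l2: "projected_space (l2_on d \<omega>) (restrict_l2 d \<omega>)"
  by (intro projected_space.intro bounded_linear_restrict_l2 restrict_l2_in restrict_l2_id)

end

lemma restrict_restrict_l2:
  assumes "\<omega> \<in> sets (lebesgue_dim d)" "\<omega>' \<in> sets (lebesgue_dim d)"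
  shows "restrict_l2 d \<omega> (restrict_l2 d \<omega>' u) = restrict_l2 d (\<omega> \<inter> \<omega>') u"
  by (cases u rule: l2_cases)
    (auto simp: restrict_abs_l2 assms sets.Int sq_int_indicator_mult slice_lebesgue
      intro!: arg_cong[of _ _ abs_l2] split: split_indicator)

lemma l2_on_mono: "\<Omega> \<subseteq> \<Omega>' \<Longrightarrow> l2_on d \<Omega> \<subseteq> l2_on d \<Omega>'"
  unfolding l2_on_def by (auto elim!: eventually_mono)

lemma l2_on_scaleC: "u \<in> l2_on d \<Omega> \<Longrightarrow> c *\<^sub>C u \<in> l2_on d \<Omega>"
  by (cases u rule: l2_cases) (auto simp: l2_on_abs_l2 scaleC_abs_l2 sq_int_scaleC elim!: eventually_mono)

lemma l2_on_add: "u \<in> l2_on d \<Omega> \<Longrightarrow> v \<in> l2_on d \<Omega> \<Longrightarrow> u + v \<in> l2_on d \<Omega>"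
  by (cases u rule: l2_cases, cases v rule: l2_cases)
    (auto simp: l2_on_abs_l2 abs_l2_add sq_int_add elim!: eventually_elim2)

lemma l2_on_scaleR: "u \<in> l2_on d \<Omega> \<Longrightarrow> c *\<^sub>R u \<in> l2_on d \<Omega>"
  by (simp add: scaleR_eq_scaleC l2_on_scaleC)

lemma l2_on_diff: "u \<in> l2_on d \<Omega> \<Longrightarrow> v \<in> l2_on d \<Omega> \<Longrightarrow> u - v \<in> l2_on d \<Omega>"
  using l2_on_add[of u d \<Omega> "(-1) *\<^sub>R v"] l2_on_scaleR[of v d \<Omega> "-1"] by simp

text \<open>Required by \<open>endo\<close>, and one unit vector suffices: R^0 is a single point of
  mass 1, so the indicator of its slice has norm 1.\<close>

instance l2 :: perfect_space
proof
  fix x :: l2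
  define D where "D = ({0} \<times> UNIV :: (nat \<times> (nat \<Rightarrow> real)) set)"
  have D: "D \<in> sets borel" unfolding D_def by (intro slice_borel) simp
  interpret product_sigma_finite "\<lambda>_::nat. lborel :: real measure" by standard
  have "emeasure lborel_all D = 1"
    using emeasure_lborel_all_slice[OF D, of 0]
    by (simp add: D_def lborel_dim_def space_PiM vimage_def emeasure_PiM_empty[unfolded PiE_empty_domain])
  then have em: "emeasure lebesgue_all D = 1" using D by (simp add: emeasure_lebesgue_all)
  define v where "v = abs_l2 (\<lambda>p. 1 * indicator D p)"
  have sq: "sq_int (\<lambda>p. 1 * indicator D p)"
    by (intro sq_int_indicator sets_lebesgue_allI D) (simp add: em)
  have "(norm v)\<^sup>2 = (LINT p|lebesgue_all. indicator D p)"
    unfolding v_def norm_abs_l2[OF sq] by (intro Bochner_Integration.integral_cong) (auto simp: indicator_def)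
  also have "\<dots> = 1" using em sets_lebesgue_allI[OF D] by (simp add: measure_def)
  finally have v: "norm v = 1" by (simp add: power2_eq_1_iff) (smt (verit) norm_ge_zero)
  show "\<not> open {x}"
  proof
    assume "open {x}"
    then obtain e where e: "e > 0" "\<And>y. dist y x < e \<Longrightarrow> y = x" unfolding open_dist by blast
    have "dist (x + (e / 2) *\<^sub>R v) x < e" using e(1) v by (simp add: dist_norm)
    then have "(e / 2) *\<^sub>R v = 0" using e(2) by fastforce
    then show False using e(1) v by simp
  qed
qed

section \<open>Smooth functions and test functions\<close>

lemma Rn_upd: "x \<in> Rn d \<Longrightarrow> i < d \<Longrightarrow> x(i := t) \<in> Rn d"
  by (auto simp: Rn_def PiE_iff extensional_def)

lemma partial_deriv_cong:
  assumes "\<And>y. y \<in> Rn d \<Longrightarrow> f y = g y" "i < d" "x \<in> Rn d"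
  shows "partial_deriv i f x = partial_deriv i g x"
  unfolding partial_deriv_def using assms by (simp add: Rn_upd)

lemma partial_derivI:
  "((\<lambda>t. f (x(i := t))) has_vector_derivative f') (at (x i)) \<Longrightarrow> partial_deriv i f x = f'"
  unfolding partial_deriv_def by (rule vector_derivative_at)

text \<open>\<open>smooth\<close> quantifies over iterated partial derivatives. A family of
  continuous functions that is closed under partial derivatives, compared on \<open>Rn d\<close>
  only, is invariant under this iteration. The closure properties of smooth functions below each
  come from a suitable family.\<close>

lemma smooth_coinduct:
  assumes \<phi>: "\<phi> \<in> F"
    and cont: "\<And>f. f \<in> F \<Longrightarrow> continuous_on (Rn d) f"
    and diff: "\<And>f i. f \<in> F \<Longrightarrow> i < d \<Longrightarrow> \<exists>g\<in>F. \<forall>x\<in>Rn d. ((\<lambda>t. f (x(i := t))) has_vector_derivative g x) (at (x i))"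
  shows "smooth d \<phi>"
proof -
  have step: "\<exists>g\<in>F. \<forall>x\<in>Rn d. fold partial_deriv js \<phi> x = g x" if "js \<in> lists {..<d}" for js
    using that
  proof (induction js rule: rev_induct)
    case Nil
    then show ?case using \<phi> by auto
  next
    case (snoc i js)
    then have i: "i < d" and "js \<in> lists {..<d}" by auto
    then obtain g where g: "g \<in> F" "\<And>x. x \<in> Rn d \<Longrightarrow> fold partial_deriv js \<phi> x = g x"
      using snoc.IH by blast
    obtain h where h: "h \<in> F" "\<And>x. x \<in> Rn d \<Longrightarrow> ((\<lambda>t. g (x(i := t))) has_vector_derivative h x) (at (x i))"
      using diff[OF g(1) i] by blast
    have "fold partial_deriv (js @ [i]) \<phi> x = h x" if x: "x \<in> Rn d" for x
      using partial_deriv_cong[OF g(2) i x] partial_derivI[OF h(2)[OF x]] by simp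
    then show ?case using h(1) by blast
  qed
  show ?thesis
    unfolding smooth_def
  proof (intro ballI conjI allI impI)
    fix js assume "js \<in> lists {..<d}"
    then obtain g where g: "g \<in> F" "\<And>x. x \<in> Rn d \<Longrightarrow> fold partial_deriv js \<phi> x = g x"
      using step by blast
    show "continuous_on (Rn d) (fold partial_deriv js \<phi>)"
      using cont[OF g(1)] g(2) by (simp cong: continuous_on_cong)
    fix i x assume i: "i < d" and x: "x \<in> Rn d"
    have "(\<lambda>t. g (x(i := t))) differentiable (at (x i))"
      using diff[OF g(1) i] x by (metis differentiableI_vector)
    then show "(\<lambda>t. fold partial_deriv js \<phi> (x(i := t))) differentiable (at (x i))"
      using g(2) i x by (simp add: Rn_upd)
  qed
qed

lemma smooth_continuous: "smooth d \<phi> \<Longrightarrow> continuous_on (Rn d) \<phi>"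
  unfolding smooth_def by (drule bspec[of _ _ "[]"]) auto

lemma smooth_partial_deriv: "smooth d \<phi> \<Longrightarrow> i < d \<Longrightarrow> smooth d (partial_deriv i \<phi>)"
  unfolding smooth_def
proof
  fix js assume *: "\<forall>js\<in>lists {..<d}. continuous_on (Rn d) (fold partial_deriv js \<phi>) \<and>
     (\<forall>i<d. \<forall>x\<in>Rn d. (\<lambda>t. fold partial_deriv js \<phi> (x(i := t))) differentiable (at (x i)))"
    and i: "i < d" and js: "js \<in> lists {..<d}"
  show "continuous_on (Rn d) (fold partial_deriv js (partial_deriv i \<phi>)) \<and>
     (\<forall>k<d. \<forall>x\<in>Rn d. (\<lambda>t. fold partial_deriv js (partial_deriv i \<phi>) (x(k := t))) differentiable (at (x k)))"
    using bspec[OF *, of "i # js"] i js by simp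
qed

lemma smooth_has_partial:
  assumes "smooth d \<phi>" "i < d" "x \<in> Rn d"
  shows "((\<lambda>t. \<phi> (x(i := t))) has_vector_derivative partial_deriv i \<phi> x) (at (x i))"
proof -
  have "(\<lambda>t. \<phi> (x(i := t))) differentiable (at (x i))"
    using assms unfolding smooth_def by (auto dest: bspec[of _ _ "[]"])
  then show ?thesis unfolding partial_deriv_def by (simp add: vector_derivative_works)
qed

lemma smooth_has_partial_at:
  assumes "smooth d \<phi>" "i < d" "x \<in> Rn d"
  shows "((\<lambda>t. \<phi> (x(i := t))) has_vector_derivative partial_deriv i \<phi> (x(i := t))) (at t)"
  using smooth_has_partial[OF assms(1,2) Rn_upd[OF assms(3,2), of t]] by simp

lemma smooth_add:
  assumes "smooth d f" "smooth d g"
  shows "smooth d (\<lambda>x. f x + g x)"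
proof (rule smooth_coinduct[where F = "{h. \<exists>f g. smooth d f \<and> smooth d g \<and> h = (\<lambda>x. f x + g x)}"])
  show "(\<lambda>x. f x + g x) \<in> {h. \<exists>f g. smooth d f \<and> smooth d g \<and> h = (\<lambda>x. f x + g x)}"
    using assms by blast
  fix h assume "h \<in> {h. \<exists>f g. smooth d f \<and> smooth d g \<and> h = (\<lambda>x. f x + g x)}"
  then obtain f g where f: "smooth d f" "smooth d g" "h = (\<lambda>x. f x + g x)" by blast
  show "continuous_on (Rn d) h" unfolding f(3) by (intro continuous_on_add smooth_continuous f)
  fix i assume i: "i < d"
  show "\<exists>k\<in>{h. \<exists>f g. smooth d f \<and> smooth d g \<and> h = (\<lambda>x. f x + g x)}.
      \<forall>x\<in>Rn d. ((\<lambda>t. h (x(i := t))) has_vector_derivative k x) (at (x i))"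
  proof (intro bexI[of _ "\<lambda>x. partial_deriv i f x + partial_deriv i g x"] ballI)
    show "((\<lambda>t. h (x(i := t))) has_vector_derivative partial_deriv i f x + partial_deriv i g x) (at (x i))"
      if "x \<in> Rn d" for x
      unfolding f(3) by (intro has_vector_derivative_add smooth_has_partial[OF f(1) i that] smooth_has_partial[OF f(2) i that])
  qed (use smooth_partial_deriv[OF f(1) i] smooth_partial_deriv[OF f(2) i] in blast)
qed

lemma smooth_cmult:
  assumes "smooth d f"
  shows "smooth d (\<lambda>x. c * f x)"
proof (rule smooth_coinduct[where F = "{h. \<exists>f. smooth d f \<and> h = (\<lambda>x. c * f x)}"])
  show "(\<lambda>x. c * f x) \<in> {h. \<exists>f. smooth d f \<and> h = (\<lambda>x. c * f x)}" using assms by blast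
  fix h assume "h \<in> {h. \<exists>f. smooth d f \<and> h = (\<lambda>x. c * f x)}"
  then obtain f where f: "smooth d f" "h = (\<lambda>x. c * f x)" by blast
  show "continuous_on (Rn d) h" unfolding f(2) by (intro continuous_on_mult_left smooth_continuous f)
  fix i assume i: "i < d"
  show "\<exists>k\<in>{h. \<exists>f. smooth d f \<and> h = (\<lambda>x. c * f x)}. \<forall>x\<in>Rn d. ((\<lambda>t. h (x(i := t))) has_vector_derivative k x) (at (x i))"
  proof (intro bexI[of _ "\<lambda>x. c * partial_deriv i f x"] ballI)
    show "((\<lambda>t. h (x(i := t))) has_vector_derivative c * partial_deriv i f x) (at (x i))" if "x \<in> Rn d" for x
      unfolding f(2) by (intro bounded_linear.has_vector_derivative[OF bounded_linear_mult_right] smooth_has_partial[OF f(1) i that])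
  qed (use smooth_partial_deriv[OF f(1) i] in blast)
qed

lemma smooth_cnj:
  assumes "smooth d f"
  shows "smooth d (\<lambda>x. cnj (f x))"
proof (rule smooth_coinduct[where F = "{h. \<exists>f. smooth d f \<and> h = (\<lambda>x. cnj (f x))}"])
  show "(\<lambda>x. cnj (f x)) \<in> {h. \<exists>f. smooth d f \<and> h = (\<lambda>x. cnj (f x))}" using assms by blast
  fix h assume "h \<in> {h. \<exists>f. smooth d f \<and> h = (\<lambda>x. cnj (f x))}"
  then obtain f where f: "smooth d f" "h = (\<lambda>x. cnj (f x))" by blast
  show "continuous_on (Rn d) h" unfolding f(2) by (intro continuous_on_cnj smooth_continuous f)
  fix i assume i: "i < d"
  show "\<exists>k\<in>{h. \<exists>f. smooth d f \<and> h = (\<lambda>x. cnj (f x))}. \<forall>x\<in>Rn d. ((\<lambda>t. h (x(i := t))) has_vector_derivative k x) (at (x i))"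
  proof (intro bexI[of _ "\<lambda>x. cnj (partial_deriv i f x)"] ballI)
    show "((\<lambda>t. h (x(i := t))) has_vector_derivative cnj (partial_deriv i f x)) (at (x i))" if "x \<in> Rn d" for x
      unfolding f(2) by (intro bounded_linear.has_vector_derivative[OF bounded_linear_cnj] smooth_has_partial[OF f(1) i that])
  qed (use smooth_partial_deriv[OF f(1) i] in blast)
qed

text \<open>The Leibniz rule leads from products to sums of products; these form the family that
  proves \<open>smooth_mult\<close>.\<close>

inductive_set product_sums :: "nat \<Rightarrow> ((nat \<Rightarrow> real) \<Rightarrow> complex) set" for d where
  "smooth d f \<Longrightarrow> smooth d g \<Longrightarrow> (\<lambda>x. f x * g x) \<in> product_sums d"
| "f \<in> product_sums d \<Longrightarrow> g \<in> product_sums d \<Longrightarrow> (\<lambda>x. f x + g x) \<in> product_sums d"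

lemma smooth_mult:
  assumes "smooth d f" "smooth d g"
  shows "smooth d (\<lambda>x. f x * g x)"
proof (rule smooth_coinduct[where F = "product_sums d"])
  show "continuous_on (Rn d) f" if "f \<in> product_sums d" for f
    using that by induction (auto intro: continuous_on_mult continuous_on_add smooth_continuous)
  fix h i assume "h \<in> product_sums d" and i: "i < d"
  then show "\<exists>g\<in>product_sums d. \<forall>x\<in>Rn d. ((\<lambda>t. h (x(i := t))) has_vector_derivative g x) (at (x i))"
  proof induction
    case (1 f g)
    have "((\<lambda>t. f (x(i := t)) * g (x(i := t))) has_vector_derivative
        (f x * partial_deriv i g x + partial_deriv i f x * g x)) (at (x i))" if "x \<in> Rn d" for x
      using has_vector_derivative_mult[OF smooth_has_partial[OF 1(1) i that] smooth_has_partial[OF 1(2) i that]] by simp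
    moreover have "(\<lambda>x. f x * partial_deriv i g x + partial_deriv i f x * g x) \<in> product_sums d"
      by (intro product_sums.intros 1 smooth_partial_deriv i)
    ultimately show ?case by (intro bexI ballI)
  next
    case (2 f g)
    obtain f' where f': "f' \<in> product_sums d"
      "\<And>x. x \<in> Rn d \<Longrightarrow> ((\<lambda>t. f (x(i := t))) has_vector_derivative f' x) (at (x i))" using 2(3)[OF i] by blast
    obtain g' where g': "g' \<in> product_sums d"
      "\<And>x. x \<in> Rn d \<Longrightarrow> ((\<lambda>t. g (x(i := t))) has_vector_derivative g' x) (at (x i))" using 2(4)[OF i] by blast
    show ?case
    proof (intro bexI[of _ "\<lambda>x. f' x + g' x"] ballI)
      show "((\<lambda>t. f (x(i := t)) + g (x(i := t))) has_vector_derivative f' x + g' x) (at (x i))" if "x \<in> Rn d" for x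
        by (rule has_vector_derivative_add[OF f'(2)[OF that] g'(2)[OF that]])
    qed (rule product_sums.intros(2)[OF f'(1) g'(1)])
  qed
qed (intro product_sums.intros assms)

lemma partial_deriv_add:
  "smooth d f \<Longrightarrow> smooth d g \<Longrightarrow> i < d \<Longrightarrow> x \<in> Rn d \<Longrightarrow>
    partial_deriv i (\<lambda>x. f x + g x) x = partial_deriv i f x + partial_deriv i g x"
  by (intro partial_derivI has_vector_derivative_add smooth_has_partial)

lemma partial_deriv_mult:
  "smooth d f \<Longrightarrow> smooth d g \<Longrightarrow> i < d \<Longrightarrow> x \<in> Rn d \<Longrightarrow>
    partial_deriv i (\<lambda>x. f x * g x) x = f x * partial_deriv i g x + partial_deriv i f x * g x"
  using has_vector_derivative_mult[OF smooth_has_partial[of d f i x] smooth_has_partial[of d g i x]]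
  by (intro partial_derivI) simp

lemma partial_deriv_cmult:
  "smooth d f \<Longrightarrow> i < d \<Longrightarrow> x \<in> Rn d \<Longrightarrow> partial_deriv i (\<lambda>x. c * f x) x = c * partial_deriv i f x"
  by (intro partial_derivI bounded_linear.has_vector_derivative[OF bounded_linear_mult_right] smooth_has_partial)

lemma partial_deriv_cnj:
  "smooth d f \<Longrightarrow> i < d \<Longrightarrow> x \<in> Rn d \<Longrightarrow> partial_deriv i (\<lambda>x. cnj (f x)) x = cnj (partial_deriv i f x)"
  by (intro partial_derivI bounded_linear.has_vector_derivative[OF bounded_linear_cnj] smooth_has_partial)

section \<open>Smooth building blocks of one variable\<close>

definition smooth_real :: "(real \<Rightarrow> real) \<Rightarrow> bool" where
  "smooth_real h \<longleftrightarrow> (\<exists>D. D 0 = h \<and> (\<forall>n x. (D n has_real_derivative D (Suc n) x) (at x)))"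

lemma smooth_real_affine:
  assumes "smooth_real h"
  shows "smooth_real (\<lambda>x. h (a * x + b))"
proof -
  obtain D where D: "D 0 = h" "\<And>n x. (D n has_real_derivative D (Suc n) x) (at x)"
    using assms unfolding smooth_real_def by blast
  have "((\<lambda>x. a ^ n * D n (a * x + b)) has_real_derivative a ^ Suc n * D (Suc n) (a * x + b)) (at x)" for n x
    by (auto intro!: derivative_eq_intros DERIV_chain2[OF D(2)])
  then show ?thesis
    unfolding smooth_real_def using D(1) by (intro exI[of _ "\<lambda>n x. a ^ n * D n (a * x + b)"]) auto
qed

lemma continuous_on_coordinate: "continuous_on A (\<lambda>x :: nat \<Rightarrow> real. x i)"
  by (rule continuous_on_subset[OF continuous_on_product_coordinates]) simp

lemma smooth_tensor:
  assumes "\<And>i. i < d \<Longrightarrow> smooth_real (h i)"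
  shows "smooth d (\<lambda>x. complex_of_real (\<Prod>i<d. h i (x i)))"
proof -
  obtain D where D: "\<And>i. i < d \<Longrightarrow> D i 0 = h i"
    "\<And>i n x. i < d \<Longrightarrow> (D i n has_real_derivative D i (Suc n) x) (at x)"
    using assms unfolding smooth_real_def by metis
  have contD: "continuous_on UNIV (D i n)" if "i < d" for i n
    by (rule DERIV_continuous_on[OF has_field_derivative_at_within[OF D(2)[OF that]]])
  \<comment> \<open>The multi-index m counts the derivatives taken in each variable.\<close>
  define F where "F = range (\<lambda>(m :: nat \<Rightarrow> nat) (x :: nat \<Rightarrow> real). complex_of_real (\<Prod>i<d. D i (m i) (x i)))"
  show ?thesis
  proof (rule smooth_coinduct[where F = F])
    show "(\<lambda>x. complex_of_real (\<Prod>i<d. h i (x i))) \<in> F"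
      unfolding F_def using D(1) by (intro image_eqI[of _ _ "\<lambda>_. 0"]) auto
    show "continuous_on (Rn d) f" if "f \<in> F" for f
      using that unfolding F_def
      by (auto intro!: continuous_on_of_real continuous_on_prod continuous_on_compose2[OF contD]
          continuous_on_coordinate)
    fix f i assume "f \<in> F" and i: "i < d"
    then obtain m where f: "f = (\<lambda>x. complex_of_real (\<Prod>i<d. D i (m i) (x i)))" unfolding F_def by auto
    define g where "g = (\<lambda>x. complex_of_real (\<Prod>k<d. D k ((m(i := Suc (m i))) k) (x k)))"
    have split: "(\<Prod>k<d. D k (n k) (y k)) = D i (n i) (y i) * (\<Prod>k\<in>{..<d} - {i}. D k (n k) (y k))" for n :: "nat \<Rightarrow> nat" and y
      using i by (subst prod.remove[of _ i]) auto
    have "((\<lambda>t. f (x(i := t))) has_vector_derivative g x) (at (x i))" for x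
    proof -
      have "((\<lambda>t. D i (m i) t * (\<Prod>k\<in>{..<d} - {i}. D k (m k) (x k))) has_real_derivative
          D i (Suc (m i)) (x i) * (\<Prod>k\<in>{..<d} - {i}. D k (m k) (x k))) (at (x i))"
        by (rule DERIV_cmult_right[OF D(2)[OF i]])
      moreover have "f (x(i := t)) = complex_of_real (D i (m i) t * (\<Prod>k\<in>{..<d} - {i}. D k (m k) (x k)))" for t
        unfolding f split by (auto intro!: prod.cong)
      moreover have "g x = complex_of_real (D i (Suc (m i)) (x i) * (\<Prod>k\<in>{..<d} - {i}. D k (m k) (x k)))"
        unfolding g_def split by (auto intro!: prod.cong)
      ultimately show ?thesis
        by (simp only: has_vector_derivative_of_real has_real_derivative_iff_has_vector_derivative)
    qed
    moreover have "g \<in> F" unfolding g_def F_def by (rule rangeI)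
    ultimately show "\<exists>g\<in>F. \<forall>x\<in>Rn d. ((\<lambda>t. f (x(i := t))) has_vector_derivative g x) (at (x i))"
      by (intro bexI[of _ g] ballI)
  qed
qed

lemma ridge_derivative:
  fixes d :: nat
  assumes "(h has_real_derivative h') (at ((\<Sum>i<d. \<nu> i * x i) + c))" "i < d"
  shows "((\<lambda>t. complex_of_real (h ((\<Sum>k<d. \<nu> k * (x(i := t)) k) + c))) has_vector_derivative complex_of_real (h' * \<nu> i)) (at (x i))"
proof -
  have eq: "(\<Sum>k<d. \<nu> k * (x(i := t)) k) = \<nu> i * t + (\<Sum>k\<in>{..<d} - {i}. \<nu> k * x k)" for t
    using assms(2) by (subst sum.remove[of _ i]) (auto intro!: sum.cong)
  have "((\<lambda>t. h (\<nu> i * t + (\<Sum>k\<in>{..<d} - {i}. \<nu> k * x k) + c)) has_real_derivative h' * \<nu> i) (at (x i))"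
    by (rule DERIV_chain2[where f = h]) (use assms(1) eq[of "x i"] in \<open>auto intro!: derivative_eq_intros\<close>)
  then show ?thesis
    unfolding eq by (simp only: has_vector_derivative_of_real has_real_derivative_iff_has_vector_derivative)
qed

lemma smooth_ridge:
  assumes "smooth_real h"
  shows "smooth d (\<lambda>x. complex_of_real (h ((\<Sum>i<d. \<nu> i * x i) + c)))"
proof -
  obtain D where D: "D 0 = h" "\<And>n x. (D n has_real_derivative D (Suc n) x) (at x)"
    using assms unfolding smooth_real_def by blast
  have contD: "continuous_on UNIV (D n)" for n
    by (rule DERIV_continuous_on[OF has_field_derivative_at_within[OF D(2)]])
  define F where "F = (\<lambda>(k, n) (x :: nat \<Rightarrow> real). complex_of_real k * complex_of_real (D n ((\<Sum>i<d. \<nu> i * x i) + c))) ` UNIV"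
  show ?thesis
  proof (rule smooth_coinduct[where F = F])
    show "(\<lambda>x. complex_of_real (h ((\<Sum>i<d. \<nu> i * x i) + c))) \<in> F"
      unfolding F_def using D(1) by (intro image_eqI[of _ _ "(1, 0)"]) auto
    show "continuous_on (Rn d) f" if "f \<in> F" for f
      using that unfolding F_def
      by (auto intro!: continuous_intros continuous_on_compose2[OF contD] continuous_on_coordinate)
    fix f i assume "f \<in> F" and i: "i < d"
    then obtain k n where f: "f = (\<lambda>x. complex_of_real k * complex_of_real (D n ((\<Sum>i<d. \<nu> i * x i) + c)))" unfolding F_def by auto
    define g where "g = (\<lambda>x. complex_of_real (k * \<nu> i) * complex_of_real (D (Suc n) ((\<Sum>i<d. \<nu> i * x i) + c)))"
    have "((\<lambda>t. f (x(i := t))) has_vector_derivative g x) (at (x i))" for x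
      using bounded_linear.has_vector_derivative[OF bounded_linear_mult_right ridge_derivative[where \<nu> = \<nu> and x = x and c = c, OF D(2) i], of "complex_of_real k" n]
      unfolding f g_def by (simp add: mult_ac)
    moreover have "g \<in> F" unfolding g_def F_def by (rule image_eqI[of _ _ "(k * \<nu> i, Suc n)"]) auto
    ultimately show "\<exists>g\<in>F. \<forall>x\<in>Rn d. ((\<lambda>t. f (x(i := t))) has_vector_derivative g x) (at (x i))"
      by (intro bexI[of _ g] ballI)
  qed
qed

definition exp_bump :: "real \<Rightarrow> real" where
  "exp_bump x = (if x \<le> 0 then 0 else exp (- (1 / x)))"

lemma poly_exp_tendsto_0: "((\<lambda>y. poly p y * exp (- y)) \<longlongrightarrow> (0::real)) at_top"
proof -
  have "((\<lambda>y. \<Sum>i\<le>degree p. coeff p i * (y ^ i / exp y)) \<longlongrightarrow> (\<Sum>i\<le>degree p. coeff p i * 0)) at_top"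
    by (intro tendsto_sum tendsto_mult tendsto_const tendsto_power_div_exp_0)
  then show ?thesis
    by (simp add: poly_altdef sum_distrib_right exp_minus divide_inverse mult.assoc)
qed

lemma smooth_real_exp_bump: "smooth_real exp_bump"
proof -
  define G :: "real poly \<Rightarrow> real \<Rightarrow> real"
    where "G p x = (if x \<le> 0 then 0 else poly p (1 / x) * exp (- (1 / x)))" for p x
  \<comment> \<open>In the variable y = 1 / x the derivative of p(y) exp(-y) with respect to x is
    y^2 (p - p')(y) exp(-y); N gives the new polynomial factor.\<close>
  define N where "N p = [:0, 0, 1:] * (p - pderiv p)" for p :: "real poly"
  have inv_top: "filterlim (\<lambda>x::real. 1 / x) at_top (at_right 0)"
    using filterlim_inverse_at_top_right by (simp add: inverse_eq_divide)
  have der: "(G p has_real_derivative G (N p) x) (at x)" for p x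
  proof (cases x "0::real" rule: linorder_cases)
    case less
    have "((\<lambda>_. 0) has_real_derivative G (N p) x) (at x)" using less by (auto simp: G_def)
    then show ?thesis
      by (rule has_field_derivative_transform_within_open[of _ _ _ "{..<0}"]) (use less in \<open>auto simp: G_def\<close>)
  next
    case greater
    have "((\<lambda>x. poly p (1 / x) * exp (- (1 / x))) has_real_derivative G (N p) x) (at x)"
    proof -
      have 1: "((\<lambda>x. 1 / x) has_real_derivative - (1 / x\<^sup>2)) (at x)"
        using greater by (auto intro!: derivative_eq_intros simp: power2_eq_square)
      have "((\<lambda>x. poly p (1 / x) * exp (- (1 / x))) has_real_derivative
          poly (pderiv p) (1 / x) * (- (1 / x\<^sup>2)) * exp (- (1 / x)) + exp (- (1 / x)) * (- (- (1 / x\<^sup>2))) * poly p (1 / x)) (at x)"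
        by (intro DERIV_mult DERIV_chain2[OF poly_DERIV 1] DERIV_chain2[OF DERIV_exp] DERIV_minus 1)
      then show ?thesis using greater by (simp add: G_def N_def algebra_simps power2_eq_square)
    qed
    then show ?thesis
      by (rule has_field_derivative_transform_within_open[of _ _ _ "{0<..}"]) (use greater in \<open>auto simp: G_def\<close>)
  next
    case equal
    have "((\<lambda>h. G p h / h) \<longlongrightarrow> 0) (at_right 0)"
    proof -
      \<comment> \<open>Dividing by h multiplies the polynomial in 1 / h by its variable, and the
        exponential still dominates.\<close>
      have "((\<lambda>h. poly ([:0, 1:] * p) (1 / h) * exp (- (1 / h))) \<longlongrightarrow> 0) (at_right 0)"
        by (rule filterlim_compose[OF poly_exp_tendsto_0 inv_top])
      then show ?thesis
        by (rule Lim_transform_eventually)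
          (use eventually_at_right_less[of "0::real"] in \<open>auto elim!: eventually_mono simp: G_def\<close>)
    qed
    moreover have "((\<lambda>h. G p h / h) \<longlongrightarrow> 0) (at_left 0)"
      by (rule Lim_transform_eventually[OF tendsto_const]) (auto simp: eventually_at_filter G_def)
    ultimately have "((\<lambda>h. G p h / h) \<longlongrightarrow> 0) (at 0)" by (rule filterlim_split_at[rotated])
    then show ?thesis using equal by (simp add: DERIV_def G_def)
  qed
  define q where "q n = (N ^^ n) 1" for n
  have "G (q 0) = exp_bump" by (auto simp: q_def G_def exp_bump_def)
  moreover have "(G (q n) has_real_derivative G (q (Suc n)) x) (at x)" for n x
    using der[of "q n" x] by (simp add: q_def)
  ultimately show ?thesis unfolding smooth_real_def by (intro exI[of _ "\<lambda>n. G (q n)"]) blast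
qed

lemma exp_bump_bounds: "0 \<le> exp_bump x" "exp_bump x \<le> 1"
  by (auto simp: exp_bump_def)

lemma exp_bump_limit: "x > 0 \<Longrightarrow> (\<lambda>k. exp_bump (real k * x)) \<longlonglongrightarrow> 1"
proof -
  assume x: "x > 0"
  have "filterlim (\<lambda>k. real k * x) at_top sequentially"
    using x by (intro filterlim_at_top_mult_tendsto_pos[where c = x, OF tendsto_const, unfolded mult.commute[of x]] filterlim_real_sequentially) auto
  then have "(\<lambda>k. exp (- (1 / (real k * x)))) \<longlonglongrightarrow> exp (- 0)"
    by (intro tendsto_intros tendsto_divide_0[OF tendsto_const] filterlim_mono[OF _ at_top_le_at_infinity order_refl])
  then have "(\<lambda>k. exp (- (1 / (real k * x)))) \<longlonglongrightarrow> 1" by simp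
  then show ?thesis
    by (rule Lim_transform_eventually)
      (use eventually_gt_at_top[of 0] x in \<open>auto elim!: eventually_mono simp: exp_bump_def mult_le_0_iff\<close>)
qed

section \<open>Test functions as elements of L2\<close>

definition zero_ext :: "nat \<Rightarrow> ((nat \<Rightarrow> real) \<Rightarrow> complex) \<Rightarrow> nat \<times> (nat \<Rightarrow> real) \<Rightarrow> complex" where
  "zero_ext d \<phi> = (\<lambda>(k, x). if k = d \<and> x \<in> Rn d then \<phi> x else 0)"

lemma l2_of_zero_ext: "l2_of d \<phi> = abs_l2 (zero_ext d \<phi>)"
  by (simp add: l2_of_def zero_ext_def)

lemma zero_ext_cong: "(\<And>x. x \<in> Rn d \<Longrightarrow> f x = g x) \<Longrightarrow> zero_ext d f = zero_ext d g"
  by (auto simp: zero_ext_def fun_eq_iff)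

lemma l2_of_cong: "(\<And>x. x \<in> Rn d \<Longrightarrow> f x = g x) \<Longrightarrow> l2_of d f = l2_of d g"
  unfolding l2_of_zero_ext by (simp cong: zero_ext_cong)

lemma zero_ext_borel:
  assumes "continuous_on (Rn d) \<phi>"
  shows "zero_ext d \<phi> \<in> borel_measurable borel"
proof -
  have "(\<lambda>p. if p \<in> {d} \<times> Rn d then \<phi> (snd p) else 0) \<in> borel_measurable borel"
    by (intro borel_measurable_continuous_on_if slice_borel Rn_borel continuous_on_const
        continuous_on_compose2[OF assms] continuous_on_snd continuous_on_id) auto
  also have "(\<lambda>p. if p \<in> {d} \<times> Rn d then \<phi> (snd p) else 0) = zero_ext d \<phi>"
    by (auto simp: zero_ext_def fun_eq_iff)
  finally show ?thesis .
qed

lemma compact_coordinate_bound: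
  assumes "compact C"
  obtains M where "M > 0" "\<And>x i. x \<in> C \<Longrightarrow> i < (d::nat) \<Longrightarrow> \<bar>x i :: real\<bar> \<le> M"
proof -
  have "compact ((\<lambda>x. \<Sum>i<d. \<bar>x i\<bar>) ` C)"
    by (intro compact_continuous_image assms continuous_intros continuous_on_coordinate)
  from compact_imp_bounded[OF this] obtain B
    where "\<And>y. y \<in> (\<lambda>x. \<Sum>i<d. \<bar>x i\<bar>) ` C \<Longrightarrow> norm y \<le> B"
    unfolding bounded_iff by blast
  from this[OF imageI] have B: "\<And>x. x \<in> C \<Longrightarrow> norm (\<Sum>i<d. \<bar>x i\<bar>) \<le> B" .
  have "\<bar>x i\<bar> \<le> \<bar>B\<bar> + 1" if "x \<in> C" "i < d" for x i
  proof -
    have "\<bar>x i\<bar> \<le> (\<Sum>i<d. \<bar>x i\<bar>)" using that(2) by (intro member_le_sum) auto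
    also have "\<dots> \<le> B" using B[OF that(1)] by simp
    finally show ?thesis by linarith
  qed
  then show ?thesis using that[of "\<bar>B\<bar> + 1"] by (simp add: add_nonneg_pos)
qed

lemma emeasure_compact_slice:
  assumes "compact C"
  shows "{d} \<times> C \<in> sets borel" "emeasure lebesgue_all ({d} \<times> C) < \<infinity>"
proof -
  interpret product_sigma_finite "\<lambda>_::nat. lborel :: real measure" by standard
  have C: "C \<in> sets borel" using compact_imp_closed[OF assms] by (rule borel_closed)
  then show b: "{d} \<times> C \<in> sets borel" by (rule slice_borel)
  obtain M where M0: "M > 0" and M: "\<And>x i. x \<in> C \<Longrightarrow> i < d \<Longrightarrow> \<bar>x i\<bar> \<le> M"
    using compact_coordinate_bound[OF assms, of d] by blast
  have "emeasure lebesgue_all ({d} \<times> C) = emeasure lborel_all ({d} \<times> C \<inter> {d} \<times> UNIV)"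
    by (simp add: emeasure_lebesgue_all[OF b] Times_Int_Times)
  also have "\<dots> = emeasure (lborel_dim d) (Pair d -` ({d} \<times> C) \<inter> space (lborel_dim d))"
    by (rule emeasure_lborel_all_slice[OF b])
  also have "\<dots> \<le> emeasure (lborel_dim d) (Pi\<^sub>E {..<d} (\<lambda>_. {-M..M}))"
  proof (rule emeasure_mono)
    show "Pair d -` ({d} \<times> C) \<inter> space (lborel_dim d) \<subseteq> Pi\<^sub>E {..<d} (\<lambda>_. {-M..M})"
      using M by (auto simp: space_lborel_dim PiE_iff abs_le_iff) (metis minus_le_iff)
    show "Pi\<^sub>E {..<d} (\<lambda>_. {-M..M}) \<in> sets (lborel_dim d)"
      unfolding lborel_dim_def by (rule sets_PiM_I_finite) auto
  qed
  also have "\<dots> = (\<Prod>i<d. emeasure lborel {-M..M})"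
    unfolding lborel_dim_def by (rule emeasure_PiM) auto
  also have "\<dots> < \<infinity>" using M0 by (simp add: ennreal_power less_top[symmetric])
  finally show "emeasure lebesgue_all ({d} \<times> C) < \<infinity>" .
qed

lemma zero_ext_bounded:
  assumes "continuous_on (Rn d) \<phi>" "compact C" "\<And>x. x \<in> Rn d - C \<Longrightarrow> \<phi> x = 0"
  obtains M where "M \<ge> 0" "\<And>p. cmod (zero_ext d \<phi> p) \<le> M * indicator ({d} \<times> C) p"
proof -
  have "x \<in> Rn d \<longleftrightarrow> (\<forall>i. d \<le> i \<longrightarrow> x i = undefined)" for x
    unfolding Rn_def PiE_iff extensional_def by (simp add: not_less)
  then have "Rn d = (\<Inter>i\<in>{d..}. {x. x i = undefined})" by blast
  moreover have "closed {x :: nat \<Rightarrow> real. x i = undefined}" for i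
    by (intro closed_Collect_eq continuous_on_product_coordinates continuous_on_const)
  ultimately have "closed (Rn d)" by (simp add: closed_INT)
  then have "compact (C \<inter> Rn d)" using assms(2) by (simp add: compact_Int_closed)
  then have "compact (\<phi> ` (C \<inter> Rn d))"
    by (rule compact_continuous_image[rotated]) (rule continuous_on_subset[OF assms(1)], blast)
  from compact_imp_bounded[OF this] obtain B where "\<And>y. y \<in> \<phi> ` (C \<inter> Rn d) \<Longrightarrow> cmod y \<le> B"
    unfolding bounded_iff by blast
  from this[OF imageI] have B: "\<And>x. x \<in> C \<inter> Rn d \<Longrightarrow> cmod (\<phi> x) \<le> B" .
  have "cmod (zero_ext d \<phi> (k, x)) \<le> \<bar>B\<bar> * indicator ({d} \<times> C) (k, x)" for k x
    using B[of x] assms(3)[of x] by (auto simp: zero_ext_def indicator_def)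
  then show ?thesis using that[of "\<bar>B\<bar>"] by (metis abs_ge_zero surj_pair)
qed

lemma zero_ext_integrable:
  assumes "continuous_on (Rn d) \<phi>" "compact C" "\<And>x. x \<in> Rn d - C \<Longrightarrow> \<phi> x = 0"
  shows "sq_int (zero_ext d \<phi>)" "integrable lebesgue_all (zero_ext d \<phi>)"
proof -
  obtain M where M: "M \<ge> 0" "\<And>p. cmod (zero_ext d \<phi> p) \<le> M * indicator ({d} \<times> C) p"
    using zero_ext_bounded[OF assms] by blast
  have A: "{d} \<times> C \<in> sets lebesgue_all" using emeasure_compact_slice(1)[OF assms(2)] by (rule sets_lebesgue_allI)
  have int: "integrable lebesgue_all (indicator ({d} \<times> C) :: _ \<Rightarrow> real)"
    using A emeasure_compact_slice(2)[OF assms(2)] by (simp add: less_top)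
  have meas: "zero_ext d \<phi> \<in> borel_measurable lebesgue_all"
    by (intro measurable_lebesgue_allI zero_ext_borel assms)
  show "sq_int (zero_ext d \<phi>)"
  proof (rule sq_int_bound[OF _ meas])
    show "integrable lebesgue_all (\<lambda>p. M\<^sup>2 * indicator ({d} \<times> C) p)" using int by simp
    show "(cmod (zero_ext d \<phi> p))\<^sup>2 \<le> M\<^sup>2 * indicator ({d} \<times> C) p" for p
      using power_mono[OF M(2)[of p], of 2] by (cases "p \<in> {d} \<times> C") (auto simp: power_mult_distrib)
  qed
  show "integrable lebesgue_all (zero_ext d \<phi>)"
    by (rule Bochner_Integration.integrable_bound[where f = "\<lambda>p. M * indicator ({d} \<times> C) p"])
      (use int meas M in auto)
qed

lemma continuous_on_fun_upd: "continuous_on A (\<lambda>t :: real. x(i := t))"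
proof (rule continuous_on_coordinatewise_then_product)
  show "continuous_on A (\<lambda>t. (x(i := t)) j)" for j by (cases "j = i") auto
qed

lemma partial_deriv_outside:
  assumes "closed C" "\<And>x. x \<in> Rn d - C \<Longrightarrow> \<phi> x = 0" "i < d" "x \<in> Rn d - C"
  shows "partial_deriv i \<phi> x = 0"
proof (rule partial_derivI)
  have op: "open {t. x(i := t) \<in> - C}"
    using continuous_open_preimage[OF continuous_on_fun_upd[of UNIV x i] open_UNIV, of "- C"] open_Compl[OF assms(1)] by (simp add: vimage_def)
  show "((\<lambda>t. \<phi> (x(i := t))) has_vector_derivative 0) (at (x i))"
    by (rule has_vector_derivative_transform_within_open[OF has_vector_derivative_const op])
      (use assms(2-4) in \<open>auto simp: Rn_upd\<close>)
qed

lemma test_functionsE: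
  assumes "\<phi> \<in> test_functions d \<Omega>"
  obtains C where "smooth d \<phi>" "compact C" "C \<subseteq> \<Omega>" "\<And>x. x \<in> Rn d - C \<Longrightarrow> \<phi> x = 0"
  using assms unfolding test_functions_def by blast

lemma test_functionsI:
  "smooth d \<phi> \<Longrightarrow> compact C \<Longrightarrow> C \<subseteq> \<Omega> \<Longrightarrow> (\<And>x. x \<in> Rn d - C \<Longrightarrow> \<phi> x = 0) \<Longrightarrow> \<phi> \<in> test_functions d \<Omega>"
  unfolding test_functions_def by blast

lemma test_functions_smooth: "\<phi> \<in> test_functions d \<Omega> \<Longrightarrow> smooth d \<phi>"
  unfolding test_functions_def by blast

lemma test_functions_partial:
  assumes "\<phi> \<in> test_functions d \<Omega>" "i < d"
  shows "partial_deriv i \<phi> \<in> test_functions d \<Omega>"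
  using assms(1)
proof (rule test_functionsE)
  fix C assume C: "smooth d \<phi>" "compact C" "C \<subseteq> \<Omega>" "\<And>x. x \<in> Rn d - C \<Longrightarrow> \<phi> x = 0"
  show ?thesis
    by (rule test_functionsI[OF smooth_partial_deriv[OF C(1) assms(2)] C(2,3)
      partial_deriv_outside[OF compact_imp_closed[OF C(2)] C(4) assms(2)]])
qed

lemma test_functions_add:
  assumes "\<phi> \<in> test_functions d \<Omega>" "\<psi> \<in> test_functions d \<Omega>"
  shows "(\<lambda>x. \<phi> x + \<psi> x) \<in> test_functions d \<Omega>"
  using assms(1)
proof (rule test_functionsE)
  fix C assume C: "smooth d \<phi>" "compact C" "C \<subseteq> \<Omega>" "\<And>x. x \<in> Rn d - C \<Longrightarrow> \<phi> x = 0"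
  from assms(2) show ?thesis
  proof (rule test_functionsE)
    fix D assume D: "smooth d \<psi>" "compact D" "D \<subseteq> \<Omega>" "\<And>x. x \<in> Rn d - D \<Longrightarrow> \<psi> x = 0"
    show ?thesis
      by (rule test_functionsI[OF smooth_add[OF C(1) D(1)] compact_Un[OF C(2) D(2)]]) (use C D in auto)
  qed
qed

lemma test_functions_smooth_mult:
  assumes "smooth d f" "\<phi> \<in> test_functions d \<Omega>"
  shows "(\<lambda>x. f x * \<phi> x) \<in> test_functions d \<Omega>"
  using assms(2)
proof (rule test_functionsE)
  fix C assume C: "smooth d \<phi>" "compact C" "C \<subseteq> \<Omega>" "\<And>x. x \<in> Rn d - C \<Longrightarrow> \<phi> x = 0"
  show ?thesis
    by (rule test_functionsI[OF smooth_mult[OF assms(1) C(1)] C(2,3)]) (use C in auto)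
qed

lemma test_functions_cmult:
  assumes "\<phi> \<in> test_functions d \<Omega>"
  shows "(\<lambda>x. c * \<phi> x) \<in> test_functions d \<Omega>"
  using assms
proof (rule test_functionsE)
  fix C assume C: "smooth d \<phi>" "compact C" "C \<subseteq> \<Omega>" "\<And>x. x \<in> Rn d - C \<Longrightarrow> \<phi> x = 0"
  show ?thesis by (rule test_functionsI[OF smooth_cmult[OF C(1)] C(2,3)]) (use C in auto)
qed

lemma test_functions_cnj:
  assumes "\<phi> \<in> test_functions d \<Omega>"
  shows "(\<lambda>x. cnj (\<phi> x)) \<in> test_functions d \<Omega>"
  using assms
proof (rule test_functionsE)
  fix C assume C: "smooth d \<phi>" "compact C" "C \<subseteq> \<Omega>" "\<And>x. x \<in> Rn d - C \<Longrightarrow> \<phi> x = 0"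
  show ?thesis by (rule test_functionsI[OF smooth_cnj[OF C(1)] C(2,3)]) (use C in auto)
qed

lemma test_functions_mono: "\<Omega> \<subseteq> \<Omega>' \<Longrightarrow> test_functions d \<Omega> \<subseteq> test_functions d \<Omega>'"
  unfolding test_functions_def by blast

lemma sq_int_test:
  assumes "\<phi> \<in> test_functions d \<Omega>"
  shows "sq_int (zero_ext d \<phi>)" "integrable lebesgue_all (zero_ext d \<phi>)"
  using assms by (auto elim!: test_functionsE intro!: zero_ext_integrable smooth_continuous)

lemma l2_of_add:
  assumes "\<phi> \<in> test_functions d \<Omega>" "\<psi> \<in> test_functions d \<Omega>'"
  shows "l2_of d (\<lambda>x. \<phi> x + \<psi> x) = l2_of d \<phi> + l2_of d \<psi>"
  unfolding l2_of_zero_ext abs_l2_add[OF sq_int_test(1)[OF assms(1)] sq_int_test(1)[OF assms(2)]]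
  by (rule arg_cong[of _ _ abs_l2]) (auto simp: zero_ext_def)

lemma l2_of_cmult:
  assumes "\<phi> \<in> test_functions d \<Omega>"
  shows "l2_of d (\<lambda>x. c * \<phi> x) = c *\<^sub>C l2_of d \<phi>"
  unfolding l2_of_zero_ext scaleC_abs_l2[OF sq_int_test(1)[OF assms]]
  by (rule arg_cong[of _ _ abs_l2]) (auto simp: zero_ext_def)

lemma l2_of_in:
  assumes "\<phi> \<in> test_functions d \<Omega>"
  shows "l2_of d \<phi> \<in> l2_on d \<Omega>"
  using assms
proof (rule test_functionsE)
  fix C assume C: "smooth d \<phi>" "compact C" "C \<subseteq> \<Omega>" "\<And>x. x \<in> Rn d - C \<Longrightarrow> \<phi> x = 0"
  have "x \<in> \<Omega>" if "x \<in> Rn d" "\<phi> x \<noteq> 0" for x using C(3) C(4)[of x] that by blast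
  then show ?thesis
    unfolding l2_of_zero_ext l2_on_abs_l2[OF sq_int_test(1)[OF assms]]
    by (intro AE_I2) (auto simp: zero_ext_def split: if_splits)
qed

lemma integral_test:
  assumes "\<phi> \<in> test_functions d \<Omega>"
  shows "(LINT x|lebesgue_dim d. rep_l2 u (d, x) * \<phi> x) = cinner u (l2_of d (\<lambda>x. cnj (\<phi> x)))"
proof -
  have meas: "(\<lambda>p. rep_l2 u p * zero_ext d \<phi> p) \<in> borel_measurable lebesgue_all"
    using sq_int_measurable[OF sq_int_rep_l2[of u]] sq_int_measurable[OF sq_int_test(1)[OF assms]] by measurable
  have "(LINT x|lebesgue_dim d. rep_l2 u (d, x) * \<phi> x) = (LINT x|lebesgue_dim d. rep_l2 u (d, x) * zero_ext d \<phi> (d, x))"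
    by (rule Bochner_Integration.integral_cong) (auto simp: zero_ext_def lebesgue_dim_def space_lborel_dim Rn_def)
  also have "\<dots> = (LINT p|lebesgue_all. indicator ({d} \<times> UNIV) p * (rep_l2 u p * zero_ext d \<phi> p))"
    by (rule integral_slice[OF meas])
  also have "\<dots> = (LINT p|lebesgue_all. rep_l2 u p * cnj (zero_ext d (\<lambda>x. cnj (\<phi> x)) p))"
    by (rule Bochner_Integration.integral_cong) (auto simp: zero_ext_def split: split_indicator if_splits)
  also have "\<dots> = cinner (abs_l2 (rep_l2 u)) (abs_l2 (zero_ext d (\<lambda>x. cnj (\<phi> x))))"
    by (rule cinner_abs_l2[OF sq_int_rep_l2 sq_int_test(1)[OF test_functions_cnj[OF assms]], symmetric])
  finally show ?thesis by (simp add: abs_rep_l2 l2_of_zero_ext)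
qed

text \<open>\<open>cinner\<close> conjugates its second argument. As test functions are closed under
  conjugation, the integral identity can be restated inside the Hilbert space, where adjoints,
  limits and reflections act on it algebraically.\<close>

lemma weak_deriv_iff:
  assumes i: "i < d"
  shows "weak_deriv d \<Omega> i u g \<longleftrightarrow> u \<in> l2_on d \<Omega> \<and> g \<in> l2_on d \<Omega> \<and>
    (\<forall>\<phi>\<in>test_functions d \<Omega>. cinner u (l2_of d (partial_deriv i \<phi>)) = - cinner g (l2_of d \<phi>))"
proof -
  have eq: "(LINT x|lebesgue_dim d. rep_l2 u (d, x) * partial_deriv i \<phi> x) = cinner u (l2_of d (partial_deriv i (\<lambda>x. cnj (\<phi> x))))"
    if "\<phi> \<in> test_functions d \<Omega>" for \<phi>
    unfolding integral_test[OF test_functions_partial[OF that i]]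
    by (rule arg_cong[where f = "cinner u"], rule l2_of_cong)
      (rule partial_deriv_cnj[OF test_functions_smooth[OF that] i, symmetric])
  have "(\<forall>\<phi>\<in>test_functions d \<Omega>. (LINT x|lebesgue_dim d. rep_l2 u (d, x) * partial_deriv i \<phi> x) =
        - (LINT x|lebesgue_dim d. rep_l2 g (d, x) * \<phi> x))
    \<longleftrightarrow> (\<forall>\<phi>\<in>test_functions d \<Omega>. cinner u (l2_of d (partial_deriv i (\<lambda>x. cnj (\<phi> x)))) = - cinner g (l2_of d (\<lambda>x. cnj (\<phi> x))))"
    by (rule ball_cong[OF refl]) (simp add: eq integral_test)
  also have "\<dots> \<longleftrightarrow> (\<forall>\<phi>\<in>test_functions d \<Omega>. cinner u (l2_of d (partial_deriv i \<phi>)) = - cinner g (l2_of d \<phi>))"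
  proof (intro iffI ballI)
    fix \<phi> assume *: "\<forall>\<phi>\<in>test_functions d \<Omega>. cinner u (l2_of d (partial_deriv i (\<lambda>x. cnj (\<phi> x)))) = - cinner g (l2_of d (\<lambda>x. cnj (\<phi> x)))"
      and \<phi>: "\<phi> \<in> test_functions d \<Omega>"
    show "cinner u (l2_of d (partial_deriv i \<phi>)) = - cinner g (l2_of d \<phi>)"
      using bspec[OF * test_functions_cnj[OF \<phi>]] by simp
  qed (use test_functions_cnj in blast)
  finally show ?thesis unfolding weak_deriv_def by blast
qed

lemma integrable_slice:
  fixes F :: "nat \<times> (nat \<Rightarrow> real) \<Rightarrow> complex"
  assumes "F \<in> borel_measurable borel" "integrable lebesgue_all F"
  shows "integrable (lborel_dim d) (\<lambda>x. F (d, x))"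
proof -
  have D: "{d} \<times> UNIV \<in> sets lebesgue_all" by (intro sets_lebesgue_allI slice_borel) simp
  have m: "F \<in> borel_measurable lebesgue_all" using assms(2) by auto
  have "integrable (density lebesgue_all (\<lambda>p. ennreal (indicator ({d} \<times> UNIV) p))) F"
    using integrable_mult_indicator[OF D assms(2)] m D by (subst integrable_density) auto
  then have "integrable (lebesgue_dim d) (\<lambda>x. F (d, x))"
    unfolding distr_Pair_lebesgue[symmetric] using m by (simp add: integrable_distr_eq[OF measurable_Pair_lebesgue])
  moreover have "(\<lambda>x. F (d, x)) \<in> borel_measurable (lborel_dim d)"
    by (rule measurable_compose[OF measurable_Pair_lborel_dim assms(1)])
  ultimately show ?thesis unfolding lebesgue_dim_def by (simp add: integrable_completion)
qed

text \<open>Integrate in the i-th variable first: by the fundamental theorem of calculus the inner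
  integral is a difference of two values outside the support.\<close>

lemma integral_partial_deriv:
  assumes \<theta>: "\<theta> \<in> test_functions d \<Omega>" and i: "i < d"
  shows "(LINT p|lebesgue_all. zero_ext d (partial_deriv i \<theta>) p) = 0"
  using \<theta>
proof (rule test_functionsE)
  fix C assume C: "smooth d \<theta>" "compact C" "C \<subseteq> \<Omega>" "\<And>x. x \<in> Rn d - C \<Longrightarrow> \<theta> x = 0"
  interpret product_sigma_finite "\<lambda>_::nat. lborel :: real measure" by standard
  note t = test_functions_partial[OF \<theta> i]
  note s = smooth_partial_deriv[OF C(1) i]
  define h where "h x = zero_ext d (partial_deriv i \<theta>) (d, x)" for x
  define I where "I = {..<d} - {i}"
  have I: "finite I" "i \<notin> I" "insert i I = {..<d}" using i by (auto simp: I_def)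
  have bm: "zero_ext d (partial_deriv i \<theta>) \<in> borel_measurable borel" by (rule zero_ext_borel[OF smooth_continuous[OF s]])
  have hm: "h \<in> borel_measurable (lborel_dim d)"
    unfolding h_def by (rule measurable_compose[OF measurable_Pair_lborel_dim bm])
  have hint: "integrable (Pi\<^sub>M (insert i I) (\<lambda>_. lborel)) h"
    unfolding I(3) lborel_dim_def[symmetric] h_def by (rule integrable_slice[OF bm sq_int_test(2)[OF t]])
  obtain M where M0: "M > 0" and MC: "\<And>x i. x \<in> C \<Longrightarrow> i < d \<Longrightarrow> \<bar>x i\<bar> \<le> M"
    using compact_coordinate_bound[OF C(2), of d] by blast
  have M: "M > 0" "\<And>x. x \<in> C \<Longrightarrow> \<bar>x i\<bar> \<le> M" by (rule M0) (rule MC[OF _ i])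
  have inner: "(LINT y|lborel. h (x(i := y))) = 0" if "x \<in> space (Pi\<^sub>M I (\<lambda>_. lborel))" for x
  proof -
    have R: "x(i := y) \<in> Rn d" for y
      using that i unfolding Rn_def space_PiM I_def PiE_iff extensional_def by auto
    have out: "x(i := y) \<in> Rn d - C" if "y \<notin> {-M..M}" for y
      using R M(2)[of "x(i := y)"] that by (auto simp: abs_le_iff)
    \<comment> \<open>The support only satisfies |x i| \<le> M, so the interval is widened by 1 to
      have endpoints at which \<theta> vanishes.\<close>
    have "(LINT y|lborel. h (x(i := y))) = (LINT y|lborel. indicator {-(M+1)..M+1} y *\<^sub>R partial_deriv i \<theta> (x(i := y)))"
    proof (rule Bochner_Integration.integral_cong[OF refl])
      fix y
      show "h (x(i := y)) = indicator {-(M+1)..M+1} y *\<^sub>R partial_deriv i \<theta> (x(i := y))"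
      proof (cases "y \<in> {-(M+1)..M+1}")
        case False
        then have "partial_deriv i \<theta> (x(i := y)) = 0"
          by (intro partial_deriv_outside[OF compact_imp_closed[OF C(2)] C(4) i] out) auto
        then show ?thesis using False by (simp add: h_def zero_ext_def)
      qed (use R in \<open>auto simp: h_def zero_ext_def\<close>)
    qed
    also have "\<dots> = \<theta> (x(i := M + 1)) - \<theta> (x(i := -(M + 1)))"
    proof (rule integral_FTC_Icc)
      show "((\<lambda>y. \<theta> (x(i := y))) has_vector_derivative partial_deriv i \<theta> (x(i := y))) (at y within {-(M+1)..M+1})" for y
        using smooth_has_partial_at[OF C(1) i R[of 0], of y] by (simp add: has_vector_derivative_at_within)
      show "continuous_on {-(M+1)..M+1} (\<lambda>y. partial_deriv i \<theta> (x(i := y)))"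
        by (intro continuous_on_compose2[OF smooth_continuous[OF s] continuous_on_fun_upd]) (use R in auto)
    qed (use M in auto)
    also have "\<dots> = 0" using C(4)[OF out[of "M + 1"]] C(4)[OF out[of "-(M + 1)"]] M(1) by simp
    finally show ?thesis .
  qed
  have "(LINT p|lebesgue_all. zero_ext d (partial_deriv i \<theta>) p)
      = (LINT p|lebesgue_all. indicator ({d} \<times> UNIV) p * zero_ext d (partial_deriv i \<theta>) p)"
    by (rule Bochner_Integration.integral_cong) (auto simp: zero_ext_def split: split_indicator if_splits)
  also have "\<dots> = (LINT x|lebesgue_dim d. h x)"
    unfolding h_def by (rule integral_slice[symmetric]) (rule measurable_lebesgue_allI[OF bm])
  also have "\<dots> = (LINT x|lborel_dim d. h x)"
    unfolding lebesgue_dim_def by (rule integral_completion[OF hm])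
  also have "\<dots> = (LINT x|Pi\<^sub>M I (\<lambda>_. lborel). LINT y|lborel. h (x(i := y)))"
    using product_integral_insert[OF I(1,2) hint] unfolding I(3) lborel_dim_def[symmetric] .
  also have "\<dots> = (LINT x|Pi\<^sub>M I (\<lambda>_. lborel :: real measure). 0)"
    by (rule Bochner_Integration.integral_cong) (use inner in auto)
  finally show ?thesis by simp
qed

text \<open>The product of f with the conjugate of g is a test function, and the integral of its
  derivative is 0.\<close>

lemma integration_by_parts:
  assumes f: "f \<in> test_functions d \<Omega>" and g: "g \<in> test_functions d \<Omega>'" and i: "i < d"
  shows "cinner (l2_of d f) (l2_of d (partial_deriv i g)) = - cinner (l2_of d (partial_deriv i f)) (l2_of d g)"
proof -
  note cg = test_functions_cnj[OF g]
  note fi = test_functions_partial[OF f i] and gi = test_functions_partial[OF g i]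
  have prod: "(\<lambda>x. f x * cnj (g x)) \<in> test_functions d \<Omega>'"
    by (rule test_functions_smooth_mult[OF test_functions_smooth[OF f] cg])
  have int: "integrable lebesgue_all (\<lambda>p. zero_ext d a p * cnj (zero_ext d b p))"
    if "a \<in> test_functions d \<Omega>" "b \<in> test_functions d \<Omega>'" for a b
    by (intro sq_int_mult_cnj sq_int_test[OF that(1)] sq_int_test[OF that(2)])
  have "cinner (l2_of d f) (l2_of d (partial_deriv i g)) + cinner (l2_of d (partial_deriv i f)) (l2_of d g)
      = (LINT p|lebesgue_all. zero_ext d f p * cnj (zero_ext d (partial_deriv i g) p)) +
        (LINT p|lebesgue_all. zero_ext d (partial_deriv i f) p * cnj (zero_ext d g p))"
    unfolding l2_of_zero_ext
    by (simp add: cinner_abs_l2 sq_int_test[OF f] sq_int_test[OF g] sq_int_test[OF fi] sq_int_test[OF gi])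
  also have "\<dots> = (LINT p|lebesgue_all. zero_ext d f p * cnj (zero_ext d (partial_deriv i g) p) +
        zero_ext d (partial_deriv i f) p * cnj (zero_ext d g p))"
    by (rule Bochner_Integration.integral_add[symmetric]) (intro int f g fi gi)+
  also have "\<dots> = (LINT p|lebesgue_all. zero_ext d (partial_deriv i (\<lambda>x. f x * cnj (g x))) p)"
    by (rule Bochner_Integration.integral_cong)
      (auto simp: zero_ext_def partial_deriv_mult[OF test_functions_smooth[OF f] test_functions_smooth[OF cg] i]
        partial_deriv_cnj[OF test_functions_smooth[OF g] i])
  also have "\<dots> = 0" by (rule integral_partial_deriv[OF prod i])
  finally show ?thesis by (simp add: eq_neg_iff_add_eq_0)
qed

section \<open>Boxes and the fundamental lemma of the calculus of variations\<close>

definition open_box :: "nat \<Rightarrow> (nat \<Rightarrow> real) \<Rightarrow> (nat \<Rightarrow> real) \<Rightarrow> (nat \<Rightarrow> real) set" where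
  "open_box d a b = {x \<in> Rn d. \<forall>i<d. a i < x i \<and> x i < b i}"

definition closed_box :: "nat \<Rightarrow> (nat \<Rightarrow> real) \<Rightarrow> (nat \<Rightarrow> real) \<Rightarrow> (nat \<Rightarrow> real) set" where
  "closed_box d a b = {x \<in> Rn d. \<forall>i<d. a i \<le> x i \<and> x i \<le> b i}"

lemma mem_Rn_iff: "x \<in> Rn d \<longleftrightarrow> (\<forall>i. d \<le> i \<longrightarrow> x i = undefined)"
  unfolding Rn_def PiE_iff extensional_def by (simp add: not_less)

lemma compact_closed_box: "compact (closed_box d a b)"
proof -
  have mem: "x \<in> closed_box d a b \<longleftrightarrow> (\<forall>i. x i \<in> (if i < d then {a i..b i} else {undefined}))" for x
    unfolding closed_box_def mem_Rn_iff by (auto simp: not_less)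
  have "closed_box d a b = Pi\<^sub>E UNIV (\<lambda>i. if i < d then {a i..b i} else {undefined})"
    unfolding PiE_UNIV_domain using mem by (auto simp: Pi_iff)
  moreover have "compactin (product_topology (\<lambda>i. euclidean) UNIV) (Pi\<^sub>E UNIV (\<lambda>i. if i < d then {a i..b i} else {undefined :: real}))"
    by (subst compactin_PiE) auto
  ultimately show ?thesis by (simp add: euclidean_product_topology)
qed

lemma open_box_eq_PiE: "open_box d a b = Pi\<^sub>E {..<d} (\<lambda>i. {a i<..<b i})"
proof (rule set_eqI)
  show "x \<in> open_box d a b \<longleftrightarrow> x \<in> Pi\<^sub>E {..<d} (\<lambda>i. {a i<..<b i})" for x
    unfolding open_box_def Rn_def PiE_iff mem_Collect_eq lessThan_iff greaterThanLessThan_iff Ball_def by blast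
qed

lemma open_box_sets: "open_box d a b \<in> sets (lborel_dim d)"
  unfolding open_box_eq_PiE lborel_dim_def by (rule sets_PiM_I_finite) auto

text \<open>Supplies the generator for the induction over measurable sets in
  \<open>vanishes_on_box\<close>.\<close>

lemma sets_lborel_dim_boxes:
  "sets (lborel_dim d) = sigma_sets (Rn d) (range (\<lambda>(a, b). open_box d a b))"
proof -
  define E where "E = range (\<lambda>(a, b). box a b :: real set)"
  define P where "P = {{f\<in>(\<Pi>\<^sub>E i\<in>{..<d}. UNIV). \<forall>i\<in>j. f i \<in> A i} | A j. j \<in> {{..<d}} \<and> A \<in> Pi j (\<lambda>_. E)}"
  have bE: "(borel :: real measure) = sigma UNIV E" unfolding E_def by (rule borel_eq_box)
  have "sets (\<Pi>\<^sub>M i\<in>{..<d}. sigma UNIV E) = sets (sigma (\<Pi>\<^sub>E i\<in>{..<d}. UNIV) P)"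
    unfolding P_def
  proof (rule sets_PiM_sigma)
    show "\<exists>S\<subseteq>E. countable S \<and> (UNIV :: real set) = \<Union> S" for i :: nat
    proof (intro exI[of _ "range (\<lambda>n::nat. box (- real n) (real n))"] conjI)
      show "UNIV = \<Union> (range (\<lambda>n::nat. box (- real n) (real n)))"
      proof -
        have "\<exists>n::nat. - real n < x \<and> x < real n" for x :: real
        proof -
          obtain n :: nat where "\<bar>x\<bar> < real n" using reals_Archimedean2 by blast
          then show ?thesis by (intro exI[of _ n]) auto
        qed
        then show ?thesis by (auto simp: set_eq_iff)
      qed
    qed (auto simp: E_def)
  qed auto
  moreover have "sets (lborel_dim d) = sets (\<Pi>\<^sub>M i\<in>{..<d}. sigma UNIV E)"
    unfolding lborel_dim_def bE[symmetric] by (rule sets_PiM_cong) auto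
  moreover have "P = range (\<lambda>(a, b). open_box d a b)"
  proof (intro equalityI subsetI)
    fix X assume "X \<in> P"
    then obtain A where A: "X = {f\<in>(\<Pi>\<^sub>E i\<in>{..<d}. UNIV). \<forall>i\<in>{..<d}. f i \<in> A i}" "\<And>i. i < d \<Longrightarrow> A i \<in> E"
      unfolding P_def by auto
    have "\<exists>a b. i < d \<longrightarrow> A i = {a<..<b}" for i
    proof (cases "i < d")
      case True
      then obtain a b where "A i = box a b" using A(2)[of i] unfolding E_def by auto
      then have "A i = {a<..<b}" by simp
      then show ?thesis by blast
    qed simp
    then obtain a b where "\<And>i. i < d \<Longrightarrow> A i = {a i<..<b i}" by metis
    then have "X = open_box d a b" unfolding A(1) open_box_def Rn_def by auto
    then show "X \<in> range (\<lambda>(a, b). open_box d a b)" by auto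
  next
    fix X assume "X \<in> range (\<lambda>(a, b). open_box d a b)"
    then obtain a b where X: "X = open_box d a b" by auto
    have "X = {f\<in>(\<Pi>\<^sub>E i\<in>{..<d}. UNIV). \<forall>i\<in>{..<d}. f i \<in> box (a i) (b i)}"
      unfolding X open_box_def Rn_def by auto
    then show "X \<in> P"
      unfolding P_def
    proof (intro CollectI exI[of _ "\<lambda>i. box (a i) (b i)"] exI[of _ "{..<d}"] conjI)
      have "box r s \<in> E" for r s unfolding E_def by (rule range_eqI[of _ _ "(r, s)"]) (simp only: prod.case)
      then show "(\<lambda>i. box (a i) (b i)) \<in> Pi {..<d} (\<lambda>_. E)" by blast
    qed simp_all
  qed
  moreover have "P \<subseteq> Pow (\<Pi>\<^sub>E i\<in>{..<d}. UNIV)" unfolding P_def by auto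
  ultimately show ?thesis by (simp add: Rn_def)
qed

text \<open>The bump is a product of \<open>exp_bump\<close>s; scaling it up by \<open>k\<close> approximates the indicator of the box.\<close>

lemma box_integral_zero:
  assumes u: "\<And>\<phi>. \<phi> \<in> test_functions d \<Omega> \<Longrightarrow> cinner u (l2_of d \<phi>) = 0"
    and box: "closed_box d a b \<subseteq> \<Omega>"
  shows "(LINT p|lebesgue_all. indicator ({d} \<times> open_box d a b) p * rep_l2 u p) = 0"
proof -
  \<comment> \<open>The real function \<beta> serves for bounds and limits; \<phi> is the same bump
    as a product of two complex tensors, the form in which smoothness is derived.\<close>
  define \<beta> where "\<beta> k x = (\<Prod>i<d. exp_bump (real k * x i + (- real k * a i))) * (\<Prod>i<d. exp_bump ((- real k) * x i + real k * b i))"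
    for k :: nat and x :: "nat \<Rightarrow> real"
  define \<phi> where "\<phi> k x = complex_of_real (\<Prod>i<d. exp_bump (real k * x i + (- real k * a i)))
      * complex_of_real (\<Prod>i<d. exp_bump ((- real k) * x i + real k * b i))" for k :: nat and x :: "nat \<Rightarrow> real"
  have \<phi>\<beta>: "\<phi> k x = complex_of_real (\<beta> k x)" for k x by (simp add: \<phi>_def \<beta>_def)
  have \<beta>0: "\<beta> k x = 0" if "i < d" "\<not> (a i < x i \<and> x i < b i)" for k x i
  proof (cases "a i < x i")
    case True
    with that have "b i \<le> x i" by simp
    then have "(- real k) * x i + real k * b i \<le> 0" using mult_left_mono[of "b i" "x i" "real k"] by simp
    then have "exp_bump ((- real k) * x i + real k * b i) = 0" by (simp add: exp_bump_def)
    then have "(\<Prod>i<d. exp_bump ((- real k) * x i + real k * b i)) = 0"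
      using that(1) by (intro prod_zero bexI[of _ i]) auto
    then show ?thesis by (simp add: \<beta>_def)
  next
    case False
    then have "real k * x i + (- real k * a i) \<le> 0" using mult_left_mono[of "x i" "a i" "real k"] by simp
    then have "exp_bump (real k * x i + (- real k * a i)) = 0" by (simp add: exp_bump_def)
    then have "(\<Prod>i<d. exp_bump (real k * x i + (- real k * a i))) = 0"
      using that(1) by (intro prod_zero bexI[of _ i]) auto
    then show ?thesis by (simp add: \<beta>_def)
  qed
  have \<beta>b: "0 \<le> \<beta> k x \<and> \<beta> k x \<le> 1" for k x
    unfolding \<beta>_def by (intro conjI mult_nonneg_nonneg prod_nonneg mult_le_one prod_le_1) (auto simp: exp_bump_bounds)
  have \<beta>lim: "(\<lambda>k. \<beta> k x) \<longlonglongrightarrow> 1" if "x \<in> open_box d a b" for x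
  proof -
    have "(\<lambda>k. \<beta> k x) \<longlonglongrightarrow> (\<Prod>i<d. 1) * (\<Prod>i<d. 1)"
      unfolding \<beta>_def
    proof (intro tendsto_mult tendsto_prod)
      fix i assume "i \<in> {..<d}"
      then have "x i - a i > 0" "b i - x i > 0" using that by (auto simp: open_box_def)
      from exp_bump_limit[OF this(1)] exp_bump_limit[OF this(2)]
      show "(\<lambda>k. exp_bump (real k * x i + (- real k * a i))) \<longlonglongrightarrow> 1"
        "(\<lambda>k. exp_bump ((- real k) * x i + real k * b i)) \<longlonglongrightarrow> 1"
        by (simp_all add: algebra_simps)
    qed
    then show ?thesis by simp
  qed
  have \<phi>0: "\<phi> k x = 0" if "x \<in> Rn d" "x \<notin> open_box d a b" for k x
    using that \<beta>0 unfolding open_box_def \<phi>\<beta> by auto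
  have \<phi>: "\<phi> k \<in> test_functions d \<Omega>" for k
  proof (rule test_functionsI[OF _ compact_closed_box box])
    show "smooth d (\<phi> k)"
      unfolding \<phi>_def by (intro smooth_mult smooth_tensor smooth_real_affine smooth_real_exp_bump)
    show "\<phi> k x = 0" if "x \<in> Rn d - closed_box d a b" for x
      by (rule \<phi>0) (use that in \<open>auto simp: open_box_def closed_box_def less_imp_le\<close>)
  qed
  define w where "w = (\<lambda>p. cmod (rep_l2 u p) * indicator ({d} \<times> closed_box d a b) p)"
  have cb: "{d} \<times> closed_box d a b \<in> sets lebesgue_all" "emeasure lebesgue_all ({d} \<times> closed_box d a b) < \<infinity>"
    using emeasure_compact_slice[OF compact_closed_box] by (auto intro: sets_lebesgue_allI)
  have w: "integrable lebesgue_all w"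
  proof -
    have "cmod (indicator A p) = indicator A p" for A and p :: "nat \<times> (nat \<Rightarrow> real)"
      by (simp split: split_indicator)
    then show ?thesis
      using integrable_norm[OF sq_int_mult_cnj[OF sq_int_rep_l2[of u] sq_int_indicator[OF cb, of 1]]]
      by (simp add: w_def norm_mult)
  qed
  have meas: "rep_l2 u \<in> borel_measurable lebesgue_all" by (rule sq_int_measurable[OF sq_int_rep_l2])
  have ob: "{d} \<times> open_box d a b \<in> sets lebesgue_all"
    by (intro sets_lebesgue_allI slice_borel sets_lborel_dim_borel(1)[OF open_box_sets])
  have "(\<lambda>k. LINT p|lebesgue_all. rep_l2 u p * cnj (zero_ext d (\<phi> k) p))
      \<longlonglongrightarrow> (LINT p|lebesgue_all. indicator ({d} \<times> open_box d a b) p * rep_l2 u p)"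
  proof (rule integral_dominated_convergence[OF _ _ w])
    show "(\<lambda>p. indicator ({d} \<times> open_box d a b) p * rep_l2 u p) \<in> borel_measurable lebesgue_all"
      using meas ob by measurable
    show "(\<lambda>p. rep_l2 u p * cnj (zero_ext d (\<phi> k) p)) \<in> borel_measurable lebesgue_all" for k
      using sq_int_mult_cnj[OF sq_int_rep_l2[of u] sq_int_test(1)[OF \<phi>[of k]]] by (rule borel_measurable_integrable)
    show "AE p in lebesgue_all. (\<lambda>k. rep_l2 u p * cnj (zero_ext d (\<phi> k) p)) \<longlonglongrightarrow> indicator ({d} \<times> open_box d a b) p * rep_l2 u p"
    proof (rule AE_I2)
      fix p :: "nat \<times> (nat \<Rightarrow> real)"
      obtain k x where p: "p = (k, x)" by (cases p)
      show "(\<lambda>k. rep_l2 u p * cnj (zero_ext d (\<phi> k) p)) \<longlonglongrightarrow> indicator ({d} \<times> open_box d a b) p * rep_l2 u p"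
      proof (cases "k = d \<and> x \<in> open_box d a b")
        case True
        then have x: "x \<in> Rn d" by (simp add: open_box_def)
        have "(\<lambda>k. rep_l2 u p * complex_of_real (\<beta> k x)) \<longlonglongrightarrow> rep_l2 u p * complex_of_real 1"
          using True by (intro tendsto_intros \<beta>lim) simp
        then show ?thesis using True x by (simp add: p zero_ext_def \<phi>\<beta>)
      next
        case False
        then have "zero_ext d (\<phi> n) p = 0" for n using \<phi>0[of x n] by (auto simp: p zero_ext_def)
        moreover have "indicator ({d} \<times> open_box d a b) p = (0::complex)" using False by (auto simp: p)
        ultimately show ?thesis by simp
      qed
    qed
    show "AE p in lebesgue_all. norm (rep_l2 u p * cnj (zero_ext d (\<phi> k) p)) \<le> w p" for k
    proof (rule AE_I2)
      fix p :: "nat \<times> (nat \<Rightarrow> real)"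
      obtain j x where p: "p = (j, x)" by (cases p)
      have "cmod (zero_ext d (\<phi> k) p) \<le> indicator ({d} \<times> closed_box d a b) p"
      proof (cases "j = d \<and> x \<in> open_box d a b")
        case True
        then have "x \<in> closed_box d a b" by (auto simp: open_box_def closed_box_def less_imp_le)
        then show ?thesis using True \<beta>b[of k x] by (simp add: p zero_ext_def \<phi>\<beta>)
      next
        case False
        then have "zero_ext d (\<phi> k) p = 0" using \<phi>0[of x k] by (auto simp: p zero_ext_def)
        then show ?thesis by simp
      qed
      then show "norm (rep_l2 u p * cnj (zero_ext d (\<phi> k) p)) \<le> w p"
        unfolding w_def norm_mult by (intro mult_left_mono) auto
    qed
  qed
  moreover have "(LINT p|lebesgue_all. rep_l2 u p * cnj (zero_ext d (\<phi> k) p)) = 0" for k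
    using u[OF \<phi>[of k]] cinner_abs_l2[OF sq_int_rep_l2[of u] sq_int_test(1)[OF \<phi>[of k]]]
    by (simp add: abs_rep_l2 l2_of_zero_ext)
  ultimately show ?thesis by (simp add: LIMSEQ_const_iff)
qed

text \<open>The integrals over all sub-boxes vanish, hence over all measurable sets by a Dynkin
  argument, so the integrand is 0 almost everywhere. The Borel function f stands in for
  \<open>rep_l2 u\<close>, since the argument runs in the product measure before completion.\<close>

lemma vanishes_on_box:
  assumes u: "\<And>\<phi>. \<phi> \<in> test_functions d \<Omega> \<Longrightarrow> cinner u (l2_of d \<phi>) = 0"
    and box: "closed_box d a b \<subseteq> \<Omega>"
    and f: "f \<in> borel_measurable borel" "AE p in lebesgue_all. rep_l2 u p = f p"
  shows "AE x in lborel_dim d. x \<in> open_box d a b \<longrightarrow> f (d, x) = 0"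
proof -
  define Q where "Q = open_box d a b"
  define g where "g x = indicator ({d} \<times> Q) (d, x) * f (d, x)" for x
  have Qs: "Q \<in> sets (lborel_dim d)" unfolding Q_def by (rule open_box_sets)
  have Qb: "{d} \<times> Q \<in> sets borel" by (intro slice_borel sets_lborel_dim_borel(1)[OF Qs])
  have fm: "f \<in> borel_measurable lebesgue_all" by (rule measurable_lebesgue_allI[OF f(1)])
  have int_all: "integrable lebesgue_all (\<lambda>p. indicator ({d} \<times> Q) p * f p)"
  proof -
    have cb: "{d} \<times> closed_box d a b \<in> sets lebesgue_all" "emeasure lebesgue_all ({d} \<times> closed_box d a b) < \<infinity>"
      using emeasure_compact_slice[OF compact_closed_box] by (auto intro: sets_lebesgue_allI)
    have i: "integrable lebesgue_all (\<lambda>p. rep_l2 u p * cnj (1 * indicator ({d} \<times> closed_box d a b) p))"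
      by (rule sq_int_mult_cnj[OF sq_int_rep_l2 sq_int_indicator[OF cb]])
    show ?thesis
    proof (rule Bochner_Integration.integrable_bound[OF i])
      show "(\<lambda>p. indicator ({d} \<times> Q) p * f p) \<in> borel_measurable lebesgue_all"
        using fm sets_lebesgue_allI[OF Qb] by measurable
      show "AE p in lebesgue_all. norm (indicator ({d} \<times> Q) p * f p) \<le> norm (rep_l2 u p * cnj (1 * indicator ({d} \<times> closed_box d a b) p))"
        using f(2) by eventually_elim (auto simp: Q_def open_box_def closed_box_def less_imp_le split: split_indicator)
    qed
  qed
  have gm: "(\<lambda>p. indicator ({d} \<times> Q) p * f p) \<in> borel_measurable borel" using f(1) Qb by measurable
  have g_int: "integrable (lborel_dim d) g"
    unfolding g_def by (rule integrable_slice[OF gm int_all])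
  have space: "space (lborel_dim d) = Rn d" by (simp add: space_lborel_dim Rn_def)
  have conv: "(LINT x:A|lborel_dim d. g x) = (LINT p|lebesgue_all. indicator ({d} \<times> (A \<inter> Q)) p * rep_l2 u p)"
    if A: "A \<in> sets (lborel_dim d)" for A
  proof -
    have Ab: "{d} \<times> A \<in> sets borel" by (intro slice_borel sets_lborel_dim_borel(1)[OF A])
    define G where "G p = indicator ({d} \<times> A) p * (indicator ({d} \<times> Q) p * f p)" for p
    have Gm: "G \<in> borel_measurable borel" unfolding G_def using Ab gm by measurable
    have "(LINT x:A|lborel_dim d. g x) = (LINT x|lborel_dim d. G (d, x))"
      unfolding set_lebesgue_integral_def g_def G_def
      by (rule Bochner_Integration.integral_cong) (auto split: split_indicator)
    also have "\<dots> = (LINT x|lebesgue_dim d. G (d, x))"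
      unfolding lebesgue_dim_def
      by (rule integral_completion[symmetric]) (rule measurable_compose[OF measurable_Pair_lborel_dim Gm])
    also have "\<dots> = (LINT p|lebesgue_all. indicator ({d} \<times> UNIV) p * G p)"
      by (rule integral_slice[OF measurable_lebesgue_allI[OF Gm]])
    also have "\<dots> = (LINT p|lebesgue_all. indicator ({d} \<times> (A \<inter> Q)) p * rep_l2 u p)"
    proof (rule integral_cong_AE)
      show "(\<lambda>p. indicator ({d} \<times> UNIV) p * G p) \<in> borel_measurable lebesgue_all"
        using measurable_lebesgue_allI[OF Gm] sets_lebesgue_allI[OF slice_borel[of UNIV d]] by measurable
      have "{d} \<times> (A \<inter> Q) \<in> sets lebesgue_all"
        using sets_lborel_dim_borel(1)[OF A] sets_lborel_dim_borel(1)[OF Qs] by (intro sets_lebesgue_allI slice_borel) auto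
      then show "(\<lambda>p. indicator ({d} \<times> (A \<inter> Q)) p * rep_l2 u p) \<in> borel_measurable lebesgue_all"
        using sq_int_measurable[OF sq_int_rep_l2[of u]] by measurable
      show "AE p in lebesgue_all. indicator ({d} \<times> UNIV) p * G p = indicator ({d} \<times> (A \<inter> Q)) p * rep_l2 u p"
        using f(2) by eventually_elim (auto simp: G_def split: split_indicator)
    qed
    finally show ?thesis .
  qed
  have box0: "(LINT x:open_box d a' b'|lborel_dim d. g x) = 0" for a' b'
  proof -
    \<comment> \<open>An arbitrary box is cut down to Q, which keeps the corresponding closed box
      inside \<Omega>.\<close>
    have "open_box d a' b' \<inter> Q = open_box d (\<lambda>i. max (a' i) (a i)) (\<lambda>i. min (b' i) (b i))"
      unfolding Q_def open_box_def by auto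
    moreover have "closed_box d (\<lambda>i. max (a' i) (a i)) (\<lambda>i. min (b' i) (b i)) \<subseteq> \<Omega>"
      using box unfolding closed_box_def by auto
    ultimately show ?thesis
      unfolding conv[OF open_box_sets] using box_integral_zero[OF u] by simp
  qed
  have all0: "(LINT x:A|lborel_dim d. g x) = 0" if "A \<in> sets (lborel_dim d)" for A
  proof -
    have "Int_stable (range (\<lambda>(a, b). open_box d a b))"
    proof (rule Int_stableI)
      fix X Y assume "X \<in> range (\<lambda>(a, b). open_box d a b)" "Y \<in> range (\<lambda>(a, b). open_box d a b)"
      then obtain a1 b1 a2 b2 where "X = open_box d a1 b1" "Y = open_box d a2 b2" by auto
      then have "X \<inter> Y = open_box d (\<lambda>i. max (a1 i) (a2 i)) (\<lambda>i. min (b1 i) (b2 i))"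
        unfolding open_box_def by auto
      then show "X \<inter> Y \<in> range (\<lambda>(a, b). open_box d a b)" by auto
    qed
    moreover have "range (\<lambda>(a, b). open_box d a b) \<subseteq> Pow (Rn d)" by (auto simp: open_box_def)
    moreover have "A \<in> sigma_sets (Rn d) (range (\<lambda>(a, b). open_box d a b))"
      using that by (simp add: sets_lborel_dim_boxes)
    ultimately show ?thesis
    proof (induction rule: sigma_sets_induct_disjoint)
      case (basic A)
      then show ?case using box0 by auto
    next
      case empty
      then show ?case by (simp add: set_lebesgue_integral_def)
    next
      case (compl A)
      have A: "A \<in> sets (lborel_dim d)" using compl(1) by (simp add: sets_lborel_dim_boxes)
      have gA: "set_integrable (lborel_dim d) B g" if "B \<in> sets (lborel_dim d)" for B
        unfolding set_integrable_def using integrable_mult_indicator[OF that g_int] .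
      have top: "Rn d \<in> sets (lborel_dim d)" using sets.top[of "lborel_dim d"] by (simp add: space)
      have "(LINT x:Rn d|lborel_dim d. g x) = (LINT x:Q|lborel_dim d. g x)"
        unfolding set_lebesgue_integral_def g_def Q_def
        by (rule Bochner_Integration.integral_cong) (auto simp: space split: split_indicator)
      also have "\<dots> = 0" unfolding Q_def by (rule box0)
      finally have R: "(LINT x:Rn d|lborel_dim d. g x) = 0" .
      have "Rn d = A \<union> (Rn d - A)" using sets.sets_into_space[OF A] by (auto simp: space)
      then have "(LINT x:Rn d|lborel_dim d. g x) = (LINT x:A|lborel_dim d. g x) + (LINT x:(Rn d - A)|lborel_dim d. g x)"
        using set_integral_Un[of A "Rn d - A" "lborel_dim d" g] gA[OF A] gA[OF sets.Diff[OF top A]] by auto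
      then show ?case using R compl(2) by simp
    next
      case (union A)
      have A: "A i \<in> sets (lborel_dim d)" for i using union(2) by (auto simp: sets_lborel_dim_boxes)
      have "(LINT x:(\<Union>i. A i)|lborel_dim d. g x) = (\<Sum>i. LINT x:A i|lborel_dim d. g x)"
      proof (rule lebesgue_integral_countable_add[OF A])
        show "\<And>i j. i \<noteq> j \<Longrightarrow> A i \<inter> A j = {}" using union(1) by (auto simp: disjoint_family_on_def)
        show "set_integrable (lborel_dim d) (\<Union>i. A i) g"
          unfolding set_integrable_def using A by (intro integrable_mult_indicator g_int) auto
      qed
      then show ?case using union(3) by simp
    qed
  qed
  interpret product_sigma_finite "\<lambda>_::nat. lborel :: real measure" by standard
  interpret sigma_finite_measure "lborel_dim d" unfolding lborel_dim_def by (rule sigma_finite) simp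
  have "AE x in lborel_dim d. g x = 0" by (rule density_zero[OF g_int all0])
  then show ?thesis by eventually_elim (auto simp: g_def Q_def)
qed

text \<open>All points of \<open>Rn d\<close> share their coordinates from d on, so a basic
  neighbourhood in the product topology is governed by d intervals. Rational endpoints make the
  boxes a countable family.\<close>

lemma rational_box:
  assumes U: "open U" and x: "x \<in> U \<inter> Rn d"
  obtains a b where "a \<in> {..<d} \<rightarrow>\<^sub>E \<rat>" "b \<in> {..<d} \<rightarrow>\<^sub>E \<rat>" "x \<in> open_box d a b" "closed_box d a b \<subseteq> U \<inter> Rn d"
proof -
  have "openin (product_topology (\<lambda>i. euclidean) UNIV) U" using U by (simp add: euclidean_product_topology)
  then obtain X where X: "x \<in> Pi\<^sub>E UNIV X" "\<And>i. open (X i)" "Pi\<^sub>E UNIV X \<subseteq> U"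
    using product_topology_open_contains_basis[of "\<lambda>i. euclidean" UNIV U x] x by auto
  have "\<exists>a b. a \<in> \<rat> \<and> b \<in> \<rat> \<and> a < x i \<and> x i < b \<and> {a..b} \<subseteq> X i" for i
  proof -
    have "x i \<in> X i" using X(1) by auto
    then obtain e where e: "e > 0" "\<And>y. dist y (x i) < e \<Longrightarrow> y \<in> X i"
      using X(2)[of i] unfolding open_dist by blast
    obtain a where a: "a \<in> \<rat>" "x i - e < a" "a < x i" using Rats_dense_in_real[of "x i - e" "x i"] e(1) by auto
    obtain b where b: "b \<in> \<rat>" "x i < b" "b < x i + e" using Rats_dense_in_real[of "x i" "x i + e"] e(1) by auto
    have "{a..b} \<subseteq> X i" using a b by (auto intro!: e(2) simp: dist_real_def)
    then show ?thesis using a b by blast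
  qed
  then obtain a b where ab: "\<And>i. a i \<in> \<rat>" "\<And>i. b i \<in> \<rat>" "\<And>i. a i < x i" "\<And>i. x i < b i" "\<And>i. {a i..b i} \<subseteq> X i"
    by metis
  show ?thesis
  proof (rule that[of "restrict a {..<d}" "restrict b {..<d}"])
    show "x \<in> open_box d (restrict a {..<d}) (restrict b {..<d})"
      using x ab by (auto simp: open_box_def)
    show "closed_box d (restrict a {..<d}) (restrict b {..<d}) \<subseteq> U \<inter> Rn d"
    proof
      fix y assume y: "y \<in> closed_box d (restrict a {..<d}) (restrict b {..<d})"
      then have R: "y \<in> Rn d" by (simp add: closed_box_def)
      have "y i \<in> X i" for i
      proof (cases "i < d")
        case True
        then have "y i \<in> {a i..b i}" using y by (auto simp: closed_box_def)
        then show ?thesis using ab(5) by blast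
      next
        case False
        then have "y i = x i" using R x by (auto simp: mem_Rn_iff)
        then show ?thesis using X(1) by auto
      qed
      then show "y \<in> U \<inter> Rn d" using X(3) R by auto
    qed
  qed (use ab in auto)
qed

lemma completion_borel_complex:
  fixes f :: "nat \<times> (nat \<Rightarrow> real) \<Rightarrow> complex"
  assumes "f \<in> borel_measurable lebesgue_all"
  obtains g where "g \<in> borel_measurable borel" "AE p in lebesgue_all. f p = g p"
proof -
  have "(\<lambda>p. Re (f p)) \<in> borel_measurable (completion lborel_all)" "(\<lambda>p. Im (f p)) \<in> borel_measurable (completion lborel_all)"
    using assms unfolding lebesgue_all_def by measurable
  note m = this
  obtain r where r: "r \<in> borel_measurable lborel_all" "AE p in lborel_all. Re (f p) = r p"
    using completion_ex_borel_measurable_real[OF m(1)] by blast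
  obtain i where i: "i \<in> borel_measurable lborel_all" "AE p in lborel_all. Im (f p) = i p"
    using completion_ex_borel_measurable_real[OF m(2)] by blast
  have "(\<lambda>p. complex_of_real (r p) + \<i> * complex_of_real (i p)) \<in> borel_measurable borel"
    using r(1) i(1) by simp
  moreover have "AE p in lborel_all. f p = complex_of_real (r p) + \<i> * complex_of_real (i p)"
    using r(2) i(2) by eventually_elim (simp add: complex_eq_iff)
  then have "AE p in lebesgue_all. f p = complex_of_real (r p) + \<i> * complex_of_real (i p)"
    unfolding lebesgue_all_def by (rule AE_completion)
  ultimately show ?thesis using that by blast
qed

text \<open>Countably many rational boxes exhaust \<Omega>, so their exceptional sets together are
  null. Uniqueness of weak derivatives and density of the test functions both rest on this.\<close>

lemma orthogonal_to_test_functions: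
  assumes \<Omega>: "\<Omega> = U \<inter> Rn d" "open U" and uin: "u \<in> l2_on d \<Omega>"
    and u: "\<And>\<phi>. \<phi> \<in> test_functions d \<Omega> \<Longrightarrow> cinner u (l2_of d \<phi>) = 0"
  shows "u = 0"
proof -
  obtain f where f: "f \<in> borel_measurable borel" "AE p in lebesgue_all. rep_l2 u p = f p"
    using completion_borel_complex[OF sq_int_measurable[OF sq_int_rep_l2]] by blast
  define I where "I = {(a, b). a \<in> {..<d} \<rightarrow>\<^sub>E \<rat> \<and> b \<in> {..<d} \<rightarrow>\<^sub>E \<rat> \<and> closed_box d a b \<subseteq> \<Omega>}"
  have "countable ({..<d} \<rightarrow>\<^sub>E (\<rat> :: real set))" by (intro countable_PiE) (auto simp: countable_rat)
  then have "countable (({..<d} \<rightarrow>\<^sub>E (\<rat> :: real set)) \<times> ({..<d} \<rightarrow>\<^sub>E (\<rat> :: real set)))" by (intro countable_SIGMA)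
  then have I: "countable I" by (rule countable_subset[rotated]) (auto simp: I_def)
  have "AE x in lborel_dim d. \<forall>ab\<in>I. x \<in> open_box d (fst ab) (snd ab) \<longrightarrow> f (d, x) = 0"
    unfolding AE_ball_countable[OF I]
    by (intro ballI vanishes_on_box[OF u _ f]) (auto simp: I_def)
  then have in_\<Omega>: "AE x in lborel_dim d. x \<in> \<Omega> \<longrightarrow> f (d, x) = 0"
  proof eventually_elim
    case (elim x)
    show ?case
    proof
      assume "x \<in> \<Omega>"
      then obtain a b where ab: "a \<in> {..<d} \<rightarrow>\<^sub>E \<rat>" "b \<in> {..<d} \<rightarrow>\<^sub>E \<rat>" "x \<in> open_box d a b" "closed_box d a b \<subseteq> U \<inter> Rn d"
        using rational_box[OF \<Omega>(2), of x d] unfolding \<Omega>(1) by blast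
      then have "(a, b) \<in> I" unfolding I_def \<Omega>(1) by blast
      from bspec[OF elim this] show "f (d, x) = 0" using ab(3) by simp
    qed
  qed
  have "AE p in lebesgue_all. p \<notin> {d} \<times> \<Omega> \<longrightarrow> rep_l2 u p = 0" using uin by (simp add: l2_on_def)
  then have out: "AE p in lebesgue_all. p \<notin> {d} \<times> \<Omega> \<longrightarrow> f p = 0" using f(2) by eventually_elim auto
  then have "AE x in lborel_dim d. (d, x) \<notin> {d} \<times> \<Omega> \<longrightarrow> f (d, x) = 0"
    unfolding lebesgue_all_def AE_completion_iff by (rule AE_slice)
  with in_\<Omega> have "AE x in lborel_dim d. f (d, x) = 0" by eventually_elim auto
  then have "AE x in lebesgue_dim d. f (d, x) = 0" unfolding lebesgue_dim_def by (rule AE_completion)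
  then have "AE p in lebesgue_all. p \<in> {d} \<times> UNIV \<longrightarrow> f p = 0"
    by (subst AE_lebesgue_slice_iff[symmetric]) (use measurable_lebesgue_allI[OF f(1)] in measurable)
  with out f(2) have "AE p in lebesgue_all. rep_l2 u p = 0" by eventually_elim auto
  then have "abs_l2 (rep_l2 u) = abs_l2 (\<lambda>_. 0)" by (subst abs_l2_eq_iff[OF sq_int_rep_l2 sq_int_zero])
  then show ?thesis by (simp add: abs_rep_l2 zero_l2.abs_eq)
qed

section \<open>Weak derivatives and the heat semigroup\<close>

text \<open>Openness is relative: \<open>Rn d\<close> fixes all coordinates from d on and has empty
  interior in the type.\<close>

definition open_domain :: "nat \<Rightarrow> (nat \<Rightarrow> real) set \<Rightarrow> bool" where
  "open_domain d \<Omega> \<longleftrightarrow> (\<exists>U. open U \<and> \<Omega> = U \<inter> Rn d)"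

lemma sets_lborel_dimI:
  assumes "A \<in> sets borel" "A \<subseteq> Rn d"
  shows "A \<in> sets (lborel_dim d)"
proof -
  have "Pair d -` ({d} \<times> A) \<inter> space (lborel_dim d) \<in> sets (lborel_dim d)"
    by (rule measurable_sets[OF measurable_Pair_lborel_dim slice_borel[OF assms(1)]])
  moreover have "Pair d -` ({d} \<times> A) \<inter> space (lborel_dim d) = A"
    using assms(2) by (auto simp: space_lborel_dim Rn_def)
  ultimately show ?thesis by simp
qed

lemma sets_lebesgue_dimI: "A \<in> sets (lborel_dim d) \<Longrightarrow> A \<in> sets (lebesgue_dim d)"
  unfolding lebesgue_dim_def by (rule sets_completionI_sets)

lemma open_domain_sets: "open_domain d \<Omega> \<Longrightarrow> \<Omega> \<in> sets (lebesgue_dim d)"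
  unfolding open_domain_def
  by (elim exE conjE, hypsubst)
    (rule sets_lebesgue_dimI[OF sets_lborel_dimI[OF sets.Int[OF borel_open Rn_borel] Int_lower2]])

lemma closed_l2_on: "\<omega> \<in> sets (lebesgue_dim d) \<Longrightarrow> closed (l2_on d \<omega>)"
  by (rule projected_space.closed_X[OF projected_space_restrict_l2])

lemma subspace_closure:
  fixes T :: "'a::real_normed_vector set"
  assumes "subspace T"
  shows "subspace (closure T)"
proof (rule subspaceI)
  show "0 \<in> closure T" using subspace_0[OF assms] closure_subset by blast
  fix u v assume uv: "u \<in> closure T" "v \<in> closure T"
  obtain x where x: "\<And>n. x n \<in> T" "x \<longlonglongrightarrow> u" using uv(1) unfolding closure_sequential by blast
  obtain y where y: "\<And>n. y n \<in> T" "y \<longlonglongrightarrow> v" using uv(2) unfolding closure_sequential by blast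
  have "x n + y n \<in> T" for n by (rule subspace_add[OF assms x(1) y(1)])
  then show "u + v \<in> closure T"
    unfolding closure_sequential using tendsto_add[OF x(2) y(2)] by (intro exI[of _ "\<lambda>n. x n + y n"] conjI allI)
  have "c *\<^sub>R x n \<in> T" for c n by (rule subspace_scale[OF assms x(1)])
  then show "c *\<^sub>R u \<in> closure T" for c
    unfolding closure_sequential using tendsto_scaleR[OF tendsto_const x(2), of c]
    by (intro exI[of _ "\<lambda>n. c *\<^sub>R x n"] conjI allI)
qed

locale domain =
  fixes d :: nat and \<Omega> :: "(nat \<Rightarrow> real) set"
  assumes open_domain: "open_domain d \<Omega>"
begin

lemma \<Omega>_sets: "\<Omega> \<in> sets (lebesgue_dim d)"
  by (rule open_domain_sets[OF open_domain])

lemma zero_if_orthogonal: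
  assumes "u \<in> l2_on d \<Omega>" "\<And>\<phi>. \<phi> \<in> test_functions d \<Omega> \<Longrightarrow> cinner u (l2_of d \<phi>) = 0"
  shows "u = 0"
  using open_domain orthogonal_to_test_functions[OF _ _ assms] unfolding open_domain_def by blast

lemma weak_deriv_unique:
  assumes i: "i < d" and "weak_deriv d \<Omega> i u g" "weak_deriv d \<Omega> i u h"
  shows "g = h"
proof -
  have "g - h = 0"
  proof (rule zero_if_orthogonal)
    show "g - h \<in> l2_on d \<Omega>" using assms by (intro l2_on_diff) (auto simp: weak_deriv_iff)
    show "cinner (g - h) (l2_of d \<phi>) = 0" if "\<phi> \<in> test_functions d \<Omega>" for \<phi>
    proof -
      have "- cinner g (l2_of d \<phi>) = - cinner h (l2_of d \<phi>)"
        using assms that unfolding weak_deriv_iff[OF i] by metis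
      then show ?thesis by (simp add: cinner_diff)
    qed
  qed
  then show ?thesis by simp
qed

lemma wderiv_eq: "i < d \<Longrightarrow> weak_deriv d \<Omega> i u g \<Longrightarrow> wderiv d \<Omega> i u = g"
  unfolding wderiv_def by (rule the_equality) (auto intro: weak_deriv_unique)

lemma weak_deriv_add:
  "i < d \<Longrightarrow> weak_deriv d \<Omega> i u g \<Longrightarrow> weak_deriv d \<Omega> i v h \<Longrightarrow> weak_deriv d \<Omega> i (u + v) (g + h)"
  by (simp add: weak_deriv_iff l2_on_add cinner_add_left)

lemma weak_deriv_scaleC:
  "i < d \<Longrightarrow> weak_deriv d \<Omega> i u g \<Longrightarrow> weak_deriv d \<Omega> i (c *\<^sub>C u) (c *\<^sub>C g)"
  by (simp add: weak_deriv_iff l2_on_scaleC cinner_scaleC_left)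

lemma weak_deriv_limit:
  assumes i: "i < d" and w: "\<And>n::nat. weak_deriv d \<Omega> i (u n) (g n)" and u: "u \<longlonglongrightarrow> u'" and g: "g \<longlonglongrightarrow> g'"
  shows "weak_deriv d \<Omega> i u' g'"
  unfolding weak_deriv_iff[OF i]
proof (intro conjI ballI)
  show "u' \<in> l2_on d \<Omega>" "g' \<in> l2_on d \<Omega>"
    using w closed_sequentially[OF closed_l2_on[OF \<Omega>_sets] _ u] closed_sequentially[OF closed_l2_on[OF \<Omega>_sets] _ g]
    by (auto simp: weak_deriv_iff[OF i])
  fix \<phi> assume \<phi>: "\<phi> \<in> test_functions d \<Omega>"
  have "(\<lambda>n. cinner (u n) (l2_of d (partial_deriv i \<phi>))) \<longlonglongrightarrow> cinner u' (l2_of d (partial_deriv i \<phi>))"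
    by (intro tendsto_cinner u tendsto_const)
  moreover have "cinner (u n) (l2_of d (partial_deriv i \<phi>)) = - cinner (g n) (l2_of d \<phi>)" for n
    using w[of n] \<phi> unfolding weak_deriv_iff[OF i] by blast
  ultimately have "(\<lambda>n. - cinner (g n) (l2_of d \<phi>)) \<longlonglongrightarrow> cinner u' (l2_of d (partial_deriv i \<phi>))" by simp
  moreover have "(\<lambda>n. - cinner (g n) (l2_of d \<phi>)) \<longlonglongrightarrow> - cinner g' (l2_of d \<phi>)"
    by (intro tendsto_minus tendsto_cinner g tendsto_const)
  ultimately show "cinner u' (l2_of d (partial_deriv i \<phi>)) = - cinner g' (l2_of d \<phi>)" by (rule LIMSEQ_unique)
qed

lemma weak_deriv_test:
  assumes i: "i < d" and \<phi>: "\<phi> \<in> test_functions d \<Omega>"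
  shows "weak_deriv d \<Omega> i (l2_of d \<phi>) (l2_of d (partial_deriv i \<phi>))"
  unfolding weak_deriv_iff[OF i]
  using l2_of_in[OF \<phi>] l2_of_in[OF test_functions_partial[OF \<phi> i]] integration_by_parts[OF \<phi> _ i] by blast

section \<open>Sobolev spaces and form domains\<close>

lemma H1_I: "(\<And>i. i < d \<Longrightarrow> weak_deriv d \<Omega> i u (g i)) \<Longrightarrow> u \<in> l2_on d \<Omega> \<Longrightarrow> u \<in> H1 d \<Omega>"
  unfolding H1_def by blast

lemma H1_weak_deriv: "u \<in> H1 d \<Omega> \<Longrightarrow> i < d \<Longrightarrow> weak_deriv d \<Omega> i u (wderiv d \<Omega> i u)"
  unfolding H1_def using wderiv_eq by auto

lemma H1_in: "u \<in> H1 d \<Omega> \<Longrightarrow> u \<in> l2_on d \<Omega>"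
  unfolding H1_def by blast

lemma wderiv_in: "u \<in> H1 d \<Omega> \<Longrightarrow> i < d \<Longrightarrow> wderiv d \<Omega> i u \<in> l2_on d \<Omega>"
  using H1_weak_deriv weak_deriv_iff by blast

lemma H1_add: "u \<in> H1 d \<Omega> \<Longrightarrow> v \<in> H1 d \<Omega> \<Longrightarrow> u + v \<in> H1 d \<Omega>"
  by (rule H1_I[OF weak_deriv_add]) (auto intro: H1_weak_deriv l2_on_add H1_in)

lemma H1_scaleC: "u \<in> H1 d \<Omega> \<Longrightarrow> c *\<^sub>C u \<in> H1 d \<Omega>"
  by (rule H1_I[OF weak_deriv_scaleC]) (auto intro: H1_weak_deriv l2_on_scaleC H1_in)

lemma wderiv_add: "u \<in> H1 d \<Omega> \<Longrightarrow> v \<in> H1 d \<Omega> \<Longrightarrow> i < d \<Longrightarrow> wderiv d \<Omega> i (u + v) = wderiv d \<Omega> i u + wderiv d \<Omega> i v"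
  by (intro wderiv_eq weak_deriv_add H1_weak_deriv)

lemma wderiv_scaleC: "u \<in> H1 d \<Omega> \<Longrightarrow> i < d \<Longrightarrow> wderiv d \<Omega> i (c *\<^sub>C u) = c *\<^sub>C wderiv d \<Omega> i u"
  by (intro wderiv_eq weak_deriv_scaleC H1_weak_deriv)

lemma wderiv_scaleR: "u \<in> H1 d \<Omega> \<Longrightarrow> i < d \<Longrightarrow> wderiv d \<Omega> i (c *\<^sub>R u) = c *\<^sub>R wderiv d \<Omega> i u"
  by (simp add: scaleR_eq_scaleC wderiv_scaleC)

lemma H1_scaleR: "u \<in> H1 d \<Omega> \<Longrightarrow> c *\<^sub>R u \<in> H1 d \<Omega>"
  by (simp add: scaleR_eq_scaleC H1_scaleC)

lemma wderiv_diff: "u \<in> H1 d \<Omega> \<Longrightarrow> v \<in> H1 d \<Omega> \<Longrightarrow> i < d \<Longrightarrow> wderiv d \<Omega> i (u - v) = wderiv d \<Omega> i u - wderiv d \<Omega> i v"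
  using wderiv_add[of u "(-1) *\<^sub>R v" i] wderiv_scaleR[of v i "-1"] H1_scaleR[of v "-1"] by simp

lemma test_H1:
  assumes \<phi>: "\<phi> \<in> test_functions d \<Omega>"
  shows "l2_of d \<phi> \<in> H1 d \<Omega>" "i < d \<Longrightarrow> wderiv d \<Omega> i (l2_of d \<phi>) = l2_of d (partial_deriv i \<phi>)"
proof -
  show "l2_of d \<phi> \<in> H1 d \<Omega>"
    by (rule H1_I[OF _ l2_of_in[OF \<phi>]]) (rule weak_deriv_test[OF _ \<phi>])
  show "i < d \<Longrightarrow> wderiv d \<Omega> i (l2_of d \<phi>) = l2_of d (partial_deriv i \<phi>)"
    by (rule wderiv_eq[OF _ weak_deriv_test[OF _ \<phi>]])
qed

lemma H1_limit:
  assumes u: "\<And>n::nat. u n \<in> H1 d \<Omega>" "u \<longlonglongrightarrow> u'" and g: "\<And>i. i < d \<Longrightarrow> (\<lambda>n. wderiv d \<Omega> i (u n)) \<longlonglongrightarrow> g i"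
  shows "u' \<in> H1 d \<Omega>" "i < d \<Longrightarrow> wderiv d \<Omega> i u' = g i"
proof -
  have w: "weak_deriv d \<Omega> i u' (g i)" if "i < d" for i
    by (rule weak_deriv_limit[OF that H1_weak_deriv[OF u(1) that] u(2) g[OF that]])
  show "u' \<in> H1 d \<Omega>"
    by (rule H1_I[OF w closed_sequentially[OF closed_l2_on[OF \<Omega>_sets] H1_in[OF u(1)] u(2)]])
  show "i < d \<Longrightarrow> wderiv d \<Omega> i u' = g i" by (rule wderiv_eq[OF _ w])
qed

text \<open>Trades the H1 norm for separate smallness of the function and of each derivative, from
  which approximating sequences can be read off.\<close>

lemma H1_0_iff:
  "u \<in> H1_0 d \<Omega> \<longleftrightarrow> u \<in> H1 d \<Omega> \<and> (\<forall>\<epsilon>>0. \<exists>\<phi>\<in>test_functions d \<Omega>. norm (u - l2_of d \<phi>) < \<epsilon> \<and>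
     (\<forall>i<d. norm (wderiv d \<Omega> i u - l2_of d (partial_deriv i \<phi>)) < \<epsilon>))"
proof -
  define N where "N \<phi> = norm (u - l2_of d \<phi>)" for \<phi>
  define G where "G \<phi> i = norm (wderiv d \<Omega> i u - l2_of d (partial_deriv i \<phi>))" for \<phi> i
  have eq: "H1_norm d \<Omega> (u - l2_of d \<phi>) = sqrt ((N \<phi>)\<^sup>2 + (\<Sum>i<d. (G \<phi> i)\<^sup>2))"
    if "u \<in> H1 d \<Omega>" "\<phi> \<in> test_functions d \<Omega>" for \<phi>
    unfolding H1_norm_def N_def G_def using that test_H1[OF that(2)] by (simp add: wderiv_diff)
  have ge: "N \<phi> \<le> sqrt ((N \<phi>)\<^sup>2 + (\<Sum>i<d. (G \<phi> i)\<^sup>2))" for \<phi>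
    by (rule real_le_rsqrt) (simp add: sum_nonneg)
  have ge': "G \<phi> i \<le> sqrt ((N \<phi>)\<^sup>2 + (\<Sum>i<d. (G \<phi> i)\<^sup>2))" if "i < d" for \<phi> i
  proof (rule real_le_rsqrt)
    have "(G \<phi> i)\<^sup>2 \<le> (\<Sum>i<d. (G \<phi> i)\<^sup>2)" using that by (intro member_le_sum) auto
    then show "(G \<phi> i)\<^sup>2 \<le> (N \<phi>)\<^sup>2 + (\<Sum>i<d. (G \<phi> i)\<^sup>2)" by (simp add: add_increasing)
  qed
  have le: "sqrt ((N \<phi>)\<^sup>2 + (\<Sum>i<d. (G \<phi> i)\<^sup>2)) \<le> N \<phi> + (\<Sum>i<d. G \<phi> i)" for \<phi>
  proof -
    have "sqrt ((N \<phi>)\<^sup>2 + (\<Sum>i<d. (G \<phi> i)\<^sup>2)) \<le> sqrt ((N \<phi>)\<^sup>2) + sqrt (\<Sum>i<d. (G \<phi> i)\<^sup>2)"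
      by (rule sqrt_add_le_add_sqrt) (auto intro: sum_nonneg)
    also have "sqrt (\<Sum>i<d. (G \<phi> i)\<^sup>2) \<le> (\<Sum>i<d. G \<phi> i)"
      using L2_set_le_sum[of "{..<d}" "G \<phi>"] by (simp add: L2_set_def G_def)
    finally show ?thesis by (simp add: N_def)
  qed
  show ?thesis
    unfolding N_def[symmetric] G_def[symmetric]
  proof (intro iffI conjI)
    assume u: "u \<in> H1_0 d \<Omega>"
    then show u1: "u \<in> H1 d \<Omega>" by (simp add: H1_0_def)
    show "\<forall>\<epsilon>>0. \<exists>\<phi>\<in>test_functions d \<Omega>. N \<phi> < \<epsilon> \<and> (\<forall>i<d. G \<phi> i < \<epsilon>)"
    proof (intro allI impI)
      fix \<epsilon> :: real assume "\<epsilon> > 0"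
      then obtain \<phi> where "\<phi> \<in> test_functions d \<Omega>" "H1_norm d \<Omega> (u - l2_of d \<phi>) < \<epsilon>"
        using u by (auto simp: H1_0_def)
      then show "\<exists>\<phi>\<in>test_functions d \<Omega>. N \<phi> < \<epsilon> \<and> (\<forall>i<d. G \<phi> i < \<epsilon>)"
        using eq[OF u1, of \<phi>] ge[of \<phi>] ge'[of _ \<phi>] by (intro bexI[of _ \<phi>]) (auto intro: le_less_trans)
    qed
  next
    assume *: "u \<in> H1 d \<Omega> \<and> (\<forall>\<epsilon>>0. \<exists>\<phi>\<in>test_functions d \<Omega>. N \<phi> < \<epsilon> \<and> (\<forall>i<d. G \<phi> i < \<epsilon>))"
    show "u \<in> H1_0 d \<Omega>"
      unfolding H1_0_def
    proof (intro CollectI conjI allI impI)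
      show "u \<in> H1 d \<Omega>" using * by blast
      fix \<epsilon> :: real assume "\<epsilon> > 0"
      \<comment> \<open>There are d + 1 norms, and each gets an equal share of \<epsilon>.\<close>
      then have "\<epsilon> / (real d + 1) > 0" by simp
      then obtain \<phi> where \<phi>: "\<phi> \<in> test_functions d \<Omega>" "N \<phi> < \<epsilon> / (real d + 1)" "\<And>i. i < d \<Longrightarrow> G \<phi> i < \<epsilon> / (real d + 1)"
        using * by blast
      have "(\<Sum>i<d. G \<phi> i) \<le> (\<Sum>i<d. \<epsilon> / (real d + 1))" using \<phi>(3) by (intro sum_mono) (auto simp: less_imp_le)
      then have "N \<phi> + (\<Sum>i<d. G \<phi> i) < \<epsilon> / (real d + 1) + real d * (\<epsilon> / (real d + 1))" using \<phi>(2) by simp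
      also have "\<dots> = (real d + 1) * (\<epsilon> / (real d + 1))" by (simp only: distrib_right mult_1_left add.commute)
      also have "\<dots> = \<epsilon>" by simp
      finally show "\<exists>\<phi>\<in>test_functions d \<Omega>. H1_norm d \<Omega> (u - l2_of d \<phi>) < \<epsilon>"
        using le[of \<phi>] eq[OF _ \<phi>(1)] * by (intro bexI[OF _ \<phi>(1)]) simp
    qed
  qed
qed

lemma H1_0_limit:
  assumes u: "\<And>n::nat. u n \<in> H1_0 d \<Omega>" "u \<longlonglongrightarrow> u'" and g: "\<And>i. i < d \<Longrightarrow> (\<lambda>n. wderiv d \<Omega> i (u n)) \<longlonglongrightarrow> g i"
  shows "u' \<in> H1_0 d \<Omega>"
proof -
  have u1: "u n \<in> H1 d \<Omega>" for n using u(1) by (simp add: H1_0_def)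
  note lim = H1_limit[OF u1 u(2) g]
  show ?thesis
    unfolding H1_0_iff
  proof (intro conjI allI impI lim)
    fix \<epsilon> :: real assume "\<epsilon> > 0"
    then have e: "\<epsilon> / 2 > 0" by simp
    have "\<forall>\<^sub>F n in sequentially. norm (u n - u') < \<epsilon> / 2"
      using tendstoD[OF u(2) e] by (simp add: dist_norm)
    moreover have "\<forall>\<^sub>F n in sequentially. \<forall>i\<in>{..<d}. norm (wderiv d \<Omega> i (u n) - g i) < \<epsilon> / 2"
      using tendstoD[OF g e] by (intro eventually_ball_finite) (auto simp: dist_norm)
    ultimately have "\<forall>\<^sub>F n in sequentially. norm (u n - u') < \<epsilon> / 2 \<and> (\<forall>i\<in>{..<d}. norm (wderiv d \<Omega> i (u n) - g i) < \<epsilon> / 2)"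
      by eventually_elim auto
    then obtain n where n: "norm (u n - u') < \<epsilon> / 2" "\<And>i. i < d \<Longrightarrow> norm (wderiv d \<Omega> i (u n) - g i) < \<epsilon> / 2"
      by (auto simp: eventually_sequentially)
    obtain \<phi> where \<phi>: "\<phi> \<in> test_functions d \<Omega>" "norm (u n - l2_of d \<phi>) < \<epsilon> / 2"
      "\<And>i. i < d \<Longrightarrow> norm (wderiv d \<Omega> i (u n) - l2_of d (partial_deriv i \<phi>)) < \<epsilon> / 2"
      using u(1)[of n] e unfolding H1_0_iff by blast
    have tri: "norm (a - c) < \<epsilon>" if "norm (b - a) < \<epsilon> / 2" "norm (b - c) < \<epsilon> / 2" for a b c :: l2
      using norm_triangle_ineq4[of "b - c" "b - a"] that by (simp add: algebra_simps)
    show "\<exists>\<phi>\<in>test_functions d \<Omega>. norm (u' - l2_of d \<phi>) < \<epsilon> \<and> (\<forall>i<d. norm (wderiv d \<Omega> i u' - l2_of d (partial_deriv i \<phi>)) < \<epsilon>)"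
      using \<phi>(1) tri[OF n(1) \<phi>(2)] tri[OF n(2) \<phi>(3)] lim(2) by (intro bexI[of _ \<phi>]) auto
  qed
qed

lemma H1_0_H1: "u \<in> H1_0 d \<Omega> \<Longrightarrow> u \<in> H1 d \<Omega>"
  by (simp add: H1_0_def)

lemma H1_0_I:
  assumes "\<And>n::nat. \<phi> n \<in> test_functions d \<Omega>" "(\<lambda>n. l2_of d (\<phi> n)) \<longlonglongrightarrow> u"
    "\<And>i. i < d \<Longrightarrow> (\<lambda>n. l2_of d (partial_deriv i (\<phi> n))) \<longlonglongrightarrow> g i"
  shows "u \<in> H1_0 d \<Omega>" "i < d \<Longrightarrow> wderiv d \<Omega> i u = g i"
proof -
  have t0: "l2_of d (\<phi> n) \<in> H1_0 d \<Omega>" for n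
    unfolding H1_0_iff using test_H1[OF assms(1)[of n]] assms(1)[of n]
    by (auto intro!: bexI[of _ "\<phi> n"])
  have g: "(\<lambda>n. wderiv d \<Omega> i (l2_of d (\<phi> n))) \<longlonglongrightarrow> g i" if "i < d" for i
    using assms(3)[OF that] test_H1(2)[OF assms(1) that] by simp
  show "u \<in> H1_0 d \<Omega>" by (rule H1_0_limit[OF t0 assms(2) g])
  show "i < d \<Longrightarrow> wderiv d \<Omega> i u = g i" by (rule H1_limit(2)[OF H1_0_H1[OF t0] assms(2) g])
qed

lemma H1_0_E:
  assumes "u \<in> H1_0 d \<Omega>"
  obtains \<phi> :: "nat \<Rightarrow> (nat \<Rightarrow> real) \<Rightarrow> complex" where "\<And>n. \<phi> n \<in> test_functions d \<Omega>" "(\<lambda>n. l2_of d (\<phi> n)) \<longlonglongrightarrow> u"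
    "\<And>i. i < d \<Longrightarrow> (\<lambda>n. l2_of d (partial_deriv i (\<phi> n))) \<longlonglongrightarrow> wderiv d \<Omega> i u"
proof -
  have "\<exists>\<phi>\<in>test_functions d \<Omega>. norm (u - l2_of d \<phi>) < inverse (real (Suc n)) \<and>
     (\<forall>i<d. norm (wderiv d \<Omega> i u - l2_of d (partial_deriv i \<phi>)) < inverse (real (Suc n)))" for n
    using assms unfolding H1_0_iff by simp
  then obtain \<phi> where \<phi>: "\<And>n. \<phi> n \<in> test_functions d \<Omega>" "\<And>n. norm (u - l2_of d (\<phi> n)) < inverse (real (Suc n))"
     "\<And>n i. i < d \<Longrightarrow> norm (wderiv d \<Omega> i u - l2_of d (partial_deriv i (\<phi> n))) < inverse (real (Suc n))" by metis
  have lim: "f \<longlonglongrightarrow> a" if "\<And>n. norm (a - f n) < inverse (real (Suc n))" for f :: "nat \<Rightarrow> l2" and a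
    by (rule LIM_zero_cancel, rule Lim_null_comparison[OF _ LIMSEQ_inverse_real_of_nat])
      (use that in \<open>auto simp: norm_minus_commute less_imp_le\<close>)
  show ?thesis by (rule that[OF \<phi>(1) lim[OF \<phi>(2)] lim[OF \<phi>(3)]])
qed

lemma H1_0_add:
  assumes "u \<in> H1_0 d \<Omega>" "v \<in> H1_0 d \<Omega>"
  shows "u + v \<in> H1_0 d \<Omega>"
proof -
  obtain \<phi> :: "nat \<Rightarrow> (nat \<Rightarrow> real) \<Rightarrow> complex" where \<phi>: "\<And>n. \<phi> n \<in> test_functions d \<Omega>" "(\<lambda>n. l2_of d (\<phi> n)) \<longlonglongrightarrow> u"
    "\<And>i. i < d \<Longrightarrow> (\<lambda>n. l2_of d (partial_deriv i (\<phi> n))) \<longlonglongrightarrow> wderiv d \<Omega> i u" by (rule H1_0_E[OF assms(1)]) blast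
  obtain \<psi> :: "nat \<Rightarrow> (nat \<Rightarrow> real) \<Rightarrow> complex" where \<psi>: "\<And>n. \<psi> n \<in> test_functions d \<Omega>" "(\<lambda>n. l2_of d (\<psi> n)) \<longlonglongrightarrow> v"
    "\<And>i. i < d \<Longrightarrow> (\<lambda>n. l2_of d (partial_deriv i (\<psi> n))) \<longlonglongrightarrow> wderiv d \<Omega> i v" by (rule H1_0_E[OF assms(2)]) blast
  have pd: "l2_of d (partial_deriv i (\<lambda>x. \<phi> n x + \<psi> n x)) = l2_of d (partial_deriv i (\<phi> n)) + l2_of d (partial_deriv i (\<psi> n))"
    if "i < d" for i n
    unfolding l2_of_add[OF test_functions_partial[OF \<phi>(1) that] test_functions_partial[OF \<psi>(1) that], symmetric]
    by (rule l2_of_cong) (rule partial_deriv_add[OF test_functions_smooth[OF \<phi>(1)] test_functions_smooth[OF \<psi>(1)] that])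
  show ?thesis
  proof (rule H1_0_I(1))
    show "(\<lambda>x. \<phi> n x + \<psi> n x) \<in> test_functions d \<Omega>" for n by (rule test_functions_add[OF \<phi>(1) \<psi>(1)])
    show "(\<lambda>n. l2_of d (\<lambda>x. \<phi> n x + \<psi> n x)) \<longlonglongrightarrow> u + v"
      unfolding l2_of_add[OF \<phi>(1) \<psi>(1)] by (rule tendsto_add[OF \<phi>(2) \<psi>(2)])
    show "(\<lambda>n. l2_of d (partial_deriv i (\<lambda>x. \<phi> n x + \<psi> n x))) \<longlonglongrightarrow> wderiv d \<Omega> i u + wderiv d \<Omega> i v" if "i < d" for i
      unfolding pd[OF that] by (rule tendsto_add[OF \<phi>(3)[OF that] \<psi>(3)[OF that]])
  qed
qed

lemma H1_0_scaleC:
  assumes "u \<in> H1_0 d \<Omega>"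
  shows "c *\<^sub>C u \<in> H1_0 d \<Omega>"
proof -
  obtain \<phi> :: "nat \<Rightarrow> (nat \<Rightarrow> real) \<Rightarrow> complex" where \<phi>: "\<And>n. \<phi> n \<in> test_functions d \<Omega>" "(\<lambda>n. l2_of d (\<phi> n)) \<longlonglongrightarrow> u"
    "\<And>i. i < d \<Longrightarrow> (\<lambda>n. l2_of d (partial_deriv i (\<phi> n))) \<longlonglongrightarrow> wderiv d \<Omega> i u" by (rule H1_0_E[OF assms(1)]) blast
  have pd: "l2_of d (partial_deriv i (\<lambda>x. c * \<phi> n x)) = c *\<^sub>C l2_of d (partial_deriv i (\<phi> n))" if "i < d" for i n
    unfolding l2_of_cmult[OF test_functions_partial[OF \<phi>(1) that], symmetric]
    by (rule l2_of_cong) (rule partial_deriv_cmult[OF test_functions_smooth[OF \<phi>(1)] that])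
  show ?thesis
  proof (rule H1_0_I(1))
    show "(\<lambda>x. c * \<phi> n x) \<in> test_functions d \<Omega>" for n by (rule test_functions_cmult[OF \<phi>(1)])
    show "(\<lambda>n. l2_of d (\<lambda>x. c * \<phi> n x)) \<longlonglongrightarrow> c *\<^sub>C u"
      unfolding l2_of_cmult[OF \<phi>(1)] by (rule bounded_linear.tendsto[OF bounded_linear_scaleC \<phi>(2)])
    show "(\<lambda>n. l2_of d (partial_deriv i (\<lambda>x. c * \<phi> n x))) \<longlonglongrightarrow> c *\<^sub>C wderiv d \<Omega> i u" if "i < d" for i
      unfolding pd[OF that] by (rule bounded_linear.tendsto[OF bounded_linear_scaleC \<phi>(3)[OF that]])
  qed
qed

lemma form_domain_H1: "u \<in> form_domain bc d \<Omega> \<Longrightarrow> u \<in> H1 d \<Omega>"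
  by (cases bc) (auto intro: H1_0_H1)

lemma form_domain_in: "u \<in> form_domain bc d \<Omega> \<Longrightarrow> u \<in> l2_on d \<Omega>"
  by (rule H1_in[OF form_domain_H1])

lemma form_domain_add: "u \<in> form_domain bc d \<Omega> \<Longrightarrow> v \<in> form_domain bc d \<Omega> \<Longrightarrow> u + v \<in> form_domain bc d \<Omega>"
  by (cases bc) (auto intro: H1_0_add H1_add)

lemma form_domain_scaleC: "u \<in> form_domain bc d \<Omega> \<Longrightarrow> c *\<^sub>C u \<in> form_domain bc d \<Omega>"
  by (cases bc) (auto intro: H1_0_scaleC H1_scaleC)

lemma form_domain_scaleR: "u \<in> form_domain bc d \<Omega> \<Longrightarrow> c *\<^sub>R u \<in> form_domain bc d \<Omega>"
  by (simp add: scaleR_eq_scaleC form_domain_scaleC)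

lemma form_domain_diff: "u \<in> form_domain bc d \<Omega> \<Longrightarrow> v \<in> form_domain bc d \<Omega> \<Longrightarrow> u - v \<in> form_domain bc d \<Omega>"
  using form_domain_add[of u bc "(-1) *\<^sub>R v"] form_domain_scaleR[of v bc "-1"] by simp

lemma form_domain_test: "\<phi> \<in> test_functions d \<Omega> \<Longrightarrow> l2_of d \<phi> \<in> form_domain bc d \<Omega>"
  by (cases bc) (auto intro: test_H1 H1_0_I(1)[where \<phi> = "\<lambda>_. \<phi>"])

lemma form_domain_limit:
  assumes "\<And>n::nat. u n \<in> form_domain bc d \<Omega>" "u \<longlonglongrightarrow> u'" "\<And>i. i < d \<Longrightarrow> (\<lambda>n. wderiv d \<Omega> i (u n)) \<longlonglongrightarrow> g i"
  shows "u' \<in> form_domain bc d \<Omega>" "i < d \<Longrightarrow> wderiv d \<Omega> i u' = g i"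
  using assms H1_limit[of u u' g] H1_0_limit[of u u' g] H1_0_H1 by (cases bc; auto)+

lemma form_domain_0: "0 \<in> form_domain bc d \<Omega>"
proof -
  have "(\<lambda>x. 0) \<in> test_functions d \<Omega>"
    by (rule test_functionsI[where C = "{}"]) (use smooth_cmult[OF smooth_tensor[of d "\<lambda>_. exp_bump"], of 0] smooth_real_exp_bump in auto)
  from form_domain_scaleC[OF form_domain_test[OF this], of 0 bc] have "(0::complex) *\<^sub>C l2_of d (\<lambda>x. 0) \<in> form_domain bc d \<Omega>" .
  then show ?thesis using scaleR_eq_scaleC[of 0 "l2_of d (\<lambda>x. 0)"] by simp
qed

lemma subspace_form_domain: "subspace (form_domain bc d \<Omega>)"
  by (rule subspaceI) (auto intro: form_domain_0 form_domain_add form_domain_scaleR)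

section \<open>The form, its resolvent and the heat semigroup\<close>

definition dform :: "l2 \<Rightarrow> l2 \<Rightarrow> real" where
  "dform u v = (\<Sum>i<d. inner (wderiv d \<Omega> i u) (wderiv d \<Omega> i v))"

lemma Re_energy: "Re (energy_form d \<Omega> u v) = dform u v"
  by (simp add: energy_form_def dform_def inner_eq_Re_cinner)

lemma Im_energy:
  assumes "v \<in> H1 d \<Omega>"
  shows "Im (energy_form d \<Omega> u v) = dform u (\<i> *\<^sub>C v)"
  using assms by (simp add: energy_form_def dform_def inner_eq_Re_cinner wderiv_scaleC cinner_scaleC_right)

lemma dform_add: "u \<in> H1 d \<Omega> \<Longrightarrow> v \<in> H1 d \<Omega> \<Longrightarrow> dform (u + v) w = dform u w + dform v w"
  by (simp add: dform_def wderiv_add inner_add_left sum.distrib)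

lemma dform_scaleR: "u \<in> H1 d \<Omega> \<Longrightarrow> dform (c *\<^sub>R u) w = c * dform u w"
  by (simp add: dform_def wderiv_scaleR sum_distrib_left)

lemma dform_commute: "dform u v = dform v u"
  by (simp add: dform_def inner_commute)

lemma dform_nonneg: "dform u u \<ge> 0"
  by (simp add: dform_def sum_nonneg)

text \<open>The form domain is invariant under multiplication by i, and the imaginary part of the
  form at h is its real part at i h. So the complex identity for all h is equivalent to its real
  part, and the real Riesz and generation theorems apply.\<close>

lemma laplacian_iff:
  "laplacian bc d \<Omega> f g \<longleftrightarrow> f \<in> form_domain bc d \<Omega> \<and> g \<in> l2_on d \<Omega> \<and>
     (\<forall>h\<in>form_domain bc d \<Omega>. dform f h = - inner g h)"
proof -
  have "(\<forall>h\<in>form_domain bc d \<Omega>. energy_form d \<Omega> f h = cinner (- g) h) \<longleftrightarrow>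
    (\<forall>h\<in>form_domain bc d \<Omega>. dform f h = - inner g h)"
  proof (intro iffI ballI)
    fix h assume *: "\<forall>h\<in>form_domain bc d \<Omega>. energy_form d \<Omega> f h = cinner (- g) h" and h: "h \<in> form_domain bc d \<Omega>"
    show "dform f h = - inner g h"
      using arg_cong[OF bspec[OF * h], of Re] by (simp add: Re_energy cinner_minus inner_eq_Re_cinner)
  next
    fix h assume *: "\<forall>h\<in>form_domain bc d \<Omega>. dform f h = - inner g h" and h: "h \<in> form_domain bc d \<Omega>"
    show "energy_form d \<Omega> f h = cinner (- g) h"
    proof (rule complex_eqI)
      show "Re (energy_form d \<Omega> f h) = Re (cinner (- g) h)"
        using bspec[OF * h] by (simp add: Re_energy cinner_minus inner_eq_Re_cinner)
      show "Im (energy_form d \<Omega> f h) = Im (cinner (- g) h)"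
        using bspec[OF * form_domain_scaleC[OF h, of \<i>]]
        by (simp add: Im_energy[OF form_domain_H1[OF h]] cinner_minus inner_eq_Re_cinner cinner_scaleC_right)
    qed
  qed
  then show ?thesis unfolding laplacian_def by blast
qed

text \<open>Riesz representation for the inner product l <u, v> + dform u v. Completeness in this
  norm is the closedness of the form domain under joint convergence of functions and their weak
  derivatives.\<close>

lemma form_resolvent:
  assumes l: "l > 0" and h: "h \<in> l2_on d \<Omega>"
  shows "\<exists>f g. laplacian bc d \<Omega> f g \<and> l *\<^sub>R f - g = h"
proof -
  define a where "a u v = l * inner u v + dform u v" for u v
  have "\<exists>u\<in>form_domain bc d \<Omega>. \<forall>v\<in>form_domain bc d \<Omega>. a u v = inner h v"
  proof (rule riesz_representation[OF subspace_form_domain])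
    show "a (u + v) w = a u w + a v w" if "u \<in> form_domain bc d \<Omega>" "v \<in> form_domain bc d \<Omega>" for u v w
      using that form_domain_H1 by (simp add: a_def dform_add inner_add_left algebra_simps)
    show "a (r *\<^sub>R u) w = r * a u w" if "u \<in> form_domain bc d \<Omega>" for r u w
      using that form_domain_H1 by (simp add: a_def dform_scaleR algebra_simps)
    show "a u v = a v u" for u v by (simp add: a_def dform_commute inner_commute)
    show "0 \<le> a u u" for u using l dform_nonneg by (simp add: a_def)
    show "inner h (u + v) = inner h u + inner h v" for u v by (rule inner_add_right)
    show "inner h (r *\<^sub>R u) = r * inner h u" for r u by simp
    show "(inner h u)\<^sup>2 \<le> ((norm h)\<^sup>2 / l) * a u u" for u
    proof -
      have "(inner h u)\<^sup>2 \<le> (norm h)\<^sup>2 * (norm u)\<^sup>2"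
        using Cauchy_Schwarz_ineq[of h u] by (simp add: power2_norm_eq_inner)
      also have "\<dots> = ((norm h)\<^sup>2 / l) * (l * inner u u)" using l by (simp add: power2_norm_eq_inner)
      also have "\<dots> \<le> ((norm h)\<^sup>2 / l) * a u u" using l dform_nonneg[of u] by (intro mult_left_mono) (auto simp: a_def)
      finally show ?thesis .
    qed
  next
    fix X :: "nat \<Rightarrow> l2" assume X: "\<And>n. X n \<in> form_domain bc d \<Omega>"
      and C: "\<And>e. e > 0 \<Longrightarrow> \<exists>N. \<forall>m\<ge>N. \<forall>n\<ge>N. a (X m - X n) (X m - X n) < e"
    have aeq: "a u u = l * (norm u)\<^sup>2 + (\<Sum>i<d. (norm (wderiv d \<Omega> i u))\<^sup>2)" for u
      by (simp add: a_def dform_def power2_norm_eq_inner)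
    have le0: "l * (norm u)\<^sup>2 \<le> a u u" for u using l dform_nonneg[of u] by (simp add: a_def power2_norm_eq_inner)
    have lei: "(norm (wderiv d \<Omega> i u))\<^sup>2 \<le> a u u" if "i < d" for i u
    proof -
      have "(norm (wderiv d \<Omega> i u))\<^sup>2 \<le> (\<Sum>i<d. (norm (wderiv d \<Omega> i u))\<^sup>2)" using that by (intro member_le_sum) auto
      then show ?thesis using l unfolding aeq by (simp add: add_increasing)
    qed
    \<comment> \<open>Applied with c = l to the sequence itself and with c = 1 to its weak
      derivatives.\<close>
    have cauchy: "Cauchy f" if f: "\<And>m n. c * (norm (f m - f n))\<^sup>2 \<le> a (X m - X n) (X m - X n)" and c: "c > 0" for f :: "nat \<Rightarrow> l2" and c
    proof (rule CauchyI)
      fix e :: real assume e: "e > 0"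
      then obtain N where N: "\<And>m n. m \<ge> N \<Longrightarrow> n \<ge> N \<Longrightarrow> a (X m - X n) (X m - X n) < c * e\<^sup>2"
        using C[of "c * e\<^sup>2"] c by auto
      have "norm (f m - f n) < e" if "m \<ge> N" "n \<ge> N" for m n
      proof -
        have "c * (norm (f m - f n))\<^sup>2 < c * e\<^sup>2" using f[of m n] N[OF that] by simp
        then have "(norm (f m - f n))\<^sup>2 < e\<^sup>2" using c by simp
        then show ?thesis by (rule power_less_imp_less_base) (use e in simp)
      qed
      then show "\<exists>N. \<forall>m\<ge>N. \<forall>n\<ge>N. norm (f m - f n) < e" by blast
    qed
    have "Cauchy X" by (rule cauchy[OF le0 l])
    then obtain u where u: "X \<longlonglongrightarrow> u" by (auto simp: Cauchy_convergent_iff convergent_def)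
    have "\<exists>g. (\<lambda>n. wderiv d \<Omega> i (X n)) \<longlonglongrightarrow> g" if i: "i < d" for i
    proof -
      have "1 * (norm (wderiv d \<Omega> i (X m) - wderiv d \<Omega> i (X n)))\<^sup>2 \<le> a (X m - X n) (X m - X n)" for m n
        using lei[OF i, of "X m - X n"] wderiv_diff[OF form_domain_H1[OF X] form_domain_H1[OF X] i] by simp
      from cauchy[OF this] show ?thesis by (auto simp: Cauchy_convergent_iff convergent_def)
    qed
    then obtain g where g: "\<And>i. i < d \<Longrightarrow> (\<lambda>n. wderiv d \<Omega> i (X n)) \<longlonglongrightarrow> g i" by metis
    note lim = form_domain_limit[OF X u g]
    have "(\<lambda>n. l * (norm (X n - u))\<^sup>2 + (\<Sum>i<d. (norm (wderiv d \<Omega> i (X n) - g i))\<^sup>2)) \<longlonglongrightarrow> l * (norm (u - u))\<^sup>2 + (\<Sum>i<d. (norm (g i - g i))\<^sup>2)"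
      by (intro tendsto_intros u g) auto
    moreover have "a (X n - u) (X n - u) = l * (norm (X n - u))\<^sup>2 + (\<Sum>i<d. (norm (wderiv d \<Omega> i (X n) - g i))\<^sup>2)" for n
      unfolding aeq using wderiv_diff[OF form_domain_H1[OF X] form_domain_H1[OF lim(1)]] lim(2) by simp
    ultimately show "\<exists>u\<in>form_domain bc d \<Omega>. (\<lambda>n. a (X n - u) (X n - u)) \<longlonglongrightarrow> 0"
      using lim(1) by (intro bexI[of _ u]) simp_all
  qed
  then obtain u where u: "u \<in> form_domain bc d \<Omega>" "\<And>v. v \<in> form_domain bc d \<Omega> \<Longrightarrow> a u v = inner h v" by blast
  have "laplacian bc d \<Omega> u (l *\<^sub>R u - h)"
    unfolding laplacian_iff
  proof (intro conjI ballI)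
    show "dform u v = - inner (l *\<^sub>R u - h) v" if "v \<in> form_domain bc d \<Omega>" for v
      using u(2)[OF that] by (simp add: a_def inner_diff_left)
  qed (use u h form_domain_in[OF u(1)] in \<open>auto intro!: l2_on_diff l2_on_scaleR\<close>)
  then show ?thesis by (intro exI[of _ u] exI[of _ "l *\<^sub>R u - h"]) simp
qed

text \<open>Project x onto the closure of the test functions: the remainder is orthogonal to all of
  them and vanishes by \<open>zero_if_orthogonal\<close>.\<close>

lemma test_functions_dense:
  assumes x: "x \<in> l2_on d \<Omega>"
  shows "x \<in> closure (l2_of d ` test_functions d \<Omega>)"
proof -
  define T where "T = l2_of d ` test_functions d \<Omega>"
  have T0: "subspace T"
  proof (rule subspaceI)
    have "(\<lambda>x. 0) \<in> test_functions d \<Omega>"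
      by (rule test_functionsI[where C = "{}"]) (use smooth_cmult[OF smooth_tensor[of d "\<lambda>_. exp_bump"], of 0] smooth_real_exp_bump in auto)
    moreover have "l2_of d (\<lambda>x. 0) = 0"
      unfolding l2_of_zero_ext zero_ext_def zero_l2.abs_eq by (rule arg_cong[of _ _ abs_l2]) auto
    ultimately show "0 \<in> T" unfolding T_def by force
    show "u + v \<in> T" if "u \<in> T" "v \<in> T" for u v
      using that unfolding T_def by (auto simp: l2_of_add[symmetric] intro!: imageI test_functions_add)
    show "c *\<^sub>R u \<in> T" if "u \<in> T" for c u
      using that unfolding T_def by (auto simp: scaleR_eq_scaleC l2_of_cmult[symmetric] intro!: imageI test_functions_cmult)
  qed
  have "\<exists>u\<in>closure T. \<forall>v\<in>closure T. inner u v = inner x v"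
  proof (rule riesz_representation[OF subspace_closure[OF T0], where C = "(norm x)\<^sup>2"])
    show "(inner x u)\<^sup>2 \<le> (norm x)\<^sup>2 * inner u u" for u
      using Cauchy_Schwarz_ineq[of x u] by (simp add: power2_norm_eq_inner)
    fix X :: "nat \<Rightarrow> l2" assume X: "\<And>n. X n \<in> closure T"
      and C: "\<And>e. e > 0 \<Longrightarrow> \<exists>N. \<forall>m\<ge>N. \<forall>n\<ge>N. inner (X m - X n) (X m - X n) < e"
    have "Cauchy X"
    proof (rule CauchyI)
      fix e :: real assume e: "e > 0"
      then obtain N where N: "\<And>m n. m \<ge> N \<Longrightarrow> n \<ge> N \<Longrightarrow> (norm (X m - X n))\<^sup>2 < e\<^sup>2"
        using C[of "e\<^sup>2"] by (auto simp: power2_norm_eq_inner)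
      then show "\<exists>N. \<forall>m\<ge>N. \<forall>n\<ge>N. norm (X m - X n) < e"
        using e power_less_imp_less_base[of _ 2 e] by (intro exI[of _ N]) auto
    qed
    then obtain u where u: "X \<longlonglongrightarrow> u" by (auto simp: Cauchy_convergent_iff convergent_def)
    have "(\<lambda>n. inner (X n - u) (X n - u)) \<longlonglongrightarrow> inner (u - u) (u - u)" by (intro tendsto_intros u)
    then show "\<exists>u\<in>closure T. (\<lambda>n. inner (X n - u) (X n - u)) \<longlonglongrightarrow> 0"
      using closed_sequentially[OF closed_closure X u] by (intro bexI[of _ u]) auto
  qed (auto simp: inner_add_left inner_add_right inner_commute)
  then obtain u where u: "u \<in> closure T" "\<And>v. v \<in> closure T \<Longrightarrow> inner u v = inner x v" by blast
  have "closure T \<subseteq> l2_on d \<Omega>"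
    by (rule closure_minimal[OF _ closed_l2_on[OF \<Omega>_sets]]) (auto simp: T_def intro: l2_of_in)
  then have "x - u \<in> l2_on d \<Omega>" using u(1) x by (auto intro: l2_on_diff)
  moreover have "cinner (x - u) (l2_of d \<phi>) = 0" if \<phi>: "\<phi> \<in> test_functions d \<Omega>" for \<phi>
  proof -
    have 1: "l2_of d \<phi> \<in> closure T" by (rule subsetD[OF closure_subset]) (simp add: T_def \<phi>)
    have "\<i> *\<^sub>C l2_of d \<phi> \<in> T"
      unfolding T_def l2_of_cmult[OF \<phi>, symmetric] by (rule imageI[OF test_functions_cmult[OF \<phi>]])
    then have 2: "\<i> *\<^sub>C l2_of d \<phi> \<in> closure T" by (rule subsetD[OF closure_subset])
    have "inner (x - u) (l2_of d \<phi>) = 0" "inner (x - u) (\<i> *\<^sub>C l2_of d \<phi>) = 0"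
      unfolding inner_diff_left u(2)[OF 1] u(2)[OF 2] by simp_all
    then show ?thesis unfolding cinner_eq_inner by (simp add: complex_eq_iff)
  qed
  ultimately have "x - u = 0" by (rule zero_if_orthogonal)
  then show ?thesis using u(1) by (simp add: T_def)
qed

text \<open>For h in the form domain the solution f of l f - \<Delta> f = l h is close to h when l
  is large: the error p = f - h satisfies l |p|^2 = - dform p p - dform h p \<le> dform h h / 4. The
  form domain contains the test functions, which are dense.\<close>

lemma laplacian_domain_dense: "l2_on d \<Omega> \<subseteq> closure {f. \<exists>g. laplacian bc d \<Omega> f g}"
proof -
  define D where "D = {f. \<exists>g. laplacian bc d \<Omega> f g}"
  have V: "h \<in> closure D" if h: "h \<in> form_domain bc d \<Omega>" for h
    unfolding closure_approachable
  proof (intro allI impI)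
    fix e :: real assume e: "e > 0"
    \<comment> \<open>Makes l e^2 = dform h h + e^2, which exceeds dform h h / 4.\<close>
    define l where "l = dform h h / e\<^sup>2 + 1"
    have l: "l > 0" using dform_nonneg[of h] by (simp add: l_def add_nonneg_pos)
    obtain f g where fg: "laplacian bc d \<Omega> f g" "l *\<^sub>R f - g = l *\<^sub>R h"
      using form_resolvent[OF l, of "l *\<^sub>R h" bc] form_domain_in[OF h] l2_on_scaleR by blast
    have f: "f \<in> form_domain bc d \<Omega>" using fg(1) by (simp add: laplacian_iff)
    have g: "g = l *\<^sub>R (f - h)" using fg(2) by (simp add: algebra_simps)
    define p where "p = f - h"
    have p: "p \<in> form_domain bc d \<Omega>" unfolding p_def by (rule form_domain_diff[OF f h])
    have "dform f p = - inner g p" using fg(1) p by (simp add: laplacian_iff)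
    moreover have "f = p + h" by (simp add: p_def)
    then have "dform f p = dform p p + dform h p" using dform_add[OF form_domain_H1[OF p] form_domain_H1[OF h]] by simp
    ultimately have eq: "l * (norm p)\<^sup>2 = - dform p p - dform h p"
      by (simp add: g p_def[symmetric] power2_norm_eq_inner)
    \<comment> \<open>Completing the square bounds - dform p p - dform h p by dform h h / 4.\<close>
    have "0 \<le> dform (p + (1/2) *\<^sub>R h) (p + (1/2) *\<^sub>R h)" by (rule dform_nonneg)
    also have "\<dots> = dform p p + dform h p + dform h h / 4"
    proof -
      have H: "(1/2) *\<^sub>R h \<in> H1 d \<Omega>" by (rule H1_scaleR[OF form_domain_H1[OF h]])
      have c: "dform q (p + (1/2) *\<^sub>R h) = dform q p + (1/2) * dform q h" for q
        using dform_add[OF form_domain_H1[OF p] H, of q] dform_scaleR[OF form_domain_H1[OF h], of "1/2" q]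
        by (simp add: dform_commute[of _ q])
      show ?thesis
        unfolding dform_add[OF form_domain_H1[OF p] H] dform_scaleR[OF form_domain_H1[OF h]] c
        by (simp add: dform_commute[of p h] algebra_simps)
    qed
    finally have "l * (norm p)\<^sup>2 \<le> dform h h / 4" using eq by simp
    also have "\<dots> < l * e\<^sup>2"
    proof -
      have "l * e\<^sup>2 = dform h h + e\<^sup>2" using e by (simp add: l_def field_simps)
      moreover have "e\<^sup>2 > 0" using e by simp
      ultimately show ?thesis using dform_nonneg[of h] by linarith
    qed
    finally have "(norm p)\<^sup>2 < e\<^sup>2" using l by simp
    then have "norm p < e" by (rule power_less_imp_less_base) (use e in simp)
    then show "\<exists>y\<in>D. dist y h < e" using fg(1) by (auto simp: D_def p_def dist_norm)
  qed
  have "l2_of d ` test_functions d \<Omega> \<subseteq> closure D" using V form_domain_test by blast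
  then have "closure (l2_of d ` test_functions d \<Omega>) \<subseteq> closure D" by (simp add: closure_minimal)
  then show ?thesis using test_functions_dense unfolding D_def by blast
qed

lemma dissipative_laplacian:
  "dissipative_operator (l2_on d \<Omega>) (restrict_l2 d \<Omega>) (laplacian bc d \<Omega>)"
proof (intro dissipative_operator.intro dissipative_operator_axioms.intro projected_space_restrict_l2 \<Omega>_sets)
  show "norm (restrict_l2 d \<Omega> x) \<le> norm x" for x by (rule norm_restrict_l2[OF \<Omega>_sets])
  show "f \<in> l2_on d \<Omega> \<and> g \<in> l2_on d \<Omega>" if "laplacian bc d \<Omega> f g" for f g
    using that form_domain_in by (auto simp: laplacian_iff)
  show "laplacian bc d \<Omega> (f + f') (g + g')" if "laplacian bc d \<Omega> f g" "laplacian bc d \<Omega> f' g'" for f g f' g'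
    using that by (auto simp: laplacian_iff form_domain_add l2_on_add form_domain_H1 dform_add inner_add_left)
  show "laplacian bc d \<Omega> (c *\<^sub>R f) (c *\<^sub>R g)" if "laplacian bc d \<Omega> f g" for c f g
    using that by (auto simp: laplacian_iff form_domain_scaleR l2_on_scaleR form_domain_H1 dform_scaleR)
  show "inner g f \<le> 0" if "laplacian bc d \<Omega> f g" for f g
    using that dform_nonneg[of f] by (auto simp: laplacian_iff)
  show "\<exists>f g. laplacian bc d \<Omega> f g \<and> l *\<^sub>R f - g = h" if "l > 0" "h \<in> l2_on d \<Omega>" for l h
    by (rule form_resolvent[OF that])
qed (rule laplacian_domain_dense)

lemma laplacian_scaleC:
  assumes "laplacian bc d \<Omega> f g"
  shows "laplacian bc d \<Omega> (c *\<^sub>C f) (c *\<^sub>C g)"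
  using assms unfolding laplacian_def energy_form_def
  by (auto simp: form_domain_scaleC l2_on_scaleC wderiv_scaleC form_domain_H1 cinner_scaleC_left cinner_minus sum_distrib_left[symmetric])

end

lemma generator_eq: "generator X S f g = generates X S f g"
  by (simp add: generator_def generates_def)

lemma c0_semigroup_iff:
  "c0_semigroup X S \<longleftrightarrow> linear_semigroup X S \<and> (\<forall>t\<ge>0. \<forall>u\<in>X. \<forall>c. S t (c *\<^sub>C u) = c *\<^sub>C S t u)"
proof
  assume "c0_semigroup X S"
  then show "linear_semigroup X S \<and> (\<forall>t\<ge>0. \<forall>u\<in>X. \<forall>c. S t (c *\<^sub>C u) = c *\<^sub>C S t u)"
    unfolding c0_semigroup_def linear_semigroup_def scaleR_eq_scaleC by (elim conjE, intro conjI; simp)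
next
  assume "linear_semigroup X S \<and> (\<forall>t\<ge>0. \<forall>u\<in>X. \<forall>c. S t (c *\<^sub>C u) = c *\<^sub>C S t u)"
  then show "c0_semigroup X S"
    unfolding c0_semigroup_def linear_semigroup_def by (elim conjE, intro conjI; blast)
qed

context domain
begin

definition heat_semigroup :: "boundary_condition \<Rightarrow> (real \<Rightarrow> l2 \<Rightarrow> l2) \<Rightarrow> bool" where
  "heat_semigroup bc S \<longleftrightarrow> c0_semigroup (l2_on d \<Omega>) S \<and>
     (\<forall>f g. generator (l2_on d \<Omega>) S f g \<longleftrightarrow> laplacian bc d \<Omega> f g)"

lemma heat_semigroup_linear:
  "heat_semigroup bc S \<Longrightarrow> linear_semigroup_on (l2_on d \<Omega>) (restrict_l2 d \<Omega>) S"
  unfolding heat_semigroup_def c0_semigroup_iff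
  by (intro linear_semigroup_on.intro linear_semigroup_on_axioms.intro projected_space_restrict_l2 \<Omega>_sets) blast

text \<open>The generation theorem yields real linearity. Multiplication by c maps the graph of the
  Laplacian into itself and therefore commutes with the semigroup by
  \<open>semigroup_intertwine\<close>.\<close>

lemma heat_semigroup_exists: "\<exists>S. heat_semigroup bc S"
proof -
  interpret L: dissipative_operator "l2_on d \<Omega>" "restrict_l2 d \<Omega>" "laplacian bc d \<Omega>"
    by (rule dissipative_laplacian)
  have lin: "linear_semigroup_on (l2_on d \<Omega>) (restrict_l2 d \<Omega>) L.S"
    by unfold_locales (rule L.linear_semigroup_S)
  have "L.S t (c *\<^sub>C u) = c *\<^sub>C L.S t u" if "t \<ge> 0" "u \<in> l2_on d \<Omega>" for t c u
  proof (rule semigroup_intertwine[OF lin lin bounded_linear_scaleC, symmetric])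
    show "generates (l2_on d \<Omega>) L.S (c *\<^sub>C f) (c *\<^sub>C g)" if "generates (l2_on d \<Omega>) L.S f g" for f g
      using that laplacian_scaleC by (simp add: L.generation)
    show "l2_on d \<Omega> \<subseteq> closure {f. \<exists>g. generates (l2_on d \<Omega>) L.S f g}"
      using laplacian_domain_dense by (simp add: L.generation)
  qed (use that l2_on_scaleC in auto)
  then show ?thesis
    unfolding heat_semigroup_def c0_semigroup_iff generator_eq using L.generation by blast
qed

end

lemma heat_semigroup_intertwine:
  assumes \<Omega>: "domain d \<Omega>" "domain.heat_semigroup d \<Omega> bc S" and \<Omega>': "domain d' \<Omega>'" "domain.heat_semigroup d' \<Omega>' bc' S'"
    and B: "bounded_linear B" "\<And>x. x \<in> l2_on d' \<Omega>' \<Longrightarrow> B x \<in> l2_on d \<Omega>"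
    and lap: "\<And>f g. laplacian bc' d' \<Omega>' f g \<Longrightarrow> laplacian bc d \<Omega> (B f) (B g)"
    and t: "t \<ge> 0" and x: "x \<in> l2_on d' \<Omega>'"
  shows "B (S' t x) = S t (B x)"
proof -
  note defs = domain.heat_semigroup_def[OF \<Omega>(1)] domain.heat_semigroup_def[OF \<Omega>'(1)]
  show ?thesis
  proof (rule semigroup_intertwine[OF domain.heat_semigroup_linear[OF \<Omega>] domain.heat_semigroup_linear[OF \<Omega>'] B _ _ t x])
    show "generates (l2_on d \<Omega>) S (B f) (B g)" if "generates (l2_on d' \<Omega>') S' f g" for f g
      using that lap \<Omega>(2) \<Omega>'(2) unfolding defs generator_eq by blast
    show "l2_on d' \<Omega>' \<subseteq> closure {f. \<exists>g. generates (l2_on d' \<Omega>') S' f g}"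
      using domain.laplacian_domain_dense[OF \<Omega>'(1), of bc'] \<Omega>'(2) unfolding defs generator_eq by simp
  qed
qed

text \<open>Uniqueness of the described value is intertwining with the identity: two semigroups with
  the same generator agree on \<open>l2_on d \<Omega>\<close>.\<close>

lemma heat_eq:
  assumes "domain d \<Omega>" "domain.heat_semigroup d \<Omega> bc S" "t \<ge> 0" "u \<in> l2_on d \<Omega>"
  shows "heat bc d \<Omega> t u = S t u"
  unfolding heat_def
proof (rule the_equality)
  show "\<exists>S'. c0_semigroup (l2_on d \<Omega>) S' \<and> (\<forall>f g. generator (l2_on d \<Omega>) S' f g = laplacian bc d \<Omega> f g) \<and> S t u = S' t u"
    using assms(2) unfolding domain.heat_semigroup_def[OF assms(1)] by blast
  fix w assume "\<exists>S. c0_semigroup (l2_on d \<Omega>) S \<and> (\<forall>f g. generator (l2_on d \<Omega>) S f g = laplacian bc d \<Omega> f g) \<and> w = S t u"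
  then obtain S' where S': "domain.heat_semigroup d \<Omega> bc S'" "w = S' t u"
    unfolding domain.heat_semigroup_def[OF assms(1)] by blast
  show "w = S t u"
    unfolding S'(2)
    using heat_semigroup_intertwine[OF assms(1,2) assms(1) S'(1) bounded_linear_ident _ _ assms(3,4)] by simp
qed

theorem heat_intertwine:
  assumes \<Omega>: "domain d \<Omega>" and \<Omega>': "domain d' \<Omega>'"
    and B: "bounded_linear B" "\<And>x. x \<in> l2_on d' \<Omega>' \<Longrightarrow> B x \<in> l2_on d \<Omega>"
    and lap: "\<And>f g. laplacian bc' d' \<Omega>' f g \<Longrightarrow> laplacian bc d \<Omega> (B f) (B g)"
    and t: "t \<ge> 0" and x: "x \<in> l2_on d' \<Omega>'"
  shows "B (heat bc' d' \<Omega>' t x) = heat bc d \<Omega> t (B x)"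
proof -
  obtain S where S: "domain.heat_semigroup d \<Omega> bc S" using domain.heat_semigroup_exists[OF \<Omega>] by blast
  obtain S' where S': "domain.heat_semigroup d' \<Omega>' bc' S'" using domain.heat_semigroup_exists[OF \<Omega>'] by blast
  show ?thesis
    using heat_semigroup_intertwine[OF \<Omega> S \<Omega>' S' B lap t x] heat_eq[OF \<Omega> S t B(2)[OF x]] heat_eq[OF \<Omega>' S' t x] by simp
qed

section \<open>Reflections in lines through the origin\<close>

lemma space_lborel_dim_Rn: "space (lborel_dim d) = Rn d"
  by (simp add: space_lborel_dim Rn_def)

lemma measurable_lborel_dim_upd:
  assumes "i < d" "g \<in> borel_measurable (lborel_dim d)"
  shows "(\<lambda>x. x(i := g x)) \<in> lborel_dim d \<rightarrow>\<^sub>M lborel_dim d"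
proof -
  have "(\<lambda>x. x(i := g x)) \<in> lborel_dim d \<rightarrow>\<^sub>M Pi\<^sub>M {..<d} (\<lambda>_. lborel)"
  proof (rule measurable_PiM_single')
    fix j assume j: "j \<in> {..<d}"
    show "(\<lambda>x. (x(i := g x)) j) \<in> lborel_dim d \<rightarrow>\<^sub>M lborel"
    proof (cases "j = i")
      case True
      then show ?thesis using assms(2) by simp
    next
      case False
      have "(\<lambda>x. x j) \<in> lborel_dim d \<rightarrow>\<^sub>M lborel"
        unfolding lborel_dim_def by (rule measurable_component_singleton[OF j])
      then show ?thesis using False by simp
    qed
  next
    have "x(i := g x) \<in> Rn d" if "x \<in> Rn d" for x by (rule Rn_upd[OF that assms(1)])
    then show "(\<lambda>x. x(i := g x)) \<in> space (lborel_dim d) \<rightarrow> (\<Pi>\<^sub>E i\<in>{..<d}. space lborel)"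
      unfolding space_lborel_dim_Rn by (simp add: Rn_def)
  qed
  then show ?thesis by (simp add: lborel_dim_def)
qed

definition shear :: "nat \<Rightarrow> nat \<Rightarrow> real \<Rightarrow> real \<Rightarrow> (nat \<Rightarrow> real) \<Rightarrow> nat \<Rightarrow> real" where
  "shear i j s c x = x(i := s * x i + c * x j)"

text \<open>By Fubini in the i-th variable, the shear acts on each line as a translation, possibly
  combined with a change of sign.\<close>

lemma distr_shear:
  assumes ij: "i < d" "j < d" "i \<noteq> j" and s: "\<bar>s\<bar> = 1"
  shows "shear i j s c \<in> lborel_dim d \<rightarrow>\<^sub>M lborel_dim d" "distr (lborel_dim d) (lborel_dim d) (shear i j s c) = lborel_dim d"
proof -
  interpret product_sigma_finite "\<lambda>_::nat. lborel :: real measure" by standard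
  have comp: "(\<lambda>x. x k) \<in> borel_measurable (lborel_dim d)" if "k < d" for k
    using measurable_component_singleton[of k "{..<d}" "\<lambda>_. lborel :: real measure"] that by (simp add: lborel_dim_def)
  show m: "shear i j s c \<in> lborel_dim d \<rightarrow>\<^sub>M lborel_dim d"
    unfolding shear_def[abs_def]
    by (intro measurable_lborel_dim_upd ij borel_measurable_add borel_measurable_times borel_measurable_const comp)
  define I where "I = {..<d} - {i}"
  have I: "finite I" "i \<notin> I" "insert i I = {..<d}" using ij by (auto simp: I_def)
  show "distr (lborel_dim d) (lborel_dim d) (shear i j s c) = lborel_dim d"
  proof (rule measure_eqI)
    fix A assume "A \<in> sets (distr (lborel_dim d) (lborel_dim d) (shear i j s c))"
    then have A: "A \<in> sets (lborel_dim d)" by simp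
    let ?f = "indicator A :: (nat \<Rightarrow> real) \<Rightarrow> ennreal"
    have fm: "?f \<in> borel_measurable (lborel_dim d)" using A by simp
    have fm': "(\<lambda>x. ?f (shear i j s c x)) \<in> borel_measurable (lborel_dim d)"
      by (rule measurable_compose[OF m fm])
    have "emeasure (distr (lborel_dim d) (lborel_dim d) (shear i j s c)) A = (\<integral>\<^sup>+x. ?f (shear i j s c x) \<partial>lborel_dim d)"
      using A m fm nn_integral_distr[OF m, of ?f] by simp
    also have "\<dots> = (\<integral>\<^sup>+x. \<integral>\<^sup>+y. ?f (shear i j s c (x(i := y))) \<partial>lborel \<partial>Pi\<^sub>M I (\<lambda>_. lborel))"
      using product_nn_integral_insert[OF I(1,2), of "\<lambda>x. ?f (shear i j s c x)"] fm'
      unfolding I(3) lborel_dim_def[symmetric] by simp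
    also have "\<dots> = (\<integral>\<^sup>+x. \<integral>\<^sup>+y. ?f (x(i := y)) \<partial>lborel \<partial>Pi\<^sub>M I (\<lambda>_. lborel))"
    proof (rule nn_integral_cong)
      fix x assume x: "x \<in> space (Pi\<^sub>M I (\<lambda>_. lborel :: real measure))"
      have "(\<lambda>y. x(i := y)) \<in> lborel \<rightarrow>\<^sub>M Pi\<^sub>M (insert i I) (\<lambda>_. lborel)"
        using x by (intro measurable_fun_upd[where J = I]) auto
      then have "(\<lambda>y. ?f (x(i := y))) \<in> borel_measurable lborel"
        unfolding I(3) lborel_dim_def[symmetric] by (rule measurable_compose[OF _ fm])
      then have "(\<integral>\<^sup>+y. ?f (x(i := y)) \<partial>lborel) = ennreal \<bar>s\<bar> * (\<integral>\<^sup>+y. ?f (x(i := c * x j + s * y)) \<partial>lborel)"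
        using s by (intro nn_integral_real_affine) auto
      also have "\<dots> = (\<integral>\<^sup>+y. ?f (shear i j s c (x(i := y))) \<partial>lborel)"
        using s ij by (simp add: shear_def add.commute)
      finally show "(\<integral>\<^sup>+y. ?f (shear i j s c (x(i := y))) \<partial>lborel) = (\<integral>\<^sup>+y. ?f (x(i := y)) \<partial>lborel)" ..
    qed
    also have "\<dots> = (\<integral>\<^sup>+x. ?f x \<partial>lborel_dim d)"
      using product_nn_integral_insert[OF I(1,2), of ?f] fm
      unfolding I(3) lborel_dim_def[symmetric] by simp
    finally show "emeasure (distr (lborel_dim d) (lborel_dim d) (shear i j s c)) A = emeasure (lborel_dim d) A"
      using A by simp
  qed simp
qed

definition measure_preserving :: "'a measure \<Rightarrow> ('a \<Rightarrow> 'a) \<Rightarrow> bool" where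
  "measure_preserving M f \<longleftrightarrow> f \<in> M \<rightarrow>\<^sub>M M \<and> distr M M f = M"

lemma measure_preserving_comp:
  assumes "measure_preserving M f" "measure_preserving M g"
  shows "measure_preserving M (\<lambda>x. f (g x))"
proof -
  have m: "f \<in> M \<rightarrow>\<^sub>M M" "g \<in> M \<rightarrow>\<^sub>M M" using assms by (auto simp: measure_preserving_def)
  have "distr M M (\<lambda>x. f (g x)) = distr (distr M M g) M f"
    by (simp add: distr_distr[OF m] comp_def)
  then show ?thesis
    using assms measurable_compose[OF m(2,1)] by (simp add: measure_preserving_def)
qed

lemma measure_preserving_completion:
  assumes "measure_preserving M f"
  shows "measure_preserving (completion M) f"
proof -
  have m: "f \<in> M \<rightarrow>\<^sub>M M" "distr M M f = M" using assms by (auto simp: measure_preserving_def)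
  have m': "f \<in> completion M \<rightarrow>\<^sub>M M" by (rule measurable_completion[OF m(1)])
  have d: "distr (completion M) M f = M" unfolding distr_completion[OF m(1)] by (rule m(2))
  show ?thesis
    unfolding measure_preserving_def
    using completion.measurable_completion2[of f M M] completion.completion_distr_eq[of f M M] m' d by simp
qed

lemma measure_preserving_shear:
  "i < d \<Longrightarrow> j < d \<Longrightarrow> i \<noteq> j \<Longrightarrow> \<bar>s\<bar> = 1 \<Longrightarrow> measure_preserving (lborel_dim d) (shear i j s c)"
  using distr_shear by (auto simp: measure_preserving_def)

lemma sum_lessThan_2: "(\<Sum>i<2. f i) = f 0 + f (1::nat)" for f :: "nat \<Rightarrow> 'a::comm_monoid_add"
  by (simp add: numeral_2_eq_2 lessThan_Suc add.commute)

lemma All_less_2: "(\<forall>i<2. P i) \<longleftrightarrow> P 0 \<and> P (1::nat)"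
  by (auto simp: less_2_cases_iff)

section \<open>Coordinates and curves in the plane\<close>

definition pt :: "real \<Rightarrow> real \<Rightarrow> nat \<Rightarrow> real" where
  "pt s t = (\<lambda>i. if i = 0 then s else if i = 1 then t else undefined)"

lemma pt_Rn: "pt s t \<in> Rn 2"
  unfolding mem_Rn_iff pt_def by auto

lemma pt_simps [simp]: "pt s t 0 = s" "pt s t 1 = t" "pt s t (Suc 0) = t"
  by (simp_all add: pt_def)

lemma Rn2_eqI: "x \<in> Rn 2 \<Longrightarrow> y \<in> Rn 2 \<Longrightarrow> x 0 = y 0 \<Longrightarrow> x 1 = y 1 \<Longrightarrow> x = y"
proof
  fix i assume "x \<in> Rn 2" "y \<in> Rn 2" "x 0 = y 0" "x 1 = y 1"
  then show "x i = y i" unfolding mem_Rn_iff by (cases "i < 2") (auto simp: less_2_cases_iff)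
qed

lemma pt_eq: "x \<in> Rn 2 \<Longrightarrow> pt (x 0) (x 1) = x"
  by (rule Rn2_eqI) (simp_all add: pt_Rn)

lemma pt_upd: "(pt s t)(0 := r) = pt r t" "(pt s t)(1 := r) = pt s r"
  by (auto simp: pt_def)

lemma continuous_on_pt:
  assumes "continuous_on A a" "continuous_on A b"
  shows "continuous_on A (\<lambda>x. pt (a x) (b x))"
proof (rule continuous_on_coordinatewise_then_product)
  show "continuous_on A (\<lambda>x. pt (a x) (b x) i)" for i
    using assms by (cases "i = 0"; cases "i = 1") (auto simp: pt_def)
qed

text \<open>\<open>smooth\<close> is phrased with partial derivatives, so total differentiability
  comes first, from the continuity of one of them; then the chain rule applies.\<close>

lemma smooth_curve:
  assumes \<phi>: "smooth 2 \<phi>" and a: "(a has_real_derivative a') (at t)" and b: "(b has_real_derivative b') (at t)"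
  shows "((\<lambda>t. \<phi> (pt (a t) (b t))) has_vector_derivative
    complex_of_real a' * partial_deriv 0 \<phi> (pt (a t) (b t)) + complex_of_real b' * partial_deriv 1 \<phi> (pt (a t) (b t))) (at t)"
proof -
  define x y where "x = a t" and "y = b t"
  define fx where "fx s t = partial_deriv 0 \<phi> (pt s t)" for s t
  define fy where "fy s t = partial_deriv 1 \<phi> (pt s t)" for s t
  have cont: "continuous_on UNIV (\<lambda>p. partial_deriv 1 \<phi> (pt (fst p) (snd p)))"
    by (rule continuous_on_compose2[OF smooth_continuous[OF smooth_partial_deriv[OF \<phi>, of 1]] continuous_on_pt])
      (auto intro: continuous_intros pt_Rn)
  have "((\<lambda>(s, t). \<phi> (pt s t)) has_derivative (\<lambda>(h, k). h *\<^sub>R fx x y + blinfun_apply (blinfun_scaleR_left (fy x y)) k)) (at (x, y) within UNIV \<times> UNIV)"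
  proof (rule has_derivative_partialsI)
    show "((\<lambda>s. \<phi> (pt s y)) has_derivative (\<lambda>h. h *\<^sub>R fx x y)) (at x within UNIV)"
      using smooth_has_partial[OF \<phi> _ pt_Rn, of 0 x y]
      by (simp add: has_vector_derivative_def pt_upd fx_def)
    show "((\<lambda>t. \<phi> (pt s t)) has_derivative blinfun_apply (blinfun_scaleR_left (fy s t))) (at t within UNIV)" for s t
      using smooth_has_partial[OF \<phi> _ pt_Rn, of 1 s t] pt_upd(2)[of s t]
      by (simp add: has_vector_derivative_def fy_def)
    have "continuous_on UNIV (\<lambda>p. blinfun_scaleR_left (fy (fst p) (snd p)))"
      unfolding fy_def by (intro bounded_linear.continuous_on[OF bounded_linear_blinfun_scaleR_left] cont)
    then show "continuous (at (x, y) within UNIV \<times> UNIV) (\<lambda>(s, t). blinfun_scaleR_left (fy s t))"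
      by (simp add: continuous_on_eq_continuous_at case_prod_unfold)
  qed auto
  then have D: "((\<lambda>(s, t). \<phi> (pt s t)) has_derivative (\<lambda>(h, k). h *\<^sub>R fx x y + k *\<^sub>R fy x y)) (at (x, y))" by simp
  have "((\<lambda>t. (a t, b t)) has_derivative (\<lambda>h. (h * a', h * b'))) (at t)"
    using a b unfolding has_field_derivative_def by (intro has_derivative_Pair) (simp_all add: mult_commute_abs)
  from has_derivative_compose[OF this D[unfolded x_def y_def]]
  have "((\<lambda>t. \<phi> (pt (a t) (b t))) has_derivative (\<lambda>h. (h * a') *\<^sub>R fx x y + (h * b') *\<^sub>R fy x y)) (at t)"
    by (simp add: x_def y_def)
  then show ?thesis
    unfolding has_vector_derivative_def fx_def fy_def x_def y_def
    by (simp add: scaleR_conv_of_real algebra_simps)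
qed

locale reflection =
  fixes \<nu> :: "nat \<Rightarrow> real"
  assumes unit: "(\<nu> 0)\<^sup>2 + (\<nu> 1)\<^sup>2 = 1"
begin

definition dist_line :: "(nat \<Rightarrow> real) \<Rightarrow> real" where
  "dist_line x = \<nu> 0 * x 0 + \<nu> 1 * x 1"

definition refl :: "(nat \<Rightarrow> real) \<Rightarrow> nat \<Rightarrow> real" where
  "refl x = x(0 := x 0 - 2 * dist_line x * \<nu> 0, 1 := x 1 - 2 * dist_line x * \<nu> 1)"

text \<open>The matrix I - 2 \<nu> \<nu>^T of the reflection, by which gradients transform.\<close>

definition r :: "nat \<Rightarrow> nat \<Rightarrow> real" where
  "r i j = (if i = j then 1 else 0) - 2 * \<nu> i * \<nu> j"

lemma refl_simps: "refl x 0 = x 0 - 2 * dist_line x * \<nu> 0" "refl x 1 = x 1 - 2 * dist_line x * \<nu> 1"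
  by (simp_all add: refl_def)

lemma refl_Rn: "x \<in> Rn 2 \<Longrightarrow> refl x \<in> Rn 2"
  unfolding refl_def by (intro Rn_upd) auto

lemma dist_line_refl: "dist_line (refl x) = - dist_line x"
proof -
  have "dist_line (refl x) = dist_line x - 2 * dist_line x * ((\<nu> 0)\<^sup>2 + (\<nu> 1)\<^sup>2)"
    unfolding dist_line_def refl_simps by (simp add: algebra_simps power2_eq_square)
  then show ?thesis unfolding unit by simp
qed

lemma refl_refl: "refl (refl x) = x"
proof
  show "refl (refl x) i = x i" for i
    unfolding refl_def[of "refl x"] dist_line_refl
    by (cases "i = 0"; cases "i = 1") (auto simp: refl_def)
qed

text \<open>The reflection has rows (p, q) and (q, -p) with p^2 + q^2 = 1. Up to a sign change of
  the first coordinate it is a rotation, and for q different from 0 a rotation is a product of three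
  shears, each of which preserves the measure by Fubini.\<close>

lemma measure_preserving_refl: "measure_preserving (lborel_dim 2) refl"
proof -
  define p q where "p = 1 - 2 * (\<nu> 0)\<^sup>2" and "q = - 2 * \<nu> 0 * \<nu> 1"
  have refl: "refl x = x(0 := p * x 0 + q * x 1, 1 := q * x 0 - p * x 1)" for x :: "nat \<Rightarrow> real"
  proof -
    have p': "- p = 1 - 2 * (\<nu> 1)\<^sup>2" using unit by (simp add: p_def)
    have 1: "x 0 - 2 * dist_line x * \<nu> 0 = p * x 0 + q * x 1"
      by (simp add: dist_line_def p_def q_def algebra_simps power2_eq_square)
    have "x 1 - 2 * dist_line x * \<nu> 1 = q * x 0 + (- p) * x 1"
      unfolding p' by (simp add: dist_line_def q_def algebra_simps power2_eq_square)
    then have 2: "x 1 - 2 * dist_line x * \<nu> 1 = q * x 0 - p * x 1" by simp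
    show ?thesis unfolding refl_def 1 2 ..
  qed
  have pq: "p\<^sup>2 + q\<^sup>2 = 1"
  proof -
    have n1: "(\<nu> 1)\<^sup>2 = 1 - (\<nu> 0)\<^sup>2" using unit by simp
    have "p\<^sup>2 + q\<^sup>2 = (1 - 2 * (\<nu> 0)\<^sup>2)\<^sup>2 + 4 * (\<nu> 0)\<^sup>2 * (\<nu> 1)\<^sup>2"
      by (simp add: p_def q_def power_mult_distrib)
    also have "\<dots> = 1" unfolding n1 by (simp add: power2_eq_square algebra_simps)
    finally show ?thesis .
  qed
  show ?thesis
  proof (cases "q = 0")
    case True
    then consider "p = 1" | "p = -1" using pq by (auto simp: power2_eq_1_iff)
    then show ?thesis
    proof cases
      case 1
      then have "refl = shear 1 0 (-1) 0" using True by (auto simp: refl shear_def fun_eq_iff)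
      then show ?thesis by (simp add: measure_preserving_shear)
    next
      case 2
      then have "refl = shear 0 1 (-1) 0" using True by (auto simp: refl shear_def fun_eq_iff)
      then show ?thesis by (simp add: measure_preserving_shear)
    qed
  next
    case False
    \<comment> \<open>The tangent of half the rotation angle, as in the factorisation of a rotation
      into three shears.\<close>
    define \<beta> where "\<beta> = - (1 + p) / q"
    have b: "1 + q * \<beta> = - p" "q * \<beta> = - p - 1" using False by (simp_all add: \<beta>_def)
    have b2: "\<beta> * (1 - p) = - q"
    proof -
      have "(1 + p) * (1 - p) = q * q" using pq by (simp add: algebra_simps power2_eq_square)
      moreover have "\<beta> * (1 - p) = - ((1 + p) * (1 - p)) / q"
        unfolding \<beta>_def minus_mult_left by (rule times_divide_eq_left)
      ultimately have "\<beta> * (1 - p) = - (q * q) / q" by (simp only:)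
      then show ?thesis using False by simp
    qed
    have "refl = (\<lambda>x. shear 1 0 1 \<beta> (shear 0 1 1 q (shear 1 0 1 \<beta> (shear 0 1 (-1) 0 x))))"
    proof (intro ext)
      fix x :: "nat \<Rightarrow> real" and i
      have e0: "- x 0 + q * (x 1 - \<beta> * x 0) = p * x 0 + q * x 1"
      proof -
        have "- x 0 + q * (x 1 - \<beta> * x 0) = - (1 + q * \<beta>) * x 0 + q * x 1" by (simp add: algebra_simps)
        then show ?thesis unfolding b(1) by simp
      qed
      have e1: "x 1 - \<beta> * x 0 + \<beta> * (p * x 0 + q * x 1) = q * x 0 - p * x 1"
      proof -
        have "x 1 - \<beta> * x 0 + \<beta> * (p * x 0 + q * x 1) = (1 + q * \<beta>) * x 1 - (\<beta> * (1 - p)) * x 0" by (simp add: algebra_simps)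
        then show ?thesis unfolding b(1) b2 by simp
      qed
      show "refl x i = shear 1 0 1 \<beta> (shear 0 1 1 q (shear 1 0 1 \<beta> (shear 0 1 (-1) 0 x))) i"
        using e0 e1 by (cases "i = 0"; cases "i = 1") (auto simp: refl shear_def)
    qed
    moreover have "measure_preserving (lborel_dim 2) (shear 0 1 (-1) 0)" "measure_preserving (lborel_dim 2) (shear 1 0 1 \<beta>)"
      "measure_preserving (lborel_dim 2) (shear 0 1 1 q)" by (simp_all add: measure_preserving_shear)
    ultimately show ?thesis
      using measure_preserving_comp[OF _ measure_preserving_comp[OF _ measure_preserving_comp]] by metis
  qed
qed

lemma continuous_refl: "continuous_on A refl"
proof (rule continuous_on_coordinatewise_then_product)
  show "continuous_on A (\<lambda>x. refl x i)" for i
    by (cases "i = 0"; cases "i = 1")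
      (auto simp: refl_def dist_line_def intro!: continuous_intros continuous_on_coordinate)
qed

lemma partial_deriv_refl:
  assumes \<phi>: "smooth 2 \<phi>" and x: "x \<in> Rn 2" and i: "i < 2"
  shows "((\<lambda>t. \<phi> (refl (x(i := t)))) has_vector_derivative
    complex_of_real (r i 0) * partial_deriv 0 \<phi> (refl x) + complex_of_real (r i 1) * partial_deriv 1 \<phi> (refl x)) (at (x i))"
proof -
  have eq: "refl (x(i := t)) = pt (refl (x(i := t)) 0) (refl (x(i := t)) 1)" for t
    by (rule pt_eq[OF refl_Rn[OF Rn_upd[OF x i]], symmetric])
  have d: "((\<lambda>t. refl (x(i := t)) j) has_real_derivative r i j) (at (x i))" if "j < 2" for j
  proof -
    have c: "i = 0 \<or> i = 1" "j = 0 \<or> j = 1" using i that by (auto simp: less_2_cases_iff)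
    then show ?thesis
      by (auto simp: refl_def dist_line_def r_def intro!: derivative_eq_intros simp: algebra_simps)
  qed
  show ?thesis
    using smooth_curve[OF \<phi> d[of 0] d[of 1]] unfolding eq[symmetric] by simp
qed

lemma smooth_refl:
  assumes "smooth 2 \<phi>"
  shows "smooth 2 (\<lambda>x. \<phi> (refl x))"
proof (rule smooth_coinduct[where F = "{h. \<exists>\<phi>. smooth 2 \<phi> \<and> h = (\<lambda>x. \<phi> (refl x))}"])
  show "(\<lambda>x. \<phi> (refl x)) \<in> {h. \<exists>\<phi>. smooth 2 \<phi> \<and> h = (\<lambda>x. \<phi> (refl x))}" using assms by blast
  fix h assume "h \<in> {h. \<exists>\<phi>. smooth 2 \<phi> \<and> h = (\<lambda>x. \<phi> (refl x))}"
  then obtain \<psi> where \<psi>: "smooth 2 \<psi>" "h = (\<lambda>x. \<psi> (refl x))" by blast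
  show "continuous_on (Rn 2) h"
    unfolding \<psi>(2) by (rule continuous_on_compose2[OF smooth_continuous[OF \<psi>(1)] continuous_refl]) (use refl_Rn in blast)
  fix i :: nat assume i: "i < 2"
  define k where "k x = complex_of_real (r i 0) * partial_deriv 0 \<psi> x + complex_of_real (r i 1) * partial_deriv 1 \<psi> x" for x
  have "smooth 2 k" unfolding k_def by (intro smooth_add smooth_cmult smooth_partial_deriv \<psi>) auto
  then have "(\<lambda>x. k (refl x)) \<in> {h. \<exists>\<phi>. smooth 2 \<phi> \<and> h = (\<lambda>x. \<phi> (refl x))}" by blast
  then show "\<exists>g\<in>{h. \<exists>\<phi>. smooth 2 \<phi> \<and> h = (\<lambda>x. \<phi> (refl x))}. \<forall>x\<in>Rn 2. ((\<lambda>t. h (x(i := t))) has_vector_derivative g x) (at (x i))"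
    by (rule bexI[rotated]) (use partial_deriv_refl[OF \<psi>(1) _ i] in \<open>simp add: \<psi>(2) k_def\<close>)
qed

text \<open>Acts on the slice of dimension 2 and fixes all other slices, so that it is a bijection
  of the whole space underlying \<open>l2\<close>.\<close>

definition refl_all :: "nat \<times> (nat \<Rightarrow> real) \<Rightarrow> nat \<times> (nat \<Rightarrow> real)" where
  "refl_all p = (if fst p = 2 then (2, refl (snd p)) else p)"

lemma refl_all_refl_all: "refl_all (refl_all p) = p"
  by (cases p) (simp add: refl_all_def refl_refl)

lemma measure_preserving_refl_all: "measure_preserving lborel_all refl_all"
  unfolding measure_preserving_def
proof
  have "(\<lambda>p. if fst p = 2 then (2, refl (snd p)) else p) \<in> borel \<rightarrow>\<^sub>M (borel :: (nat \<times> (nat \<Rightarrow> real)) measure)"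
  proof (rule measurable_If)
    show "(\<lambda>p. (2::nat, refl (snd p))) \<in> borel \<rightarrow>\<^sub>M (borel :: (nat \<times> (nat \<Rightarrow> real)) measure)"
      by (intro borel_measurable_continuous_onI continuous_on_Pair continuous_on_const
          continuous_on_compose2[OF continuous_refl] continuous_on_snd continuous_on_id) auto
    have "{2} \<times> UNIV \<in> sets (borel :: (nat \<times> (nat \<Rightarrow> real)) measure)" by (rule slice_borel) simp
    moreover have "{p \<in> space borel. fst p = (2::nat)} = ({2} \<times> UNIV :: (nat \<times> (nat \<Rightarrow> real)) set)" by auto
    ultimately show "{p \<in> space borel. fst p = (2::nat)} \<in> sets (borel :: (nat \<times> (nat \<Rightarrow> real)) measure)" by simp
  qed simp
  then have mb: "refl_all \<in> borel \<rightarrow>\<^sub>M borel" by (simp add: refl_all_def[abs_def])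
  then show m: "refl_all \<in> lborel_all \<rightarrow>\<^sub>M lborel_all" by simp
  show "distr lborel_all lborel_all refl_all = lborel_all"
  proof (rule measure_eqI)
    fix A assume "A \<in> sets (distr lborel_all lborel_all refl_all)"
    then have A: "A \<in> sets borel" by simp
    have A': "refl_all -` A \<in> sets borel" using measurable_sets[OF mb A] by simp
    have rm: "refl \<in> lborel_dim 2 \<rightarrow>\<^sub>M lborel_dim 2" "distr (lborel_dim 2) (lborel_dim 2) refl = lborel_dim 2"
      using measure_preserving_refl by (auto simp: measure_preserving_def)
    have "emeasure (distr (lborel_dim k) borel (Pair k)) (refl_all -` A) = emeasure (distr (lborel_dim k) borel (Pair k)) A" for k
    proof (cases "k = 2")
      case True
      define B where "B = Pair 2 -` A \<inter> space (lborel_dim 2)"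
      have B: "B \<in> sets (lborel_dim 2)" unfolding B_def by (rule measurable_sets[OF measurable_Pair_lborel_dim A])
      have "Pair 2 -` (refl_all -` A) \<inter> space (lborel_dim 2) = refl -` B \<inter> space (lborel_dim 2)"
        unfolding B_def space_lborel_dim_Rn using refl_Rn by (auto simp: refl_all_def)
      then have "emeasure (distr (lborel_dim 2) borel (Pair 2)) (refl_all -` A) = emeasure (lborel_dim 2) (refl -` B \<inter> space (lborel_dim 2))"
        by (simp add: emeasure_distr[OF measurable_Pair_lborel_dim A'])
      also have "\<dots> = emeasure (distr (lborel_dim 2) (lborel_dim 2) refl) B" by (rule emeasure_distr[OF rm(1) B, symmetric])
      also have "\<dots> = emeasure (distr (lborel_dim 2) borel (Pair 2)) A"
        unfolding rm(2) by (simp add: emeasure_distr[OF measurable_Pair_lborel_dim A] B_def)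
      finally show ?thesis using True by simp
    next
      case False
      then have "Pair k -` (refl_all -` A) = Pair k -` A" by (auto simp: refl_all_def)
      then show ?thesis by (simp add: emeasure_distr[OF measurable_Pair_lborel_dim] A A')
    qed
    then show "emeasure (distr lborel_all lborel_all refl_all) A = emeasure lborel_all A"
      using m A by (simp add: emeasure_distr emeasure_lborel_all[OF A] emeasure_lborel_all[OF A'])
  qed simp
qed

lemma measure_preserving_lebesgue: "measure_preserving lebesgue_all refl_all"
  unfolding lebesgue_all_def by (rule measure_preserving_completion[OF measure_preserving_refl_all])

lemma refl_measurable: "refl_all \<in> lebesgue_all \<rightarrow>\<^sub>M lebesgue_all"
  using measure_preserving_lebesgue by (simp add: measure_preserving_def)

lemma refl_distr: "distr lebesgue_all lebesgue_all refl_all = lebesgue_all"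
  using measure_preserving_lebesgue by (simp add: measure_preserving_def)

lemma AE_refl: "(AE p in lebesgue_all. Q p) \<Longrightarrow> (AE p in lebesgue_all. Q (refl_all p))"
  using AE_distrD[OF refl_measurable, of Q] unfolding refl_distr .

lemma integral_refl:
  fixes f :: "_ \<Rightarrow> 'b::{banach,second_countable_topology}"
  assumes "f \<in> borel_measurable lebesgue_all"
  shows "(LINT p|lebesgue_all. f (refl_all p)) = (LINT p|lebesgue_all. f p)"
  using integral_distr[OF refl_measurable assms] measure_preserving_lebesgue by (simp add: measure_preserving_def)

lemma sq_int_refl:
  assumes "sq_int f"
  shows "sq_int (\<lambda>p. f (refl_all p))"
proof -
  have "integrable (distr lebesgue_all lebesgue_all refl_all) (\<lambda>p. (cmod (f p))\<^sup>2)"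
    using assms measure_preserving_lebesgue by (simp add: measure_preserving_def sq_int_def)
  then have "integrable lebesgue_all (\<lambda>p. (cmod (f (refl_all p)))\<^sup>2)"
    by (rule integrable_distr[OF refl_measurable])
  then show ?thesis
    using measurable_compose[OF refl_measurable sq_int_measurable[OF assms]] by (simp add: sq_int_def)
qed

section \<open>The reflection as an operator on L2\<close>

definition J :: "l2 \<Rightarrow> l2" where
  "J u = abs_l2 (\<lambda>p. rep_l2 u (refl_all p))"

lemma J_abs_l2: "sq_int f \<Longrightarrow> J (abs_l2 f) = abs_l2 (\<lambda>p. f (refl_all p))"
  unfolding J_def
  by (subst abs_l2_eq_iff) (auto intro: sq_int_refl sq_int_rep_l2 AE_refl rep_abs_l2)

lemma J_add: "J (u + v) = J u + J v"
  by (cases u rule: l2_cases, cases v rule: l2_cases) (simp add: abs_l2_add J_abs_l2 sq_int_add sq_int_refl)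

lemma J_scaleC: "J (c *\<^sub>C u) = c *\<^sub>C J u"
  by (cases u rule: l2_cases) (simp add: scaleC_abs_l2 J_abs_l2 sq_int_scaleC sq_int_refl)

lemma J_scaleR: "J (c *\<^sub>R u) = c *\<^sub>R J u"
  by (simp add: scaleR_eq_scaleC J_scaleC)

lemma J_J: "J (J u) = u"
  by (cases u rule: l2_cases) (simp add: J_abs_l2 sq_int_refl refl_all_refl_all)

lemma cinner_J_J: "cinner (J u) (J v) = cinner u v"
proof (cases u rule: l2_cases)
  case (1 f)
  show ?thesis
  proof (cases v rule: l2_cases)
    case (1 g)
    show ?thesis
      using integral_refl[OF borel_measurable_integrable[OF sq_int_mult_cnj[OF \<open>sq_int f\<close> \<open>sq_int g\<close>]]]
      by (simp add: \<open>u = abs_l2 f\<close> 1 J_abs_l2 cinner_abs_l2 sq_int_refl \<open>sq_int f\<close>)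
  qed
qed

lemma cinner_J: "cinner (J u) v = cinner u (J v)"
  using cinner_J_J[of u "J v"] by (simp add: J_J)

lemma norm_J: "norm (J u) = norm u"
proof -
  have "complex_of_real ((norm (J u))\<^sup>2) = complex_of_real ((norm u)\<^sup>2)"
    unfolding cinner_self[symmetric] by (rule cinner_J_J)
  then have "(norm (J u))\<^sup>2 = (norm u)\<^sup>2" unfolding of_real_eq_iff .
  then show ?thesis by simp
qed

lemma bounded_linear_J: "bounded_linear J"
  by (rule bounded_linear_intro[where K = 1]) (simp_all add: J_add J_scaleR norm_J)

lemma restrict_J:
  assumes "\<omega> \<in> sets (lebesgue_dim 2)" "\<omega>' \<in> sets (lebesgue_dim 2)" and eq: "\<And>x. refl x \<in> \<omega>' \<longleftrightarrow> x \<in> \<omega>"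
  shows "restrict_l2 2 \<omega> (J u) = J (restrict_l2 2 \<omega>' u)"
proof (cases u rule: l2_cases)
  case (1 f)
  have "indicator ({2} \<times> \<omega>') (refl_all p) = (indicator ({2} \<times> \<omega>) p :: complex)" for p
    by (cases p) (auto simp: refl_all_def eq split: split_indicator)
  then show ?thesis
    using 1 by (simp add: restrict_abs_l2 assms J_abs_l2 sq_int_refl sq_int_indicator_mult slice_lebesgue)
qed

lemma J_in:
  assumes "u \<in> l2_on 2 \<Omega>'" "\<And>x. refl x \<in> \<Omega>' \<longleftrightarrow> x \<in> \<Omega>"
  shows "J u \<in> l2_on 2 \<Omega>"
proof (cases u rule: l2_cases)
  case (1 f)
  have "AE p in lebesgue_all. p \<notin> {2} \<times> \<Omega>' \<longrightarrow> f p = 0" using assms(1) 1 by (simp add: l2_on_abs_l2)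
  from AE_refl[OF this] have "AE p in lebesgue_all. p \<notin> {2} \<times> \<Omega> \<longrightarrow> f (refl_all p) = 0"
    by eventually_elim (auto simp: refl_all_def assms(2))
  then show ?thesis using 1 by (simp add: J_abs_l2 l2_on_abs_l2 sq_int_refl)
qed

lemma refl_Rn_iff: "refl x \<in> Rn 2 \<longleftrightarrow> x \<in> Rn 2"
  using refl_Rn[of x] refl_Rn[of "refl x"] by (auto simp: refl_refl)

lemma J_l2_of:
  assumes "\<phi> \<in> test_functions 2 \<Omega>"
  shows "J (l2_of 2 \<phi>) = l2_of 2 (\<lambda>x. \<phi> (refl x))"
  unfolding l2_of_zero_ext J_abs_l2[OF sq_int_test(1)[OF assms]]
  by (rule arg_cong[of _ _ abs_l2]) (auto simp: zero_ext_def refl_all_def refl_Rn_iff)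

lemma test_functions_refl:
  assumes "\<phi> \<in> test_functions 2 \<Omega>'" "\<And>x. refl x \<in> \<Omega>' \<longleftrightarrow> x \<in> \<Omega>"
  shows "(\<lambda>x. \<phi> (refl x)) \<in> test_functions 2 \<Omega>"
  using assms(1)
proof (rule test_functionsE)
  fix C assume C: "smooth 2 \<phi>" "compact C" "C \<subseteq> \<Omega>'" "\<And>x. x \<in> Rn 2 - C \<Longrightarrow> \<phi> x = 0"
  show ?thesis
  proof (rule test_functionsI[OF smooth_refl[OF C(1)] compact_continuous_image[OF continuous_refl C(2)]])
    have "refl y \<in> \<Omega>" if "y \<in> C" for y using that C(3) assms(2)[of "refl y"] by (auto simp: refl_refl)
    then show "refl ` C \<subseteq> \<Omega>" by blast
    show "\<phi> (refl x) = 0" if "x \<in> Rn 2 - refl ` C" for x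
    proof (rule C(4))
      have "refl x \<notin> C" using that refl_refl[of x] by (metis DiffD2 imageI)
      then show "refl x \<in> Rn 2 - C" using that refl_Rn by blast
    qed
  qed
qed

lemma J_partial:
  assumes \<phi>: "\<phi> \<in> test_functions 2 \<Omega>" and i: "i < 2"
  shows "l2_of 2 (partial_deriv i (\<lambda>x. \<phi> (refl x))) = (\<Sum>j<2. complex_of_real (r i j) *\<^sub>C J (l2_of 2 (partial_deriv j \<phi>)))"
proof -
  have p: "partial_deriv j \<phi> \<in> test_functions 2 \<Omega>" if "j < 2" for j by (rule test_functions_partial[OF \<phi> that])
  define k where "k x = complex_of_real (r i 0) * partial_deriv 0 \<phi> x + complex_of_real (r i 1) * partial_deriv 1 \<phi> x" for x
  have k: "k \<in> test_functions 2 \<Omega>" unfolding k_def by (intro test_functions_add test_functions_cmult p) auto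
  have "l2_of 2 (partial_deriv i (\<lambda>x. \<phi> (refl x))) = l2_of 2 (\<lambda>x. k (refl x))"
    by (rule l2_of_cong) (simp add: k_def partial_derivI[OF partial_deriv_refl[OF test_functions_smooth[OF \<phi>] _ i]])
  also have "\<dots> = J (l2_of 2 k)" by (rule J_l2_of[OF k, symmetric])
  also have "l2_of 2 k = complex_of_real (r i 0) *\<^sub>C l2_of 2 (partial_deriv 0 \<phi>) + complex_of_real (r i 1) *\<^sub>C l2_of 2 (partial_deriv 1 \<phi>)"
    unfolding k_def
    by (simp add: l2_of_add[OF test_functions_cmult[OF p] test_functions_cmult[OF p]] l2_of_cmult[OF p])
  finally show ?thesis by (simp add: sum_lessThan_2 J_add J_scaleC)
qed

end

section \<open>Extension by reflection\<close>

definition exp_bump' :: "real \<Rightarrow> real" where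
  "exp_bump' = deriv exp_bump"

lemma exp_bump_DERIV: "(exp_bump has_real_derivative exp_bump' x) (at x)"
proof -
  obtain D where "D 0 = exp_bump" "\<And>n x. (D n has_real_derivative D (Suc n) x) (at x)"
    using smooth_real_exp_bump unfolding smooth_real_def by blast
  then have "(exp_bump has_real_derivative D 1 x) (at x)" by (metis One_nat_def)
  then show ?thesis unfolding exp_bump'_def by (metis DERIV_imp_deriv)
qed

text \<open>Such points are minima of a nonnegative function.\<close>

lemma exp_bump'_nonpos: "x \<le> 0 \<Longrightarrow> exp_bump' x = 0"
  by (rule DERIV_local_min[OF exp_bump_DERIV zero_less_one]) (simp add: exp_bump_bounds exp_bump_def[of x])

lemma exp_bump'_pos:
  assumes "x > 0"
  shows "exp_bump' x = exp (- (1 / x)) / x\<^sup>2"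
proof (rule DERIV_unique[OF exp_bump_DERIV])
  have "((\<lambda>x. exp (- (1 / x))) has_real_derivative exp (- (1 / x)) / x\<^sup>2) (at x)"
    using assms by (auto intro!: derivative_eq_intros simp: power2_eq_square)
  then show "(exp_bump has_real_derivative exp (- (1 / x)) / x\<^sup>2) (at x)"
    by (rule has_field_derivative_transform_within_open[of _ _ _ "{0<..}"]) (use assms in \<open>auto simp: exp_bump_def\<close>)
qed

text \<open>At x = k s - 1 the factor x + 1 equals k s, so this bounds the slope of the k-th cutoff
  times the distance s from the line, independently of k. With y = 1 / x it reads (y + y^2) exp (-
  y) \<le> 2.\<close>

lemma exp_bump'_bound: "\<bar>(x + 1) * exp_bump' x\<bar> \<le> 2"
proof (cases "x \<le> 0")
  case False
  then have x: "x > 0" by simp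
  define y where "y = 1 / x"
  have y: "y > 0" using x by (simp add: y_def)
  have "(x + 1) * exp_bump' x = (y + y\<^sup>2) * exp (- y)"
    using x by (simp add: exp_bump'_pos y_def power2_eq_square field_simps)
  moreover have "(y + y\<^sup>2) * exp (- y) \<le> 2"
  proof -
    have "1 + y + y\<^sup>2 / 2 \<le> exp y" using y by (intro exp_lower_Taylor_quadratic) simp
    then have "y + y\<^sup>2 \<le> 2 * exp y" using y by linarith
    then have "(y + y\<^sup>2) * exp (- y) \<le> 2 * exp y * exp (- y)" by (intro mult_right_mono) auto
    also have "\<dots> = 2" by (simp add: exp_minus)
    finally show ?thesis .
  qed
  moreover have "0 \<le> (y + y\<^sup>2) * exp (- y)" using y by simp
  ultimately show ?thesis by simp
qed (simp add: exp_bump'_nonpos)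

lemma exp_bump'_le: "x > 0 \<Longrightarrow> \<bar>exp_bump' x\<bar> \<le> 1 / x\<^sup>2"
  by (simp add: exp_bump'_pos divide_right_mono)

lemma filterlim_mult_minus_1: "s > 0 \<Longrightarrow> filterlim (\<lambda>k. real k * s - 1) at_top sequentially"
proof -
  assume "s > 0"
  then have "filterlim (\<lambda>k. s * real k) at_top sequentially"
    by (intro filterlim_tendsto_pos_mult_at_top[OF tendsto_const _ filterlim_real_sequentially])
  then show ?thesis
    using filterlim_tendsto_add_at_top[OF tendsto_const[of "-1"]] by (simp add: mult.commute)
qed

text \<open>Cutoff and slope at a fixed distance s from the line while the boundary layer shrinks.
  The growing factor k is beaten by the decay 1 / x^2 of \<open>exp_bump'\<close>.\<close>

lemma exp_bump_shift_limit:
  assumes s: "s > 0"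
  shows "(\<lambda>k. exp_bump (real k * s - 1)) \<longlonglongrightarrow> 1" "(\<lambda>k. real k * exp_bump' (real k * s - 1)) \<longlonglongrightarrow> 0"
proof -
  note lim = filterlim_mult_minus_1[OF s]
  have inv: "((\<lambda>x::real. 1 / x) \<longlongrightarrow> 0) at_top"
    using tendsto_inverse_0_at_top[OF filterlim_ident] by (simp add: inverse_eq_divide)
  have ev: "\<forall>\<^sub>F k in sequentially. real k * s - 1 > 0" using lim unfolding filterlim_at_top_dense by blast
  have "((\<lambda>x::real. exp (- (1 / x))) \<longlongrightarrow> exp (- 0)) at_top" by (intro tendsto_intros inv)
  from filterlim_compose[OF this lim] have "(\<lambda>k. exp (- (1 / (real k * s - 1)))) \<longlonglongrightarrow> 1" by simp
  then show "(\<lambda>k. exp_bump (real k * s - 1)) \<longlonglongrightarrow> 1"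
    by (rule Lim_transform_eventually) (use ev in eventually_elim, simp add: exp_bump_def)
  have "((\<lambda>x::real. (1 / s) * ((1 / x) + (1 / x) * (1 / x))) \<longlongrightarrow> (1 / s) * (0 + 0 * 0)) at_top" by (intro tendsto_intros inv)
  from filterlim_compose[OF this lim]
  have l0: "(\<lambda>k. (1 / s) * ((1 / (real k * s - 1)) + (1 / (real k * s - 1)) * (1 / (real k * s - 1)))) \<longlonglongrightarrow> 0" by simp
  show "(\<lambda>k. real k * exp_bump' (real k * s - 1)) \<longlonglongrightarrow> 0"
  proof (rule Lim_null_comparison[OF _ l0])
    show "\<forall>\<^sub>F k in sequentially. norm (real k * exp_bump' (real k * s - 1)) \<le> (1 / s) * ((1 / (real k * s - 1)) + (1 / (real k * s - 1)) * (1 / (real k * s - 1)))"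
      using ev
    proof eventually_elim
      case (elim k)
      define x where "x = real k * s - 1"
      have x: "x > 0" using elim by (simp add: x_def)
      have k: "real k = (x + 1) / s" using s by (simp add: x_def)
      have "norm (real k * exp_bump' x) = (x + 1) / s * \<bar>exp_bump' x\<bar>" using x s by (simp add: k abs_mult)
      also have "\<dots> \<le> (x + 1) / s * (1 / x\<^sup>2)" using exp_bump'_le[OF x] x s by (intro mult_left_mono) auto
      also have "\<dots> = (1 / s) * (1 / x + (1 / x) * (1 / x))" using x s by (simp add: field_simps power2_eq_square)
      finally show ?case unfolding x_def .
    qed
  qed
qed

lemma tendsto_abs_l2:
  assumes F: "\<And>k::nat. sq_int (F k)" and f: "sq_int f" and w: "sq_int w"
    and lim: "\<And>p. (\<lambda>k. F k p) \<longlonglongrightarrow> f p" and le: "\<And>k p. cmod (F k p) \<le> cmod (w p)"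
  shows "(\<lambda>k. abs_l2 (F k)) \<longlonglongrightarrow> abs_l2 f"
proof -
  have fw: "cmod (f p) \<le> cmod (w p)" for p
    by (rule LIMSEQ_le_const2[OF tendsto_norm[OF lim]]) (use le in auto)
  have m: "f \<in> borel_measurable lebesgue_all" "F k \<in> borel_measurable lebesgue_all" for k
    using F f by (auto intro: sq_int_measurable)
  have "(\<lambda>k. LINT p|lebesgue_all. (cmod (F k p - f p))\<^sup>2) \<longlonglongrightarrow> (LINT p|lebesgue_all. 0)"
  proof (rule integral_dominated_convergence)
    show "integrable lebesgue_all (\<lambda>p. 4 * (cmod (w p))\<^sup>2)" using w by (simp add: sq_int_def)
    show "AE p in lebesgue_all. (\<lambda>k. (cmod (F k p - f p))\<^sup>2) \<longlonglongrightarrow> 0"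
    proof (rule AE_I2)
      fix p
      have "(\<lambda>k. (cmod (F k p - f p))\<^sup>2) \<longlonglongrightarrow> (cmod (f p - f p))\<^sup>2" by (intro tendsto_intros lim)
      then show "(\<lambda>k. (cmod (F k p - f p))\<^sup>2) \<longlonglongrightarrow> 0" by simp
    qed
    show "AE p in lebesgue_all. norm ((cmod (F k p - f p))\<^sup>2) \<le> 4 * (cmod (w p))\<^sup>2" for k
    proof (rule AE_I2)
      fix p
      have "cmod (F k p - f p) \<le> 2 * cmod (w p)"
        using norm_triangle_ineq4[of "F k p" "f p"] le[of k p] fw[of p] by linarith
      then have "(cmod (F k p - f p))\<^sup>2 \<le> (2 * cmod (w p))\<^sup>2" by (intro power_mono) auto
      then show "norm ((cmod (F k p - f p))\<^sup>2) \<le> 4 * (cmod (w p))\<^sup>2" by (simp add: power_mult_distrib)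
    qed
  qed (use m in measurable)
  then have "(\<lambda>k. (norm (abs_l2 (F k) - abs_l2 f))\<^sup>2) \<longlonglongrightarrow> 0"
    by (simp add: abs_l2_diff f F norm_abs_l2 sq_int_diff)
  then have "(\<lambda>k. norm (abs_l2 (F k) - abs_l2 f)) \<longlonglongrightarrow> 0" by simp
  then show ?thesis by (simp add: LIM_zero_iff tendsto_norm_zero_iff)
qed

section \<open>Cutoffs at the line of reflection\<close>

locale reflected_domain = reflection \<nu> for \<nu> +
  fixes \<Omega>' :: "(nat \<Rightarrow> real) set"
  assumes open_\<Omega>': "open_domain 2 \<Omega>'" and sym: "\<And>x. refl x \<in> \<Omega>' \<longleftrightarrow> x \<in> \<Omega>'"
begin

definition half :: "(nat \<Rightarrow> real) set" where
  "half = {x \<in> \<Omega>'. 0 < dist_line x}"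

lemma half_sub: "half \<subseteq> \<Omega>'"
  by (auto simp: half_def)

lemma continuous_dist_line: "continuous_on A dist_line"
  unfolding dist_line_def by (intro continuous_intros continuous_on_coordinate)

lemma open_half: "open_domain 2 half"
proof -
  obtain U where U: "open U" "\<Omega>' = U \<inter> Rn 2" using open_\<Omega>' by (auto simp: open_domain_def)
  have "open {x. 0 < dist_line x}"
    by (intro open_Collect_less continuous_on_const continuous_dist_line)
  then have "open (U \<inter> {x. 0 < dist_line x})" using U(1) by (rule open_Int[rotated])
  moreover have "half = (U \<inter> {x. 0 < dist_line x}) \<inter> Rn 2" unfolding half_def unfolding U(2) by blast
  ultimately show ?thesis unfolding open_domain_def by blast
qed

sublocale big: domain 2 \<Omega>'
  by unfold_locales (rule open_\<Omega>')

sublocale small: domain 2 half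
  by unfold_locales (rule open_half)

abbreviation P :: "l2 \<Rightarrow> l2" where
  "P \<equiv> restrict_l2 2 half"

lemmas P_add = restrict_l2_add[OF small.\<Omega>_sets]
  and P_scaleC = restrict_l2_scaleC[OF small.\<Omega>_sets]
  and P_scaleR = restrict_l2_scaleR[OF small.\<Omega>_sets]
  and P_in = restrict_l2_in[OF small.\<Omega>_sets]
  and P_id = restrict_l2_id[OF small.\<Omega>_sets]
  and cinner_P = cinner_restrict_l2[OF small.\<Omega>_sets]
  and P_lin = bounded_linear_restrict_l2[OF small.\<Omega>_sets]

text \<open>The shift by 1 makes the k-th cutoff vanish up to distance 1 / k from the line, so that
  its product with a test function of \<Omega>' has compact support inside \<open>half\<close>. The
  argument is written as a sum to match \<open>smooth_ridge\<close>.\<close>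

definition cutoff :: "nat \<Rightarrow> (nat \<Rightarrow> real) \<Rightarrow> complex" where
  "cutoff k = (\<lambda>x. complex_of_real (exp_bump ((\<Sum>i<2. (real k * \<nu> i) * x i) + (- 1))))"

lemma cutoff_arg: "(\<Sum>i<2. (real k * \<nu> i) * x i) + (- 1) = real k * dist_line x - 1"
  unfolding sum_lessThan_2 dist_line_def by (simp add: algebra_simps)

lemma cutoff_eq: "cutoff k x = complex_of_real (exp_bump (real k * dist_line x - 1))"
  unfolding cutoff_def cutoff_arg ..

lemma smooth_cutoff: "smooth 2 (cutoff k)"
  unfolding cutoff_def by (rule smooth_ridge[OF smooth_real_exp_bump])

lemma partial_deriv_cutoff:
  assumes "i < 2"
  shows "partial_deriv i (cutoff k) x = complex_of_real (real k * exp_bump' (real k * dist_line x - 1)) * complex_of_real (\<nu> i)"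
proof -
  have "partial_deriv i (cutoff k) x = complex_of_real (exp_bump' (real k * dist_line x - 1) * (real k * \<nu> i))"
    unfolding cutoff_def
    by (rule partial_derivI, rule ridge_derivative[OF _ assms]) (unfold cutoff_arg, rule exp_bump_DERIV)
  then show ?thesis by simp
qed

lemma cutoff_test:
  assumes "\<phi> \<in> test_functions 2 \<Omega>'"
  shows "(\<lambda>x. cutoff k x * \<phi> x) \<in> test_functions 2 half"
  using assms
proof (rule test_functionsE)
  fix C assume C: "smooth 2 \<phi>" "compact C" "C \<subseteq> \<Omega>'" "\<And>x. x \<in> Rn 2 - C \<Longrightarrow> \<phi> x = 0"
  have "closed {x. 1 \<le> real k * dist_line x}"
    by (intro closed_Collect_le continuous_on_const continuous_on_mult_left continuous_dist_line)
  then have "compact (C \<inter> {x. 1 \<le> real k * dist_line x})" using C(2) by (rule compact_Int_closed[rotated])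
  moreover have "C \<inter> {x. 1 \<le> real k * dist_line x} \<subseteq> half"
  proof
    fix x assume x: "x \<in> C \<inter> {x. 1 \<le> real k * dist_line x}"
    have "0 < dist_line x"
    proof (rule ccontr)
      assume "\<not> 0 < dist_line x"
      then have "real k * dist_line x \<le> 0" by (intro mult_nonneg_nonpos) auto
      then show False using x by auto
    qed
    then show "x \<in> half" using x C(3) by (auto simp: half_def)
  qed
  ultimately show ?thesis
  proof (rule test_functionsI[OF smooth_mult[OF smooth_cutoff C(1)]])
    fix x assume x: "x \<in> Rn 2 - C \<inter> {x. 1 \<le> real k * dist_line x}"
    show "cutoff k x * \<phi> x = 0"
    proof (cases "x \<in> C")
      case True
      then have "real k * dist_line x - 1 \<le> 0" using x by auto
      then show ?thesis by (simp add: cutoff_eq exp_bump_def)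
    next
      case False
      then show ?thesis using C(4) x by simp
    qed
  qed
qed

lemma cutoff_limit:
  assumes \<phi>: "\<phi> \<in> test_functions 2 \<Omega>'"
  shows "(\<lambda>k. l2_of 2 (\<lambda>x. cutoff k x * \<phi> x)) \<longlonglongrightarrow> P (l2_of 2 \<phi>)"
  unfolding l2_of_zero_ext restrict_abs_l2[OF small.\<Omega>_sets sq_int_test(1)[OF \<phi>]]
proof (rule tendsto_abs_l2[where w = "zero_ext 2 \<phi>"])
  show "sq_int (zero_ext 2 (\<lambda>x. cutoff k x * \<phi> x))" for k by (rule sq_int_test(1)[OF cutoff_test[OF \<phi>]])
  show "sq_int (\<lambda>p. indicator ({2} \<times> half) p * zero_ext 2 \<phi> p)"
    by (intro sq_int_indicator_mult slice_lebesgue small.\<Omega>_sets sq_int_test(1)[OF \<phi>])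
  show "sq_int (zero_ext 2 \<phi>)" by (rule sq_int_test(1)[OF \<phi>])
  show "cmod (zero_ext 2 (\<lambda>x. cutoff k x * \<phi> x) p) \<le> cmod (zero_ext 2 \<phi> p)" for k p
    by (cases p) (auto simp: zero_ext_def cutoff_eq norm_mult exp_bump_bounds intro!: mult_left_le_one_le)
  fix p :: "nat \<times> (nat \<Rightarrow> real)"
  obtain j x where p: "p = (j, x)" by (cases p)
  show "(\<lambda>k. zero_ext 2 (\<lambda>x. cutoff k x * \<phi> x) p) \<longlonglongrightarrow> indicator ({2} \<times> half) p * zero_ext 2 \<phi> p"
  proof (cases "j = 2 \<and> x \<in> Rn 2")
    case True
    have supp: "x \<in> \<Omega>'" if "\<phi> x \<noteq> 0"
      using \<phi> that True by (elim test_functionsE) blast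
    show ?thesis
    proof (cases "0 < dist_line x")
      case pos: True
      have "(\<lambda>k. complex_of_real (exp_bump (real k * dist_line x - 1)) * \<phi> x) \<longlonglongrightarrow> complex_of_real 1 * \<phi> x"
        by (intro tendsto_intros exp_bump_shift_limit pos)
      moreover have i: "indicator ({2} \<times> half) p * zero_ext 2 \<phi> p = \<phi> x"
        using True pos supp by (auto simp: p zero_ext_def half_def indicator_def)
      moreover have e: "zero_ext 2 (\<lambda>x. cutoff k x * \<phi> x) p = complex_of_real (exp_bump (real k * dist_line x - 1)) * \<phi> x" for k
        using True by (simp add: p zero_ext_def cutoff_eq)
      ultimately show ?thesis by (simp only: i e of_real_1 mult_1_left)
    next
      case False
      have "real k * dist_line x - 1 \<le> 0" for k
        using mult_nonneg_nonpos[of "real k" "dist_line x"] False by simp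
      then have z: "zero_ext 2 (\<lambda>x. cutoff k x * \<phi> x) p = 0" for k
        by (simp add: p zero_ext_def cutoff_eq exp_bump_def)
      have i: "indicator ({2} \<times> half) p * zero_ext 2 \<phi> p = 0"
        using False by (auto simp: p half_def)
      show ?thesis unfolding z i by (rule tendsto_const)
    qed
  qed (auto simp: p zero_ext_def)
qed

text \<open>An odd function takes opposite values at x and at its mirror image, so the modulus at x
  is half that of the increment along the segment between them, which has length 2
  |\<open>dist_line x\<close>|. The derivative bounds hold in the whole plane, so the segment may
  leave \<Omega>'.\<close>

lemma odd_bound:
  assumes \<phi>: "\<phi> \<in> test_functions 2 \<Omega>'" and odd: "\<And>x. x \<in> Rn 2 \<Longrightarrow> \<phi> (refl x) = - \<phi> x"
  obtains L where "\<And>x. x \<in> Rn 2 \<Longrightarrow> cmod (\<phi> x) \<le> L * \<bar>dist_line x\<bar>"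
proof -
  have "\<exists>M\<ge>0. \<forall>x\<in>Rn 2. cmod (partial_deriv i \<phi> x) \<le> M" if i: "i < 2" for i
  proof -
    obtain C where C: "smooth 2 (partial_deriv i \<phi>)" "compact C" "\<And>x. x \<in> Rn 2 - C \<Longrightarrow> partial_deriv i \<phi> x = 0"
      using test_functions_partial[OF \<phi> i] by (rule test_functionsE) blast
    obtain M where M: "M \<ge> 0" "\<And>p. cmod (zero_ext 2 (partial_deriv i \<phi>) p) \<le> M * indicator ({2} \<times> C) p"
      using zero_ext_bounded[OF smooth_continuous[OF C(1)] C(2,3)] by blast
    have "cmod (partial_deriv i \<phi> x) \<le> M" if "x \<in> Rn 2" for x
    proof -
      have "cmod (partial_deriv i \<phi> x) \<le> M * indicator ({2} \<times> C) (2::nat, x)" using M(2)[of "(2, x)"] that by (simp add: zero_ext_def)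
      also have "\<dots> \<le> M" using M(1) by (auto simp: indicator_def)
      finally show ?thesis .
    qed
    then show ?thesis using M(1) by blast
  qed
  then obtain M where M: "\<And>i. i < 2 \<Longrightarrow> 0 \<le> M i" "\<And>i x. i < 2 \<Longrightarrow> x \<in> Rn 2 \<Longrightarrow> cmod (partial_deriv i \<phi> x) \<le> M i"
    by metis
  have nu: "\<bar>\<nu> 0\<bar> \<le> 1" "\<bar>\<nu> 1\<bar> \<le> 1"
  proof -
    have "(\<nu> 0)\<^sup>2 \<le> 1" "(\<nu> 1)\<^sup>2 \<le> 1"
      using unit zero_le_power2[of "\<nu> 0"] zero_le_power2[of "\<nu> 1"] by linarith+
    then show "\<bar>\<nu> 0\<bar> \<le> 1" "\<bar>\<nu> 1\<bar> \<le> 1" by (simp_all add: abs_square_le_1)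
  qed
  have "cmod (\<phi> x) \<le> (M 0 + M 1) * \<bar>dist_line x\<bar>" if x: "x \<in> Rn 2" for x
  proof -
    define s where "s = 2 * dist_line x"
    define \<gamma> where "\<gamma> t = pt (x 0 - t * (s * \<nu> 0)) (x 1 - t * (s * \<nu> 1))" for t
    have "cmod (\<phi> (\<gamma> 1) - \<phi> (\<gamma> 0)) \<le> 1 * (\<bar>s\<bar> * (M 0 + M 1))"
    proof (rule norm_increment_le)
      fix t :: real
      have d: "((\<lambda>t. \<phi> (\<gamma> t)) has_vector_derivative
          complex_of_real (- (s * \<nu> 0)) * partial_deriv 0 \<phi> (\<gamma> t) + complex_of_real (- (s * \<nu> 1)) * partial_deriv 1 \<phi> (\<gamma> t)) (at t)"
        unfolding \<gamma>_def
        by (rule smooth_curve[OF test_functions_smooth[OF \<phi>]]) (auto intro!: derivative_eq_intros)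
      then show "((\<lambda>t. \<phi> (\<gamma> t)) has_vector_derivative
          complex_of_real (- (s * \<nu> 0)) * partial_deriv 0 \<phi> (\<gamma> t) + complex_of_real (- (s * \<nu> 1)) * partial_deriv 1 \<phi> (\<gamma> t)) (at t within {0..1})"
        by (rule has_vector_derivative_at_within)
      have b: "cmod (complex_of_real (- (s * \<nu> i)) * partial_deriv i \<phi> (\<gamma> t)) \<le> \<bar>s\<bar> * M i" if "i < 2" "\<bar>\<nu> i\<bar> \<le> 1" for i
      proof -
        have "\<bar>s\<bar> * \<bar>\<nu> i\<bar> * cmod (partial_deriv i \<phi> (\<gamma> t)) \<le> \<bar>s\<bar> * 1 * M i"
          using that M[OF that(1)] by (intro mult_mono) (auto simp: \<gamma>_def pt_Rn)
        then show ?thesis by (simp add: norm_mult abs_mult)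
      qed
      show "norm (complex_of_real (- (s * \<nu> 0)) * partial_deriv 0 \<phi> (\<gamma> t) + complex_of_real (- (s * \<nu> 1)) * partial_deriv 1 \<phi> (\<gamma> t)) \<le> \<bar>s\<bar> * (M 0 + M 1)"
        using norm_triangle_ineq[of "complex_of_real (- (s * \<nu> 0)) * partial_deriv 0 \<phi> (\<gamma> t)" "complex_of_real (- (s * \<nu> 1)) * partial_deriv 1 \<phi> (\<gamma> t)"]
          b[of 0] b[of 1] nu unfolding distrib_left by linarith
    qed simp
    moreover have "\<gamma> 0 = x" using pt_eq[OF x] by (simp add: \<gamma>_def)
    moreover have "\<gamma> 1 = refl x"
    proof (rule Rn2_eqI[OF _ refl_Rn[OF x]])
      show "\<gamma> 1 \<in> Rn 2" unfolding \<gamma>_def by (rule pt_Rn)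
    qed (simp_all add: \<gamma>_def s_def refl_simps refl_simps[simplified])
    ultimately have "cmod (- \<phi> x - \<phi> x) \<le> \<bar>s\<bar> * (M 0 + M 1)" using odd[OF x] by simp
    moreover have "cmod (- \<phi> x - \<phi> x) = 2 * cmod (\<phi> x)"
    proof -
      have "- \<phi> x - \<phi> x = (- 2) * \<phi> x" by simp
      then show ?thesis by (simp only: norm_mult) simp
    qed
    ultimately show ?thesis by (simp add: s_def abs_mult algebra_simps)
  qed
  then show ?thesis using that by blast
qed

text \<open>The product rule leaves a term with the derivative of the cutoff. By
  \<open>odd_bound\<close> it is at most a constant times slope times distance, which
  \<open>exp_bump'_bound\<close> controls, and it tends to 0 pointwise; dominated convergence
  removes it.\<close>

lemma odd_cutoff_limit:
  assumes \<phi>: "\<phi> \<in> test_functions 2 \<Omega>'" and odd: "\<And>x. x \<in> Rn 2 \<Longrightarrow> \<phi> (refl x) = - \<phi> x" and i: "i < 2"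
  shows "(\<lambda>k. l2_of 2 (partial_deriv i (\<lambda>x. cutoff k x * \<phi> x))) \<longlonglongrightarrow> P (l2_of 2 (partial_deriv i \<phi>))"
proof -
  note \<phi>i = test_functions_partial[OF \<phi> i]
  obtain L where L: "\<And>x. x \<in> Rn 2 \<Longrightarrow> cmod (\<phi> x) \<le> L * \<bar>dist_line x\<bar>" using odd_bound[OF \<phi> odd] by blast
  obtain C where C: "compact C" "\<And>x. x \<in> Rn 2 - C \<Longrightarrow> \<phi> x = 0" using \<phi> by (rule test_functionsE) blast
  define \<psi> where "\<psi> k = (\<lambda>x. partial_deriv i (cutoff k) x * \<phi> x)" for k
  have \<psi>: "\<psi> k \<in> test_functions 2 \<Omega>'" for k
    unfolding \<psi>_def by (rule test_functions_smooth_mult[OF smooth_partial_deriv[OF smooth_cutoff i] \<phi>])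
  have "(\<lambda>k. l2_of 2 (\<psi> k)) \<longlonglongrightarrow> abs_l2 (\<lambda>_. 0)"
    unfolding l2_of_zero_ext
  proof (rule tendsto_abs_l2[where w = "\<lambda>p. complex_of_real (2 * \<bar>L\<bar> * \<bar>\<nu> i\<bar>) * indicator ({2} \<times> C) p"])
    show "sq_int (zero_ext 2 (\<psi> k))" for k by (rule sq_int_test(1)[OF \<psi>])
    show "sq_int (\<lambda>_. 0)" by (rule sq_int_zero)
    show "sq_int (\<lambda>p. complex_of_real (2 * \<bar>L\<bar> * \<bar>\<nu> i\<bar>) * indicator ({2} \<times> C) p)"
      using emeasure_compact_slice[OF C(1), of 2] by (intro sq_int_indicator sets_lebesgue_allI)
    have \<psi>x: "\<psi> k x = complex_of_real (real k * exp_bump' (real k * dist_line x - 1)) * complex_of_real (\<nu> i) * \<phi> x" for k x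
      by (simp add: \<psi>_def partial_deriv_cutoff[OF i])
    fix p :: "nat \<times> (nat \<Rightarrow> real)"
    obtain j x where p: "p = (j, x)" by (cases p)
    show "(\<lambda>k. zero_ext 2 (\<psi> k) p) \<longlonglongrightarrow> 0"
    proof (cases "0 < dist_line x")
      case True
      have "(\<lambda>k. complex_of_real (real k * exp_bump' (real k * dist_line x - 1)) * complex_of_real (\<nu> i) * \<phi> x) \<longlonglongrightarrow> complex_of_real 0 * complex_of_real (\<nu> i) * \<phi> x"
        by (intro tendsto_mult tendsto_const tendsto_of_real exp_bump_shift_limit(2)[OF True])
      then have "(\<lambda>k. \<psi> k x) \<longlonglongrightarrow> 0" unfolding \<psi>x by (simp only: of_real_0 mult_zero_left)
      then show ?thesis unfolding p zero_ext_def by (cases "j = 2 \<and> x \<in> Rn 2") auto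
    next
      case False
      have "real k * dist_line x - 1 \<le> 0" for k
        using mult_nonneg_nonpos[of "real k" "dist_line x"] False by simp
      then have "\<psi> k x = 0" for k unfolding \<psi>x by (subst exp_bump'_nonpos) auto
      then have "zero_ext 2 (\<psi> k) p = 0" for k by (simp add: p zero_ext_def)
      then show ?thesis by simp
    qed
    show "cmod (zero_ext 2 (\<psi> k) p) \<le> cmod (complex_of_real (2 * \<bar>L\<bar> * \<bar>\<nu> i\<bar>) * indicator ({2} \<times> C) p)" for k
    proof (cases "j = 2 \<and> x \<in> Rn 2 \<and> x \<in> C")
      case True
      have "cmod (\<psi> k x) = \<bar>real k * exp_bump' (real k * dist_line x - 1)\<bar> * \<bar>\<nu> i\<bar> * cmod (\<phi> x)"
        by (simp add: \<psi>x norm_mult abs_mult)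
      also have "\<dots> \<le> \<bar>real k * exp_bump' (real k * dist_line x - 1)\<bar> * \<bar>\<nu> i\<bar> * (\<bar>L\<bar> * \<bar>dist_line x\<bar>)"
        using L[of x] True by (intro mult_left_mono order_trans[OF L mult_right_mono]) auto
      also have "\<dots> = \<bar>(real k * dist_line x - 1 + 1) * exp_bump' (real k * dist_line x - 1)\<bar> * \<bar>\<nu> i\<bar> * \<bar>L\<bar>"
        by (simp add: abs_mult mult_ac)
      also have "\<dots> \<le> 2 * \<bar>\<nu> i\<bar> * \<bar>L\<bar>"
        by (intro mult_right_mono exp_bump'_bound) auto
      finally show ?thesis using True by (simp add: p zero_ext_def mult_ac norm_mult)
    next
      case False
      then have "zero_ext 2 (\<psi> k) p = 0" using C(2)[of x] by (auto simp: p zero_ext_def \<psi>x)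
      then show ?thesis by simp
    qed
  qed
  then have 0: "(\<lambda>k. l2_of 2 (\<psi> k)) \<longlonglongrightarrow> 0" by (simp add: zero_l2.abs_eq)
  have "l2_of 2 (partial_deriv i (\<lambda>x. cutoff k x * \<phi> x)) = l2_of 2 (\<lambda>x. cutoff k x * partial_deriv i \<phi> x) + l2_of 2 (\<psi> k)" for k
    unfolding l2_of_add[OF cutoff_test[OF \<phi>i] \<psi>, symmetric]
    by (rule l2_of_cong) (simp add: \<psi>_def partial_deriv_mult[OF smooth_cutoff test_functions_smooth[OF \<phi>] i])
  then show ?thesis using tendsto_add[OF cutoff_limit[OF \<phi>i] 0] by simp
qed

text \<open>The gradient of the cutoff is a multiple of \<nu>, so in the combination along \<tau>
  the derivatives of the cutoff cancel.\<close>

lemma tangential_cutoff_limit: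
  fixes \<tau> :: "nat \<Rightarrow> real"
  assumes \<phi>: "\<phi> \<in> test_functions 2 \<Omega>'" and \<tau>: "\<tau> 0 * \<nu> 0 + \<tau> 1 * \<nu> 1 = 0"
  shows "(\<lambda>k. \<Sum>i<2. \<tau> i *\<^sub>R l2_of 2 (partial_deriv i (\<lambda>x. cutoff k x * \<phi> x))) \<longlonglongrightarrow> P (\<Sum>i<2. \<tau> i *\<^sub>R l2_of 2 (partial_deriv i \<phi>))"
proof -
  have comb: "(\<Sum>i<2. \<tau> i *\<^sub>R l2_of 2 (f i)) = l2_of 2 (\<lambda>x. complex_of_real (\<tau> 0) * f 0 x + complex_of_real (\<tau> 1) * f 1 x)"
    if "\<And>i. i < 2 \<Longrightarrow> f i \<in> test_functions 2 W" for f W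
  proof -
    have f: "f 0 \<in> test_functions 2 W" "f 1 \<in> test_functions 2 W" using that by auto
    show ?thesis
      unfolding sum_lessThan_2 l2_of_add[OF test_functions_cmult[OF f(1)] test_functions_cmult[OF f(2)]]
      by (simp add: l2_of_cmult[OF f(1)] l2_of_cmult[OF f(2)] l2_of_cmult[OF f(2)[simplified]] scaleR_eq_scaleC)
  qed
  note \<phi>i = test_functions_partial[OF \<phi>]
  define \<psi> where "\<psi> x = complex_of_real (\<tau> 0) * partial_deriv 0 \<phi> x + complex_of_real (\<tau> 1) * partial_deriv 1 \<phi> x" for x
  have \<psi>: "\<psi> \<in> test_functions 2 \<Omega>'" unfolding \<psi>_def by (intro test_functions_add test_functions_cmult \<phi>i) auto
  have "(\<Sum>i<2. \<tau> i *\<^sub>R l2_of 2 (partial_deriv i (\<lambda>x. cutoff k x * \<phi> x))) = l2_of 2 (\<lambda>x. cutoff k x * \<psi> x)" for k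
  proof (rule trans[OF comb[where W = half] l2_of_cong])
    show "partial_deriv i (\<lambda>x. cutoff k x * \<phi> x) \<in> test_functions 2 half" if "i < 2" for i
      by (rule test_functions_partial[OF cutoff_test[OF \<phi>] that])
    fix x :: "nat \<Rightarrow> real" assume x: "x \<in> Rn 2"
    define e where "e = complex_of_real (real k * exp_bump' (real k * dist_line x - 1)) * \<phi> x"
    have pd: "partial_deriv i (\<lambda>x. cutoff k x * \<phi> x) x = cutoff k x * partial_deriv i \<phi> x + complex_of_real (\<nu> i) * e" if "i < 2" for i
      unfolding partial_deriv_mult[OF smooth_cutoff test_functions_smooth[OF \<phi>] that x] partial_deriv_cutoff[OF that] e_def
      by (simp add: mult_ac)
    have "complex_of_real (\<tau> 0) * (complex_of_real (\<nu> 0) * e) + complex_of_real (\<tau> 1) * (complex_of_real (\<nu> 1) * e)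
        = complex_of_real (\<tau> 0 * \<nu> 0 + \<tau> 1 * \<nu> 1) * e" by (simp add: algebra_simps)
    also have "\<dots> = 0" unfolding \<tau> by simp
    finally have z: "complex_of_real (\<tau> 0) * (complex_of_real (\<nu> 0) * e) + complex_of_real (\<tau> 1) * (complex_of_real (\<nu> 1) * e) = 0" .
    have "complex_of_real (\<tau> 0) * (cutoff k x * partial_deriv 0 \<phi> x + complex_of_real (\<nu> 0) * e) + complex_of_real (\<tau> 1) * (cutoff k x * partial_deriv 1 \<phi> x + complex_of_real (\<nu> 1) * e)
        = cutoff k x * \<psi> x + (complex_of_real (\<tau> 0) * (complex_of_real (\<nu> 0) * e) + complex_of_real (\<tau> 1) * (complex_of_real (\<nu> 1) * e))"
      unfolding \<psi>_def by (simp only: algebra_simps)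
    then show "complex_of_real (\<tau> 0) * partial_deriv 0 (\<lambda>x. cutoff k x * \<phi> x) x + complex_of_real (\<tau> 1) * partial_deriv 1 (\<lambda>x. cutoff k x * \<phi> x) x = cutoff k x * \<psi> x"
      unfolding z using pd[of 0] pd[of 1] by simp
  qed
  moreover have "(\<Sum>i<2. \<tau> i *\<^sub>R l2_of 2 (partial_deriv i \<phi>)) = l2_of 2 \<psi>"
    unfolding \<psi>_def by (rule comb[where W = \<Omega>']) (rule \<phi>i)
  ultimately show ?thesis using cutoff_limit[OF \<psi>] by simp
qed

lemma J_sum: "J (\<Sum>i\<in>I. f i) = (\<Sum>i\<in>I. J (f i))"
  by (rule linear_sum[OF bounded_linear.linear[OF bounded_linear_J]])

lemma r_commute: "r i j = r j i"
  by (simp add: r_def)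

lemma refl_test: "\<phi> \<in> test_functions 2 \<Omega>' \<Longrightarrow> (\<lambda>x. \<phi> (refl x)) \<in> test_functions 2 \<Omega>'"
  by (rule test_functions_refl[OF _ sym])

lemma partial_refl:
  assumes "\<phi> \<in> test_functions 2 \<Omega>'" "i < 2"
  shows "l2_of 2 (partial_deriv i (\<lambda>x. \<phi> (refl x))) = (\<Sum>j<2. r i j *\<^sub>R J (l2_of 2 (partial_deriv j \<phi>)))"
  using J_partial[OF assms] by (simp add: scaleR_eq_scaleC)

lemma J_l2_of_partial:
  assumes \<phi>: "\<phi> \<in> test_functions 2 \<Omega>'" and i: "i < 2"
  shows "J (l2_of 2 (partial_deriv i \<phi>)) = (\<Sum>j<2. r i j *\<^sub>R l2_of 2 (partial_deriv j (\<lambda>x. \<phi> (refl x))))"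
proof -
  have "l2_of 2 (partial_deriv i \<phi>) = (\<Sum>j<2. r i j *\<^sub>R J (l2_of 2 (partial_deriv j (\<lambda>x. \<phi> (refl x)))))"
    using partial_refl[OF refl_test[OF \<phi>] i] by (simp add: refl_refl)
  then show ?thesis by (simp add: J_sum J_scaleR J_J)
qed

lemma l2_on_half: "u \<in> l2_on 2 half \<Longrightarrow> u \<in> l2_on 2 \<Omega>'"
  using l2_on_mono[OF half_sub] by blast

lemma J_in_domain: "u \<in> l2_on 2 \<Omega>' \<Longrightarrow> J u \<in> l2_on 2 \<Omega>'"
  by (rule J_in[OF _ sym])

lemma l2_on_sum: "(\<And>i. i \<in> I \<Longrightarrow> f i \<in> l2_on 2 W) \<Longrightarrow> 0 \<in> l2_on 2 W \<Longrightarrow> (\<Sum>i\<in>I. f i) \<in> l2_on 2 W"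
  by (induction I rule: infinite_finite_induct) (auto intro: l2_on_add)

lemma zero_l2_on: "0 \<in> l2_on 2 W"
  unfolding zero_l2.abs_eq l2_on_abs_l2[OF sq_int_zero] by simp

text \<open>
  The defect in the integration by parts formula against a test function that need not vanish
  near the line of reflection. It only sees the normal component of the test vector field.
\<close>

definition defect :: "l2 \<Rightarrow> nat \<Rightarrow> ((nat \<Rightarrow> real) \<Rightarrow> complex) \<Rightarrow> complex" where
  "defect u i \<phi> = cinner u (l2_of 2 (partial_deriv i \<phi>)) + cinner (wderiv 2 half i u) (l2_of 2 \<phi>)"

lemma defect_half: "u \<in> H1 2 half \<Longrightarrow> i < 2 \<Longrightarrow> \<phi> \<in> test_functions 2 half \<Longrightarrow> defect u i \<phi> = 0"
  using small.H1_weak_deriv[of u i] by (simp add: weak_deriv_iff defect_def)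

lemma cinner_P_half: "u \<in> l2_on 2 half \<Longrightarrow> cinner u (P v) = cinner u v"
  using cinner_P[of u v] by (simp add: P_id)

text \<open>The truncated functions are test functions of \<open>half\<close>, where the defect
  vanishes; oddness allows the cutoff to be removed in the limit.\<close>

lemma defect_odd:
  assumes u: "u \<in> H1 2 half" and i: "i < 2" and \<phi>: "\<phi> \<in> test_functions 2 \<Omega>'"
    and odd: "\<And>x. x \<in> Rn 2 \<Longrightarrow> \<phi> (refl x) = - \<phi> x"
  shows "defect u i \<phi> = 0"
proof -
  have "(\<lambda>k. cinner u (l2_of 2 (partial_deriv i (\<lambda>x. cutoff k x * \<phi> x))) + cinner (wderiv 2 half i u) (l2_of 2 (\<lambda>x. cutoff k x * \<phi> x)))
    \<longlonglongrightarrow> cinner u (P (l2_of 2 (partial_deriv i \<phi>))) + cinner (wderiv 2 half i u) (P (l2_of 2 \<phi>))"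
    by (intro tendsto_add tendsto_cinner tendsto_const odd_cutoff_limit[OF \<phi> odd i] cutoff_limit[OF \<phi>])
  then have "(\<lambda>k. defect u i (\<lambda>x. cutoff k x * \<phi> x)) \<longlonglongrightarrow> defect u i \<phi>"
    unfolding cinner_P_half[OF small.H1_in[OF u]] cinner_P_half[OF small.wderiv_in[OF u i]] defect_def .
  then show ?thesis
    using defect_half[OF u i cutoff_test[OF \<phi>]] by (simp add: LIMSEQ_const_iff)
qed

text \<open>The same limit, with the tangential combination in place of oddness.\<close>

lemma defect_tangential:
  fixes \<tau> :: "nat \<Rightarrow> real"
  assumes u: "u \<in> H1 2 half" and \<phi>: "\<phi> \<in> test_functions 2 \<Omega>'" and \<tau>: "\<tau> 0 * \<nu> 0 + \<tau> 1 * \<nu> 1 = 0"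
  shows "(\<Sum>i<2. complex_of_real (\<tau> i) * defect u i \<phi>) = 0"
proof -
  have sum_eq: "(\<Sum>i<2. complex_of_real (\<tau> i) * defect u i \<psi>) =
      cinner u (\<Sum>i<2. \<tau> i *\<^sub>R l2_of 2 (partial_deriv i \<psi>)) + (\<Sum>i<2. complex_of_real (\<tau> i) * cinner (wderiv 2 half i u) (l2_of 2 \<psi>))" for \<psi>
    by (simp add: defect_def cinner_sum cinner_scaleR distrib_left sum.distrib)
  have "(\<lambda>k. cinner u (\<Sum>i<2. \<tau> i *\<^sub>R l2_of 2 (partial_deriv i (\<lambda>x. cutoff k x * \<phi> x))) +
      (\<Sum>i<2. complex_of_real (\<tau> i) * cinner (wderiv 2 half i u) (l2_of 2 (\<lambda>x. cutoff k x * \<phi> x))))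
    \<longlonglongrightarrow> cinner u (P (\<Sum>i<2. \<tau> i *\<^sub>R l2_of 2 (partial_deriv i \<phi>))) +
      (\<Sum>i<2. complex_of_real (\<tau> i) * cinner (wderiv 2 half i u) (P (l2_of 2 \<phi>)))"
    by (intro tendsto_add tendsto_sum tendsto_mult tendsto_cinner tendsto_const tangential_cutoff_limit[OF \<phi> \<tau>] cutoff_limit[OF \<phi>])
  moreover have "(\<Sum>i<2. complex_of_real (\<tau> i) * cinner (wderiv 2 half i u) (P (l2_of 2 \<phi>)))
      = (\<Sum>i<2. complex_of_real (\<tau> i) * cinner (wderiv 2 half i u) (l2_of 2 \<phi>))"
    by (rule sum.cong) (auto simp: cinner_P_half small.wderiv_in[OF u])
  ultimately have "(\<lambda>k. \<Sum>i<2. complex_of_real (\<tau> i) * defect u i (\<lambda>x. cutoff k x * \<phi> x)) \<longlonglongrightarrow> (\<Sum>i<2. complex_of_real (\<tau> i) * defect u i \<phi>)"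
    unfolding sum_eq cinner_P_half[OF small.H1_in[OF u]] by simp
  moreover have "(\<Sum>i<2. complex_of_real (\<tau> i) * defect u i (\<lambda>x. cutoff k x * \<phi> x)) = 0" for k
    using defect_half[OF u _ cutoff_test[OF \<phi>]] by simp
  ultimately show ?thesis by (simp add: LIMSEQ_const_iff)
qed

text \<open>The difference of the two sides is, up to sign, the defect of the odd function \<phi> -
  \<phi> \<circ> \<open>refl\<close>.\<close>

lemma defect_refl:
  assumes u: "u \<in> H1 2 half" and i: "i < 2" and \<phi>: "\<phi> \<in> test_functions 2 \<Omega>'"
  shows "defect u i (\<lambda>x. \<phi> (refl x)) = defect u i \<phi>"
proof -
  note \<phi>R = refl_test[OF \<phi>]
  note m = test_functions_cmult[OF \<phi>R, of "- 1"]
  define \<psi> where "\<psi> = (\<lambda>x. \<phi> x + (- 1) * \<phi> (refl x))"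
  have \<psi>: "\<psi> \<in> test_functions 2 \<Omega>'" unfolding \<psi>_def by (rule test_functions_add[OF \<phi> m])
  have "defect u i \<psi> = 0"
    by (rule defect_odd[OF u i \<psi>]) (simp add: \<psi>_def refl_refl)
  moreover have "l2_of 2 \<psi> = l2_of 2 \<phi> + (- 1) *\<^sub>C l2_of 2 (\<lambda>x. \<phi> (refl x))"
    unfolding \<psi>_def l2_of_add[OF \<phi> m] l2_of_cmult[OF \<phi>R] ..
  moreover have "l2_of 2 (partial_deriv i \<psi>) = l2_of 2 (partial_deriv i \<phi>) + (- 1) *\<^sub>C l2_of 2 (partial_deriv i (\<lambda>x. \<phi> (refl x)))"
  proof -
    note mi = test_functions_cmult[OF test_functions_partial[OF \<phi>R i], of "- 1"]
    have "l2_of 2 (partial_deriv i \<psi>) = l2_of 2 (\<lambda>x. partial_deriv i \<phi> x + (- 1) * partial_deriv i (\<lambda>x. \<phi> (refl x)) x)"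
      unfolding \<psi>_def
      by (rule l2_of_cong) (simp only: partial_deriv_add[OF test_functions_smooth[OF \<phi>] test_functions_smooth[OF m] i]
          partial_deriv_cmult[OF test_functions_smooth[OF \<phi>R] i])
    then show ?thesis
      by (simp only: l2_of_add[OF test_functions_partial[OF \<phi> i] mi] l2_of_cmult[OF test_functions_partial[OF \<phi>R i]])
  qed
  ultimately show ?thesis
    by (simp add: defect_def cinner_add_right cinner_scaleC_right algebra_simps)
qed

text \<open>Moving J and the matrix r onto the test function turns the integration by parts error of
  the extension into the sum over j of (\<delta>_ij + \<open>r i j\<close>)
  \<open>defect u j \<phi>\<close>. The coefficient vector is 2 (e_i - \<nu>_i \<nu>), which is
  tangential.\<close>

lemma even_extension:
  assumes u: "u \<in> H1 2 half" and i: "i < 2"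
  shows "weak_deriv 2 \<Omega>' i (u + J u) (wderiv 2 half i u + (\<Sum>j<2. r i j *\<^sub>R J (wderiv 2 half j u)))"
  unfolding weak_deriv_iff[OF i]
proof (intro conjI ballI)
  show "u + J u \<in> l2_on 2 \<Omega>'"
    by (intro l2_on_add J_in_domain l2_on_half small.H1_in u)
  show "wderiv 2 half i u + (\<Sum>j<2. r i j *\<^sub>R J (wderiv 2 half j u)) \<in> l2_on 2 \<Omega>'"
    by (intro l2_on_add l2_on_sum l2_on_scaleR zero_l2_on J_in_domain l2_on_half small.wderiv_in[OF u]) (use i in auto)
  fix \<phi> assume \<phi>: "\<phi> \<in> test_functions 2 \<Omega>'"
  have "cinner (u + J u) (l2_of 2 (partial_deriv i \<phi>)) +
      cinner (wderiv 2 half i u + (\<Sum>j<2. r i j *\<^sub>R J (wderiv 2 half j u))) (l2_of 2 \<phi>)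
    = defect u i \<phi> + (\<Sum>j<2. complex_of_real (r i j) * defect u j (\<lambda>x. \<phi> (refl x)))"
    by (simp add: cinner_add_left cinner_J J_l2_of_partial[OF \<phi> i] J_l2_of[OF \<phi>] cinner_sum cinner_scaleR defect_def
        sum.distrib distrib_left)
  also have "\<dots> = defect u i \<phi> + (\<Sum>j<2. complex_of_real (r i j) * defect u j \<phi>)"
    using defect_refl[OF u _ \<phi>] by simp
  also have "\<dots> = (\<Sum>j<2. complex_of_real ((if i = j then 1 else 0) + r i j) * defect u j \<phi>)"
    using i by (auto simp: sum_lessThan_2 less_2_cases_iff algebra_simps)
  also have "\<dots> = 0"
  proof (rule defect_tangential[OF u \<phi>])
    have n: "\<nu> 0 * \<nu> 0 + \<nu> 1 * \<nu> 1 = 1" using unit by (simp only: power2_eq_square)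
    have "((if i = 0 then 1 else 0) + r i 0) * \<nu> 0 + ((if i = 1 then 1 else 0) + r i 1) * \<nu> 1
      = 2 * ((if i = 0 then \<nu> 0 else 0) + (if i = 1 then \<nu> 1 else 0)) - 2 * \<nu> i * (\<nu> 0 * \<nu> 0 + \<nu> 1 * \<nu> 1)"
      unfolding r_def by (auto simp: algebra_simps)
    also have "\<dots> = 0" unfolding n using i by (auto simp: less_2_cases_iff)
    finally show "((if i = 0 then 1 else 0) + r i 0) * \<nu> 0 + ((if i = 1 then 1 else 0) + r i 1) * \<nu> 1 = 0" .
  qed
  finally show "cinner (u + J u) (l2_of 2 (partial_deriv i \<phi>)) =
      - cinner (wderiv 2 half i u + (\<Sum>j<2. r i j *\<^sub>R J (wderiv 2 half j u))) (l2_of 2 \<phi>)"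
    by (simp add: eq_neg_iff_add_eq_0)
qed

lemma odd_part:
  assumes \<phi>: "\<phi> \<in> test_functions 2 \<Omega>'"
  shows "(\<lambda>x. \<phi> x + (- 1) * \<phi> (refl x)) \<in> test_functions 2 \<Omega>'"
    "l2_of 2 (\<lambda>x. \<phi> x + (- 1) * \<phi> (refl x)) = l2_of 2 \<phi> - J (l2_of 2 \<phi>)"
    "i < 2 \<Longrightarrow> l2_of 2 (partial_deriv i (\<lambda>x. \<phi> x + (- 1) * \<phi> (refl x))) =
      l2_of 2 (partial_deriv i \<phi>) - (\<Sum>j<2. r i j *\<^sub>R J (l2_of 2 (partial_deriv j \<phi>)))"
proof -
  note \<phi>R = refl_test[OF \<phi>]
  note m = test_functions_cmult[OF \<phi>R, of "- 1"]
  have neg: "(- 1) *\<^sub>C w = - w" for w using scaleR_eq_scaleC[of "-1" w] by simp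
  show "(\<lambda>x. \<phi> x + (- 1) * \<phi> (refl x)) \<in> test_functions 2 \<Omega>'" by (rule test_functions_add[OF \<phi> m])
  show "l2_of 2 (\<lambda>x. \<phi> x + (- 1) * \<phi> (refl x)) = l2_of 2 \<phi> - J (l2_of 2 \<phi>)"
    unfolding l2_of_add[OF \<phi> m] l2_of_cmult[OF \<phi>R] neg J_l2_of[OF \<phi>] by simp
  show "l2_of 2 (partial_deriv i (\<lambda>x. \<phi> x + (- 1) * \<phi> (refl x))) =
      l2_of 2 (partial_deriv i \<phi>) - (\<Sum>j<2. r i j *\<^sub>R J (l2_of 2 (partial_deriv j \<phi>)))" if i: "i < 2"
  proof -
    note mi = test_functions_cmult[OF test_functions_partial[OF \<phi>R i], of "- 1"]
    have "l2_of 2 (partial_deriv i (\<lambda>x. \<phi> x + (- 1) * \<phi> (refl x)))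
        = l2_of 2 (\<lambda>x. partial_deriv i \<phi> x + (- 1) * partial_deriv i (\<lambda>x. \<phi> (refl x)) x)"
      by (rule l2_of_cong) (simp only: partial_deriv_add[OF test_functions_smooth[OF \<phi>] test_functions_smooth[OF m] i]
          partial_deriv_cmult[OF test_functions_smooth[OF \<phi>R] i])
    also have "\<dots> = l2_of 2 (partial_deriv i \<phi>) - l2_of 2 (partial_deriv i (\<lambda>x. \<phi> (refl x)))"
      unfolding l2_of_add[OF test_functions_partial[OF \<phi> i] mi] l2_of_cmult[OF test_functions_partial[OF \<phi>R i]] neg by simp
    finally show ?thesis unfolding partial_refl[OF \<phi> i] .
  qed
qed

lemma tendsto_J: "(f \<longlongrightarrow> a) F \<Longrightarrow> ((\<lambda>x. J (f x)) \<longlongrightarrow> J a) F"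
  by (rule bounded_linear.tendsto[OF bounded_linear_J])

lemma tendsto_P: "(f \<longlongrightarrow> a) F \<Longrightarrow> ((\<lambda>x. P (f x)) \<longlongrightarrow> P a) F"
  by (rule bounded_linear.tendsto[OF P_lin])

text \<open>The odd part of a test function of \<open>half\<close> is a test function of \<Omega>',
  so an approximating sequence is simply carried over together with its derivatives.\<close>

lemma odd_extension:
  assumes u: "u \<in> H1_0 2 half"
  shows "u - J u \<in> H1_0 2 \<Omega>'"
    "i < 2 \<Longrightarrow> wderiv 2 \<Omega>' i (u - J u) = wderiv 2 half i u - (\<Sum>j<2. r i j *\<^sub>R J (wderiv 2 half j u))"
proof -
  obtain \<phi> :: "nat \<Rightarrow> (nat \<Rightarrow> real) \<Rightarrow> complex" where \<phi>0: "\<And>n. \<phi> n \<in> test_functions 2 half" and lim: "(\<lambda>n. l2_of 2 (\<phi> n)) \<longlonglongrightarrow> u"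
    "\<And>i. i < 2 \<Longrightarrow> (\<lambda>n. l2_of 2 (partial_deriv i (\<phi> n))) \<longlonglongrightarrow> wderiv 2 half i u" by (rule small.H1_0_E[OF u]) blast
  have \<phi>: "\<phi> n \<in> test_functions 2 \<Omega>'" for n using \<phi>0 test_functions_mono[OF half_sub] by blast
  have 1: "(\<lambda>n. l2_of 2 (\<lambda>x. \<phi> n x + (- 1) * \<phi> n (refl x))) \<longlonglongrightarrow> u - J u"
    unfolding odd_part(2)[OF \<phi>] by (intro tendsto_diff tendsto_J lim)
  have 2: "(\<lambda>n. l2_of 2 (partial_deriv i (\<lambda>x. \<phi> n x + (- 1) * \<phi> n (refl x)))) \<longlonglongrightarrow>
      wderiv 2 half i u - (\<Sum>j<2. r i j *\<^sub>R J (wderiv 2 half j u))" if "i < 2" for i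
    unfolding odd_part(3)[OF \<phi> that] by (intro tendsto_diff tendsto_sum tendsto_scaleR tendsto_const tendsto_J lim that) simp
  show "u - J u \<in> H1_0 2 \<Omega>'"
    "i < 2 \<Longrightarrow> wderiv 2 \<Omega>' i (u - J u) = wderiv 2 half i u - (\<Sum>j<2. r i j *\<^sub>R J (wderiv 2 half j u))"
    by (rule big.H1_0_I(1)[OF odd_part(1)[OF \<phi>] 1 2], assumption) (rule big.H1_0_I(2)[OF odd_part(1)[OF \<phi>] 1 2])
qed

lemma J_weak_deriv:
  assumes f: "f \<in> H1 2 \<Omega>'" and i: "i < 2"
  shows "weak_deriv 2 \<Omega>' i (J f) (\<Sum>j<2. r i j *\<^sub>R J (wderiv 2 \<Omega>' j f))"
  unfolding weak_deriv_iff[OF i]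
proof (intro conjI ballI)
  show "J f \<in> l2_on 2 \<Omega>'" by (rule J_in_domain[OF big.H1_in[OF f]])
  show "(\<Sum>j<2. r i j *\<^sub>R J (wderiv 2 \<Omega>' j f)) \<in> l2_on 2 \<Omega>'"
    by (intro l2_on_sum l2_on_scaleR zero_l2_on J_in_domain big.wderiv_in[OF f]) simp
  fix \<phi> assume \<phi>: "\<phi> \<in> test_functions 2 \<Omega>'"
  have "cinner f (l2_of 2 (partial_deriv j (\<lambda>x. \<phi> (refl x)))) = - cinner (wderiv 2 \<Omega>' j f) (J (l2_of 2 \<phi>))" if "j < 2" for j
    using big.H1_weak_deriv[OF f that] refl_test[OF \<phi>] unfolding weak_deriv_iff[OF that] J_l2_of[OF \<phi>] by blast
  then show "cinner (J f) (l2_of 2 (partial_deriv i \<phi>)) = - cinner (\<Sum>j<2. r i j *\<^sub>R J (wderiv 2 \<Omega>' j f)) (l2_of 2 \<phi>)"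
    by (simp add: cinner_J J_l2_of_partial[OF \<phi> i] cinner_sum cinner_scaleR sum_negf)
qed

lemma P_weak_deriv:
  assumes "weak_deriv 2 \<Omega>' i f g" and i: "i < 2"
  shows "weak_deriv 2 half i (P f) (P g)"
  unfolding weak_deriv_iff[OF i]
proof (intro conjI ballI P_in)
  fix \<phi> assume \<phi>: "\<phi> \<in> test_functions 2 half"
  have "\<phi> \<in> test_functions 2 \<Omega>'" using \<phi> test_functions_mono[OF half_sub] by blast
  then have "cinner f (l2_of 2 (partial_deriv i \<phi>)) = - cinner g (l2_of 2 \<phi>)"
    using assms(1) unfolding weak_deriv_iff[OF i] by blast
  then show "cinner (P f) (l2_of 2 (partial_deriv i \<phi>)) = - cinner (P g) (l2_of 2 \<phi>)"
    unfolding cinner_P P_id[OF l2_of_in[OF \<phi>]] P_id[OF l2_of_in[OF test_functions_partial[OF \<phi> i]]] .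
qed

text \<open>The odd parts of the approximating test functions, multiplied by cutoffs, are test
  functions of \<open>half\<close>. By \<open>odd_cutoff_limit\<close> they converge together with
  their derivatives.\<close>

lemma odd_restriction:
  assumes f: "f \<in> H1_0 2 \<Omega>'"
  shows "P (f - J f) \<in> H1_0 2 half"
proof -
  obtain \<phi> :: "nat \<Rightarrow> (nat \<Rightarrow> real) \<Rightarrow> complex" where \<phi>: "\<And>n. \<phi> n \<in> test_functions 2 \<Omega>'" and lim: "(\<lambda>n. l2_of 2 (\<phi> n)) \<longlonglongrightarrow> f"
    "\<And>i. i < 2 \<Longrightarrow> (\<lambda>n. l2_of 2 (partial_deriv i (\<phi> n))) \<longlonglongrightarrow> wderiv 2 \<Omega>' i f" by (rule big.H1_0_E[OF f]) blast
  define \<psi> where "\<psi> n = (\<lambda>x. \<phi> n x + (- 1) * \<phi> n (refl x))" for n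
  have \<psi>: "\<psi> n \<in> test_functions 2 \<Omega>'" for n unfolding \<psi>_def by (rule odd_part(1)[OF \<phi>])
  have odd: "\<psi> n (refl x) = - \<psi> n x" for n x by (simp add: \<psi>_def refl_refl)
  have in_H: "P (l2_of 2 (\<psi> n)) \<in> H1_0 2 half" for n
    by (rule small.H1_0_I(1)[OF cutoff_test[OF \<psi>] cutoff_limit[OF \<psi>] odd_cutoff_limit[OF \<psi> odd]])
  have wd: "wderiv 2 half i (P (l2_of 2 (\<psi> n))) = P (l2_of 2 (partial_deriv i (\<psi> n)))" if "i < 2" for i n
    by (rule small.H1_0_I(2)[OF cutoff_test[OF \<psi>] cutoff_limit[OF \<psi>] odd_cutoff_limit[OF \<psi> odd] that])
  show ?thesis
  proof (rule small.H1_0_limit[OF in_H])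
    show "(\<lambda>n. P (l2_of 2 (\<psi> n))) \<longlonglongrightarrow> P (f - J f)"
      unfolding \<psi>_def odd_part(2)[OF \<phi>] by (intro tendsto_P tendsto_diff tendsto_J lim)
    show "(\<lambda>n. wderiv 2 half i (P (l2_of 2 (\<psi> n)))) \<longlonglongrightarrow> P (wderiv 2 \<Omega>' i f - (\<Sum>j<2. r i j *\<^sub>R J (wderiv 2 \<Omega>' j f)))" if "i < 2" for i
      unfolding wd[OF that] unfolding \<psi>_def odd_part(3)[OF \<phi> that]
      by (intro tendsto_P tendsto_diff tendsto_sum tendsto_scaleR tendsto_const tendsto_J lim that) simp
  qed
qed

section \<open>The isometry \<open>lift\<close> and its adjoint\<close>

fun sign :: "boundary_condition \<Rightarrow> real" where
  "sign Dirichlet = - 1"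
| "sign Neumann = 1"

lemma sign_sign: "sign bc * sign bc = 1"
  by (cases bc) auto

definition lift :: "boundary_condition \<Rightarrow> l2 \<Rightarrow> l2" where
  "lift bc u = (1 / sqrt 2) *\<^sub>R (u + sign bc *\<^sub>R J u)"

definition unlift :: "boundary_condition \<Rightarrow> l2 \<Rightarrow> l2" where
  "unlift bc u = P (lift bc u)"

text \<open>What \<open>lift\<close> does to gradients: the chain rule for the reflection
  contributes the matrix \<open>r\<close>.\<close>

definition lift_deriv :: "boundary_condition \<Rightarrow> (nat \<Rightarrow> l2) \<Rightarrow> nat \<Rightarrow> l2" where
  "lift_deriv bc g i = (1 / sqrt 2) *\<^sub>R (g i + sign bc *\<^sub>R (\<Sum>j<2. r i j *\<^sub>R J (g j)))"

lemma lift_form_domain: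
  assumes u: "u \<in> form_domain bc 2 half"
  shows "lift bc u \<in> form_domain bc 2 \<Omega>'" "i < 2 \<Longrightarrow> wderiv 2 \<Omega>' i (lift bc u) = lift_deriv bc (\<lambda>i. wderiv 2 half i u) i"
proof -
  have ext: "u + sign bc *\<^sub>R J u \<in> form_domain bc 2 \<Omega>' \<and> (\<forall>i<2. wderiv 2 \<Omega>' i (u + sign bc *\<^sub>R J u)
      = wderiv 2 half i u + sign bc *\<^sub>R (\<Sum>j<2. r i j *\<^sub>R J (wderiv 2 half j u)))"
  proof (cases bc)
    case Dirichlet
    then show ?thesis using odd_extension[of u] u by simp
  next
    case Neumann
    then have u1: "u \<in> H1 2 half" using u by simp
    have "u + J u \<in> H1 2 \<Omega>'"
    proof (rule big.H1_I[OF even_extension[OF u1]])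
      show "u + J u \<in> l2_on 2 \<Omega>'" by (intro l2_on_add J_in_domain l2_on_half small.H1_in[OF u1])
    qed
    then show ?thesis using Neumann big.wderiv_eq[OF _ even_extension[OF u1]] by simp
  qed
  show "lift bc u \<in> form_domain bc 2 \<Omega>'" unfolding lift_def using ext by (intro big.form_domain_scaleR) blast
  show "i < 2 \<Longrightarrow> wderiv 2 \<Omega>' i (lift bc u) = lift_deriv bc (\<lambda>i. wderiv 2 half i u) i"
    unfolding lift_def lift_deriv_def using ext big.wderiv_scaleR[OF big.form_domain_H1[OF conjunct1[OF ext]]] by simp
qed

lemma unlift_form_domain:
  assumes f: "f \<in> form_domain bc 2 \<Omega>'"
  shows "unlift bc f \<in> form_domain bc 2 half" "i < 2 \<Longrightarrow> wderiv 2 half i (unlift bc f) = P (lift_deriv bc (\<lambda>i. wderiv 2 \<Omega>' i f) i)"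
proof -
  note f1 = big.form_domain_H1[OF f]
  have w: "weak_deriv 2 half i (unlift bc f) (P (lift_deriv bc (\<lambda>i. wderiv 2 \<Omega>' i f) i))" if i: "i < 2" for i
  proof -
    have "weak_deriv 2 \<Omega>' i (lift bc f) (lift_deriv bc (\<lambda>i. wderiv 2 \<Omega>' i f) i)"
      unfolding lift_def lift_deriv_def scaleR_eq_scaleC[of "1 / sqrt 2"] scaleR_eq_scaleC[of "sign bc"]
      by (intro big.weak_deriv_scaleC big.weak_deriv_add big.H1_weak_deriv f1 J_weak_deriv i)
    then show ?thesis unfolding unlift_def by (rule P_weak_deriv[OF _ i])
  qed
  show "i < 2 \<Longrightarrow> wderiv 2 half i (unlift bc f) = P (lift_deriv bc (\<lambda>i. wderiv 2 \<Omega>' i f) i)"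
    by (rule small.wderiv_eq[OF _ w])
  show "unlift bc f \<in> form_domain bc 2 half"
  proof (cases bc)
    case Dirichlet
    then show ?thesis
      using odd_restriction[of f] f small.form_domain_scaleR[of "P (f - J f)" Dirichlet "1 / sqrt 2"] by (simp add: unlift_def lift_def P_scaleR)
  next
    case Neumann
    have "unlift bc f \<in> H1 2 half"
      by (rule small.H1_I[OF w]) (auto simp: unlift_def P_in)
    then show ?thesis using Neumann by simp
  qed
qed

lemma inner_J: "inner (J u) v = inner u (J v)"
  by (simp add: inner_eq_Re_cinner cinner_J)

lemma inner_P: "inner (P u) v = inner u (P v)"
  by (simp add: inner_eq_Re_cinner cinner_P)

lemma inner_lift: "inner (lift bc u) v = inner u (lift bc v)"
  by (simp add: lift_def inner_add_left inner_add_right inner_J)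

text \<open>On functions living on \<open>half\<close>, \<open>unlift\<close> is the adjoint of
  \<open>lift\<close>; \<open>norm_unlift\<close> and \<open>unlift_laplacian\<close> exploit
  this.\<close>

lemma inner_unlift: "v \<in> l2_on 2 half \<Longrightarrow> inner (unlift bc u) v = inner u (lift bc v)"
  by (simp add: unlift_def inner_P P_id inner_lift)

text \<open>Adjointness for the forms, from the self-adjointness of J and the symmetry of the matrix
  \<open>r\<close>.\<close>

lemma dform_unlift:
  assumes f: "f \<in> form_domain bc 2 \<Omega>'" and h: "h \<in> form_domain bc 2 half"
  shows "small.dform (unlift bc f) h = big.dform f (lift bc h)"
proof -
  define F where "F i = wderiv 2 \<Omega>' i f" for i
  define H where "H i = wderiv 2 half i h" for i
  have "small.dform (unlift bc f) h = (\<Sum>i<2. inner (lift_deriv bc F i) (H i))"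
    unfolding small.dform_def
  proof (rule sum.cong[OF refl])
    fix i :: nat assume "i \<in> {..<2}"
    then have i: "i < 2" by simp
    have "wderiv 2 half i h \<in> l2_on 2 half" by (rule small.wderiv_in[OF small.form_domain_H1[OF h] i])
    then show "inner (wderiv 2 half i (unlift bc f)) (wderiv 2 half i h) = inner (lift_deriv bc F i) (H i)"
      unfolding unlift_form_domain(2)[OF f i] inner_P F_def H_def by (simp add: P_id)
  qed
  also have "\<dots> = (\<Sum>i<2. inner (F i) (lift_deriv bc H i))"
    unfolding sum_lessThan_2 lift_deriv_def
    by (simp add: inner_add_left inner_add_right inner_J r_commute[of "Suc 0" 0] algebra_simps)
  also have "\<dots> = big.dform f (lift bc h)"
    unfolding big.dform_def F_def H_def using lift_form_domain(2)[OF h] by simp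
  finally show ?thesis .
qed

text \<open>Testing on \<open>half\<close> with h amounts to testing on \<Omega>' with
  \<open>lift bc h\<close>, which is admissible by \<open>lift_form_domain\<close>.\<close>

lemma unlift_laplacian:
  assumes "laplacian bc 2 \<Omega>' f g"
  shows "laplacian bc 2 half (unlift bc f) (unlift bc g)"
proof -
  have f: "f \<in> form_domain bc 2 \<Omega>'" and eq: "\<And>h. h \<in> form_domain bc 2 \<Omega>' \<Longrightarrow> big.dform f h = - inner g h"
    using assms unfolding big.laplacian_iff by blast+
  show ?thesis
    unfolding small.laplacian_iff
  proof (intro conjI ballI)
    show "unlift bc f \<in> form_domain bc 2 half" by (rule unlift_form_domain(1)[OF f])
    show "unlift bc g \<in> l2_on 2 half" unfolding unlift_def by (rule P_in)
    fix h assume h: "h \<in> form_domain bc 2 half"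
    show "small.dform (unlift bc f) h = - inner (unlift bc g) h"
      unfolding dform_unlift[OF f h] inner_unlift[OF small.form_domain_in[OF h]] by (rule eq[OF lift_form_domain(1)[OF h]])
  qed
qed

lemma bounded_linear_lift: "bounded_linear (lift bc)"
  unfolding lift_def
  by (intro bounded_linear_const_scaleR bounded_linear_add bounded_linear_ident bounded_linear_J)

lemma bounded_linear_unlift: "bounded_linear (unlift bc)"
  unfolding unlift_def by (rule bounded_linear_compose[OF P_lin bounded_linear_lift])

lemma unlift_in: "unlift bc u \<in> l2_on 2 half"
  unfolding unlift_def by (rule P_in)

lemma lift_in: "u \<in> l2_on 2 half \<Longrightarrow> lift bc u \<in> l2_on 2 \<Omega>'"
  unfolding lift_def by (intro l2_on_scaleR l2_on_add J_in_domain l2_on_half)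

text \<open>\<open>J u\<close> lives on the mirror image of \<open>half\<close>, where
  \<open>dist_line\<close> is negative.\<close>

lemma P_J_half:
  assumes u: "u \<in> l2_on 2 half"
  shows "P (J u) = 0"
proof -
  define W where "W = {x. refl x \<in> half}"
  have "J u \<in> l2_on 2 W" by (rule J_in[OF u]) (simp add: W_def)
  then have "AE p in lebesgue_all. p \<notin> {2} \<times> W \<longrightarrow> rep_l2 (J u) p = 0" by (simp add: l2_on_def)
  then have "AE p in lebesgue_all. indicator ({2} \<times> half) p * rep_l2 (J u) p = 0"
  proof eventually_elim
    case (elim p)
    have "p \<notin> {2} \<times> half" if "p \<in> {2} \<times> W"
      using that by (auto simp: W_def half_def dist_line_refl)
    then show ?case using elim by (auto simp: indicator_def)
  qed
  then have "abs_l2 (\<lambda>p. indicator ({2} \<times> half) p * rep_l2 (J u) p) = abs_l2 (\<lambda>_. 0)"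
    by (subst abs_l2_eq_iff)
      (auto intro!: sq_int_indicator_mult slice_lebesgue small.\<Omega>_sets sq_int_rep_l2 sq_int_zero)
  then show ?thesis by (simp add: restrict_l2_def zero_l2.abs_eq)
qed

lemma inner_J_half: "u \<in> l2_on 2 half \<Longrightarrow> inner u (J u) = 0"
  using inner_P[of u "J u"] by (simp add: P_id P_J_half)

text \<open>The functions u and \<open>J u\<close> are orthogonal and of equal norm, which the
  factor 1 / sqrt 2 compensates.\<close>

lemma norm_lift:
  assumes "u \<in> l2_on 2 half"
  shows "norm (lift bc u) = norm u"
proof -
  have half: "(1 / sqrt 2) * (1 / sqrt 2) = (1/2 :: real)" by simp
  have s: "(1 / sqrt 2) * ((1 / sqrt 2) * z) = (1/2) * z" for z :: real
    by (simp only: mult.assoc[symmetric] half)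
  have "(norm (lift bc u))\<^sup>2 = (1/2) * (inner u u + sign bc * sign bc * inner (J u) (J u))"
    unfolding lift_def power2_norm_eq_inner inner_scaleR_left[of "1 / sqrt 2"] inner_scaleR_right[of _ "1 / sqrt 2"] s
    by (simp add: inner_add_left inner_add_right inner_commute[of "J u" u] inner_J_half[OF assms])
  also have "inner (J u) (J u) = inner u u" by (simp add: inner_J J_J)
  finally have "(norm (lift bc u))\<^sup>2 = (norm u)\<^sup>2" unfolding sign_sign by (simp add: power2_norm_eq_inner)
  then show ?thesis by simp
qed

text \<open>J is an involution and the sign squares to 1, so lifting twice gives u + \<sigma> J u,
  and restriction to \<open>half\<close> removes the reflected part.\<close>

lemma unlift_lift:
  assumes u: "u \<in> l2_on 2 half"
  shows "unlift bc (lift bc u) = u"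
proof -
  have s: "(1 / sqrt 2) * (1 / sqrt 2) = 1/2" by simp
  have "lift bc (lift bc u) = ((1 / sqrt 2) * (1 / sqrt 2)) *\<^sub>R (u + sign bc *\<^sub>R J u + sign bc *\<^sub>R (J u + sign bc *\<^sub>R u))"
    unfolding lift_def J_scaleR J_add J_J by (simp only: scaleR_scaleR[symmetric] scaleR_add_right scaleR_left_commute)
  also have "\<dots> = (1/2) *\<^sub>R ((1 + sign bc * sign bc) *\<^sub>R u + (2 * sign bc) *\<^sub>R J u)"
  proof -
    have "(2 * sign bc) *\<^sub>R w = sign bc *\<^sub>R w + sign bc *\<^sub>R w" for w :: l2
      by (simp only: mult_2 scaleR_add_left)
    then show ?thesis unfolding s by (simp only: scaleR_add_right scaleR_add_left scaleR_scaleR scaleR_one ac_simps)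
  qed
  also have "\<dots> = u + sign bc *\<^sub>R J u" unfolding sign_sign by (simp add: scaleR_add_right)
  finally show ?thesis unfolding unlift_def by (simp add: P_add P_scaleR P_J_half[OF u] P_id[OF u])
qed

text \<open>The adjoint of an isometry is a contraction, by Cauchy-Schwarz.\<close>

lemma norm_unlift: "norm (unlift bc v) \<le> norm v"
proof -
  have "(norm (unlift bc v))\<^sup>2 = inner v (lift bc (unlift bc v))"
    by (simp add: power2_norm_eq_inner inner_unlift[OF unlift_in])
  also have "\<dots> \<le> norm v * norm (lift bc (unlift bc v))" by (rule norm_cauchy_schwarz)
  also have "\<dots> = norm v * norm (unlift bc v)" by (simp add: norm_lift[OF unlift_in])
  finally show ?thesis by (cases "norm (unlift bc v) = 0") (auto simp: power2_eq_square)
qed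

text \<open>Restriction to a symmetric set commutes with J, hence with \<open>lift\<close>.\<close>

lemma unlift_restrict:
  assumes \<omega>': "\<omega>' \<in> sets (lebesgue_dim 2)" "\<And>x. refl x \<in> \<omega>' \<longleftrightarrow> x \<in> \<omega>'"
  shows "unlift bc (restrict_l2 2 \<omega>' v) = restrict_l2 2 (\<omega>' \<inter> half) (unlift bc v)"
proof -
  note h = small.\<Omega>_sets
  have "lift bc (restrict_l2 2 \<omega>' v) = restrict_l2 2 \<omega>' (lift bc v)"
    unfolding lift_def restrict_J[OF \<omega>'(1) \<omega>'(1) \<omega>'(2), symmetric] restrict_l2_scaleR[OF \<omega>'(1)] restrict_l2_add[OF \<omega>'(1)] ..
  then show ?thesis
    unfolding unlift_def by (simp add: restrict_restrict_l2[OF h \<omega>'(1)] restrict_restrict_l2[OF sets.Int[OF \<omega>'(1) h] h] Int_ac)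
qed

theorem unlift_heat:
  assumes "t \<ge> 0" "u \<in> l2_on 2 \<Omega>'"
  shows "unlift bc (heat bc 2 \<Omega>' t u) = heat bc 2 half t (unlift bc u)"
  by (rule heat_intertwine[OF small.domain_axioms big.domain_axioms bounded_linear_unlift unlift_in unlift_laplacian assms])

section \<open>Transfer of controls to half of a symmetric domain\<close>

lemma unlift_controls:
  assumes v: "v \<in> controls 2 \<Omega>' T"
  shows "(\<lambda>s. unlift bc (v s)) \<in> controls 2 half T"
proof -
  have m: "(\<lambda>s. indicator {0<..<T} s *\<^sub>R v s) \<in> borel_measurable lebesgue"
    and i: "set_integrable lebesgue {0<..<T} (\<lambda>s. (norm (v s))\<^sup>2)"
    using v by (auto simp: controls_def set_borel_measurable_def)
  have eq: "indicator {0<..<T} s *\<^sub>R unlift bc (v s) = unlift bc (indicator {0<..<T} s *\<^sub>R v s)" for s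
    by (simp add: linear_scale[OF bounded_linear.linear[OF bounded_linear_unlift]])
  have m': "(\<lambda>s. indicator {0<..<T} s *\<^sub>R unlift bc (v s)) \<in> borel_measurable lebesgue"
    unfolding eq by (rule measurable_compose[OF m])
      (intro borel_measurable_continuous_onI linear_continuous_on bounded_linear_unlift)
  have "set_integrable lebesgue {0<..<T} (\<lambda>s. (norm (unlift bc (v s)))\<^sup>2)"
    unfolding set_integrable_def
  proof (rule Bochner_Integration.integrable_bound)
    show "integrable lebesgue (\<lambda>s. indicator {0<..<T} s *\<^sub>R (norm (v s))\<^sup>2)" using i by (simp add: set_integrable_def)
    have "(\<lambda>s. (norm (indicator {0<..<T} s *\<^sub>R unlift bc (v s)))\<^sup>2) \<in> borel_measurable lebesgue" using m' by measurable
    moreover have "(norm (indicator {0<..<T} s *\<^sub>R unlift bc (v s)))\<^sup>2 = indicator {0<..<T} s *\<^sub>R (norm (unlift bc (v s)))\<^sup>2" for s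
      by (simp split: split_indicator)
    ultimately show "(\<lambda>s. indicator {0<..<T} s *\<^sub>R (norm (unlift bc (v s)))\<^sup>2) \<in> borel_measurable lebesgue" by simp
    show "AE s in lebesgue. norm (indicator {0<..<T} s *\<^sub>R (norm (unlift bc (v s)))\<^sup>2) \<le> norm (indicator {0<..<T} s *\<^sub>R (norm (v s))\<^sup>2)"
      by (intro AE_I2) (simp add: power_mono norm_unlift split: split_indicator)
  qed
  then show ?thesis using m' by (simp add: controls_def set_borel_measurable_def unlift_in)
qed

text \<open>A bounded linear map passes through the Bochner integral, and \<open>unlift\<close>
  carries the integrand on \<Omega>' to the one on \<open>half\<close>. The indicator stays inside
  because \<open>heat\<close> is described for times T - s \<ge> 0 only.\<close>

lemma unlift_steers:
  assumes \<omega>': "\<omega>' \<in> sets (lebesgue_dim 2)" "\<And>x. refl x \<in> \<omega>' \<longleftrightarrow> x \<in> \<omega>'" "\<omega>' \<subseteq> \<Omega>'"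
    and v: "v \<in> controls 2 \<Omega>' T" and st: "steers bc 2 \<Omega>' \<omega>' T u v" and u: "u \<in> l2_on 2 \<Omega>'" and T: "T > 0"
  shows "steers bc 2 half (\<omega>' \<inter> half) T (unlift bc u) (\<lambda>s. unlift bc (v s))"
proof -
  define F where "F s = heat bc 2 \<Omega>' (T - s) (restrict_l2 2 \<omega>' (v s))" for s
  define G where "G s = heat bc 2 half (T - s) (restrict_l2 2 (\<omega>' \<inter> half) (unlift bc (v s)))" for s
  have FG: "indicator {0<..<T} s *\<^sub>R G s = unlift bc (indicator {0<..<T} s *\<^sub>R F s)" for s
  proof (cases "s \<in> {0<..<T}")
    case True
    have "restrict_l2 2 \<omega>' (v s) \<in> l2_on 2 \<Omega>'"
      using restrict_l2_in[OF \<omega>'(1)] l2_on_mono[OF \<omega>'(3)] by blast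
    then have "unlift bc (F s) = G s"
      unfolding F_def G_def using True by (subst unlift_heat) (auto simp: unlift_restrict[OF \<omega>'(1,2)])
    then show ?thesis using True by simp
  next
    case False
    then show ?thesis by (simp add: linear_0[OF bounded_linear.linear[OF bounded_linear_unlift]])
  qed
  have iF: "integrable lebesgue (\<lambda>s. indicator {0<..<T} s *\<^sub>R F s)"
    and eF: "heat bc 2 \<Omega>' T u + (LINT s|lebesgue. indicator {0<..<T} s *\<^sub>R F s) = 0"
    using st unfolding steers_def F_def set_integrable_def set_lebesgue_integral_def by auto
  have iG: "integrable lebesgue (\<lambda>s. indicator {0<..<T} s *\<^sub>R G s)"
    unfolding FG by (rule integrable_bounded_linear[OF bounded_linear_unlift iF])
  have "(LINT s|lebesgue. indicator {0<..<T} s *\<^sub>R G s) = unlift bc (LINT s|lebesgue. indicator {0<..<T} s *\<^sub>R F s)"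
    unfolding FG by (rule integral_bounded_linear[OF bounded_linear_unlift iF])
  moreover have "heat bc 2 half T (unlift bc u) = unlift bc (heat bc 2 \<Omega>' T u)"
    using unlift_heat[OF _ u, of T bc] T by simp
  ultimately have "heat bc 2 half T (unlift bc u) + (LINT s|lebesgue. indicator {0<..<T} s *\<^sub>R G s)
      = unlift bc (heat bc 2 \<Omega>' T u + (LINT s|lebesgue. indicator {0<..<T} s *\<^sub>R F s))"
    by (simp add: linear_add[OF bounded_linear.linear[OF bounded_linear_unlift]])
  then have "heat bc 2 half T (unlift bc u) + (LINT s|lebesgue. indicator {0<..<T} s *\<^sub>R G s) = 0"
    unfolding eF by (simp add: linear_0[OF bounded_linear.linear[OF bounded_linear_unlift]])
  then show ?thesis
    using iG unfolding steers_def G_def set_integrable_def set_lebesgue_integral_def by simp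
qed

lemma unlift_control_norm:
  assumes \<omega>': "\<omega>' \<in> sets (lebesgue_dim 2)" "\<And>x. refl x \<in> \<omega>' \<longleftrightarrow> x \<in> \<omega>'"
    and v: "v \<in> controls 2 \<Omega>' T"
  shows "control_norm 2 (\<omega>' \<inter> half) T (\<lambda>s. unlift bc (v s)) \<le> control_norm 2 \<omega>' T v"
proof -
  have m: "(\<lambda>s. indicator {0<..<T} s *\<^sub>R v s) \<in> borel_measurable lebesgue"
    and i: "integrable lebesgue (\<lambda>s. indicator {0<..<T} s *\<^sub>R (norm (v s))\<^sup>2)"
    using v by (auto simp: controls_def set_borel_measurable_def set_integrable_def)
  have int: "integrable lebesgue (\<lambda>s. indicator {0<..<T} s *\<^sub>R (norm (B (v s)))\<^sup>2)"
    if B: "bounded_linear B" "\<And>u. norm (B u) \<le> norm u" for B :: "l2 \<Rightarrow> l2"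
  proof (rule Bochner_Integration.integrable_bound[OF i])
    have "(\<lambda>s. B (indicator {0<..<T} s *\<^sub>R v s)) \<in> borel_measurable lebesgue"
      by (rule measurable_compose[OF m]) (intro borel_measurable_continuous_onI linear_continuous_on B)
    then have "(\<lambda>s. (norm (B (indicator {0<..<T} s *\<^sub>R v s)))\<^sup>2) \<in> borel_measurable lebesgue" by measurable
    moreover have "(norm (B (indicator {0<..<T} s *\<^sub>R v s)))\<^sup>2 = indicator {0<..<T} s *\<^sub>R (norm (B (v s)))\<^sup>2" for s
      by (simp add: linear_0[OF bounded_linear.linear[OF B(1)]] split: split_indicator)
    ultimately show "(\<lambda>s. indicator {0<..<T} s *\<^sub>R (norm (B (v s)))\<^sup>2) \<in> borel_measurable lebesgue" by simp
    show "AE s in lebesgue. norm (indicator {0<..<T} s *\<^sub>R (norm (B (v s)))\<^sup>2) \<le> norm (indicator {0<..<T} s *\<^sub>R (norm (v s))\<^sup>2)"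
      by (intro AE_I2) (simp add: power_mono B(2) split: split_indicator)
  qed
  have bl: "bounded_linear (\<lambda>u. unlift bc (restrict_l2 2 \<omega>' u))"
    by (rule bounded_linear_compose[OF bounded_linear_unlift bounded_linear_restrict_l2[OF \<omega>'(1)]])
  have le: "norm (unlift bc (restrict_l2 2 \<omega>' u)) \<le> norm (restrict_l2 2 \<omega>' u)" for u by (rule norm_unlift)
  show ?thesis
    unfolding control_norm_def set_lebesgue_integral_def unlift_restrict[OF \<omega>', symmetric]
  proof (intro real_sqrt_le_mono integral_mono)
    show "integrable lebesgue (\<lambda>s. indicator {0<..<T} s *\<^sub>R (norm (unlift bc (restrict_l2 2 \<omega>' (v s))))\<^sup>2)"
      by (rule int[OF bl order_trans[OF le norm_restrict_l2[OF \<omega>'(1)]]])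
    show "integrable lebesgue (\<lambda>s. indicator {0<..<T} s *\<^sub>R (norm (restrict_l2 2 \<omega>' (v s)))\<^sup>2)"
      by (rule int[OF bounded_linear_restrict_l2[OF \<omega>'(1)] norm_restrict_l2[OF \<omega>'(1)]])
    show "indicator {0<..<T} s *\<^sub>R (norm (unlift bc (restrict_l2 2 \<omega>' (v s))))\<^sup>2
        \<le> indicator {0<..<T} s *\<^sub>R (norm (restrict_l2 2 \<omega>' (v s)))\<^sup>2" for s
      by (simp add: power_mono le split: split_indicator)
  qed
qed

text \<open>A control for \<open>lift bc u\<close> is mapped by \<open>unlift\<close> to a control
  for u of no larger norm. As lifting preserves the norm, every infimum on \<open>half\<close> is
  bounded by one that enters the supremum on \<Omega>'.\<close>

theorem control_transfer:
  assumes \<omega>: "\<omega> \<in> sets (lebesgue_dim 2)" "\<omega> \<subseteq> half"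
    and \<omega>': "\<omega> \<union> refl -` \<omega> \<in> sets (lebesgue_dim 2)" and T: "T > 0"
    and nc: "null_controllable bc 2 \<Omega>' (\<omega> \<union> refl -` \<omega>) T"
  shows "null_controllable bc 2 half \<omega> T" "control_cost bc 2 half \<omega> T \<le> control_cost bc 2 \<Omega>' (\<omega> \<union> refl -` \<omega>) T"
proof -
  define W where "W = \<omega> \<union> refl -` \<omega>"
  have W: "W \<in> sets (lebesgue_dim 2)" "\<And>x. refl x \<in> W \<longleftrightarrow> x \<in> W"
    using \<omega>' by (auto simp: W_def refl_refl)
  have W\<Omega>: "W \<subseteq> \<Omega>'" using \<omega>(2) half_sub sym by (auto simp: W_def)
  \<comment> \<open>The added part lies where \<open>dist_line\<close> is negative.\<close>
  have Wh: "W \<inter> half = \<omega>" using \<omega>(2) by (auto simp: W_def half_def dist_line_refl subset_iff)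
  have steer: "(\<lambda>s. unlift bc (v s)) \<in> controls 2 half T \<and> steers bc 2 half \<omega> T u (\<lambda>s. unlift bc (v s))"
    if "u \<in> l2_on 2 half" "v \<in> controls 2 \<Omega>' T" "steers bc 2 \<Omega>' W T (lift bc u) v" for u v
    using unlift_controls[OF that(2)] unlift_steers[OF W W\<Omega> that(2,3) lift_in[OF that(1)] T] unlift_lift[OF that(1)]
    unfolding Wh by simp
  show "null_controllable bc 2 half \<omega> T"
    unfolding null_controllable_def
  proof
    fix u assume u: "u \<in> l2_on 2 half"
    obtain v where "v \<in> controls 2 \<Omega>' T" "steers bc 2 \<Omega>' W T (lift bc u) v"
      using nc lift_in[OF u] unfolding null_controllable_def W_def by blast
    from steer[OF u this] show "\<exists>v\<in>controls 2 half T. steers bc 2 half \<omega> T u v" by blast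
  qed
  have "control_cost bc 2 half \<omega> T \<le> control_cost bc 2 \<Omega>' W T"
    unfolding control_cost_def
  proof (rule SUP_least)
    fix u assume "u \<in> {u \<in> l2_on 2 half. norm u = 1}"
    then have u: "u \<in> l2_on 2 half" "norm u = 1" by auto
    have "(INF v\<in>{v \<in> controls 2 half T. steers bc 2 half \<omega> T u v}. ennreal (control_norm 2 \<omega> T v))
        \<le> (INF v\<in>{v \<in> controls 2 \<Omega>' T. steers bc 2 \<Omega>' W T (lift bc u) v}. ennreal (control_norm 2 W T v))"
    proof (rule INF_mono)
      fix v assume "v \<in> {v \<in> controls 2 \<Omega>' T. steers bc 2 \<Omega>' W T (lift bc u) v}"
      then have v: "v \<in> controls 2 \<Omega>' T" "steers bc 2 \<Omega>' W T (lift bc u) v" by auto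
      show "\<exists>w\<in>{v \<in> controls 2 half T. steers bc 2 half \<omega> T u v}. ennreal (control_norm 2 \<omega> T w) \<le> ennreal (control_norm 2 W T v)"
      proof (intro bexI[of _ "\<lambda>s. unlift bc (v s)"])
        show "ennreal (control_norm 2 \<omega> T (\<lambda>s. unlift bc (v s))) \<le> ennreal (control_norm 2 W T v)"
          using unlift_control_norm[OF W v(1), of bc] unfolding Wh by (rule ennreal_leI)
      qed (use steer[OF u(1) v] in blast)
    qed
    also have "\<dots> \<le> (SUP u\<in>{u \<in> l2_on 2 \<Omega>'. norm u = 1}.
        INF v\<in>{v \<in> controls 2 \<Omega>' T. steers bc 2 \<Omega>' W T u v}. ennreal (control_norm 2 W T v))"
      by (rule SUP_upper) (use lift_in[OF u(1)] norm_lift[OF u(1)] u(2) in simp)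
    finally show "(INF v\<in>{v \<in> controls 2 half T. steers bc 2 half \<omega> T u v}. ennreal (control_norm 2 \<omega> T v))
        \<le> (SUP u\<in>{u \<in> l2_on 2 \<Omega>'. norm u = 1}.
        INF v\<in>{v \<in> controls 2 \<Omega>' T. steers bc 2 \<Omega>' W T u v}. ennreal (control_norm 2 W T v))" .
  qed
  then show "control_cost bc 2 half \<omega> T \<le> control_cost bc 2 \<Omega>' (\<omega> \<union> refl -` \<omega>) T" by (simp add: W_def)
qed

end

section \<open>Discs and density measured in discs\<close>

definition disk :: "(nat \<Rightarrow> real) \<Rightarrow> real \<Rightarrow> (nat \<Rightarrow> real) set" where
  "disk c \<rho> = {x \<in> Rn 2. (x 0 - c 0)\<^sup>2 + (x 1 - c 1)\<^sup>2 \<le> \<rho>\<^sup>2}"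

lemma closed_box_fmeasurable: "closed_box d a b \<in> fmeasurable (lebesgue_dim d)"
proof (rule fmeasurableI)
  have b: "closed_box d a b \<in> sets borel" by (rule borel_closed[OF compact_imp_closed[OF compact_closed_box]])
  show s: "closed_box d a b \<in> sets (lebesgue_dim d)"
    by (intro sets_lebesgue_dimI sets_lborel_dimI b) (auto simp: closed_box_def)
  have s': "closed_box d a b \<in> sets (lborel_dim d)" by (rule sets_lborel_dimI[OF b]) (auto simp: closed_box_def)
  have "emeasure (lebesgue_dim d) (closed_box d a b) = emeasure (lborel_dim d) (closed_box d a b)"
    unfolding lebesgue_dim_def using s' by (simp add: emeasure_completion)
  also have "\<dots> = emeasure lebesgue_all ({d} \<times> closed_box d a b)"
  proof -
    have "Pair d -` ({d} \<times> closed_box d a b) \<inter> space (lborel_dim d) = closed_box d a b"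
      unfolding space_lborel_dim_Rn by (auto simp: closed_box_def)
    then show ?thesis
      using emeasure_lborel_all_slice[OF slice_borel[OF b], of d d] emeasure_lebesgue_all[OF slice_borel[OF b], of d]
      by (simp add: Times_Int_Times)
  qed
  also have "\<dots> < \<infinity>" by (rule emeasure_compact_slice(2)[OF compact_closed_box])
  finally show "emeasure (lebesgue_dim d) (closed_box d a b) < \<infinity>" .
qed

lemma disk_sub_box:
  assumes "\<rho> \<ge> 0"
  shows "disk c \<rho> \<subseteq> closed_box 2 (\<lambda>i. c i - \<rho>) (\<lambda>i. c i + \<rho>)"
proof
  fix x assume x: "x \<in> disk c \<rho>"
  have "(x 0 - c 0)\<^sup>2 \<le> \<rho>\<^sup>2" "(x 1 - c 1)\<^sup>2 \<le> \<rho>\<^sup>2"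
    using x zero_le_power2[of "x 0 - c 0"] zero_le_power2[of "x 1 - c 1"] unfolding disk_def mem_Collect_eq by linarith+
  then have "\<bar>x 0 - c 0\<bar> \<le> \<rho>" "\<bar>x 1 - c 1\<bar> \<le> \<rho>" using assms by (simp_all only: abs_le_square_iff[symmetric] abs_of_nonneg)
  then show "x \<in> closed_box 2 (\<lambda>i. c i - \<rho>) (\<lambda>i. c i + \<rho>)"
    using x unfolding closed_box_def disk_def mem_Collect_eq All_less_2 by (intro conjI) linarith+
qed

lemma disk_sets: "disk c \<rho> \<in> sets (lebesgue_dim 2)"
proof -
  have "closed {x :: nat \<Rightarrow> real. (x 0 - c 0)\<^sup>2 + (x 1 - c 1)\<^sup>2 \<le> \<rho>\<^sup>2}"
    by (intro closed_Collect_le continuous_intros continuous_on_coordinate)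
  then have "Rn 2 \<inter> {x. (x 0 - c 0)\<^sup>2 + (x 1 - c 1)\<^sup>2 \<le> \<rho>\<^sup>2} \<in> sets borel"
    by (intro sets.Int Rn_borel borel_closed)
  moreover have "disk c \<rho> = Rn 2 \<inter> {x. (x 0 - c 0)\<^sup>2 + (x 1 - c 1)\<^sup>2 \<le> \<rho>\<^sup>2}" by (auto simp: disk_def)
  ultimately show ?thesis by (intro sets_lebesgue_dimI sets_lborel_dimI) (auto simp: disk_def)
qed

lemma disk_fmeasurable: "\<rho> \<ge> 0 \<Longrightarrow> disk c \<rho> \<in> fmeasurable (lebesgue_dim 2)"
  by (rule fmeasurableI2[OF closed_box_fmeasurable disk_sub_box disk_sets])

text \<open>A substitute for thickness with centres taken from C only. Coordinate boxes are not
  preserved by oblique reflections, discs are.\<close>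

definition disk_dense :: "real \<Rightarrow> real \<Rightarrow> (nat \<Rightarrow> real) set \<Rightarrow> (nat \<Rightarrow> real) set \<Rightarrow> bool" where
  "disk_dense \<rho> m C \<omega> \<longleftrightarrow> (\<forall>c\<in>C. m \<le> measure (lebesgue_dim 2) (\<omega> \<inter> disk c \<rho>))"

lemma measure_Int_disk_mono:
  assumes "\<rho> \<ge> 0" "A \<in> sets (lebesgue_dim 2)" "B \<in> sets (lebesgue_dim 2)" "A \<inter> disk c \<rho> \<subseteq> B"
  shows "measure (lebesgue_dim 2) (A \<inter> disk c \<rho>) \<le> measure (lebesgue_dim 2) (B \<inter> disk c \<rho>)"
  by (rule measure_mono_fmeasurable[OF _ _ fmeasurable_Int_fmeasurable[OF disk_fmeasurable, unfolded Int_commute[of "disk _ _"]]])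
    (use assms disk_sets in auto)

context reflection
begin

lemma measure_preserving_lebesgue_dim: "measure_preserving (lebesgue_dim 2) refl"
  unfolding lebesgue_dim_def by (rule measure_preserving_completion[OF measure_preserving_refl])

lemma vimage_refl_sub: "A \<subseteq> Rn 2 \<Longrightarrow> refl -` A \<subseteq> Rn 2"
  using refl_Rn_iff by auto

lemma refl_vimage:
  assumes A: "A \<in> sets (lebesgue_dim 2)"
  shows "refl -` A \<in> sets (lebesgue_dim 2)" "measure (lebesgue_dim 2) (refl -` A) = measure (lebesgue_dim 2) A"
proof -
  have m: "refl \<in> lebesgue_dim 2 \<rightarrow>\<^sub>M lebesgue_dim 2" "distr (lebesgue_dim 2) (lebesgue_dim 2) refl = lebesgue_dim 2"
    using measure_preserving_lebesgue_dim by (auto simp: measure_preserving_def)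
  have space: "space (lebesgue_dim 2) = Rn 2" by (simp add: lebesgue_dim_def space_lborel_dim_Rn)
  have eq: "refl -` A \<inter> space (lebesgue_dim 2) = refl -` A"
    using vimage_refl_sub[of A] sets.sets_into_space[OF A] unfolding space by blast
  show "refl -` A \<in> sets (lebesgue_dim 2)" using measurable_sets[OF m(1) A] unfolding eq .
  show "measure (lebesgue_dim 2) (refl -` A) = measure (lebesgue_dim 2) A"
    using measure_distr[OF m(1) A] unfolding m(2) eq by simp
qed

lemma refl_disk: "refl x \<in> disk (refl c) \<rho> \<longleftrightarrow> x \<in> disk c \<rho>"
proof -
  define y0 y1 where "y0 = x 0 - c 0" and "y1 = x 1 - c 1"
  define s where "s = \<nu> 0 * y0 + \<nu> 1 * y1"
  have d: "dist_line x - dist_line c = s" by (simp add: dist_line_def s_def y0_def y1_def algebra_simps)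
  have 0: "refl x 0 - refl c 0 = y0 - 2 * s * \<nu> 0"
    unfolding refl_simps d[symmetric] y0_def by (simp add: algebra_simps)
  have 1: "refl x 1 - refl c 1 = y1 - 2 * s * \<nu> 1"
    unfolding refl_simps d[symmetric] y1_def by (simp add: algebra_simps)
  have "(y0 - 2 * s * \<nu> 0)\<^sup>2 + (y1 - 2 * s * \<nu> 1)\<^sup>2 = y0\<^sup>2 + y1\<^sup>2 - 4 * s * (\<nu> 0 * y0 + \<nu> 1 * y1) + 4 * s\<^sup>2 * ((\<nu> 0)\<^sup>2 + (\<nu> 1)\<^sup>2)"
    by (simp add: power2_eq_square algebra_simps)
  also have "\<dots> = y0\<^sup>2 + y1\<^sup>2" unfolding unit s_def[symmetric] by (simp add: power2_eq_square)
  finally have e: "(y0 - 2 * s * \<nu> 0)\<^sup>2 + (y1 - 2 * s * \<nu> 1)\<^sup>2 = y0\<^sup>2 + y1\<^sup>2" .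
  show ?thesis unfolding disk_def mem_Collect_eq 0 1 e refl_Rn_iff y0_def[symmetric] y1_def[symmetric] ..
qed

text \<open>If the mirror image of the centre lies in C, the disc around that image has enough mass
  of \<omega>, and the reflection carries this mass back to the given disc.\<close>

lemma disk_dense_reflect:
  assumes \<omega>: "\<omega> \<in> sets (lebesgue_dim 2)" and \<rho>: "\<rho> \<ge> 0"
    and d: "disk_dense \<rho> m C \<omega>" and C: "\<And>c. c \<in> C' \<Longrightarrow> c \<in> C \<or> refl c \<in> C"
  shows "disk_dense \<rho> m C' (\<omega> \<union> refl -` \<omega>)"
  unfolding disk_dense_def
proof
  fix c assume "c \<in> C'"
  then consider "c \<in> C" | "refl c \<in> C" using C by blast
  then show "m \<le> measure (lebesgue_dim 2) ((\<omega> \<union> refl -` \<omega>) \<inter> disk c \<rho>)"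
  proof cases
    case 1
    have "m \<le> measure (lebesgue_dim 2) (\<omega> \<inter> disk c \<rho>)" using d 1 by (simp add: disk_dense_def)
    also have "\<dots> \<le> measure (lebesgue_dim 2) ((\<omega> \<union> refl -` \<omega>) \<inter> disk c \<rho>)"
      by (rule measure_Int_disk_mono[OF \<rho> \<omega>]) (use \<omega> refl_vimage in auto)
    finally show ?thesis .
  next
    case 2
    have "m \<le> measure (lebesgue_dim 2) (\<omega> \<inter> disk (refl c) \<rho>)" using d 2 by (simp add: disk_dense_def)
    also have "\<dots> = measure (lebesgue_dim 2) (refl -` (\<omega> \<inter> disk (refl c) \<rho>))"
      by (rule refl_vimage(2)[symmetric]) (use \<omega> disk_sets in auto)
    also have "refl -` (\<omega> \<inter> disk (refl c) \<rho>) = refl -` \<omega> \<inter> disk c \<rho>" by (auto simp: refl_disk)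
    also have "measure (lebesgue_dim 2) (refl -` \<omega> \<inter> disk c \<rho>) \<le> measure (lebesgue_dim 2) ((\<omega> \<union> refl -` \<omega>) \<inter> disk c \<rho>)"
      by (rule measure_Int_disk_mono[OF \<rho> refl_vimage(1)[OF \<omega>]]) (use \<omega> refl_vimage in auto)
    finally show ?thesis .
  qed
qed

end

section \<open>Thick sets in sectors\<close>

definition angle :: "nat \<Rightarrow> real" where
  "angle k = pi / 2 ^ k"

text \<open>The unit normal of the oblique edge, pointing into the wedge; for k = 0 it is (0,
  1).\<close>

definition edge_normal :: "nat \<Rightarrow> nat \<Rightarrow> real" where
  "edge_normal k i = (if i = 0 then sin (angle k) else - cos (angle k))"

text \<open>Two linear inequalities instead of a slope, so that the angles \<pi> and \<pi>/2 fit in.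
  For k = 0 both say 0 < x 1, and the wedge is the upper half-plane.\<close>

definition wedge :: "nat \<Rightarrow> (nat \<Rightarrow> real) set" where
  "wedge k = {x \<in> Rn 2. 0 < x 1 \<and> 0 < sin (angle k) * x 0 - cos (angle k) * x 1}"

text \<open>The range of the disc centres. It is closed because all points of the plane, including
  those on the lines of reflection, have to be moved into it.\<close>

definition closed_wedge :: "nat \<Rightarrow> (nat \<Rightarrow> real) set" where
  "closed_wedge k = {x \<in> Rn 2. 0 \<le> x 1 \<and> 0 \<le> sin (angle k) * x 0 - cos (angle k) * x 1}"

lemma reflection_edge_normal: "reflection (edge_normal k)"
  by unfold_locales (simp add: edge_normal_def)

lemma dist_line_edge: "reflection.dist_line (edge_normal k) x = sin (angle k) * x 0 - cos (angle k) * x 1"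
  by (simp add: reflection.dist_line_def[OF reflection_edge_normal] edge_normal_def)

lemma angle_Suc: "angle k = 2 * angle (Suc k)"
  by (simp add: angle_def)

lemma cos_angle_nonneg: "0 \<le> cos (angle (Suc k))"
proof (rule cos_ge_zero)
  have "(1::real) \<le> 2 ^ k" by simp
  then have "pi / 2 ^ k \<le> pi / 1" by (intro divide_left_mono) auto
  then show "angle (Suc k) \<le> pi / 2" by (simp add: angle_def)
  show "- (pi / 2) \<le> angle (Suc k)" using pi_ge_zero by (simp add: angle_def) (smt (verit) divide_nonneg_pos pi_ge_zero zero_less_power)
qed

text \<open>The oblique edge of \<open>wedge (Suc k)\<close> bisects \<open>wedge k\<close>, so
  reflection in it exchanges the signed distances to the two edges of \<open>wedge k\<close>; the
  double-angle formulas express this.\<close>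

lemma refl_edge_1: "reflection.refl (edge_normal (Suc k)) x 1 = sin (angle k) * x 0 - cos (angle k) * x 1"
  unfolding reflection.refl_simps[OF reflection_edge_normal] dist_line_edge angle_Suc[of k]
    sin_double cos_double_cos
  by (simp add: edge_normal_def algebra_simps power2_eq_square)

lemma refl_edge_normal: "sin (angle k) * reflection.refl (edge_normal (Suc k)) x 0 - cos (angle k) * reflection.refl (edge_normal (Suc k)) x 1 = x 1"
  using refl_edge_1[of k "reflection.refl (edge_normal (Suc k)) x"]
  by (simp add: reflection.refl_refl[OF reflection_edge_normal])

lemma open_wedge: "open_domain 2 (wedge k)"
  unfolding open_domain_def
proof (intro exI conjI)
  show "open ({x. 0 < x 1} \<inter> {x :: nat \<Rightarrow> real. 0 < sin (angle k) * x 0 - cos (angle k) * x 1})"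
    by (intro open_Int open_Collect_less continuous_intros continuous_on_coordinate)
  show "wedge k = {x. 0 < x 1} \<inter> {x. 0 < sin (angle k) * x 0 - cos (angle k) * x 1} \<inter> Rn 2"
    by (auto simp: wedge_def)
qed

lemma reflected_plane: "reflected_domain (edge_normal 0) (Rn 2)"
proof (intro reflected_domain.intro reflected_domain_axioms.intro reflection_edge_normal)
  show "open_domain 2 (Rn 2)" unfolding open_domain_def by (intro exI[of _ UNIV]) simp
  show "reflection.refl (edge_normal 0) x \<in> Rn 2 \<longleftrightarrow> x \<in> Rn 2" for x
    by (rule reflection.refl_Rn_iff[OF reflection_edge_normal])
qed

lemma reflected_wedge: "reflected_domain (edge_normal (Suc k)) (wedge k)"
proof (intro reflected_domain.intro reflected_domain_axioms.intro reflection_edge_normal open_wedge)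
  show "reflection.refl (edge_normal (Suc k)) x \<in> wedge k \<longleftrightarrow> x \<in> wedge k" for x
    unfolding wedge_def mem_Collect_eq refl_edge_normal
    unfolding refl_edge_1 reflection.refl_Rn_iff[OF reflection_edge_normal] by blast
qed

lemma half_plane: "reflected_domain.half (edge_normal 0) (Rn 2) = wedge 0"
  unfolding reflected_domain.half_def[OF reflected_plane] dist_line_edge wedge_def by (simp add: angle_def)

lemma half_wedge: "reflected_domain.half (edge_normal (Suc k)) (wedge k) = wedge (Suc k)"
proof (rule set_eqI)
  fix x :: "nat \<Rightarrow> real"
  \<comment> \<open>The form of the outer edge is a nonnegative multiple of that of the bisector
    plus x 1, so its positivity is implied on the smaller wedge.\<close>
  have id: "sin (angle k) * x 0 - cos (angle k) * x 1
      = 2 * cos (angle (Suc k)) * (sin (angle (Suc k)) * x 0 - cos (angle (Suc k)) * x 1) + x 1"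
    unfolding angle_Suc[of k] sin_double cos_double_cos by (simp add: algebra_simps power2_eq_square)
  have "0 < sin (angle k) * x 0 - cos (angle k) * x 1" if "0 < x 1" "0 < sin (angle (Suc k)) * x 0 - cos (angle (Suc k)) * x 1"
    unfolding id using that cos_angle_nonneg[of k] by (intro add_nonneg_pos mult_nonneg_nonneg) auto
  then show "x \<in> reflected_domain.half (edge_normal (Suc k)) (wedge k) \<longleftrightarrow> x \<in> wedge (Suc k)"
    unfolding reflected_domain.half_def[OF reflected_wedge] dist_line_edge by (auto simp: wedge_def)
qed

lemma closed_wedge_0: "c \<in> Rn 2 \<Longrightarrow> c \<in> closed_wedge 0 \<or> reflection.refl (edge_normal 0) c \<in> closed_wedge 0"
  unfolding closed_wedge_def mem_Collect_eq reflection.refl_Rn_iff[OF reflection_edge_normal]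
    reflection.refl_simps[OF reflection_edge_normal] dist_line_edge
  by (auto simp: angle_def edge_normal_def)

lemma closed_wedge_Suc:
  assumes c: "c \<in> closed_wedge k"
  shows "c \<in> closed_wedge (Suc k) \<or> reflection.refl (edge_normal (Suc k)) c \<in> closed_wedge (Suc k)"
proof (cases "0 \<le> sin (angle (Suc k)) * c 0 - cos (angle (Suc k)) * c 1")
  case True
  then show ?thesis using c by (simp add: closed_wedge_def)
next
  case False
  have "0 \<le> reflection.dist_line (edge_normal (Suc k)) (reflection.refl (edge_normal (Suc k)) c)"
    unfolding reflection.dist_line_refl[OF reflection_edge_normal] using False unfolding dist_line_edge by linarith
  moreover have "0 \<le> reflection.refl (edge_normal (Suc k)) c 1"
    unfolding refl_edge_1 using c by (simp add: closed_wedge_def)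
  moreover have "reflection.refl (edge_normal (Suc k)) c \<in> Rn 2"
    unfolding reflection.refl_Rn_iff[OF reflection_edge_normal] using c by (simp add: closed_wedge_def)
  ultimately have "reflection.refl (edge_normal (Suc k)) c \<in> closed_wedge (Suc k)"
    unfolding closed_wedge_def dist_line_edge by blast
  then show ?thesis by blast
qed

text \<open>A square of side 2 \<rho> contains the disc about its centre; the mass in the disc is
  therefore measured against the area of the square.\<close>

lemma thick_of_disk_dense:
  assumes \<omega>: "\<omega> \<in> sets (lebesgue_dim 2)" and \<rho>: "\<rho> > 0" and g: "0 < \<gamma>" "\<gamma> \<le> 1"
    and d: "disk_dense \<rho> (\<gamma> * (2 * \<rho>)\<^sup>2) (Rn 2) \<omega>"
  shows "thick 2 \<gamma> (\<lambda>_. 2 * \<rho>) \<omega>"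
  unfolding thick_def
proof (intro conjI allI impI ballI g \<omega>)
  show "0 < 2 * \<rho>" using \<rho> by simp
  fix x assume x: "x \<in> Rn 2"
  define c where "c = pt (x 0 + \<rho>) (x 1 + \<rho>)"
  have box: "(\<Pi>\<^sub>E j\<in>{..<2}. {x j..x j + 2 * \<rho>}) = closed_box 2 x (\<lambda>j. x j + 2 * \<rho>)"
    unfolding closed_box_def Rn_def by (rule set_eqI) (simp only: PiE_iff Ball_def mem_Collect_eq atLeastAtMost_iff lessThan_iff UNIV_I simp_thms, blast)
  have "\<gamma> * (2 * \<rho>)\<^sup>2 \<le> measure (lebesgue_dim 2) (\<omega> \<inter> disk c \<rho>)"
    using d pt_Rn by (simp add: disk_dense_def c_def)
  also have "\<dots> \<le> measure (lebesgue_dim 2) (\<omega> \<inter> closed_box 2 x (\<lambda>j. x j + 2 * \<rho>))"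
  proof (rule measure_mono_fmeasurable)
    have "disk c \<rho> \<subseteq> closed_box 2 (\<lambda>i. c i - \<rho>) (\<lambda>i. c i + \<rho>)" by (rule disk_sub_box) (use \<rho> in simp)
    also have "\<dots> = closed_box 2 x (\<lambda>j. x j + 2 * \<rho>)" unfolding closed_box_def All_less_2 by (simp add: c_def add.commute)
    finally show "\<omega> \<inter> disk c \<rho> \<subseteq> \<omega> \<inter> closed_box 2 x (\<lambda>j. x j + 2 * \<rho>)" by blast
    show "\<omega> \<inter> disk c \<rho> \<in> sets (lebesgue_dim 2)" using \<omega> disk_sets by blast
    show "\<omega> \<inter> closed_box 2 x (\<lambda>j. x j + 2 * \<rho>) \<in> fmeasurable (lebesgue_dim 2)"
      using fmeasurable_Int_fmeasurable[OF closed_box_fmeasurable \<omega>] by (simp add: Int_commute)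
  qed
  finally show "\<gamma> * (\<Prod>j<2::nat. 2 * \<rho>) \<le> measure (lebesgue_dim 2) (\<omega> \<inter> (\<Pi>\<^sub>E j\<in>{..<2}. {x j..x j + 2 * \<rho>}))"
    unfolding box by (simp add: power2_eq_square)
qed

text \<open>Each reflection enlarges \<omega> and the set of admissible centres, while \<rho>,
  \<gamma> and the bound stay the same, so the plane bound passes down through all wedges. For
  squares of side 2 \<rho> the sum of the sides is 4 \<rho>, and the exponent K d / 2 is K.\<close>

lemma wedge_control:
  assumes K: "control_constant K" and \<rho>: "\<rho> > 0" and g: "0 < \<gamma>" "\<gamma> \<le> 1" and T: "T > 0"
  shows "\<omega> \<in> sets (lebesgue_dim 2) \<Longrightarrow> \<omega> \<subseteq> wedge k \<Longrightarrow> disk_dense \<rho> (\<gamma> * (2 * \<rho>)\<^sup>2) (closed_wedge k) \<omega> \<Longrightarrow>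
    null_controllable bc 2 (wedge k) \<omega> T \<and> control_cost bc 2 (wedge k) \<omega> T \<le> ennreal (
      1 / sqrt T * (K\<^sup>2 / \<gamma>) powr K * exp (K * (4 * \<rho>)\<^sup>2 * (ln (K\<^sup>2 / \<gamma>))\<^sup>2 / (2 * T)))"
proof (induction k arbitrary: \<omega>)
  case 0
  interpret reflected_domain "edge_normal 0" "Rn 2" by (rule reflected_plane)
  define W where "W = \<omega> \<union> refl -` \<omega>"
  have W: "W \<in> sets (lebesgue_dim 2)" unfolding W_def using 0(1) refl_vimage(1)[OF 0(1)] by blast
  have WR: "W \<subseteq> Rn 2" unfolding W_def using 0(2) vimage_refl_sub[of \<omega>] by (auto simp: wedge_def)
  have "disk_dense \<rho> (\<gamma> * (2 * \<rho>)\<^sup>2) (Rn 2) W"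
    unfolding W_def by (rule disk_dense_reflect[OF 0(1) _ 0(3) closed_wedge_0]) (use \<rho> in auto)
  then have th: "thick 2 \<gamma> (\<lambda>_. 2 * \<rho>) W" by (rule thick_of_disk_dense[OF W \<rho> g])
  have RW: "Rn 2 \<inter> W = W" using WR by blast
  have "null_controllable bc 2 (Rn 2) (Rn 2 \<inter> W) T \<and> control_cost bc 2 (Rn 2) (Rn 2 \<inter> W) T \<le> ennreal (
      1 / sqrt T * (K ^ 2 / \<gamma>) powr (K * real 2 / 2) *
      exp (K * (\<Sum>j<(2::nat). 2 * \<rho>)\<^sup>2 * (ln (K ^ 2 / \<gamma>))\<^sup>2 / (2 * T)))"
  proof -
    \<comment> \<open>L is the side of the square, so that the condition on the box holds in either
      case of the implication.\<close>
    have *: "1 \<le> (2::nat)" "0 < 2 * \<rho>" "Rn 2 \<in> {Rn 2, cube 2 (2 * \<rho>)}"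
      "Rn 2 = cube 2 (2 * \<rho>) \<longrightarrow> (\<forall>j<2. 2 * \<rho> \<le> 2 * \<rho>)" using \<rho> by simp_all
    show ?thesis
      by (rule conjunct2[OF K[unfolded control_constant_def], rule_format, OF * (1,2,3) th *(4)[rule_format] T])
  qed
  then have cost: "null_controllable bc 2 (Rn 2) W T" "control_cost bc 2 (Rn 2) W T \<le> ennreal (
      1 / sqrt T * (K\<^sup>2 / \<gamma>) powr K * exp (K * (4 * \<rho>)\<^sup>2 * (ln (K\<^sup>2 / \<gamma>))\<^sup>2 / (2 * T)))"
    unfolding RW by (simp_all add: sum_lessThan_2)
  have h: "\<omega> \<subseteq> half" using 0(2) unfolding half_plane .
  note tr = control_transfer[OF 0(1) h W[unfolded W_def] T cost(1)[unfolded W_def]]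
  show ?case
    using tr(1) order_trans[OF tr(2) cost(2)[unfolded W_def]] unfolding half_plane by (rule conjI)
next
  case (Suc k)
  interpret reflected_domain "edge_normal (Suc k)" "wedge k" by (rule reflected_wedge)
  define W where "W = \<omega> \<union> refl -` \<omega>"
  have W: "W \<in> sets (lebesgue_dim 2)" unfolding W_def using Suc.prems(1) refl_vimage(1)[OF Suc.prems(1)] by blast
  have h: "\<omega> \<subseteq> half" using Suc.prems(2) unfolding half_wedge .
  have WR: "W \<subseteq> wedge k" unfolding W_def using h half_sub sym by auto
  have "disk_dense \<rho> (\<gamma> * (2 * \<rho>)\<^sup>2) (closed_wedge k) W"
    unfolding W_def by (rule disk_dense_reflect[OF Suc.prems(1) _ Suc.prems(3) closed_wedge_Suc]) (use \<rho> in auto)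
  note IH = Suc.IH[OF W WR this]
  note tr = control_transfer[OF Suc.prems(1) h W[unfolded W_def] T conjunct1[OF IH, unfolded W_def]]
  show ?case
    using tr(1) order_trans[OF tr(2) conjunct2[OF IH, unfolded W_def]] unfolding half_wedge by (rule conjI)
qed

section \<open>Trigonometric bounds and boxes in the sector\<close>

lemma angle_pos: "0 < angle k"
  by (simp add: angle_def)

lemma angle_less: "angle (Suc (Suc k)) < pi / 2"
proof -
  have "(1::real) \<le> 2 ^ k" by simp
  then have "(2::real) < 4 * 2 ^ k" by linarith
  then have "pi / (4 * 2 ^ k) < pi / 2" by (intro divide_strict_left_mono) auto
  then show ?thesis by (simp add: angle_def)
qed

lemma sin_angle_pos: "0 < sin (angle (Suc (Suc k)))"
  using angle_pos[of "Suc (Suc k)"] angle_less[of k] pi_gt_zero by (intro sin_gt_zero) linarith+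

lemma cos_angle_pos: "0 < cos (angle (Suc (Suc k)))"
  using angle_pos[of "Suc (Suc k)"] angle_less[of k] pi_gt_zero by (intro cos_gt_zero_pi) linarith+

text \<open>From the angle \<pi>/4 downwards the cosine is positive, so the slope condition can be
  multiplied out, and 0 < x 0 follows from the other two inequalities.\<close>

lemma sector_wedge: "sector (Suc (Suc k)) = wedge (Suc (Suc k))"
proof (rule set_eqI)
  fix x :: "nat \<Rightarrow> real"
  define s c where "s = sin (angle (Suc (Suc k)))" and "c = cos (angle (Suc (Suc k)))"
  have sc: "0 < s" "0 < c" using sin_angle_pos cos_angle_pos by (auto simp: s_def c_def)
  have t: "tan (pi / 2 ^ Suc (Suc k)) = s / c" by (simp only: s_def c_def tan_def angle_def)
  have "x 1 < s / c * x 0 \<longleftrightarrow> 0 < s * x 0 - c * x 1" using sc(2) by (simp add: field_simps)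
  moreover have "0 < x 0" if "0 < x 1" "0 < s * x 0 - c * x 1"
  proof -
    have "0 < c * x 1" using sc(2) that(1) by (rule mult_pos_pos)
    then have "0 < s * x 0" using that(2) by linarith
    then show ?thesis using sc(1) by (simp add: zero_less_mult_iff)
  qed
  ultimately show "x \<in> sector (Suc (Suc k)) \<longleftrightarrow> x \<in> wedge (Suc (Suc k))"
    unfolding sector_def wedge_def mem_Collect_eq t s_def[symmetric] c_def[symmetric] by blast
qed

text \<open>Halving the angle turns a bound m on the cotangent into 2 m + 1; the start is cot
  (\<pi>/4) = 1.\<close>

lemma cos_angle_le: "cos (angle (Suc (Suc k))) \<le> (2 ^ Suc k - 1) * sin (angle (Suc (Suc k)))"
proof (induction k)
  case 0
  show ?case by (simp add: angle_def cos_45 sin_45)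
next
  case (Suc k)
  define m s c where "m = (2 ^ Suc k - 1 :: real)" and "s = sin (angle (Suc (Suc (Suc k))))"
    and "c = cos (angle (Suc (Suc (Suc k))))"
  have "(1::real) \<le> 2 ^ Suc k" by (rule one_le_power) simp
  then have m: "0 \<le> m" unfolding m_def by linarith
  have s: "0 < s" using sin_angle_pos by (simp only: s_def)
  have IH: "c\<^sup>2 - s\<^sup>2 \<le> m * (2 * s * c)"
    using Suc.IH unfolding angle_Suc[of "Suc (Suc k)"] sin_double cos_double m_def s_def c_def .
  have "c \<le> (2 * m + 1) * s"
  proof (rule ccontr)
    assume "\<not> c \<le> (2 * m + 1) * s"
    then have "0 < (c - (2 * m + 1) * s) * (c + s)"
      using s m by (intro mult_pos_pos) (auto intro!: add_nonneg_pos less_imp_le[OF cos_angle_pos] simp: c_def)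
    \<comment> \<open>Both factors are positive by assumption, while the induction hypothesis makes
      the expanded expression at most 0.\<close>
    moreover have "(c - (2 * m + 1) * s) * (c + s) = c\<^sup>2 - s\<^sup>2 - m * (2 * s * c) - 2 * m * s\<^sup>2"
      by (simp add: power2_eq_square algebra_simps)
    moreover have "0 \<le> 2 * m * s\<^sup>2" using m by simp
    ultimately show False using IH by linarith
  qed
  then show ?case by (simp add: m_def s_def c_def)
qed

text \<open>Source of the constant: for n = k + 2 the power of 2 is 2^(3n-4). The factors 4 and 3
  leave the room that \<open>disk_dense_wedge\<close> spends on its margin. For k = 0 both sides are
  12.\<close>

lemma cot_angle_bound:
  "4 * (2 + (cos (angle (Suc (Suc k))) / sin (angle (Suc (Suc k))))\<^sup>2) \<le> 3 * 2 ^ (3 * k + 2)"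
proof -
  define N :: real where "N = 2 ^ Suc k"
  define \<kappa> where "\<kappa> = cos (angle (Suc (Suc k))) / sin (angle (Suc (Suc k)))"
  have N: "2 \<le> N" by (simp add: N_def)
  have "0 \<le> \<kappa>" using sin_angle_pos[of k] cos_angle_pos[of k] by (simp add: \<kappa>_def)
  moreover have "\<kappa> \<le> N - 1"
    using cos_angle_le[of k] sin_angle_pos[of k] unfolding \<kappa>_def N_def by (simp only: pos_divide_le_eq)
  ultimately have "\<kappa>\<^sup>2 \<le> (N - 1)\<^sup>2" by (intro power_mono)
  then have "4 * (2 + \<kappa>\<^sup>2) \<le> 4 * (2 + (N - 1)\<^sup>2)" by simp
  also have "\<dots> \<le> 3 / 2 * N ^ 3"
  proof -
    \<comment> \<open>N = 2, the case k = 0, is a root of the difference, so N - 2 splits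
      off.\<close>
    have "3 / 2 * N ^ 3 - 4 * (2 + (N - 1)\<^sup>2) = (N - 2) * (3 / 2 * N\<^sup>2 - N + 6)"
    by (simp add: power2_eq_square power3_eq_cube field_simps)
    moreover have "0 \<le> (N - 2) * (3 / 2 * N\<^sup>2 - N + 6)"
  proof (rule mult_nonneg_nonneg)
    have "N * 1 \<le> N * N" using N by (intro mult_left_mono) auto
    then show "0 \<le> 3 / 2 * N\<^sup>2 - N + 6" unfolding power2_eq_square using N by simp
  qed (use N in simp)
    ultimately show ?thesis by (metis diff_ge_0_iff_ge)
  qed
  also have "\<dots> = 3 * 2 ^ (3 * k + 2)"
    by (simp add: N_def power_mult[symmetric] power_add power_mult_distrib mult.commute)
  finally show ?thesis unfolding \<kappa>_def .
qed

text \<open>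
  A box fits into the sector once its lower left corner lies to the right of \<open>c\<close> by the
  cotangent of the angle times its height; the margin \<open>e\<close> keeps it off the boundary. For
  \<open>k = 0\<close> the radius leaves just the factor \<open>4 / 3\<close> to spare for that margin.
\<close>

lemma disk_dense_wedge:
  assumes S: "thick 2 \<gamma> a S" and r: "r = sqrt ((a 0)\<^sup>2 + (a 1)\<^sup>2)" and \<rho>: "\<rho> = r * sqrt (2 ^ (3 * k + 2))"
  shows "disk_dense \<rho> (\<gamma> * a 0 * a 1) (closed_wedge (Suc (Suc k))) (wedge (Suc (Suc k)) \<inter> S)"
  unfolding disk_dense_def
proof
  define s co where "s = sin (angle (Suc (Suc k)))" and "co = cos (angle (Suc (Suc k)))"
  define \<kappa> where "\<kappa> = co / s"
  have sc: "0 < s" "0 < co" using sin_angle_pos cos_angle_pos by (auto simp: s_def co_def)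
  have \<kappa>: "0 < \<kappa>" "s * \<kappa> = co" using sc by (simp_all add: \<kappa>_def)
  have a: "0 < a 0" "0 < a 1" and Sm: "S \<in> sets (lebesgue_dim 2)" using S by (auto simp: thick_def)
  have r2: "r\<^sup>2 = (a 0)\<^sup>2 + (a 1)\<^sup>2" unfolding r by simp
  have r0: "0 < r" unfolding r using a by (simp add: sum_power2_gt_zero_iff)
  have ar: "a 0 \<le> r" "a 1 \<le> r" unfolding r by (simp_all add: real_le_rsqrt)
  have \<rho>0: "0 \<le> \<rho>" unfolding \<rho> using r0 by simp
  \<comment> \<open>Small enough that 4 e r + 2 e^2 = 0.205 r^2 is at most r^2 / 3, as the estimate
    of A^2 + B^2 demands.\<close>
  define e where "e = r / 20"
  have e: "0 < e" using r0 by (simp add: e_def)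
  define A B where "A = a 0 + e" and "B = a 1 + e"
  have AB: "0 < A" "0 < B" using a e by (simp_all add: A_def B_def)
  fix c assume c: "c \<in> closed_wedge (Suc (Suc k))"
  then have c1: "0 \<le> c 1" and cs: "co * c 1 \<le> s * c 0" by (simp_all add: closed_wedge_def s_def co_def)
  define p where "p = pt (c 0 + e + \<kappa> * B) (c 1 + e)"
  have p: "p \<in> Rn 2" "p 0 = c 0 + e + \<kappa> * B" "p 1 = c 1 + e" unfolding p_def by (simp_all add: pt_Rn)
  define X where "X = (\<Pi>\<^sub>E j\<in>{..<2}. {p j..p j + a j})"
  have X: "x \<in> Rn 2 \<and> p 0 \<le> x 0 \<and> x 0 \<le> p 0 + a 0 \<and> p 1 \<le> x 1 \<and> x 1 \<le> p 1 + a 1" if "x \<in> X" for x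
    using that unfolding X_def Rn_def by (simp add: PiE_iff)
  have "X \<subseteq> wedge (Suc (Suc k))"
  proof
    fix x assume "x \<in> X"
    note x = X[OF this]
    have "s * (\<kappa> * (x 1 - c 1)) \<le> s * (\<kappa> * B)" using x sc \<kappa> unfolding p B_def by (intro mult_left_mono) auto
    moreover have "s * (c 0 + e + \<kappa> * B) \<le> s * x 0" using x sc unfolding p by (intro mult_left_mono) auto
    moreover have "0 < s * e" using sc e by simp
    moreover have "s * (\<kappa> * (x 1 - c 1)) = co * x 1 - co * c 1" unfolding \<kappa>(2)[symmetric] by (simp add: algebra_simps)
    moreover have "s * (c 0 + e + \<kappa> * B) = s * c 0 + s * e + s * (\<kappa> * B)" by (simp add: algebra_simps)
    ultimately have "0 < s * x 0 - co * x 1" using cs by linarith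
    moreover have "0 < x 1" using x c1 e unfolding p by linarith
    ultimately show "x \<in> wedge (Suc (Suc k))" using x unfolding wedge_def s_def co_def by blast
  qed
  moreover have "X \<subseteq> disk c \<rho>"
  proof
    fix x assume "x \<in> X"
    note x = X[OF this]
    have "\<bar>x 0 - c 0\<bar> \<le> A + \<kappa> * B" "\<bar>x 1 - c 1\<bar> \<le> B"
      using x e \<kappa>(1) AB mult_pos_pos[OF \<kappa>(1) AB(2)] unfolding p A_def B_def by linarith+
    then have "(x 0 - c 0)\<^sup>2 \<le> (A + \<kappa> * B)\<^sup>2" "(x 1 - c 1)\<^sup>2 \<le> B\<^sup>2"
      by (metis abs_ge_zero power2_abs power_mono)+
    then have "(x 0 - c 0)\<^sup>2 + (x 1 - c 1)\<^sup>2 \<le> (A + \<kappa> * B)\<^sup>2 + B\<^sup>2" by linarith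
    also have "\<dots> \<le> (2 + \<kappa>\<^sup>2) * (A\<^sup>2 + B\<^sup>2)"
    proof -
      have "(2 + \<kappa>\<^sup>2) * (A\<^sup>2 + B\<^sup>2) - ((A + \<kappa> * B)\<^sup>2 + B\<^sup>2) = (\<kappa> * A - B)\<^sup>2 + A\<^sup>2"
        by (simp add: power2_eq_square algebra_simps)
      moreover have "0 \<le> (\<kappa> * A - B)\<^sup>2 + A\<^sup>2" by simp
      ultimately show ?thesis by linarith
    qed
    also have "\<dots> \<le> (2 + \<kappa>\<^sup>2) * (4 / 3 * r\<^sup>2)"
    proof (rule mult_left_mono)
      have "A\<^sup>2 + B\<^sup>2 = r\<^sup>2 + 2 * e * (a 0 + a 1) + 2 * e\<^sup>2" unfolding r2 A_def B_def by (simp add: power2_eq_square algebra_simps)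
      also have "\<dots> \<le> r\<^sup>2 + 2 * e * (r + r) + 2 * e\<^sup>2" using ar e by (intro add_mono mult_left_mono) auto
      also have "\<dots> \<le> 4 / 3 * r\<^sup>2" by (simp add: e_def power2_eq_square)
      finally show "A\<^sup>2 + B\<^sup>2 \<le> 4 / 3 * r\<^sup>2" .
    qed simp
    also have "\<dots> = 4 * (2 + \<kappa>\<^sup>2) * (r\<^sup>2 / 3)" by simp
    also have "\<dots> \<le> (3 * 2 ^ (3 * k + 2)) * (r\<^sup>2 / 3)"
      using cot_angle_bound[of k] unfolding \<kappa>_def s_def co_def by (intro mult_right_mono) auto
    also have "\<dots> = \<rho>\<^sup>2" unfolding \<rho> by (simp add: power_mult_distrib)
    finally show "x \<in> disk c \<rho>" using x by (simp add: disk_def)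
  qed
  ultimately have sub: "S \<inter> X \<subseteq> wedge (Suc (Suc k)) \<inter> S \<inter> disk c \<rho>" by blast
  have "\<gamma> * (\<Prod>j<2::nat. a j) \<le> measure (lebesgue_dim 2) (S \<inter> X)"
    using S p(1) by (simp add: thick_def X_def)
  moreover have "\<gamma> * (\<Prod>j<2::nat. a j) = \<gamma> * a 0 * a 1" by (simp add: numeral_2_eq_2)
  moreover have "measure (lebesgue_dim 2) (S \<inter> X) \<le> measure (lebesgue_dim 2) (wedge (Suc (Suc k)) \<inter> S \<inter> disk c \<rho>)"
  proof (rule measure_mono_fmeasurable[OF sub])
    have "X = closed_box 2 p (\<lambda>j. p j + a j)"
      unfolding X_def closed_box_def Rn_def by (rule set_eqI) (simp only: PiE_iff Ball_def mem_Collect_eq atLeastAtMost_iff lessThan_iff UNIV_I simp_thms, blast)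
    then have "X \<in> sets (lebesgue_dim 2)" using fmeasurableD[OF closed_box_fmeasurable] by simp
    then show "S \<inter> X \<in> sets (lebesgue_dim 2)" using Sm by blast
    have "wedge (Suc (Suc k)) \<inter> S \<in> sets (lebesgue_dim 2)"
      using Sm open_domain_sets[OF open_wedge] by blast
    from fmeasurable_Int_fmeasurable[OF disk_fmeasurable[OF \<rho>0] this]
    show "wedge (Suc (Suc k)) \<inter> S \<inter> disk c \<rho> \<in> fmeasurable (lebesgue_dim 2)" by (simp add: Int_commute)
  qed
  ultimately show "\<gamma> * a 0 * a 1 \<le> measure (lebesgue_dim 2) (wedge (Suc (Suc k)) \<inter> S \<inter> disk c \<rho>)" by linarith
qed

theorem proposition2p7:
  fixes K \<gamma> \<gamma>' T :: real and a a' :: "nat \<Rightarrow> real" and n :: nat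
    and S \<Omega> \<omega> :: "(nat \<Rightarrow> real) set" and bc :: boundary_condition
  assumes K: "control_constant K"
    and n: "n \<ge> 2"
    and \<Omega>: "\<Omega> = sector n"
    and S: "thick 2 \<gamma> a S"
    and \<omega>: "\<omega> = \<Omega> \<inter> S"
    and \<gamma>': "\<gamma>' = \<gamma> * a 0 * a 1 / (4 * ((a 0)\<^sup>2 + (a 1)\<^sup>2))"
    and a': "a' = (\<lambda>_. 2 * sqrt ((a 0)\<^sup>2 + (a 1)\<^sup>2))"
    and T: "T > 0"
  shows "null_controllable bc 2 \<Omega> \<omega> T \<and>
         control_cost bc 2 \<Omega> \<omega> T \<le> ennreal (
           1 / sqrt T * (2 ^ (3 * n - 4) * K\<^sup>2 / \<gamma>') powr K *
           exp (2 ^ (3 * n - 4) * K * (\<Sum>j<2. a' j)\<^sup>2 *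
             (ln (2 ^ (3 * n - 4) * K\<^sup>2 / \<gamma>'))\<^sup>2 / (2 * T)))"
proof -
  obtain k where k: "n = Suc (Suc k)" using n by (metis add_2_eq_Suc le_Suc_ex)
  have kn: "3 * k + 2 = 3 * n - 4" unfolding k by simp
  define q :: real where "q = 2 ^ (3 * n - 4)"
  define r where "r = sqrt ((a 0)\<^sup>2 + (a 1)\<^sup>2)"
  \<comment> \<open>By \<open>disk_dense_wedge\<close>, discs of this radius around points of the
    closed sector contain a translate of the box inside the sector.\<close>
  define \<rho> where "\<rho> = r * sqrt q"
  have q: "1 \<le> q" unfolding q_def by simp
  have a: "0 < a 0" "0 < a 1" and g: "0 < \<gamma>" "\<gamma> \<le> 1" and Sm: "S \<in> sets (lebesgue_dim 2)"
    using S by (auto simp: thick_def)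
  have r0: "0 < r" unfolding r_def using a by (simp add: sum_power2_gt_zero_iff)
  have r2: "r\<^sup>2 = (a 0)\<^sup>2 + (a 1)\<^sup>2" unfolding r_def by simp
  have \<rho>2: "\<rho>\<^sup>2 = r\<^sup>2 * q" unfolding \<rho>_def using q by (simp add: power_mult_distrib)
  have g': "\<gamma>' * (4 * r\<^sup>2) = \<gamma> * a 0 * a 1" unfolding \<gamma>' r2[symmetric] using r0 by simp
  have g'0: "0 < \<gamma>'" unfolding \<gamma>' r2[symmetric] using a g r0 by simp
  have "\<gamma> * (a 0 * a 1) \<le> 1 * (a 0 * a 1)" using g a by (intro mult_right_mono) auto
  also have "\<dots> \<le> 4 * r\<^sup>2"
  proof -
    \<comment> \<open>Here p is the product of the two sides of the box and t the sum of their
      squares.\<close>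
    have "p \<le> 4 * t" if "2 * p \<le> t" "0 < p" for p t :: real using that by linarith
    from this[OF sum_squares_bound[of "a 0" "a 1", unfolded mult.assoc] mult_pos_pos[OF a]]
    show ?thesis unfolding r2 by simp
  qed
  finally have g'1: "\<gamma>' \<le> 1" unfolding \<gamma>' r2[symmetric] using r0 by (simp add: mult.assoc)
  \<comment> \<open>The box contributes the mass \<gamma> a0 a1 to each disc. Relative to the square
    of side 2 \<rho>, whose area is 4 q r^2, this is the density
    \<open>\<gamma>' / q\<close>.\<close>
  have m: "\<gamma>' / q * (2 * \<rho>)\<^sup>2 = \<gamma> * a 0 * a 1"
    unfolding g'[symmetric] power_mult_distrib \<rho>2 using q by simp
  have \<omega>w: "\<omega> = wedge n \<inter> S" unfolding \<omega> \<Omega> k sector_wedge ..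
  have dd: "disk_dense \<rho> (\<gamma>' / q * (2 * \<rho>)\<^sup>2) (closed_wedge n) \<omega>"
    unfolding m \<omega>w k by (rule disk_dense_wedge[OF S r_def]) (simp only: \<rho>_def q_def kn)
  have "\<omega> \<in> sets (lebesgue_dim 2)" unfolding \<omega>w using Sm open_domain_sets[OF open_wedge] by blast
  moreover have "\<omega> \<subseteq> wedge n" unfolding \<omega>w by blast
  moreover have "0 < \<rho>" unfolding \<rho>_def using r0 q by simp
  moreover have "0 < \<gamma>' / q" "\<gamma>' / q \<le> 1" using g'0 g'1 q by (simp_all add: divide_le_eq)
  ultimately have res: "null_controllable bc 2 (wedge n) \<omega> T \<and> control_cost bc 2 (wedge n) \<omega> T \<le> ennreal (
      1 / sqrt T * (K\<^sup>2 / (\<gamma>' / q)) powr K * exp (K * (4 * \<rho>)\<^sup>2 * (ln (K\<^sup>2 / (\<gamma>' / q)))\<^sup>2 / (2 * T)))"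
    using dd by (intro wedge_control[OF K _ _ _ T])
  have c1: "K\<^sup>2 / (\<gamma>' / q) = 2 ^ (3 * n - 4) * K\<^sup>2 / \<gamma>'" by (simp add: q_def)
  \<comment> \<open>The entries of \<open>a'\<close> add up to 4 r, and \<rho>^2 = q r^2.\<close>
  have c2: "K * (4 * \<rho>)\<^sup>2 = 2 ^ (3 * n - 4) * K * (\<Sum>j<2. a' j)\<^sup>2"
    unfolding a' r_def[symmetric] power_mult_distrib \<rho>2 q_def by (simp add: sum_lessThan_2 power_mult_distrib)
  have "wedge n = \<Omega>" unfolding \<Omega> k sector_wedge ..
  then show ?thesis using res unfolding c1 c2 by simp
qed

end
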